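(* A tiling of the plane with colored tiles is a (colored) substitution tiling if and only if it is an L-tiling.
   Context: Tiles. Let $\phi=\sqrt{(\sqrt5-1)/2}$, so $\phi^2+\phi^4=1$. The large proto-tile $L$ is the right triangle with hypotenuse $1$, large leg $\phi$, small leg $\phi^2$; the small proto-tile $S$ is the right triangle with hypotenuse $\phi$, large leg $\phi^2$, small leg $\phi^3$. Large (small) tiles are isometric images (reflections allowed) of $L$ (of $S$). A tiling is a family of tiles with pairwise disjoint interiors; $[T]$ is the union of the tiles of $T$; $T$ is a tiling of the plane if $[T]$ is the plane. A colored (decorated) tile is a tile each of whose three sides carries an orientation and a label in $\{0,1,2,3\}=\mathbb Z/4$, such that the hypotenuse and the small leg of a large tile and the large leg of a small tile have even labels and all the other sides have odd labels. A colored tiling consists of colored tiles. Decomposition, supertiles, substitution tilings. Fix a homothety $H$ with coefficient $1/\phi$. To decompose a colored tiling: increase all labels by 1 mod 4, keeping all orientations; cut each large tile by its altitude to the hypotenuse into a copy of $\phi L$ and a copy of $\phi S$, where the two parts of the hypotenuse keep its (increased) label and its orientation, and the altitude (as a side of both parts) gets label $0$ and is oriented from its foot to the vertex of the right angle; each small tile is left uncut (it is a copy of $\phi L$); finally apply $H$. The result is denoted $\sigma T$. A colored supertile of order $n\ge 0$ is $\sigma^n\{A\}$, where $A$ is a colored large tile. A colored tiling $T$ is a substitution tiling if every finite subset $P\subset T$ is included in some colored supertile. Stars. Let $A$ be a vertex of a tile of a colored tiling $T$. The star within $T$ centered at $A$ consists of all tiles of $T$ that contain the point $A$ (not necessarily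 as a vertex), considered without colors, together with the labels and orientations of precisely those sides of these tiles that contain $A$. The star is complete if the union of its tiles contains a neighborhood of $A$. Stars are considered up to isometry. Legal stars. A complete star is legal if, up to an isometry (reflections allowed), it is one of the stars $C_1,\dots,C_7$ described now. Place the center $A$ at the origin; the axis is a horizontal line through $A$. Write $h,b,a$ for the hypotenuse, large leg and small leg. $X^{xy}$ (with $X\in\{L,S\}$) is a tile of type $X$ with vertex at $A$, the two sides meeting at $A$ being $x$ and $y$. In the upper half-plane the tiles are listed clockwise from the left ray of the axis to the right ray; in the lower half-plane counterclockwise from the left ray to the right ray; in each $X^{xy}$ side $x$ comes first in this order, and consecutive tiles have adjacent sides along a common ray from $A$. $C_1$: upper $L^{ba},S^{ba}$; lower: one large tile whose large leg lies on the axis and contains $A$ in its interior, the right-angle vertex being at distance $\phi^5$ to the left of $A$ and the other end at distance $\phi^3$ to the right of $A$. $C_2$: upper $L^{ha},S^{bh},L^{ba}$; lower: one large tile whose hypotenuse lies on the axis, $A$ being the foot of its altitude, with the endpoint of the hypotenuse at the larger acute angle at distance $\phi^4$ to the left of $A$ and the other endpoint at distance $\phi^2$ to the right of $A$. $C_3$: upper $S^{ah},L^{bh},L^{ha},S^{bh}$; lower $S^{ab},L^{ab}$. $C_4$: upper $L^{ah},L^{hb},S^{ah},L^{bh}$; lower $L^{ab},S^{hb},L^{ah}$. $C_5$: upper $S^{ha},L^{bh},L^{ah},L^{hb}$; lower $S^{hb},L^{ah},L^{hb},S^{ha}$. $C_6$: upper $L^{ha},L^{hb},S^{ha},L^{bh}$;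 lower $L^{hb},S^{ha},L^{bh},L^{ha}$. $C_7$: upper $S^{ah},L^{bh},L^{ha},L^{hb}$; lower $L^{bh},L^{ha},L^{hb},S^{ah}$. Decoration of $C_n$: all sides containing $A$ and lying on the axis have one and the same orientation (either of the two) and one and the same label (either of the two labels congruent to $n$ mod 2). Every other side containing $A$ is either perpendicular to the axis, and then it is oriented away from $A$, or it forms with the axis the smaller acute angle $\arcsin((\sqrt5-1)/2)$ or the larger acute angle $\arccos((\sqrt5-1)/2)$, and then it is oriented towards $A$. In the upper half-plane the labels (mod 4) are: $n+1$ for sides at the smaller acute angle, $n+2$ for sides at the larger acute angle, $n+3$ for perpendicular sides. In the lower half-plane they are $n-1$, $n$, $n+1$, respectively. L-tilings. A colored tiling of the plane is an L-tiling if (i) any two sides of its tiles that share a common interval have matching (equal) orientations and labels, and (ii) every star within it is legal. *)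

theory Defs
  imports "HOL-Analysis.Analysis"
begin

definition phi :: real where
  "phi = sqrt ((sqrt 5 - 1) / 2)"

definition isometry :: "(complex \<Rightarrow> complex) \<Rightarrow> bool" where
  "isometry f \<longleftrightarrow> (\<forall>x y. dist (f x) (f y) = dist x y)"

definition homothety :: "complex \<Rightarrow> real \<Rightarrow> complex \<Rightarrow> complex" where
  "homothety c k z = c + k *\<^sub>R (z - c)"


section \<open>Tiles\<close>

datatype kind = Large | Small

text \<open>\<open>Rt\<close> is the right angle, \<open>Sh\<close> the smaller and \<open>Bl\<close> the larger acute angle.\<close>

datatype corner = Rt | Sh | Bl

datatype side = Hyp | LLeg | SLeg

fun corners :: "side \<Rightarrow> corner set" where
  "corners Hyp = {Sh, Bl}"
| "corners LLeg = {Rt, Sh}"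
| "corners SLeg = {Rt, Bl}"

fun side_len :: "kind \<Rightarrow> side \<Rightarrow> real" where
  "side_len Large Hyp = 1"
| "side_len Large LLeg = phi"
| "side_len Large SLeg = phi ^ 2"
| "side_len Small Hyp = phi"
| "side_len Small LLeg = phi ^ 2"
| "side_len Small SLeg = phi ^ 3"

fun proto :: "kind \<Rightarrow> corner \<Rightarrow> complex" where
  "proto k Rt = 0"
| "proto k Sh = Complex (side_len k LLeg) 0"
| "proto k Bl = Complex 0 (side_len k SLeg)"

text \<open>Since the proto-tiles are scalene, the point set \<open>body t\<close> of a tile determines its kind
  and which vertex is which corner; so a tile can be given by its kind and its vertices.\<close>

record tile =
  kind :: kind
  vert :: "corner \<Rightarrow> complex"

definition is_tile :: "tile \<Rightarrow> bool" where
  "is_tile t \<longleftrightarrow> (\<exists>f. isometry f \<and> vert t = f \<circ> proto (kind t))"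

definition body :: "tile \<Rightarrow> complex set" where
  "body t = convex hull (range (vert t))"

definition side_of :: "tile \<Rightarrow> side \<Rightarrow> complex set" where
  "side_of t s = convex hull (vert t ` corners s)"

definition map_tile :: "(complex \<Rightarrow> complex) \<Rightarrow> tile \<Rightarrow> tile" where
  "map_tile f t = \<lparr>kind = kind t, vert = f \<circ> vert t\<rparr>"


section \<open>Colored tiles and tilings\<close>

text \<open>The color of a side: its label in Z/4, and its orientation, given by
  naming one endpoint of the side the tail and the other one the head.\<close>

record mark =
  label :: 4
  tail :: complex
  head :: complex

type_synonym ctile = "tile \<times> (side \<Rightarrow> mark)"

definition map_mark :: "(complex \<Rightarrow> complex) \<Rightarrow> mark \<Rightarrow> mark" where
  "map_mark f m = \<lparr>label = label m, tail = f (tail m), head = f (head m)\<rparr>"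

definition map_ctile :: "(complex \<Rightarrow> complex) \<Rightarrow> ctile \<Rightarrow> ctile" where
  "map_ctile f X = (map_tile f (fst X), map_mark f \<circ> snd X)"

fun even_side :: "kind \<Rightarrow> side \<Rightarrow> bool" where
  "even_side Large s \<longleftrightarrow> s = Hyp \<or> s = SLeg"
| "even_side Small s \<longleftrightarrow> s = LLeg"

definition colored_tile :: "ctile \<Rightarrow> bool" where
  "colored_tile X \<longleftrightarrow> (case X of (t, \<kappa>) \<Rightarrow>
     is_tile t \<and>
     (\<forall>s. {tail (\<kappa> s), head (\<kappa> s)} = vert t ` corners s \<and>
          label (\<kappa> s) \<in> (if even_side (kind t) s then {0, 2} else {1, 3})))"

definition colored_tiling :: "ctile set \<Rightarrow> bool" where
  "colored_tiling T \<longleftrightarrow>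
     (\<forall>X\<in>T. colored_tile X) \<and>
     pairwise (\<lambda>X Y. disjnt (interior (body (fst X))) (interior (body (fst Y)))) T"

definition support :: "ctile set \<Rightarrow> complex set" where
  "support T = (\<Union>X\<in>T. body (fst X))"

definition colored_tiling_of_plane :: "ctile set \<Rightarrow> bool" where
  "colored_tiling_of_plane T \<longleftrightarrow> colored_tiling T \<and> support T = UNIV"


section \<open>Decomposition and substitution tilings\<close>

text \<open>The foot of the altitude: orthogonal projection of the right-angle vertex to the hypotenuse.\<close>

definition foot :: "tile \<Rightarrow> complex" where
  "foot t = (let r = vert t Rt; a = vert t Sh; b = vert t Bl in
     a + (((r - a) \<bullet> (b - a)) / ((b - a) \<bullet> (b - a))) *\<^sub>R (b - a))"

definition incr :: "mark \<Rightarrow> mark" where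
  "incr m = m\<lparr>label := label m + 1\<rparr>"

text \<open>The mark \<open>m\<close> of a side with endpoint \<open>x\<close>, inherited by the part of that side from \<open>x\<close> to \<open>p\<close>.\<close>

definition part :: "complex \<Rightarrow> complex \<Rightarrow> mark \<Rightarrow> mark" where
  "part p x m = (if tail m = x then m\<lparr>head := p\<rparr> else m\<lparr>tail := p\<rparr>)"

text \<open>The result of cutting, before the homothety is applied: the pieces of kind \<open>Large\<close> and
  \<open>Small\<close> are copies of the proto-tiles scaled by \<open>phi\<close>.\<close>

definition decompose :: "ctile \<Rightarrow> ctile set" where
  "decompose X = (case X of (t, \<kappa>) \<Rightarrow>
     (let r = vert t Rt; a = vert t Sh; b = vert t Bl; p = foot t; \<kappa>' = incr \<circ> \<kappa>;
          altitude = \<lparr>label = 0, tail = p, head = r\<rparr>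
      in case kind t of
           Large \<Rightarrow>
             {(\<lparr>kind = Large, vert = case_corner p a r\<rparr>,
               case_side (\<kappa>' LLeg) (part p a (\<kappa>' Hyp)) altitude),
              (\<lparr>kind = Small, vert = case_corner p r b\<rparr>,
               case_side (\<kappa>' SLeg) altitude (part p b (\<kappa>' Hyp)))}
         | Small \<Rightarrow> {(\<lparr>kind = Large, vert = vert t\<rparr>, \<kappa>')}))"

text \<open>The parameter \<open>c\<close> is the center of the fixed homothety.\<close>

definition sigma :: "complex \<Rightarrow> ctile set \<Rightarrow> ctile set" where
  "sigma c T = map_ctile (homothety c (1 / phi)) ` (\<Union>X\<in>T. decompose X)"

definition colored_supertile :: "complex \<Rightarrow> nat \<Rightarrow> ctile set \<Rightarrow> bool" where
  "colored_supertile c n P \<longleftrightarrow>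
     (\<exists>X. colored_tile X \<and> kind (fst X) = Large \<and> P = (sigma c ^^ n) {X})"

definition substitution_tiling :: "complex \<Rightarrow> ctile set \<Rightarrow> bool" where
  "substitution_tiling c T \<longleftrightarrow>
     colored_tiling T \<and>
     (\<forall>P. finite P \<and> P \<subseteq> T \<longrightarrow> (\<exists>n Q. colored_supertile c n Q \<and> P \<subseteq> Q))"


section \<open>Stars\<close>

text \<open>In a star, \<open>None\<close> means that the side does not contain the center,
  so that its color is not recorded.\<close>

type_synonym star_tile = "tile \<times> (side \<Rightarrow> mark option)"

definition star :: "ctile set \<Rightarrow> complex \<Rightarrow> star_tile set" where
  "star T A = {(t, \<lambda>s. if A \<in> side_of t s then Some (\<kappa> s) else None) | t \<kappa>.
     (t, \<kappa>) \<in> T \<and> A \<in> body t}"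

definition map_star :: "(complex \<Rightarrow> complex) \<Rightarrow> star_tile set \<Rightarrow> star_tile set" where
  "map_star f S = (\<lambda>(t, \<kappa>). (map_tile f t, map_option (map_mark f) \<circ> \<kappa>)) ` S"

definition complete_star :: "complex \<Rightarrow> star_tile set \<Rightarrow> bool" where
  "complete_star A S \<longleftrightarrow> A \<in> interior (\<Union>X\<in>S. body (fst X))"


section \<open>The legal stars\<close>

text \<open>A triple \<open>(k, x, y)\<close> stands for a tile of kind \<open>k\<close> with a vertex at the origin, where its
  sides \<open>x\<close> and \<open>y\<close> meet. In the names, \<open>h\<close>, \<open>b\<close>, \<open>a\<close> mean hypotenuse, large leg, small leg.\<close>

type_synonym wedge = "kind \<times> side \<times> side"

abbreviation "Lhb \<equiv> (Large, Hyp, LLeg)"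
abbreviation "Lbh \<equiv> (Large, LLeg, Hyp)"
abbreviation "Lha \<equiv> (Large, Hyp, SLeg)"
abbreviation "Lah \<equiv> (Large, SLeg, Hyp)"
abbreviation "Lba \<equiv> (Large, LLeg, SLeg)"
abbreviation "Lab \<equiv> (Large, SLeg, LLeg)"
abbreviation "Shb \<equiv> (Small, Hyp, LLeg)"
abbreviation "Sbh \<equiv> (Small, LLeg, Hyp)"
abbreviation "Sha \<equiv> (Small, Hyp, SLeg)"
abbreviation "Sah \<equiv> (Small, SLeg, Hyp)"
abbreviation "Sba \<equiv> (Small, LLeg, SLeg)"
abbreviation "Sab \<equiv> (Small, SLeg, LLeg)"

definition small_angle :: real where
  "small_angle = arcsin ((sqrt 5 - 1) / 2)"

definition large_angle :: real where
  "large_angle = arccos ((sqrt 5 - 1) / 2)"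

fun angle_at :: "corner \<Rightarrow> real" where
  "angle_at Rt = pi / 2"
| "angle_at Sh = small_angle"
| "angle_at Bl = large_angle"

text \<open>The corner at which two different sides meet (the value for equal sides is irrelevant).\<close>

fun apex :: "side \<Rightarrow> side \<Rightarrow> corner" where
  "apex Hyp LLeg = Sh"
| "apex LLeg Hyp = Sh"
| "apex Hyp SLeg = Bl"
| "apex SLeg Hyp = Bl"
| "apex _ _ = Rt"

text \<open>\<open>fan e u ws\<close> places the tiles \<open>ws\<close> one after another around the origin: the first side of the
  first tile lies on the ray in direction \<open>u\<close> (a unit vector), and one proceeds counterclockwise
  if \<open>e = 1\<close> and clockwise if \<open>e = -1\<close>.\<close>

fun place :: "real \<Rightarrow> complex \<Rightarrow> wedge \<Rightarrow> tile" where
  "place e u (k, x, y) = \<lparr>kind = k, vert = (\<lambda>v.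
     if v = apex x y then 0
     else if v \<in> corners x then of_real (side_len k x) * u
     else of_real (side_len k y) * (u * cis (e * angle_at (apex x y))))\<rparr>"

fun fan :: "real \<Rightarrow> complex \<Rightarrow> wedge list \<Rightarrow> tile set" where
  "fan e u [] = {}"
| "fan e u ((k, x, y) # ws) =
     insert (place e u (k, x, y)) (fan e (u * cis (e * angle_at (apex x y))) ws)"

text \<open>Below, the number \<open>n\<close> of a star ranges over \<open>{1..7}\<close>; the axis is the real line.\<close>

definition upper_tiles :: "nat \<Rightarrow> tile set" where
  "upper_tiles n = fan (-1) (-1)
     ([[Lba, Sba],
       [Lha, Sbh, Lba],
       [Sah, Lbh, Lha, Sbh],
       [Lah, Lhb, Sah, Lbh],
       [Sha, Lbh, Lah, Lhb],
       [Lha, Lhb, Sha, Lbh],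
       [Sah, Lbh, Lha, Lhb]] ! (n - 1))"

definition lower_tiles :: "nat \<Rightarrow> tile set" where
  "lower_tiles n =
     (if n = 1 then
        {\<lparr>kind = Large, vert =
            case_corner (Complex (- (phi ^ 5)) 0) (Complex (phi ^ 3) 0)
              (Complex (- (phi ^ 5)) (- (phi ^ 2)))\<rparr>}
      else if n = 2 then
        {\<lparr>kind = Large, vert =
            case_corner (Complex 0 (- (phi ^ 3))) (Complex (phi ^ 2) 0) (Complex (- (phi ^ 4)) 0)\<rparr>}
      else fan 1 (-1)
        ([[Sab, Lab],
          [Lab, Shb, Lah],
          [Shb, Lah, Lhb, Sha],
          [Lhb, Sha, Lbh, Lha],
          [Lbh, Lha, Lhb, Sah]] ! (n - 3)))"

text \<open>The angle in \<open>[0, pi/2]\<close> between the axis and the line through the origin and \<open>w\<close>.\<close>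

definition axis_angle :: "complex \<Rightarrow> real" where
  "axis_angle w = arccos (\<bar>Re w\<bar> / cmod w)"

text \<open>The mark of a side with endpoints \<open>p\<close>, \<open>q\<close> that contains the origin. Sides on the axis have
  label \<open>l\<close> and point to the right if \<open>right\<close> holds, to the left otherwise. A side not on the axis
  has the origin as an endpoint; in the last case its angle with the axis is \<open>large_angle\<close>.\<close>

definition legal_mark :: "nat \<Rightarrow> 4 \<Rightarrow> bool \<Rightarrow> complex \<Rightarrow> complex \<Rightarrow> mark" where
  "legal_mark n l right p q =
     (if Im p = 0 \<and> Im q = 0 then
        (if right \<longleftrightarrow> Re p < Re q then \<lparr>label = l, tail = p, head = q\<rparr>
         else \<lparr>label = l, tail = q, head = p\<rparr>)
      else
        (let w = (if p = 0 then q else p) in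
         if axis_angle w = pi / 2 then
           \<lparr>label = of_nat n + (if Im w > 0 then 3 else 1), tail = 0, head = w\<rparr>
         else if axis_angle w = small_angle then
           \<lparr>label = of_nat n + (if Im w > 0 then 1 else - 1), tail = w, head = 0\<rparr>
         else
           \<lparr>label = of_nat n + (if Im w > 0 then 2 else 0), tail = w, head = 0\<rparr>))"

definition decorate :: "nat \<Rightarrow> 4 \<Rightarrow> bool \<Rightarrow> tile \<Rightarrow> star_tile" where
  "decorate n l right t = (t, \<lambda>s.
     if 0 \<in> side_of t s then
       Some (case s of
           Hyp \<Rightarrow> legal_mark n l right (vert t Sh) (vert t Bl)
         | LLeg \<Rightarrow> legal_mark n l right (vert t Rt) (vert t Sh)
         | SLeg \<Rightarrow> legal_mark n l right (vert t Rt) (vert t Bl))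
     else None)"

definition C_star :: "nat \<Rightarrow> 4 \<Rightarrow> bool \<Rightarrow> star_tile set" where
  "C_star n l right = decorate n l right ` (upper_tiles n \<union> lower_tiles n)"

definition legal_star :: "complex \<Rightarrow> star_tile set \<Rightarrow> bool" where
  "legal_star A S \<longleftrightarrow>
     complete_star A S \<and>
     (\<exists>f n l right. isometry f \<and> f A = 0 \<and> n \<in> {1..7} \<and> l \<in> {of_nat n, of_nat n + 2} \<and>
        map_star f S = C_star n l right)"


section \<open>L-tilings\<close>

text \<open>As sides have positive length, equally oriented collinear sides are those whose
  normalized direction vectors coincide.\<close>

definition sides_match :: "ctile set \<Rightarrow> bool" where
  "sides_match T \<longleftrightarrow>
     (\<forall>(t, \<kappa>)\<in>T. \<forall>(t', \<kappa>')\<in>T. \<forall>s s'.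
        (\<exists>x y. x \<noteq> y \<and> closed_segment x y \<subseteq> side_of t s \<inter> side_of t' s') \<longrightarrow>
        label (\<kappa> s) = label (\<kappa>' s') \<and>
        sgn (head (\<kappa> s) - tail (\<kappa> s)) = sgn (head (\<kappa>' s') - tail (\<kappa>' s')))"

definition L_tiling :: "ctile set \<Rightarrow> bool" where
  "L_tiling T \<longleftrightarrow>
     colored_tiling_of_plane T \<and>
     sides_match T \<and>
     (\<forall>A. (\<exists>X\<in>T. A \<in> range (vert (fst X))) \<longrightarrow> legal_star A (star T A))"

end

theory Submission
  imports Defs "HOL-Analysis.Isolated"
begin

text \<open>
  Decomposition acts on tiles by fixed rigid motions: if a tile is the image of its proto-tile under an isometry \<open>f\<close>, its
  \<^emph>\<open>frame\<close>, then the pieces have the frames \<open>lift c f \<circ> df p\<close>, where \<open>lift\<close> conjugates \<open>f\<close> by the homothety and \<open>df p\<close> depends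
  only on the piece \<open>p\<close> (\<open>sigma_ct\<close>). Relative to its center, each of the seven legal stars is a finite list of frames whose
  entries lie in the ring generated by \<open>phi\<close> and \<open>\<i>\<close>, so all questions about finite configurations become exact integer
  computations (\<open>legal_star_iff\<close>).

  Substitution tilings have legal stars and matching sides. Decomposition turns the star \<open>C_n\<close> into \<open>C_(n+1)\<close>, and \<open>C_7\<close> into
  \<open>C_6\<close> (\<open>legalat_sigma\<close>). So only the new vertices need an argument: they are feet of altitudes in the interior of a
  hypotenuse. The tiles of a supertile that share a piece of a side do so in one of 14 relative positions, with matching
  marks, because this list contains the two halves of a cut tile and is closed under decomposition (\<open>paired_sigma\<close>). In only
  one of these positions the foot is no vertex of the tile across, and there decomposition creates a \<open>C_1\<close>
  (\<open>new_vertex_legal\<close>). In the plane every star and every pair of tiles belongs to a finite patch, hence to a supertile.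

  Conversely, a tiling \<open>T\<close> with legal stars can be composed. The star at the right angle of a tile tells whether the tile is
  half of a cut tile (\<open>sibp_iff\<close>). For the composed tiling to have legal stars again, the tiles of each star \<open>C_n\<close>
  must have the roles that they have in a decomposed \<open>C_(n-1)\<close>. A wrong role of one tile forces one legal star after
  another, until no star fits: this is a finite search, and certificates for its outcome are checked by
  \<open>root_exists\<close>. So \<open>T\<close> is the \<open>K\<close>-fold decomposition of a tiling with legal stars for every \<open>K\<close> (\<open>legal_tiling_compo\<close>).

  Let \<open>P \<subseteq> T\<close> be finite. In the \<open>K\<close>-fold composition, scaled back to tiles of the original size, \<open>P\<close> becomes as small as one
  wants, and then it fits into the core of one star: the interior of the star without the sides that do not contain its
  center (\<open>core_radius\<close>, a Lebesgue number that is uniform as there are finitely many stars). The colors of the omitted sides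
  do not influence \<open>P\<close> (\<open>recolor\<close>), and every legal star occurs in some supertile (\<open>every_star_occurs\<close>). So \<open>P\<close> lies in a
  decomposition of that supertile.
\<close>

section \<open>The number phi\<close>

lemma phi_sq: "phi^2 = (sqrt 5 - 1) / 2"
  unfolding phi_def by (simp add: real_le_rsqrt)

lemma phi_4: "phi^4 = 1 - phi^2"
proof -
  have "phi^4 = (phi^2)^2" by simp
  also have "\<dots> = 1 - phi^2"
    unfolding phi_sq by (simp add: power2_eq_square field_simps)
  finally show ?thesis .
qed

lemma phi_bounds: "0.786 < phi" "phi < 0.7862"
proof -
  have s: "2.236 < sqrt 5" "sqrt 5 < 2.2361"
    by (rule real_less_rsqrt, simp add: power2_eq_square) (rule real_less_lsqrt, simp_all add: power2_eq_square)
  have 1: "0.786^2 < phi^2" and 2: "phi^2 < 0.7862^2"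
    unfolding phi_sq using s by (auto simp: power2_eq_square)
  have 3: "0 \<le> phi" unfolding phi_def using s by (intro real_sqrt_ge_zero) auto
  show "0.786 < phi" by (rule power_less_imp_less_base[OF 1 3])
  show "phi < 0.7862" by (rule power_less_imp_less_base[OF 2]) simp
qed

lemma phi_pos [simp]: "0 < phi" using phi_bounds by simp
lemma phi_nonneg [simp]: "0 \<le> phi" using phi_bounds by simp
lemma phi_nz [simp]: "phi \<noteq> 0" using phi_pos by linarith
lemma phi_lt1: "phi < 1" using phi_bounds by simp

lemma sin_small: "sin small_angle = phi^2"
  unfolding small_angle_def phi_sq[symmetric]
  using phi_pos phi_lt1 by (intro sin_arcsin) (auto simp: power_le_one intro: order_trans[of "-1" 0])

lemma cos_small: "cos small_angle = phi"
proof -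
  have "cos small_angle = sqrt (1 - (phi^2)^2)"
    unfolding small_angle_def phi_sq[symmetric]
    using phi_pos phi_lt1 by (intro cos_arcsin) (auto simp: power_le_one intro: order_trans[of "-1" 0])
  also have "1 - (phi^2)^2 = phi^2" using phi_4 by simp
  finally show ?thesis by simp
qed

lemma large_angle_eq: "large_angle = pi / 2 - small_angle"
  unfolding large_angle_def small_angle_def phi_sq[symmetric]
  using phi_pos phi_lt1 by (intro arccos_arcsin_eq) (auto simp: power_le_one intro: order_trans[of "-1" 0])

lemma cis_small: "cis small_angle = Complex phi (phi^2)"
  by (simp add: cis.ctr sin_small cos_small)

section \<open>Isometries of the complex plane\<close>

text \<open>Every isometry of the plane has this form (\<open>isometry_form\<close>): a rotation, possibly after a reflection, and a translation.\<close>

definition iso :: "bool \<Rightarrow> complex \<Rightarrow> complex \<Rightarrow> complex \<Rightarrow> complex" where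
  "iso cj u w z = u * (if cj then cnj z else z) + w"

lemma isometry_iso: "cmod u = 1 \<Longrightarrow> isometry (iso cj u w)"
  unfolding isometry_def iso_def dist_norm
  by (auto simp: norm_mult simp flip: right_diff_distrib complex_cnj_diff)

text \<open>The images of \<open>0\<close>, \<open>1\<close> and \<open>\<i>\<close> determine everything: the distances to the first two leave two candidates for each image
  point, which the distance to the third one tells apart.\<close>

lemma isometry_form:
  assumes "isometry f"
  obtains cj u w where "cmod u = 1" "f = iso cj u w"
proof -
  define u where "u = f 1 - f 0"
  define h where "h z = cnj u * (f z - f 0)" for z
  have d: "cmod (f x - f y) = cmod (x - y)" for x y
    using assms unfolding isometry_def dist_norm by blast
  have u1: "cmod u = 1" unfolding u_def using d[of 1 0] by simp
  have uu: "u * cnj u = 1" using complex_norm_square[of u] u1 by simp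
  have hd: "cmod (h x - h y) = cmod (x - y)" for x y
  proof -
    have "h x - h y = cnj u * (f x - f y)" unfolding h_def by (simp add: algebra_simps)
    then show ?thesis by (simp add: norm_mult u1 d)
  qed
  have h0: "h 0 = 0" and h1: "h 1 = 1"
    using uu by (auto simp: h_def u_def[symmetric] mult.commute)
  have hn: "cmod (h x) = cmod x" for x using hd[of x 0] h0 by simp
  have sq: "(Re (h x))\<^sup>2 + (Im (h x))\<^sup>2 = (Re x)\<^sup>2 + (Im x)\<^sup>2" for x
    using hn[of x] by (simp add: cmod_def)
  have sq2: "(Re (h x) - Re (h y))\<^sup>2 + (Im (h x) - Im (h y))\<^sup>2 = (Re x - Re y)\<^sup>2 + (Im x - Im y)\<^sup>2" for x y
    using hd[of x y] by (simp add: cmod_def)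
  have re: "Re (h x) = Re x" for x
  proof -
    have "(Re (h x) - 1)\<^sup>2 = (Re (h x))\<^sup>2 - 2 * Re (h x) + 1" "(Re x - 1)\<^sup>2 = (Re x)\<^sup>2 - 2 * Re x + 1"
      by (simp_all add: power2_diff)
    then show ?thesis using sq[of x] sq2[of x 1] by (simp add: h1)
  qed
  have hi: "Im (h \<i>) = 1 \<or> Im (h \<i>) = -1"
    using sq[of \<i>] re[of \<i>] by (simp add: power2_eq_1_iff)
  have im: "Im (h x) * Im (h \<i>) = Im x" for x
  proof -
    have "(Im (h x) - Im (h \<i>))\<^sup>2 = (Im (h x))\<^sup>2 - 2 * (Im (h x) * Im (h \<i>)) + (Im (h \<i>))\<^sup>2"
        "(Im x - 1)\<^sup>2 = (Im x)\<^sup>2 - 2 * Im x + 1" "(Im (h \<i>))\<^sup>2 = 1"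
      using hi by (auto simp: power2_diff)
    then show ?thesis using sq[of x] sq2[of x \<i>] re[of x] re[of \<i>] by simp
  qed
  have fh: "f z = u * h z + f 0" for z
    unfolding h_def using uu by (simp add: mult.assoc[symmetric])
  from hi show thesis
  proof
    assume "Im (h \<i>) = 1"
    then have "h z = z" for z using im[of z] re[of z] by (simp add: complex_eq_iff)
    then have "f z = iso False u (f 0) z" for z unfolding iso_def by (subst fh) simp
    then have "f = iso False u (f 0)" by (rule ext)
    then show thesis using that u1 by blast
  next
    assume a: "Im (h \<i>) = -1"
    have "h z = cnj z" for z using im[of z] re[of z] a by (auto simp: complex_eq_iff)
    then have "f z = iso True u (f 0) z" for z unfolding iso_def by (subst fh) simp
    then have "f = iso True u (f 0)" by (rule ext)
    then show thesis using that u1 by blast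
  qed
qed

lemma isometry_id: "isometry (\<lambda>z. z)" by (simp add: isometry_def)

lemma isometry_comp: "isometry f \<Longrightarrow> isometry g \<Longrightarrow> isometry (f \<circ> g)"
  by (simp add: isometry_def)

lemma isometry_inj: "isometry f \<Longrightarrow> inj f"
  by (rule injI) (metis dist_eq_0_iff isometry_def)

lemma isometry_surj:
  assumes "isometry f" shows "surj f"
proof -
  obtain cj u w where u: "cmod u = 1" and f: "f = iso cj u w" using isometry_form[OF assms] .
  have uu: "u * cnj u = 1" using complex_norm_square[of u] u by simp
  have "y = f (if cj then cnj (cnj u * (y - w)) else cnj u * (y - w))" for y
  proof -
    have e: "u * (cnj u * (y - w)) + w = y" using uu by (metis diff_add_cancel mult.assoc mult_1)
    show ?thesis by (cases cj) (simp_all only: f iso_def if_True if_False complex_cnj_cnj e)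
  qed
  then show ?thesis unfolding surj_def by blast
qed

lemma isometry_bij: "isometry f \<Longrightarrow> bij f"
  by (simp add: bij_def isometry_inj isometry_surj)

lemma isometry_inv:
  assumes "isometry f" shows "isometry (inv f)"
  unfolding isometry_def
  by (metis assms bij_inv_eq_iff isometry_bij isometry_def)

lemma isometry_inv_comp:
  assumes "isometry f"
  shows "inv f (f x) = x" "f (inv f x) = x" "inv f \<circ> f = (\<lambda>z. z)" "f \<circ> inv f = (\<lambda>z. z)"
  using isometry_bij[OF assms] by (auto simp: bij_def surj_f_inv_f)

text \<open>The linear part.\<close>

definition ilin :: "(complex \<Rightarrow> complex) \<Rightarrow> complex \<Rightarrow> complex" where
  "ilin f z = f z - f 0"

lemma isometry_linear:
  assumes "isometry f"
  shows "linear (ilin f)" "inj (ilin f)" "f = (\<lambda>z. f 0 + ilin f z)"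
proof -
  obtain cj u w where u: "cmod u = 1" and f: "f = iso cj u w" using isometry_form[OF assms] .
  show "linear (ilin f)" unfolding ilin_def f iso_def
    by (intro linearI) (auto simp: algebra_simps)
  show "inj (ilin f)" using isometry_inj[OF assms] by (auto simp: ilin_def inj_on_def)
  show "f = (\<lambda>z. f 0 + ilin f z)" by (auto simp: ilin_def)
qed

lemma isometry_convex_hull:
  assumes "isometry f" shows "convex hull (f ` S) = f ` (convex hull S)"
proof -
  note L = isometry_linear[OF assms]
  have im: "f ` A = (\<lambda>x. f 0 + x) ` (ilin f ` A)" for A
    by (subst L(3)) (auto simp: image_image)
  show ?thesis unfolding im by (simp add: convex_hull_translation convex_hull_linear_image[OF L(1)])
qed

lemma isometry_interior:
  assumes "isometry f" shows "interior (f ` S) = f ` interior S"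
proof -
  note L = isometry_linear[OF assms]
  have im: "f ` A = (\<lambda>x. f 0 + x) ` (ilin f ` A)" for A
    by (subst L(3)) (auto simp: image_image)
  show ?thesis unfolding im by (simp add: interior_translation interior_injective_linear_image[OF L(1,2)])
qed

lemma isometry_affine:
  assumes "isometry f"
  shows "f ((1 - t) *\<^sub>R x + t *\<^sub>R y) = (1 - t) *\<^sub>R f x + t *\<^sub>R f y"
proof -
  obtain cj u w where f: "f = iso cj u w" using isometry_form[OF assms] .
  show ?thesis unfolding f iso_def by (auto simp: algebra_simps scaleR_conv_of_real)
qed

lemma isometry_segment:
  assumes "isometry f" shows "f ` closed_segment x y = closed_segment (f x) (f y)"
  by (simp add: segment_convex_hull isometry_convex_hull[OF assms, symmetric])

section \<open>Colored tiles by frames\<close>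

fun c0 :: "side \<Rightarrow> corner" where "c0 Hyp = Sh" | "c0 LLeg = Rt" | "c0 SLeg = Rt"
fun c1 :: "side \<Rightarrow> corner" where "c1 Hyp = Bl" | "c1 LLeg = Sh" | "c1 SLeg = Bl"

lemma corners_c: "corners s = {c0 s, c1 s}" "c0 s \<noteq> c1 s" by (cases s; auto)+

lemma corner_UNIV: "(UNIV :: corner set) = {Rt, Sh, Bl}"
  by (rule set_eqI, rename_tac x, case_tac x) auto
lemma side_UNIV: "(UNIV :: side set) = {Hyp, LLeg, SLeg}"
  by (rule set_eqI, rename_tac x, case_tac x) auto

text \<open>A mark in frame-independent form: the label, and whether the side is oriented from \<open>c0\<close> to \<open>c1\<close>.\<close>

definition mk_mark :: "(corner \<Rightarrow> complex) \<Rightarrow> side \<Rightarrow> 4 \<times> bool \<Rightarrow> mark" where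
  "mk_mark v s p = \<lparr>label = fst p, tail = v (if snd p then c0 s else c1 s),
                    head = v (if snd p then c1 s else c0 s)\<rparr>"

definition tl :: "kind \<Rightarrow> (complex \<Rightarrow> complex) \<Rightarrow> tile" where
  "tl k f = \<lparr>kind = k, vert = f \<circ> proto k\<rparr>"

text \<open>Every colored tile has this form for unique \<open>k\<close>, \<open>f\<close> and \<open>m\<close> (\<open>colored_tileE\<close>, \<open>ct_eqD\<close>), since proto-tiles have three different sides.\<close>

definition ct :: "kind \<Rightarrow> (complex \<Rightarrow> complex) \<Rightarrow> (side \<Rightarrow> 4 \<times> bool) \<Rightarrow> ctile" where
  "ct k f m = (tl k f, \<lambda>s. mk_mark (f \<circ> proto k) s (m s))"

lemma tl_sel [simp]: "kind (tl k f) = k" "vert (tl k f) = f \<circ> proto k"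
  by (auto simp: tl_def)

lemma fst_ct [simp]: "fst (ct k f m) = tl k f" by (simp add: ct_def)

definition parity_ok :: "kind \<Rightarrow> (side \<Rightarrow> 4 \<times> bool) \<Rightarrow> bool" where
  "parity_ok k m \<longleftrightarrow> (\<forall>s. fst (m s) \<in> (if even_side k s then {0, 2} else {1, 3}))"

lemma side_len_pos [simp]: "0 < side_len k s"
  by (cases k; cases s) auto

lemma inj_proto: "inj (proto k)"
proof (rule injI)
  fix x y assume "proto k x = proto k y"
  then show "x = y" using side_len_pos[of k LLeg] side_len_pos[of k SLeg]
    by (cases x; cases y; auto simp: complex_eq_iff simp del: side_len.simps side_len_pos)
qed

lemma colored_tile_ct:
  assumes "isometry f" shows "colored_tile (ct k f m) \<longleftrightarrow> parity_ok k m"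
proof -
  have "is_tile (tl k f)" using assms by (auto simp: is_tile_def tl_def)
  moreover have "{tail (mk_mark v s p), head (mk_mark v s p)} = v ` corners s" for v s p
    by (auto simp: mk_mark_def corners_c)
  ultimately show ?thesis
    by (simp add: colored_tile_def ct_def parity_ok_def) (simp add: mk_mark_def tl_def)
qed

lemma colored_tileE:
  assumes "colored_tile X"
  obtains k f m where "isometry f" "X = ct k f m" "parity_ok k m" "k = kind (fst X)"
proof -
  obtain t \<kappa> where X: "X = (t, \<kappa>)" by force
  from assms obtain f where f: "isometry f" "vert t = f \<circ> proto (kind t)"
    and c: "\<And>s. {tail (\<kappa> s), head (\<kappa> s)} = vert t ` corners s"
    by (auto simp: colored_tile_def X is_tile_def)
  define m where "m s = (label (\<kappa> s), tail (\<kappa> s) = vert t (c0 s))" for s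
  have inj: "inj (vert t)" unfolding f(2) using isometry_inj[OF f(1)] inj_proto by (rule inj_compose)
  have "\<kappa> s = mk_mark (f \<circ> proto (kind t)) s (m s)" for s
  proof -
    have "vert t (c0 s) \<noteq> vert t (c1 s)" using inj corners_c(2)[of s] by (simp add: inj_eq)
    then have "(tail (\<kappa> s) = vert t (c0 s) \<and> head (\<kappa> s) = vert t (c1 s)) \<or>
          (tail (\<kappa> s) = vert t (c1 s) \<and> head (\<kappa> s) = vert t (c0 s) \<and> tail (\<kappa> s) \<noteq> vert t (c0 s))"
      using c[of s] by (auto simp: corners_c doubleton_eq_iff)
    then show ?thesis unfolding mk_mark_def m_def f(2)[symmetric] by (auto intro!: mark.equality)
  qed
  moreover have "t = tl (kind t) f" unfolding tl_def using f(2) by simp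
  ultimately have e: "X = ct (kind t) f m" unfolding X ct_def by auto
  moreover have "parity_ok (kind t) m" using assms colored_tile_ct[OF f(1)] e by simp
  ultimately show thesis by (intro that[OF f(1) e]) (simp_all add: e)
qed

text \<open>A tile determines its frame, since an isometry of the plane is determined by its values on
  three non-collinear points.\<close>

lemma tl_eqD:
  assumes "isometry f" "isometry g" "tl k f = tl k' g"
  shows "k = k'" "f = g"
proof -
  show k: "k = k'" using arg_cong[OF assms(3), of kind] by simp
  have v: "f (proto k c) = g (proto k c)" for c
    using arg_cong[OF assms(3), of vert] k by (auto simp: fun_eq_iff)
  obtain cj u w where f: "f = iso cj u w" using isometry_form[OF assms(1)] .
  obtain cj' u' w' where g: "g = iso cj' u' w'" and u': "cmod u' = 1" using isometry_form[OF assms(2)] by metis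
  have w: "w = w'" using v[of Rt] by (cases cj; cases cj'; simp add: f g iso_def)
  define a b where "a = side_len k LLeg" and "b = side_len k SLeg"
  have ab: "a > 0" "b > 0" by (auto simp only: a_def b_def side_len_pos)
  have ps: "proto k Sh = of_real a" and pb: "proto k Bl = \<i> * of_real b"
    by (auto simp: complex_eq_iff a_def b_def)
  have "f (of_real a) = u * of_real a + w" "g (of_real a) = u' * of_real a + w"
    by (auto simp: f g iso_def w)
  then have "u * of_real a = u' * of_real a" using v[of Sh] unfolding ps by (metis add_right_cancel)
  then have u: "u = u'" using ab by simp
  have "f (\<i> * of_real b) = (if cj then - 1 else 1) * (u * (\<i> * of_real b)) + w"
       "g (\<i> * of_real b) = (if cj' then - 1 else 1) * (u' * (\<i> * of_real b)) + w"
    by (auto simp: f g iso_def w)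
  then have e: "(if cj then - 1 else 1) * (u' * (\<i> * of_real b)) = (if cj' then - 1 else 1) * (u' * (\<i> * of_real b))"
    using v[of Bl] unfolding pb u by (metis add_right_cancel)
  have "cj = cj'"
  proof (rule ccontr)
    assume "cj \<noteq> cj'"
    then have "u' * (\<i> * of_real b) = 0" using e by (cases cj; cases cj') (simp_all only: if_True if_False, simp_all)
    then show False using ab u' by auto
  qed
  then show "f = g" using f g u w by simp
qed

lemma mk_mark_eqD:
  assumes "inj v" "mk_mark v s p = mk_mark v s q" shows "p = q"
proof -
  have "v (c0 s) \<noteq> v (c1 s)" using assms(1) corners_c(2)[of s] by (simp add: inj_eq)
  then show ?thesis using assms(2) by (auto simp: mk_mark_def prod_eq_iff split: if_splits)
qed

lemma inj_vert: "isometry f \<Longrightarrow> inj (f \<circ> proto k)"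
  by (simp add: inj_compose inj_proto isometry_inj)

lemma ct_eqD:
  assumes "isometry f" "isometry g" "ct k f m = ct k' g m'"
  shows "k = k'" "f = g" "m = m'"
proof -
  have "tl k f = tl k' g" using assms(3) by (simp add: ct_def)
  from tl_eqD[OF assms(1,2) this] show k: "k = k'" and f: "f = g" .
  show "m = m'"
  proof
    fix s
    have "snd (ct k f m) s = snd (ct k f m') s" using assms(3) k f by simp
    then have "mk_mark (f \<circ> proto k) s (m s) = mk_mark (f \<circ> proto k) s (m' s)"
      by (simp add: ct_def)
    then show "m s = m' s" using mk_mark_eqD inj_vert[OF assms(1)] by blast
  qed
qed

section \<open>Bodies of tiles in barycentric coordinates\<close>

text \<open>Barycentric coordinates with respect to the proto-tile: they make containment in a tile, its interior and its sides
  a matter of three signs.\<close>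

fun bary :: "kind \<Rightarrow> corner \<Rightarrow> complex \<Rightarrow> real" where
  "bary k Rt z = 1 - Re z / side_len k LLeg - Im z / side_len k SLeg"
| "bary k Sh z = Re z / side_len k LLeg"
| "bary k Bl z = Im z / side_len k SLeg"

fun opp :: "side \<Rightarrow> corner" where "opp Hyp = Rt" | "opp LLeg = Bl" | "opp SLeg = Sh"

definition std :: "kind \<Rightarrow> complex set" where "std k = {z. \<forall>c. 0 \<le> bary k c z}"

lemma all_corner: "(\<forall>c. P c) \<longleftrightarrow> P Rt \<and> P Sh \<and> P Bl"
  by (metis corner.exhaust)

lemma bary_proto [simp]: "bary k c (proto k d) = (if c = d then 1 else 0)"
  using side_len_pos[of k LLeg] side_len_pos[of k SLeg]
  by (cases c; cases d; simp del: side_len.simps side_len_pos)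

lemma bary_sum: "bary k Rt z + bary k Sh z + bary k Bl z = 1" by simp

lemma bary_combine:
  "z = bary k Rt z *\<^sub>R proto k Rt + bary k Sh z *\<^sub>R proto k Sh + bary k Bl z *\<^sub>R proto k Bl"
  using side_len_pos[of k LLeg] side_len_pos[of k SLeg]
  by (simp add: complex_eq_iff del: side_len.simps side_len_pos)

lemma bary_affine: "bary k c ((1 - t) *\<^sub>R x + t *\<^sub>R y) = (1 - t) * bary k c x + t * bary k c y"
  by (cases c) (auto simp: algebra_simps add_divide_distrib diff_divide_distrib)

lemma continuous_bary: "continuous_on UNIV (bary k c)"
  using side_len_pos[of k LLeg] side_len_pos[of k SLeg]
  by (cases c) (auto intro!: continuous_intros simp del: side_len.simps side_len_pos)

lemma convex_hull_proto: "convex hull (range (proto k)) = std k"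
proof -
  have r: "range (proto k) = {proto k Rt, proto k Sh, proto k Bl}" by (auto simp: corner_UNIV)
  show ?thesis
  proof (intro equalityI subsetI)
    fix z assume "z \<in> convex hull (range (proto k))"
    then obtain u v w where uvw: "0 \<le> u" "0 \<le> v" "0 \<le> w" "u + v + w = 1"
      and z: "z = u *\<^sub>R proto k Rt + v *\<^sub>R proto k Sh + w *\<^sub>R proto k Bl"
      unfolding r convex_hull_3 by auto
    have "Re z = v * side_len k LLeg" "Im z = w * side_len k SLeg" by (simp_all add: z)
    then have "bary k Sh z = v" "bary k Bl z = w" "bary k Rt z = u"
      using uvw(4) side_len_pos[of k LLeg] side_len_pos[of k SLeg]
      by (auto simp: less_imp_neq[THEN not_sym] simp del: side_len.simps side_len_pos)
    then show "z \<in> std k" unfolding std_def using uvw by (auto simp: all_corner simp del: bary.simps)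
  next
    fix z assume "z \<in> std k"
    then have "0 \<le> bary k Rt z" "0 \<le> bary k Sh z" "0 \<le> bary k Bl z" unfolding std_def by blast+
    then show "z \<in> convex hull (range (proto k))"
      unfolding r convex_hull_3 using bary_combine[of z k] bary_sum[of k z] by blast
  qed
qed

lemma body_tl: "isometry f \<Longrightarrow> body (tl k f) = f ` std k"
  unfolding body_def tl_sel image_comp[symmetric] isometry_convex_hull convex_hull_proto ..

lemma side_std: "closed_segment (proto k (c0 s)) (proto k (c1 s)) = {z \<in> std k. bary k (opp s) z = 0}"
proof (intro equalityI subsetI)
  fix z assume "z \<in> closed_segment (proto k (c0 s)) (proto k (c1 s))"
  then obtain t where t: "0 \<le> t" "t \<le> 1" "z = (1 - t) *\<^sub>R proto k (c0 s) + t *\<^sub>R proto k (c1 s)"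
    unfolding closed_segment_def by blast
  then have "bary k c z = (1 - t) * (if c = c0 s then 1 else 0) + t * (if c = c1 s then 1 else 0)" for c
    by (simp only: bary_affine bary_proto)
  then show "z \<in> {z \<in> std k. bary k (opp s) z = 0}" unfolding std_def using t
    by (cases s) (auto simp: all_corner simp del: bary.simps)
next
  fix z assume "z \<in> {z \<in> std k. bary k (opp s) z = 0}"
  then have b: "\<And>c. 0 \<le> bary k c z" "bary k (opp s) z = 0" by (auto simp: std_def)
  have "z = (1 - bary k (c1 s) z) *\<^sub>R proto k (c0 s) + bary k (c1 s) z *\<^sub>R proto k (c1 s)"
    using bary_combine[of z k] bary_sum[of k z] b(2)
    by (cases s) (simp_all del: bary.simps proto.simps add: eq_diff_eq[symmetric])
  moreover have "bary k (c1 s) z \<le> 1"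
    using b(1)[of Rt] b(1)[of Sh] b(1)[of Bl] bary_sum[of k z] by (cases s) (simp_all del: bary.simps)
  ultimately show "z \<in> closed_segment (proto k (c0 s)) (proto k (c1 s))"
    unfolding closed_segment_def using b(1) by blast
qed

lemma side_of_tl:
  assumes "isometry f"
  shows "side_of (tl k f) s = f ` {z \<in> std k. bary k (opp s) z = 0}"
    and "side_of (tl k f) s = closed_segment (f (proto k (c0 s))) (f (proto k (c1 s)))"
proof -
  show 2: "side_of (tl k f) s = closed_segment (f (proto k (c0 s))) (f (proto k (c1 s)))"
    unfolding side_of_def by (simp add: corners_c segment_convex_hull)
  show "side_of (tl k f) s = f ` {z \<in> std k. bary k (opp s) z = 0}"
    unfolding 2 by (simp add: isometry_segment[OF assms, symmetric] side_std)
qed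

definition centroid :: "kind \<Rightarrow> complex" where
  "centroid k = Complex (side_len k LLeg / 3) (side_len k SLeg / 3)"

lemma bary_centroid [simp]: "bary k c (centroid k) = 1 / 3"
  using side_len_pos[of k LLeg] side_len_pos[of k SLeg]
  by (cases c) (auto simp: centroid_def simp del: side_len.simps side_len_pos)

text \<open>The strict inequalities define an open set; conversely, at a boundary point a small step away from the vertex whose
  coordinate vanishes leaves the tile.\<close>

lemma interior_std: "interior (std k) = {z. \<forall>c. 0 < bary k c z}"
proof (intro equalityI subsetI)
  fix z assume z: "z \<in> interior (std k)"
  then obtain e where e: "e > 0" "ball z e \<subseteq> std k" by (meson mem_interior)
  define t where "t = e / (2 * (1 + cmod (z - centroid k)))"
  have t: "t > 0" using e by (auto simp: t_def intro!: divide_pos_pos add_pos_nonneg)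
  define z' where "z' = (1 + t) *\<^sub>R z - t *\<^sub>R centroid k"
  have "z' - z = t *\<^sub>R (z - centroid k)" by (simp add: z'_def algebra_simps)
  then have "dist z z' = t * cmod (z - centroid k)" using t by (simp add: dist_norm norm_minus_commute)
  also have "\<dots> < e"
  proof -
    have "cmod (z - centroid k) / (2 * (1 + cmod (z - centroid k))) < 1"
      by (simp add: divide_simps) (smt (verit) norm_ge_zero)
    then have "e * (cmod (z - centroid k) / (2 * (1 + cmod (z - centroid k)))) < e * 1"
      using e(1) by (intro mult_strict_left_mono) auto
    then show ?thesis unfolding t_def by simp
  qed
  finally have "z' \<in> std k" using e by auto
  then have "0 \<le> bary k c z'" for c by (simp add: std_def)
  moreover have "bary k c z' = (1 + t) * bary k c z - t / 3" for c
    using bary_affine[of k c "-t" z "centroid k"] by (simp add: z'_def del: bary.simps)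
  ultimately have "0 < (1 + t) * bary k c z" for c using t by (smt (verit) divide_pos_pos)
  then show "z \<in> {z. \<forall>c. 0 < bary k c z}" using t by (simp add: zero_less_mult_iff del: bary.simps)
next
  fix z assume z: "z \<in> {z. \<forall>c. 0 < bary k c z}"
  have "open {z. \<forall>c. 0 < bary k c z}"
    unfolding all_corner
    by (intro open_Collect_conj open_Collect_less continuous_bary continuous_on_const)
  moreover have "{z. \<forall>c. 0 < bary k c z} \<subseteq> std k" by (auto simp: std_def less_imp_le)
  ultimately show "z \<in> interior (std k)" using z by (meson interior_maximal subsetD)
qed

lemma compact_std: "compact (std k)"
  using convex_hull_proto[of k] by (metis finite_imp_compact_convex_hull finite_imageI finite.intros corner_UNIV)

lemma interior_body: "isometry f \<Longrightarrow> interior (body (tl k f)) = f ` {z. \<forall>c. 0 < bary k c z}"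
  by (simp add: body_tl isometry_interior interior_std)

lemma body_compact: "compact (body t)"
  unfolding body_def by (intro finite_imp_compact_convex_hull finite_imageI) (simp add: corner_UNIV)

lemma isometry_continuous: "isometry f \<Longrightarrow> continuous_on S f"
  unfolding isometry_def continuous_on_iff by auto

text \<open>Every open set that touches a tile meets its interior: move towards the centroid.\<close>

lemma open_meets_interior:
  assumes "isometry f" "open W" "W \<inter> body (tl k f) \<noteq> {}"
  shows "W \<inter> interior (body (tl k f)) \<noteq> {}"
proof -
  obtain z where z: "z \<in> std k" "f z \<in> W" using assms(3) by (auto simp: body_tl[OF assms(1)])
  have "open (f -` W)" using assms(1,2) by (simp add: isometry_continuous open_vimage)
  then obtain e where e: "e > 0" "ball z e \<subseteq> f -` W" using z(2) by (meson open_contains_ball vimage_eq)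
  define t where "t = min (1/2) (e / (2 * (1 + cmod (z - centroid k))))"
  have t: "t > 0" "t < 1" using e by (auto simp: t_def intro!: divide_pos_pos add_pos_nonneg)
  define z' where "z' = (1 - t) *\<^sub>R z + t *\<^sub>R centroid k"
  have "z - z' = t *\<^sub>R (z - centroid k)" by (simp add: z'_def algebra_simps)
  then have "dist z z' = t * cmod (z - centroid k)" using t by (simp add: dist_norm)
  also have "\<dots> \<le> e / (2 * (1 + cmod (z - centroid k))) * cmod (z - centroid k)"
    by (intro mult_right_mono) (auto simp: t_def)
  also have "\<dots> < e"
  proof -
    have "cmod (z - centroid k) / (2 * (1 + cmod (z - centroid k))) < 1"
      by (simp add: divide_simps) (smt (verit) norm_ge_zero)
    then have "e * (cmod (z - centroid k) / (2 * (1 + cmod (z - centroid k)))) < e * 1"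
      using e(1) by (intro mult_strict_left_mono) auto
    then show ?thesis by simp
  qed
  finally have "f z' \<in> W" using e by auto
  moreover have "0 < bary k c z'" for c
    using z(1) t by (auto simp: z'_def bary_affine std_def simp del: bary.simps intro!: add_nonneg_pos)
  ultimately show ?thesis by (auto simp: interior_body[OF assms(1)])
qed

text \<open>Baire for finite families: a finite union of closed sets without interior has none.\<close>

lemma open_subset_finite_Union_meets_interior:
  fixes W :: "'a::topological_space set"
  assumes "finite F" "open W" "W \<noteq> {}" "W \<subseteq> \<Union>F" "\<And>B. B \<in> F \<Longrightarrow> closed B"
  shows "\<exists>B\<in>F. W \<inter> interior B \<noteq> {}"
  using assms
proof (induction F arbitrary: W rule: finite_induct)
  case (insert B F)
  show ?case
  proof (cases "W - B = {}")
    case True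
    then have "W \<subseteq> interior B" using insert.prems(1) by (intro interior_maximal) auto
    then show ?thesis using insert.prems(2) by auto
  next
    case False
    have "open (W - B)" using insert.prems by (intro open_Diff) auto
    moreover have "W - B \<subseteq> \<Union>F" using insert.prems by auto
    ultimately obtain C where "C \<in> F" "(W - B) \<inter> interior C \<noteq> {}"
      using insert.IH[of "W - B"] False insert.prems by blast
    then show ?thesis by blast
  qed
qed auto

section \<open>Decomposition in terms of frames\<close>

lemma phi_red:
  "phi * (phi * (phi * phi)) = 1 - phi * phi"
  "phi * (phi * (phi * (phi * z))) = z - phi * (phi * z)"
proof -
  show p: "phi * (phi * (phi * phi)) = 1 - phi * phi" using phi_4 by (simp add: power_numeral_reduce)
  show "phi * (phi * (phi * (phi * z))) = z - phi * (phi * z)"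
    using arg_cong[OF p, of "\<lambda>u. u * z"] by (simp add: algebra_simps)
qed

text \<open>Normal form for polynomials in \<open>phi\<close>: the relation \<open>phi^4 = 1 - phi^2\<close> reduces them to degree 3.\<close>

lemmas phi_alg = power_numeral_reduce algebra_simps phi_red

lemma div_phi:
  "x / phi = x * (phi + phi^3)" "x / phi^2 = x * (1 + phi^2)" "x / phi^3 = x * (2 * phi + phi^3)"
proof -
  have "phi * (phi + phi^3) = 1" "phi^2 * (1 + phi^2) = 1" "phi^3 * (2 * phi + phi^3) = 1"
    by (simp_all add: phi_alg)
  then show "x / phi = x * (phi + phi^3)" "x / phi^2 = x * (1 + phi^2)" "x / phi^3 = x * (2 * phi + phi^3)"
    by (simp_all add: divide_eq_eq mult.assoc mult.commute)
qed

text \<open>The frame of a tile after the homothety: conjugation by \<open>homothety c (1 / phi)\<close>, with the argument rescaled so that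
  proto-tiles of the original size are used.\<close>

definition lift :: "complex \<Rightarrow> (complex \<Rightarrow> complex) \<Rightarrow> complex \<Rightarrow> complex" where
  "lift c f z = homothety c (1 / phi) (f (phi *\<^sub>R z))"

definition shrink :: "(complex \<Rightarrow> complex) \<Rightarrow> complex \<Rightarrow> complex" where
  "shrink g z = (1 / phi) *\<^sub>R g (phi *\<^sub>R z)"

definition drop :: "complex \<Rightarrow> (complex \<Rightarrow> complex) \<Rightarrow> complex \<Rightarrow> complex" where
  "drop c f z = homothety c phi (f ((1 / phi) *\<^sub>R z))"

lemma dist_homothety: "dist (homothety c k x) (homothety c k y) = \<bar>k\<bar> * dist x y"
proof -
  have "homothety c k x - homothety c k y = k *\<^sub>R (x - y)" by (simp add: homothety_def algebra_simps)
  then show ?thesis by (simp add: dist_norm)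
qed

lemma homothety_inverse [simp]:
  "homothety c phi (homothety c (1 / phi) z) = z" "homothety c (1 / phi) (homothety c phi z) = z"
  by (simp_all add: homothety_def)

lemma dist_scale: "dist (k *\<^sub>R x) (k *\<^sub>R y) = \<bar>k\<bar> * dist x (y :: complex)"
  by (simp add: dist_norm flip: scaleR_diff_right)

lemma isometry_lift: "isometry f \<Longrightarrow> isometry (lift c f)"
  by (simp add: isometry_def lift_def dist_homothety dist_scale)

lemma isometry_drop: "isometry f \<Longrightarrow> isometry (drop c f)"
  by (simp add: isometry_def drop_def dist_homothety dist_scale)

lemma lift_drop [simp]: "lift c (drop c f) = f" "drop c (lift c f) = f"
  by (auto simp: lift_def drop_def fun_eq_iff)

lemma lift_comp: "lift c (f \<circ> g) = lift c f \<circ> shrink g"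
  by (auto simp: lift_def shrink_def fun_eq_iff)

lemma shrink_iso: "shrink (iso cj u w) = iso cj u (w / of_real phi)"
  by (auto simp: shrink_def iso_def fun_eq_iff scaleR_conv_of_real field_simps)

text \<open>The pieces a tile can be cut into: the large and the small part of a large tile, and the uncut
  small tile.\<close>

datatype pc = PL | PS | PU

fun pk :: "pc \<Rightarrow> kind" where "pk PL = Large" | "pk PS = Small" | "pk PU = Large"
fun par :: "pc \<Rightarrow> kind" where "par PL = Large" | "par PS = Large" | "par PU = Small"

text \<open>The frames of the pieces relative to their parent, after rescaling. Cutting at the altitude places \<open>PL\<close> and \<open>PS\<close> with
  the right angle at the foot of the altitude; \<open>PU\<close> only turns a small tile into a large one.\<close>

fun df :: "pc \<Rightarrow> complex \<Rightarrow> complex" where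
  "df PL = iso True (Complex phi (- (phi^2))) (Complex (phi^4) (phi^3))"
| "df PS = iso True (Complex (- (phi^2)) (- phi)) (Complex (phi^4) (phi^3))"
| "df PU = (\<lambda>z. z)"

text \<open>The marks of the pieces. The altitude is \<open>SLeg\<close> of \<open>PL\<close> and \<open>LLeg\<close> of \<open>PS\<close>; both begin at the right angle, so its
  orientation away from the foot is \<open>True\<close>. On the sides of \<open>PL\<close> that it inherits, the canonical direction is reversed.\<close>

fun pm :: "pc \<Rightarrow> (side \<Rightarrow> 4 \<times> bool) \<Rightarrow> side \<Rightarrow> 4 \<times> bool" where
  "pm PL m Hyp = (fst (m LLeg) + 1, \<not> snd (m LLeg))"
| "pm PL m LLeg = (fst (m Hyp) + 1, \<not> snd (m Hyp))"
| "pm PL m SLeg = (0, True)"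
| "pm PS m Hyp = (fst (m SLeg) + 1, snd (m SLeg))"
| "pm PS m LLeg = (0, True)"
| "pm PS m SLeg = (fst (m Hyp) + 1, snd (m Hyp))"
| "pm PU m s = (fst (m s) + 1, snd (m s))"

definition piece :: "complex \<Rightarrow> pc \<Rightarrow> (complex \<Rightarrow> complex) \<Rightarrow> (side \<Rightarrow> 4 \<times> bool) \<Rightarrow> ctile" where
  "piece c p f m = ct (pk p) (lift c f \<circ> df p) (pm p m)"

lemma isometry_df: "isometry (df p)"
proof -
  have n: "cmod (Complex phi (- (phi^2))) = 1" "cmod (Complex (- (phi^2)) (- phi)) = 1"
    using phi_4 by (simp_all add: cmod_def)
  show ?thesis by (cases p) (auto intro!: isometry_iso n isometry_id simp del: complex_norm)
qed

lemma isometry_piece: "isometry f \<Longrightarrow> isometry (lift c f \<circ> df p)"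
  by (intro isometry_comp isometry_lift isometry_df)

definition foot0 :: complex where "foot0 = Complex (phi^5) (phi^4)"

lemma df_proto:
  "phi *\<^sub>R df PL (proto Large Rt) = foot0"
  "phi *\<^sub>R df PL (proto Large Sh) = proto Large Sh"
  "phi *\<^sub>R df PL (proto Large Bl) = proto Large Rt"
  "phi *\<^sub>R df PS (proto Small Rt) = foot0"
  "phi *\<^sub>R df PS (proto Small Sh) = proto Large Rt"
  "phi *\<^sub>R df PS (proto Small Bl) = proto Large Bl"
  "phi *\<^sub>R df PU (proto Large v) = proto Small v"
  by (simp_all add: df.simps iso_def foot0_def complex_eq_iff phi_alg)
     (cases v; simp add: complex_eq_iff phi_alg)

lemma isometry_inner:
  assumes "isometry f"
  shows "(f x - f y) \<bullet> (f z - f y) = (x - y) \<bullet> (z - y)"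
proof -
  have d: "norm (f a - f b) = norm (a - b)" for a b using assms by (simp add: isometry_def dist_norm)
  have e: "u \<bullet> v = ((norm u)\<^sup>2 + (norm v)\<^sup>2 - (norm (u - v))\<^sup>2) / 2" for u v :: complex
    by (simp add: power2_norm_eq_inner inner_diff_left inner_diff_right inner_commute)
  show ?thesis unfolding e by (simp add: d)
qed

lemma foot_tl: assumes "isometry f" shows "foot (tl Large f) = f foot0"
proof -
  let ?a = "proto Large Sh" and ?b = "proto Large Bl" and ?r = "proto Large Rt"
  have q: "(?r - ?a) \<bullet> (?b - ?a) = phi^2" "(?b - ?a) \<bullet> (?b - ?a) = 1"
    by (simp_all add: inner_complex_def phi_alg)
  have "foot (tl Large f) = f ?a + phi^2 *\<^sub>R (f ?b - f ?a)"
    unfolding foot_def Let_def tl_sel o_def isometry_inner[OF assms] q by simp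
  also have "\<dots> = (1 - phi^2) *\<^sub>R f ?a + phi^2 *\<^sub>R f ?b" by (simp add: algebra_simps)
  also have "\<dots> = f ((1 - phi^2) *\<^sub>R ?a + phi^2 *\<^sub>R ?b)" by (rule isometry_affine[OF assms, symmetric])
  also have "(1 - phi^2) *\<^sub>R ?a + phi^2 *\<^sub>R ?b = foot0"
    by (simp add: foot0_def complex_eq_iff phi_alg)
  finally show ?thesis .
qed

lemma map_mark_mk: "map_mark h (mk_mark v s p) = mk_mark (h \<circ> v) s p"
  by (simp add: map_mark_def mk_mark_def)

lemma lift_df: "lift c f (df p z) = homothety c (1 / phi) (f (phi *\<^sub>R df p z))"
  by (simp add: lift_def)

lemma all_side: "(\<forall>s. P s) \<longleftrightarrow> P Hyp \<and> P LLeg \<and> P SLeg"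
  by (metis side.exhaust)

lemma map_decompose:
  assumes f: "isometry f"
  shows "map_ctile (homothety c (1 / phi)) ` decompose (ct k f m) = {piece c p f m | p. par p = k}"
proof (cases k)
  case Large
  let ?h = "homothety c (1 / phi)"
  have ne: "f (proto Large c0) = f (proto Large d) \<longleftrightarrow> c0 = d" for c0 d
    using inv_into_f_f[OF isometry_inj[OF f]] inj_proto[of Large] isometry_inj[OF f] by (auto simp: inj_eq)
  have ft: "foot (tl Large f) = f foot0" by (rule foot_tl[OF f])
  have pieces: "{piece c p f m | p. par p = Large} = {piece c PL f m, piece c PS f m}"
    by (auto, metis par.simps pc.exhaust kind.distinct(1))+
  have vL: "lift c f (df PL (proto Large v)) = ?h (case v of Rt \<Rightarrow> f foot0 | Sh \<Rightarrow> f (proto Large Sh) | Bl \<Rightarrow> f (proto Large Rt))" for v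
    unfolding lift_df by (cases v) (simp_all only: df_proto corner.case)
  have vS: "lift c f (df PS (proto Small v)) = ?h (case v of Rt \<Rightarrow> f foot0 | Sh \<Rightarrow> f (proto Large Rt) | Bl \<Rightarrow> f (proto Large Bl))" for v
    unfolding lift_df by (cases v) (simp_all only: df_proto corner.case)
  define t where "t = tl Large f"
  have vt: "vert t v = f (proto Large v)" for v by (simp add: t_def)
  define \<kappa> where "\<kappa> = (\<lambda>s. incr (mk_mark (f \<circ> proto Large) s (m s)))"
  have dec: "decompose (ct Large f m) =
      {(\<lparr>kind = Large, vert = case_corner (f foot0) (f (proto Large Sh)) (f (proto Large Rt))\<rparr>,
        case_side (\<kappa> LLeg) (part (f foot0) (f (proto Large Sh)) (\<kappa> Hyp)) \<lparr>label = 0, tail = f foot0, head = f (proto Large Rt)\<rparr>),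
       (\<lparr>kind = Small, vert = case_corner (f foot0) (f (proto Large Rt)) (f (proto Large Bl))\<rparr>,
        case_side (\<kappa> SLeg) \<lparr>label = 0, tail = f foot0, head = f (proto Large Rt)\<rparr> (part (f foot0) (f (proto Large Bl)) (\<kappa> Hyp)))}"
    unfolding decompose_def ct_def \<kappa>_def by (simp add: Let_def ft o_def del: proto.simps)
  have PL: "map_ctile ?h (\<lparr>kind = Large, vert = case_corner (f foot0) (f (proto Large Sh)) (f (proto Large Rt))\<rparr>,
        case_side (\<kappa> LLeg) (part (f foot0) (f (proto Large Sh)) (\<kappa> Hyp)) \<lparr>label = 0, tail = f foot0, head = f (proto Large Rt)\<rparr>)
      = piece c PL f m" (is "map_ctile ?h (?t, ?\<kappa>) = _")
  proof -
    have "map_tile ?h ?t = tl Large (lift c f \<circ> df PL)"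
      by (auto simp: map_tile_def tl_def fun_eq_iff vL all_corner simp del: df.simps proto.simps)
    moreover have "map_mark ?h (?\<kappa> s) = mk_mark ((lift c f \<circ> df PL) \<circ> proto Large) s (pm PL m s)" for s
      by (cases s) (simp_all add: mk_mark_def map_mark_def vL \<kappa>_def incr_def part_def ne del: df.simps proto.simps)
    ultimately show ?thesis unfolding map_ctile_def piece_def ct_def
      by (intro prod_eqI ext) (simp_all add: o_def del: df.simps proto.simps)
  qed
  have PS: "map_ctile ?h (\<lparr>kind = Small, vert = case_corner (f foot0) (f (proto Large Rt)) (f (proto Large Bl))\<rparr>,
        case_side (\<kappa> SLeg) \<lparr>label = 0, tail = f foot0, head = f (proto Large Rt)\<rparr> (part (f foot0) (f (proto Large Bl)) (\<kappa> Hyp)))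
      = piece c PS f m" (is "map_ctile ?h (?t, ?\<kappa>) = _")
  proof -
    have "map_tile ?h ?t = tl Small (lift c f \<circ> df PS)"
      by (auto simp: map_tile_def tl_def fun_eq_iff vS all_corner simp del: df.simps proto.simps)
    moreover have "map_mark ?h (?\<kappa> s) = mk_mark ((lift c f \<circ> df PS) \<circ> proto Small) s (pm PS m s)" for s
      by (cases s) (simp_all add: mk_mark_def map_mark_def vS \<kappa>_def incr_def part_def ne del: df.simps proto.simps)
    ultimately show ?thesis unfolding map_ctile_def piece_def ct_def
      by (intro prod_eqI ext) (simp_all add: o_def del: df.simps proto.simps)
  qed
  show ?thesis unfolding Large pieces dec image_insert image_empty PL PS ..
next
  case Small
  let ?h = "homothety c (1 / phi)"
  have pieces: "{piece c p f m | p. par p = Small} = {piece c PU f m}"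
    by (auto, metis par.simps pc.exhaust kind.distinct(1))+
  have v: "lift c f (df PU (proto Large v)) = ?h (f (proto Small v))" for v
    unfolding lift_df by (simp only: df_proto)
  have "map_ctile ?h (\<lparr>kind = Large, vert = f \<circ> proto Small\<rparr>, \<lambda>s. incr (mk_mark (f \<circ> proto Small) s (m s)))
      = piece c PU f m" (is "map_ctile ?h (?t, ?\<kappa>) = _")
  proof -
    have "map_tile ?h ?t = tl Large (lift c f \<circ> df PU)"
      by (auto simp: map_tile_def tl_def fun_eq_iff v simp del: df.simps proto.simps)
    moreover have "map_mark ?h (?\<kappa> s) = mk_mark ((lift c f \<circ> df PU) \<circ> proto Large) s (pm PU m s)" for s
      by (simp_all add: mk_mark_def map_mark_def v incr_def del: df.simps proto.simps)
    ultimately show ?thesis unfolding map_ctile_def piece_def ct_def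
      by (intro prod_eqI ext) (simp_all add: o_def del: df.simps proto.simps)
  qed
  then show ?thesis unfolding Small pieces decompose_def ct_def
    by (simp add: Let_def o_def)
qed

text \<open>Decomposition becomes a rule on frames and marks. All later arguments use this form instead of the definition.\<close>

lemma sigma_ct:
  assumes "\<And>X. X \<in> T \<Longrightarrow> colored_tile X"
  shows "sigma c T = {piece c p f m | p f m. isometry f \<and> ct (par p) f m \<in> T}"
proof (intro equalityI subsetI)
  fix Y assume "Y \<in> sigma c T"
  then obtain X where X: "X \<in> T" "Y \<in> map_ctile (homothety c (1 / phi)) ` decompose X" by (auto simp: sigma_def)
  obtain k f m where "isometry f" "X = ct k f m" using colored_tileE[OF assms[OF X(1)]] by metis
  then show "Y \<in> {piece c p f m | p f m. isometry f \<and> ct (par p) f m \<in> T}"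
    using X by (auto simp: map_decompose)
next
  fix Y assume "Y \<in> {piece c p f m | p f m. isometry f \<and> ct (par p) f m \<in> T}"
  then obtain p f m where Y: "Y = piece c p f m" "isometry f" "ct (par p) f m \<in> T" by blast
  then have "Y \<in> map_ctile (homothety c (1 / phi)) ` decompose (ct (par p) f m)"
    by (auto simp: map_decompose)
  then show "Y \<in> sigma c T" unfolding sigma_def using Y(3) by blast
qed

lemma parity_pm: "parity_ok (par p) m \<Longrightarrow> parity_ok (pk p) (pm p m)"
  by (cases p) (auto simp: parity_ok_def all_side)

lemma bary_poly:
  "bary Large Rt z = 1 - Re z * (phi + phi^3) - Im z * (1 + phi^2)"
  "bary Large Sh z = Re z * (phi + phi^3)"
  "bary Large Bl z = Im z * (1 + phi^2)"
  "bary Small Rt z = 1 - Re z * (1 + phi^2) - Im z * (2 * phi + phi^3)"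
  "bary Small Sh z = Re z * (1 + phi^2)"
  "bary Small Bl z = Im z * (2 * phi + phi^3)"
  by (simp_all add: div_phi)

text \<open>Barycentric coordinates of a point of a piece with respect to the parent tile.\<close>

lemma bary_df:
  "bary Large Rt (phi *\<^sub>R df PL w) = bary Large Bl w"
  "bary Large Bl (phi *\<^sub>R df PL w) = phi^2 * bary Large Rt w"
  "bary Large Sh (phi *\<^sub>R df PL w) = bary Large Sh w + phi^4 * bary Large Rt w"
  "bary Large Rt (phi *\<^sub>R df PS w) = bary Small Sh w"
  "bary Large Sh (phi *\<^sub>R df PS w) = phi^4 * bary Small Rt w"
  "bary Large Bl (phi *\<^sub>R df PS w) = bary Small Bl w + phi^2 * bary Small Rt w"
  "bary Small v (phi *\<^sub>R df PU w) = bary Large v w"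
  by (simp_all add: df.simps iso_def bary_poly phi_alg del: bary.simps)
     (cases v; simp add: bary_poly phi_alg del: bary.simps)

section \<open>Pieces cover their parent without overlapping\<close>

text \<open>The embedding of a piece into its parent, in proto-tile coordinates before rescaling.\<close>

definition emb :: "pc \<Rightarrow> complex \<Rightarrow> complex" where "emb p w = phi *\<^sub>R df p w"

lemma emb_surj: "\<exists>w. emb p w = z"
proof -
  obtain w where "df p w = (1 / phi) *\<^sub>R z" using isometry_surj[OF isometry_df, of p] by (metis surjD)
  then show ?thesis unfolding emb_def by (intro exI[of _ w]) simp
qed

lemmas bary_emb = bary_df[folded emb_def]

lemma emb_std: "emb p ` std (pk p) \<subseteq> std (par p)"
  by (cases p) (auto simp: std_def all_corner bary_emb simp del: bary.simps)

text \<open>The altitude divides a large tile by the sign of a linear functional; in barycentric coordinates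
  one side of it is \<open>PL\<close> and the other one \<open>PS\<close>.\<close>

lemma std_pieces: "std k = (\<Union>p\<in>{p. par p = k}. emb p ` std (pk p))"
proof (intro equalityI subsetI)
  fix z assume z: "z \<in> std k"
  show "z \<in> (\<Union>p\<in>{p. par p = k}. emb p ` std (pk p))"
  proof (cases k)
    case Small
    obtain w where "emb PU w = z" using emb_surj by blast
    moreover from this have "w \<in> std Large" using z Small by (auto simp: std_def bary_emb simp del: bary.simps)
    ultimately show ?thesis using Small by (intro UN_I[of PU]) auto
  next
    case Large
    obtain v where v: "emb PL v = z" using emb_surj by blast
    obtain w where w: "emb PS w = z" using emb_surj by blast
    have b: "0 \<le> bary Large Rt z" "0 \<le> bary Large Sh z" "0 \<le> bary Large Bl z" using z Large by (auto simp: std_def simp del: bary.simps)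
    have p: "phi^2 > 0" "phi^4 > 0" by simp_all
    have e: "bary Large Bl z = phi^2 * bary Large Rt v" "bary Large Sh z = bary Large Sh v + phi^4 * bary Large Rt v"
       "bary Large Rt z = bary Large Bl v"
       "bary Large Sh z = phi^4 * bary Small Rt w" "bary Large Bl z = bary Small Bl w + phi^2 * bary Small Rt w"
       "bary Large Rt z = bary Small Sh w"
      using bary_emb(1-3)[of v] bary_emb(4-6)[of w] unfolding v w by auto
    have "0 \<le> bary Large Rt v" "0 \<le> bary Small Rt w" using e(1,4) b p by (metis zero_le_mult_iff not_less)+
    moreover have "bary Large Sh v = - (phi^2 * bary Small Bl w)"
    proof -
      have "phi^2 * bary Small Bl w + bary Large Sh v = phi^2 * bary Large Bl z + bary Large Sh z
             - phi^4 * bary Small Rt w - phi^4 * bary Large Rt v"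
        using e(2) e(5) by (simp add: algebra_simps power_numeral_reduce del: bary.simps)
      also have "phi^4 * bary Large Rt v = phi^2 * bary Large Bl z" unfolding e(1) by (simp add: power_numeral_reduce del: bary.simps)
      finally show ?thesis using e(4) by simp
    qed
    ultimately have "v \<in> std Large \<or> w \<in> std Small" using b e p
      by (auto simp: std_def all_corner mult_le_0_iff simp del: bary.simps)
    then show ?thesis
    proof
      assume "v \<in> std Large" then show ?thesis using v Large by (intro UN_I[of PL]) auto
    next
      assume "w \<in> std Small" then show ?thesis using w Large by (intro UN_I[of PS]) auto
    qed
  qed
next
  fix z assume "z \<in> (\<Union>p\<in>{p. par p = k}. emb p ` std (pk p))"
  then show "z \<in> std k" using emb_std by blast
qed

lemma body_piece:
  assumes "isometry f"
  shows "body (fst (piece c p f m)) = homothety c (1 / phi) ` f ` emb p ` std (pk p)"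
  unfolding piece_def fst_ct body_tl[OF isometry_piece[OF assms]] by (auto simp: lift_df emb_def image_image)

lemma homothety_image_body:
  assumes "isometry f"
  shows "homothety c (1 / phi) ` body (tl k f) = (\<Union>p\<in>{p. par p = k}. body (fst (piece c p f m)))"
  unfolding body_piece[OF assms] body_tl[OF assms] by (subst std_pieces) blast

lemma body_piece_subset:
  assumes "isometry f"
  shows "body (fst (piece c p f m)) \<subseteq> homothety c (1 / phi) ` body (tl (par p) f)"
  unfolding homothety_image_body[OF assms, of c "par p" m] by blast

lemma homothety_inj: "inj (homothety c (1 / phi))"
  by (metis homothety_inverse(1) injI)

lemma homothety_surj: "surj (homothety c (1 / phi))"
  by (metis homothety_inverse(2) surjI)

lemma homothety_continuous: "continuous_on S (homothety c k)"
  unfolding homothety_def by (intro continuous_intros)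

lemma open_homothety_image:
  assumes "open S" shows "open (homothety c (1 / phi) ` S)"
proof -
  have "homothety c (1 / phi) ` S = homothety c phi -` S"
  proof (intro equalityI subsetI)
    fix x assume "x \<in> homothety c phi -` S"
    then show "x \<in> homothety c (1 / phi) ` S" by (metis homothety_inverse(2) imageI vimage_eq)
  qed auto
  then show ?thesis using assms homothety_continuous[of UNIV c phi] by (simp add: open_vimage)
qed

lemma interior_homothety: "interior (homothety c (1 / phi) ` S) = homothety c (1 / phi) ` interior S"
proof (intro equalityI subsetI)
  fix z assume z: "z \<in> interior (homothety c (1 / phi) ` S)"
  have "open (homothety c (1/phi) -` interior (homothety c (1 / phi) ` S))"
    using homothety_continuous[of UNIV c "1/phi"] by (simp add: open_vimage)
  moreover have "homothety c (1/phi) -` interior (homothety c (1 / phi) ` S) \<subseteq> S"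
    using interior_subset[of "homothety c (1 / phi) ` S"] homothety_inj[of c] by (auto dest!: subsetD simp: inj_eq)
  ultimately have "homothety c (1/phi) -` interior (homothety c (1 / phi) ` S) \<subseteq> interior S"
    by (simp add: interior_maximal)
  moreover have "homothety c phi z \<in> homothety c (1/phi) -` interior (homothety c (1 / phi) ` S)" using z by simp
  ultimately show "z \<in> homothety c (1 / phi) ` interior S"
    by (metis homothety_inverse(2) imageI subsetD)
next
  fix z assume "z \<in> homothety c (1 / phi) ` interior S"
  then show "z \<in> interior (homothety c (1 / phi) ` S)"
    using interior_maximal[OF image_mono[OF interior_subset] open_homothety_image[OF open_interior]] by blast
qed

lemma interior_piece:
  assumes "isometry f"
  shows "interior (body (fst (piece c p f m))) = homothety c (1 / phi) ` f ` emb p ` {w. \<forall>v. 0 < bary (pk p) v w}"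
  unfolding piece_def fst_ct interior_body[OF isometry_piece[OF assms]] by (auto simp: lift_df emb_def image_image)

lemma siblings_disjoint:
  assumes f: "isometry f" and pq: "p \<noteq> q" "par p = par q"
  shows "disjnt (interior (body (fst (piece c p f m)))) (interior (body (fst (piece c q f m'))))"
proof -
  have L: False if "emb PL v = emb PS w" "\<forall>c. 0 < bary Large c v" "\<forall>c. 0 < bary Small c w" for v w
  proof -
    let ?z = "emb PL v"
    have e: "bary Large Bl ?z = phi^2 * bary Large Rt v" "bary Large Sh ?z = bary Large Sh v + phi^4 * bary Large Rt v"
       "bary Large Sh ?z = phi^4 * bary Small Rt w" "bary Large Bl ?z = bary Small Bl w + phi^2 * bary Small Rt w"
      using bary_emb(1-3)[of v] bary_emb(4-6)[of w] unfolding that(1) by auto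
    have p: "phi^2 > 0" by simp
    have "phi^4 * bary Small Rt w = bary Large Sh v + phi^2 * (bary Small Bl w + phi^2 * bary Small Rt w)"
      using e by (simp add: power_numeral_reduce del: bary.simps) 
    then have "bary Large Sh v + phi^2 * bary Small Bl w = 0" by (simp add: algebra_simps power_numeral_reduce del: bary.simps)
    moreover have "0 < bary Large Sh v" "0 < phi^2 * bary Small Bl w" using that(2,3) p by (simp_all del: bary.simps)
    ultimately show False by linarith
  qed
  have "p = PL \<and> q = PS \<or> p = PS \<and> q = PL" using pq by (cases p; cases q) auto
  then show ?thesis unfolding disjnt_iff interior_piece[OF f]
    using L isometry_inj[OF f] homothety_inj[of c] by (auto simp: inj_eq) metis+
qed

lemma interior_piece_subset:
  assumes "isometry f"
  shows "interior (body (fst (piece c p f m))) \<subseteq> homothety c (1 / phi) ` interior (body (tl (par p) f))"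
  using interior_mono[OF body_piece_subset[OF assms, of c p m]] by (simp add: interior_homothety)

lemma colored_tilingD:
  assumes "colored_tiling T" shows "X \<in> T \<Longrightarrow> colored_tile X"
    "X \<in> T \<Longrightarrow> Y \<in> T \<Longrightarrow> interior (body (fst X)) \<inter> interior (body (fst Y)) \<noteq> {} \<Longrightarrow> X = Y"
  using assms unfolding colored_tiling_def pairwise_def disjnt_def by blast+

lemma ct_interior_nonempty: "isometry f \<Longrightarrow> interior (body (tl k f)) \<noteq> {}"
proof -
  assume f: "isometry f"
  have "\<forall>c. 0 < bary k c (centroid k)" by (simp del: bary.simps)
  then show ?thesis unfolding interior_body[OF f] by blast
qed

lemma colored_tiling_frame_unique:
  assumes "colored_tiling T" "isometry f" "ct k f m \<in> T" "ct k f m' \<in> T" shows "m = m'"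
proof -
  have "ct k f m = ct k f m'"
    using colored_tilingD(2)[OF assms(1,3,4)] ct_interior_nonempty[OF assms(2)] by simp
  then show ?thesis using ct_eqD(3) assms(2) by blast
qed

text \<open>Pieces of different tiles lie in disjoint interiors of their parents, and the two pieces of one tile lie on different sides
  of the altitude.\<close>

lemma colored_tiling_sigma:
  assumes T: "colored_tiling T" shows "colored_tiling (sigma c T)"
  unfolding colored_tiling_def
proof (intro conjI ballI pairwiseI)
  note S = sigma_ct[OF colored_tilingD(1)[OF T], of T c, simplified]
  fix X assume "X \<in> sigma c T"
  then obtain p f m where X: "X = piece c p f m" "isometry f" "ct (par p) f m \<in> T" unfolding S by blast
  have "parity_ok (par p) m" using colored_tilingD(1)[OF T X(3)] colored_tile_ct X(2) by blast
  then show "colored_tile X" unfolding X(1) piece_def using colored_tile_ct[OF isometry_piece[OF X(2)]] parity_pm by blast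
  fix Y assume "Y \<in> sigma c T" and ne: "X \<noteq> Y"
  then obtain q g m' where Y: "Y = piece c q g m'" "isometry g" "ct (par q) g m' \<in> T" unfolding S by blast
  show "disjnt (interior (body (fst X))) (interior (body (fst Y)))"
  proof (rule ccontr)
    assume a: "\<not> ?thesis"
    then obtain z where "z \<in> interior (body (fst X))" "z \<in> interior (body (fst Y))" by (auto simp: disjnt_def)
    then have "z \<in> homothety c (1 / phi) ` interior (body (tl (par p) f))" "z \<in> homothety c (1 / phi) ` interior (body (tl (par q) g))"
      using interior_piece_subset X Y by blast+
    then have "interior (body (tl (par p) f)) \<inter> interior (body (tl (par q) g)) \<noteq> {}"
      using homothety_inj[of c] by (auto simp: inj_eq)
    then have "ct (par p) f m = ct (par q) g m'" using colored_tilingD(2)[OF T X(3) Y(3)] by simp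
    then have e: "par p = par q" "f = g" "m = m'" using ct_eqD X(2) Y(2) by blast+
    then have "p \<noteq> q" using ne X(1) Y(1) by auto
    then show False using siblings_disjoint[OF X(2) _ e(1), of c m m'] a X(1) Y(1) e by simp
  qed
qed

lemma support_sigma:
  assumes T: "\<And>X. X \<in> T \<Longrightarrow> colored_tile X"
  shows "support (sigma c T) = homothety c (1 / phi) ` support T"
proof (intro equalityI subsetI)
  have S: "sigma c T = {piece c p f m | p f m. isometry f \<and> ct (par p) f m \<in> T}"
    by (rule sigma_ct) (rule T)
  {
  fix z assume "z \<in> support (sigma c T)"
  then obtain p f m where "isometry f" "ct (par p) f m \<in> T" "z \<in> body (fst (piece c p f m))"
    unfolding support_def S by blast
  then show "z \<in> homothety c (1 / phi) ` support T"
    using body_piece_subset[of f c p m] by (force simp: support_def)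
  }
  fix z assume "z \<in> homothety c (1 / phi) ` support T"
  then obtain X where X: "X \<in> T" "z \<in> homothety c (1 / phi) ` body (fst X)" by (auto simp: support_def)
  obtain k f m where f: "isometry f" "X = ct k f m" using colored_tileE[OF T[OF X(1)]] by metis
  then obtain p where "par p = k" "z \<in> body (fst (piece c p f m))"
    using X(2) homothety_image_body[OF f(1), of c k m] by auto
  then show "z \<in> support (sigma c T)" unfolding support_def S using X(1) f by blast
qed

section \<open>The points of a tile at which stars are centered\<close>

text \<open>Besides the corners, a star may be centered at two points in the interior of a side of a large
  tile: a point of the large leg (in \<open>C_1\<close>) and the foot of the altitude (in \<open>C_2\<close>).\<close>

datatype pos = At corner | FB | FH

fun ppt :: "kind \<Rightarrow> pos \<Rightarrow> complex" where
  "ppt k (At v) = proto k v" | "ppt k FB = Complex (phi^5) 0" | "ppt k FH = foot0"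

fun vpos :: "kind \<Rightarrow> pos \<Rightarrow> bool" where
  "vpos k (At v) = True" | "vpos k FB = (k = Large)" | "vpos k FH = (k = Large)"

fun sat :: "pos \<Rightarrow> side \<Rightarrow> bool" where
  "sat (At v) s = (v \<in> corners s)" | "sat FB s = (s = LLeg)" | "sat FH s = (s = Hyp)"

lemma bary_ppt:
  "bary Large v (ppt Large FB) = (case v of Rt \<Rightarrow> phi^2 | Sh \<Rightarrow> phi^4 | Bl \<Rightarrow> 0)"
  "bary Large v (ppt Large FH) = (case v of Rt \<Rightarrow> 0 | Sh \<Rightarrow> phi^4 | Bl \<Rightarrow> phi^2)"
  by (cases v; simp add: bary_poly foot0_def phi_alg del: bary.simps)+

lemma ppt_std:
  assumes "vpos k q" shows "ppt k q \<in> std k" "bary k (opp s) (ppt k q) = 0 \<longleftrightarrow> sat q s"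
proof -
  have "(\<forall>v. 0 \<le> bary k v (ppt k q)) \<and> (bary k (opp s) (ppt k q) = 0 \<longleftrightarrow> sat q s)"
  proof (cases q)
    case (At v)
    have "(opp s \<noteq> v) = (v \<in> corners s)" by (cases s; cases v) auto
    then show ?thesis using At by (auto simp del: bary.simps)
  next
    case FB
    then show ?thesis using assms by (cases s) (auto simp: bary_ppt split: corner.split simp del: bary.simps ppt.simps)
  next
    case FH
    then show ?thesis using assms by (cases s) (auto simp: bary_ppt split: corner.split simp del: bary.simps ppt.simps)
  qed
  then show "ppt k q \<in> std k" "bary k (opp s) (ppt k q) = 0 \<longleftrightarrow> sat q s" by (auto simp: std_def)
qed

lemma ppt_inj:
  assumes "vpos k q" "vpos k q'" "ppt k q = ppt k q'" shows "q = q'"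
proof -
  have s: "sat q = sat q'" using ppt_std(2)[OF assms(1)] ppt_std(2)[OF assms(2)] assms(3) by auto
  have c: "v = w" if "\<forall>s. v \<in> corners s \<longleftrightarrow> w \<in> corners s" for v w
    using that by (cases v; cases w) (auto simp: all_side)
  have n': "\<not> (\<forall>s. s = s' \<longleftrightarrow> v \<in> corners s)" for v s'
    by (cases v; cases s') (auto simp: all_side)
  have n: "\<not> (\<forall>s. v \<in> corners s \<longleftrightarrow> s = s')" for v s'
    by (cases v; cases s') (auto simp: all_side)
  show ?thesis using s c n n'
    by (cases q; cases q') (auto simp: fun_eq_iff dest: spec[of _ Hyp])
qed

text \<open>Where a given point of the parent lies in a piece, if it lies there at all.\<close>

fun cpos :: "pc \<Rightarrow> pos \<Rightarrow> pos option" where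
  "cpos PL (At Rt) = Some (At Bl)" | "cpos PL (At Sh) = Some (At Sh)" | "cpos PL (At Bl) = None"
| "cpos PL FB = Some FH" | "cpos PL FH = Some (At Rt)"
| "cpos PS (At Rt) = Some (At Sh)" | "cpos PS (At Sh) = None" | "cpos PS (At Bl) = Some (At Bl)"
| "cpos PS FB = None" | "cpos PS FH = Some (At Rt)"
| "cpos PU (At v) = Some (At v)" | "cpos PU FB = None" | "cpos PU FH = None"

lemma emb_FB: "emb PL foot0 = Complex (phi^5) 0"
  by (simp add: emb_def df.simps iso_def foot0_def complex_eq_iff phi_alg)

lemma cpos_Some:
  assumes "vpos (par p) q" "cpos p q = Some q'"
  shows "emb p (ppt (pk p) q') = ppt (par p) q" "vpos (pk p) q'"
proof -
  have "emb p (ppt (pk p) q') = ppt (par p) q \<and> vpos (pk p) q'"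
    using assms
    by (cases "(p, q)" rule: cpos.cases) (auto simp: emb_FB simp del: df.simps proto.simps, auto simp: emb_def df_proto simp del: df.simps proto.simps)
  then show "emb p (ppt (pk p) q') = ppt (par p) q" "vpos (pk p) q'" by auto
qed

lemma cpos_None:
  assumes "vpos (par p) q" "cpos p q = None"
  shows "ppt (par p) q \<notin> emb p ` std (pk p)"
proof
  assume "ppt (par p) q \<in> emb p ` std (pk p)"
  then obtain w where w: "w \<in> std (pk p)" "ppt (par p) q = emb p w" by blast
  have b: "0 \<le> bary (pk p) v w" for v using w(1) by (simp add: std_def)
  have e: "bary (par p) v (ppt (par p) q) = bary (par p) v (emb p w)" for v using w(2) by simp
  have s: "bary (pk p) Rt w + bary (pk p) Sh w + bary (pk p) Bl w = 1" by (rule bary_sum)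
  have pos: "0 < phi^2" "0 < phi^4" by simp_all
  show False using assms e[of Rt] e[of Sh] e[of Bl] b[of Rt] b[of Sh] b[of Bl] s pos
    by (cases "(p, q)" rule: cpos.cases)
       (auto simp: bary_emb bary_ppt add_nonneg_eq_0_iff simp del: bary.simps ppt.simps(2-) proto.simps)
qed

section \<open>Exact frames\<close>

text \<open>Numbers \<open>a + b phi + c phi^2 + d phi^3\<close> with integer coefficients.\<close>

datatype zf = ZF int int int int

text \<open>The value of an exact number \<open>a + b phi + c phi^2 + d phi^3\<close>.\<close>

fun evz :: "zf \<Rightarrow> real" where "evz (ZF a b c d) = of_int a + of_int b * phi + of_int c * phi^2 + of_int d * phi^3"
fun zadd :: "zf \<Rightarrow> zf \<Rightarrow> zf" where "zadd (ZF a b c d) (ZF e f g h) = ZF (a + e) (b + f) (c + g) (d + h)"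
fun zneg :: "zf \<Rightarrow> zf" where "zneg (ZF a b c d) = ZF (- a) (- b) (- c) (- d)"
fun zphi :: "zf \<Rightarrow> zf" where "zphi (ZF a b c d) = ZF d a (b - d) c"
fun zpi :: "zf \<Rightarrow> zf" where "zpi (ZF a b c d) = ZF b (c + a) d a"

lemma evz: "evz (zadd x y) = evz x + evz y" "evz (zneg x) = - evz x" "evz (zphi x) = phi * evz x"
  "evz (zpi x) = evz x / phi"
proof -
  show "evz (zadd x y) = evz x + evz y" by (cases x; cases y) (simp add: algebra_simps)
  show "evz (zneg x) = - evz x" by (cases x) simp
  show p: "evz (zphi x) = phi * evz x" for x by (cases x) (simp add: phi_alg)
  have "zphi (zpi x) = x" by (cases x) simp
  then have "phi * evz (zpi x) = evz x" using p[of "zpi x"] by simp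
  then show "evz (zpi x) = evz x / phi" by (simp add: field_simps)
qed

datatype gs = G zf zf

fun evg :: "gs \<Rightarrow> complex" where "evg (G x y) = Complex (evz x) (evz y)"
fun gadd :: "gs \<Rightarrow> gs \<Rightarrow> gs" where "gadd (G a b) (G c d) = G (zadd a c) (zadd b d)"
fun gneg :: "gs \<Rightarrow> gs" where "gneg (G a b) = G (zneg a) (zneg b)"
fun gcnj :: "gs \<Rightarrow> gs" where "gcnj (G a b) = G a (zneg b)"
fun gi :: "gs \<Rightarrow> gs" where "gi (G a b) = G (zneg b) a"
fun gpi :: "gs \<Rightarrow> gs" where "gpi (G a b) = G (zpi a) (zpi b)"
fun gcs :: "gs \<Rightarrow> gs" where
  "gcs (G x y) = (let u = zphi x; v = zphi y in G (zadd u (zneg (zphi v))) (zadd (zphi u) v))"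
fun gcsi :: "gs \<Rightarrow> gs" where
  "gcsi (G x y) = (let u = zphi x; v = zphi y in G (zadd u (zphi v)) (zadd (zneg (zphi u)) v))"

function gpow :: "bool \<Rightarrow> int \<Rightarrow> gs \<Rightarrow> gs" where
  "gpow d n z = (if n \<le> 0 then z else gpow d (n - 1) (if d then gcs z else gcsi z))"
  by auto
termination by (relation "Wellfounded.measure (\<lambda>(d, n, z). nat n)") auto

declare gpow.simps [simp del]

definition gia :: "int \<Rightarrow> gs \<Rightarrow> gs" where
  "gia a z = (if a = 0 then z else if a = 1 then gi z else if a = 2 then gneg z else gi (gneg z))"

definition grot :: "int \<Rightarrow> int \<Rightarrow> gs \<Rightarrow> gs" where
  "grot a b z = gia (a mod 4) (if b = 0 then z else if 0 < b then gpow True b z else gpow False (- b) z)"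

text \<open>The directions that occur: any two sides of a tile form an angle that is an integer combination of the right angle and the
  smaller acute angle.\<close>

definition dirc :: "int \<Rightarrow> int \<Rightarrow> complex" where
  "dirc a b = cis (of_int a * (pi / 2) + of_int b * small_angle)"

lemma dirc_add: "dirc (a + a') (b + b') = dirc a b * dirc a' b'"
  by (simp add: dirc_def cis_mult algebra_simps add_divide_distrib)

lemma dirc_0 [simp]: "dirc 0 0 = 1" by (simp add: dirc_def)
lemma norm_dirc [simp]: "cmod (dirc a b) = 1" by (simp add: dirc_def)
lemma cnj_dirc: "cnj (dirc a b) = dirc (- a) (- b)" by (simp add: dirc_def cis_cnj)

lemma dirc_1: "dirc 1 0 = \<i>" "dirc 2 0 = -1" "dirc 3 0 = - \<i>" "dirc (-1) 0 = - \<i>"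
  "dirc 0 1 = Complex phi (phi^2)" "dirc 0 (-1) = Complex phi (- (phi^2))"
proof -
  show 1: "dirc 1 0 = \<i>" by (simp add: dirc_def cis.ctr complex_eq_iff)
  show 2: "dirc 2 0 = -1" using dirc_add[of 1 1 0 0] 1 by simp
  show "dirc 3 0 = - \<i>" using dirc_add[of 2 1 0 0] 1 2 by simp
  show "dirc (-1) 0 = - \<i>" using cnj_dirc[of 1 0] 1 by simp
  show 3: "dirc 0 1 = Complex phi (phi^2)" by (simp add: dirc_def cis_small)
  show "dirc 0 (-1) = Complex phi (- (phi^2))" using cnj_dirc[of 0 1] 3 by (simp add: complex_eq_iff)
qed

lemma dirc_mod: "dirc (a mod 4) b = dirc a b"
proof -
  have "dirc 4 0 = 1" using dirc_add[of 2 2 0 0] by (simp add: dirc_1)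
  then have 4: "dirc (4 * n) 0 = 1" for n
  proof -
    have "dirc (4 * n) 0 = cis (2 * pi * of_int n)" by (simp add: dirc_def algebra_simps)
    then show ?thesis by (simp add: cis_multiple_2pi)
  qed
  have "dirc a b = dirc (4 * (a div 4) + a mod 4) (0 + b)" by simp
  also have "\<dots> = dirc (a mod 4) b" by (simp only: dirc_add 4) simp
  finally show ?thesis ..
qed

lemma evg_simps: "evg (gadd x y) = evg x + evg y" "evg (gneg x) = - evg x" "evg (gcnj x) = cnj (evg x)"
  "evg (gi x) = \<i> * evg x" "evg (gpi x) = evg x / of_real phi"
  "evg (gcs x) = dirc 0 1 * evg x" "evg (gcsi x) = dirc 0 (-1) * evg x"
  by (cases x; cases y; simp add: complex_eq_iff evz dirc_1 power2_eq_square Let_def Re_divide_of_real Im_divide_of_real algebra_simps)+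

lemma evg_gpow: "evg (gpow d n z) = (if n \<le> 0 then 1 else dirc 0 (if d then n else - n)) * evg z"
proof (induction d n z rule: gpow.induct)
  case (1 d n z)
  show ?case
  proof (cases "n \<le> 0")
    case True then show ?thesis by (simp add: gpow.simps)
  next
    case False
    then have "evg (gpow d n z) = (if n - 1 \<le> 0 then 1 else dirc 0 (if d then n - 1 else - (n - 1))) * (dirc 0 (if d then 1 else -1) * evg z)"
      using 1 by (subst gpow.simps) (simp add: evg_simps)
    also have "(if n - 1 \<le> 0 then 1 else dirc 0 (if d then n - 1 else - (n - 1))) = dirc 0 (if d then n - 1 else - (n - 1))"
    proof -
      have "n - 1 = 0" if "n - 1 \<le> 0" using that False by linarith
      then show ?thesis by (cases "n - 1 \<le> 0") (auto simp: eq_commute[of 0])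
    qed
    also have "\<dots> * (dirc 0 (if d then 1 else -1) * evg z) = dirc 0 (if d then n else - n) * evg z"
      by (simp add: mult.assoc[symmetric] dirc_add[of 0 0, simplified, symmetric])
    finally show ?thesis using False by simp
  qed
qed

lemma evg_grot: "evg (grot a b z) = dirc a b * evg z"
proof -
  define y where "y = (if b = 0 then z else if 0 < b then gpow True b z else gpow False (- b) z)"
  have y: "evg y = dirc 0 b * evg z" by (auto simp: y_def evg_gpow)
  have "a mod 4 \<in> {0, 1, 2, 3}" by auto
  then have "evg (gia (a mod 4) y) = dirc (a mod 4) 0 * evg y"
    by (auto simp: gia_def evg_simps dirc_1)
  then show ?thesis unfolding grot_def y_def[symmetric] y dirc_mod
    by (simp add: mult.assoc[symmetric] dirc_add[symmetric])
qed

text \<open>A frame \<open>Fr cj a b z\<close> stands for a reflection if \<open>cj\<close>, a rotation by \<open>a\<close> right angles and \<open>b\<close> small acute angles, and a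
  translation by \<open>z\<close>.\<close>

datatype fr = Fr bool int int gs

fun evf :: "fr \<Rightarrow> complex \<Rightarrow> complex" where "evf (Fr cj a b z) = iso cj (dirc a b) (evg z)"

fun fcomp :: "fr \<Rightarrow> fr \<Rightarrow> fr" where
  "fcomp (Fr c a b z) (Fr c' a' b' z') =
     (if c then Fr (\<not> c') ((a - a') mod 4) (b - b') (gadd z (grot a b (gcnj z')))
      else Fr c' ((a + a') mod 4) (b + b') (gadd z (grot a b z')))"

fun finv :: "fr \<Rightarrow> fr" where
  "finv (Fr c a b z) =
     (if c then Fr True a b (gneg (grot a b (gcnj z)))
      else Fr False ((- a) mod 4) (- b) (gneg (grot (- a) (- b) z)))"

fun fshrink :: "fr \<Rightarrow> fr" where "fshrink (Fr c a b z) = Fr c a b (gpi z)"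

lemma isometry_evf: "isometry (evf F)"
  by (cases F) (simp add: isometry_iso)

lemma evf_fcomp: "evf (fcomp F F') = evf F \<circ> evf F'"
proof -
  obtain c a b z where F: "F = Fr c a b z" by (cases F)
  obtain c' a' b' z' where F': "F' = Fr c' a' b' z'" by (cases F')
  show ?thesis
    by (cases c; cases c')
       (auto simp: F F' iso_def fun_eq_iff evg_simps evg_grot dirc_mod cnj_dirc dirc_add[of a "- a'" b "- b'", simplified] dirc_add algebra_simps)
qed

lemma dirc_inverse: "dirc a b * dirc (- a) (- b) = 1" "dirc (- a) (- b) * dirc a b = 1"
  by (simp_all add: dirc_add[symmetric])

lemma evf_finv: "evf (finv F) \<circ> evf F = (\<lambda>z. z)"
proof -
  obtain c a b z where F: "F = Fr c a b z" by (cases F)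
  have 1: "dirc a b * (dirc (- a) (- b) * x) = x" "dirc (- a) (- b) * (dirc a b * x) = x" for x
    by (simp_all add: mult.assoc[symmetric] dirc_inverse)
  show ?thesis
    by (cases c) (auto simp: F iso_def fun_eq_iff evg_simps evg_grot dirc_mod cnj_dirc distrib_left 1)
qed

lemma evf_finv_inv: "evf (finv F) = inv (evf F)"
  by (metis evf_finv isometry_evf isometry_surj comp_apply surj_imp_inv_eq)

lemma evf_fshrink: "evf (fshrink F) = shrink (evf F)"
  by (cases F) (simp add: shrink_iso evg_simps)

fun fdf :: "pc \<Rightarrow> fr" where
  "fdf PL = Fr True 0 (-1) (G (ZF 1 0 (-1) 0) (ZF 0 0 0 1))"
| "fdf PS = Fr True 3 (-1) (G (ZF 1 0 (-1) 0) (ZF 0 0 0 1))"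
| "fdf PU = Fr False 0 0 (G (ZF 0 0 0 0) (ZF 0 0 0 0))"

lemma evf_fdf: "evf (fdf p) = df p"
proof -
  have "dirc 3 (-1) = dirc 3 0 * dirc 0 (-1)" using dirc_add[of 3 0 0 "-1"] by simp
  then have "dirc 3 (-1) = Complex (- (phi^2)) (- phi)" by (simp add: dirc_1 complex_eq_iff)
  moreover have "Complex 0 0 = 0" by (simp add: complex_eq_iff)
  ultimately show ?thesis by (cases p) (auto simp: dirc_1 phi_4 iso_def)
qed

section \<open>The legal stars by exact frames\<close>

datatype lab = A0 | A1 | A2 | A3

fun lv :: "lab \<Rightarrow> 4" where "lv A0 = 0" | "lv A1 = 1" | "lv A2 = 2" | "lv A3 = 3"

text \<open>The mark of a side in a star: \<open>Ax b\<close> is a side on the axis, whose direction depends on the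
  direction of the axis, and \<open>Of x b\<close> a side off the axis.\<close>

datatype sm = NoM | Ax bool | Of lab bool

datatype entry = En (ek: kind) (ep: pos) (ef: fr) sm sm sm

fun em :: "entry \<Rightarrow> side \<Rightarrow> sm" where
  "em (En k p f x y z) Hyp = x" | "em (En k p f x y z) LLeg = y" | "em (En k p f x y z) SLeg = z"

datatype sn = C1 | C2 | C3 | C4 | C5 | C6 | C7

fun num :: "sn \<Rightarrow> nat" where
  "num C1 = 1" | "num C2 = 2" | "num C3 = 3" | "num C4 = 4" | "num C5 = 5" | "num C6 = 6" | "num C7 = 7"

text \<open>The tiles of the seven stars with the center at the origin, each with its kind, the position of the center on the tile, its
  frame, and the marks of \<open>Hyp\<close>, \<open>LLeg\<close> and \<open>SLeg\<close>. That these lists are the stars of the definition is \<open>C_star_entries\<close>.\<close>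

fun entries :: "sn \<Rightarrow> entry list" where
  "entries C1 = [
     En Large (At Rt) (Fr True 2 0 (G (ZF 0 0 0 0) (ZF 0 0 0 0))) NoM (Ax False) (Of A0 True),
     En Small (At Rt) (Fr True 1 0 (G (ZF 0 0 0 0) (ZF 0 0 0 0))) NoM (Of A0 True) (Ax True),
     En Large FB (Fr True 0 0 (G (ZF 0 (-1) 0 1) (ZF 0 0 0 0))) NoM (Ax True) NoM]"
| "entries C2 = [
     En Large (At Bl) (Fr False 2 1 (G (ZF (-1) 0 1 0) (ZF 0 0 0 1))) (Ax True) NoM (Of A0 True),
     En Small (At Sh) (Fr False 3 1 (G (ZF (-1) 0 1 0) (ZF 0 0 0 1))) (Of A1 True) (Of A0 True) NoM,
     En Large (At Rt) (Fr True 1 0 (G (ZF 0 0 0 0) (ZF 0 0 0 0))) NoM (Of A1 True) (Ax True),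
     En Large FH (Fr False 0 1 (G (ZF 0 0 0 0) (ZF 0 0 0 (-1)))) (Ax False) NoM NoM]"
| "entries C3 = [
     En Small (At Bl) (Fr True 1 0 (G (ZF 0 0 0 (-1)) (ZF 0 0 0 0))) (Of A1 True) NoM (Ax True),
     En Large (At Sh) (Fr False 3 1 (G (ZF 0 0 0 (-1)) (ZF 0 0 1 0))) (Of A2 True) (Of A1 True) NoM,
     En Large (At Bl) (Fr False 1 1 (G (ZF 0 0 0 1) (ZF 1 0 (-1) 0))) (Of A2 False) NoM (Of A0 True),
     En Small (At Sh) (Fr False 2 1 (G (ZF 0 0 0 1) (ZF 1 0 (-1) 0))) (Ax True) (Of A0 True) NoM,
     En Small (At Rt) (Fr True 3 0 (G (ZF 0 0 0 0) (ZF 0 0 0 0))) NoM (Of A0 True) (Ax False),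
     En Large (At Rt) (Fr True 0 0 (G (ZF 0 0 0 0) (ZF 0 0 0 0))) NoM (Ax True) (Of A0 True)]"
| "entries C4 = [
     En Large (At Bl) (Fr True 1 0 (G (ZF 0 0 (-1) 0) (ZF 0 0 0 0))) (Of A2 True) NoM (Ax True),
     En Large (At Sh) (Fr True 3 0 (G (ZF 0 0 0 0) (ZF 0 1 0 0))) (Of A2 False) (Of A3 False) NoM,
     En Small (At Bl) (Fr True 0 0 (G (ZF 0 0 0 0) (ZF 0 0 0 1))) (Of A1 True) NoM (Of A3 False),
     En Large (At Sh) (Fr False 2 1 (G (ZF 0 0 1 0) (ZF 0 0 0 1))) (Ax True) (Of A1 True) NoM,
     En Large (At Rt) (Fr True 3 0 (G (ZF 0 0 0 0) (ZF 0 0 0 0))) NoM (Of A1 True) (Ax False),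
     En Small (At Sh) (Fr False 1 1 (G (ZF 1 0 (-1) 0) (ZF 0 0 0 (-1)))) (Of A1 True) (Of A0 True) NoM,
     En Large (At Bl) (Fr False 0 1 (G (ZF 1 0 (-1) 0) (ZF 0 0 0 (-1)))) (Ax False) NoM (Of A0 True)]"
| "entries C5 = [
     En Small (At Bl) (Fr False 2 1 (G (ZF 0 (-1) 0 1) (ZF 1 0 (-1) 0))) (Ax True) NoM (Of A3 True),
     En Large (At Sh) (Fr False 3 1 (G (ZF 0 0 0 (-1)) (ZF 0 0 1 0))) (Of A0 True) (Of A3 True) NoM,
     En Large (At Bl) (Fr True 0 0 (G (ZF 0 0 0 0) (ZF 0 0 1 0))) (Of A2 True) NoM (Of A0 False),
     En Large (At Sh) (Fr True 2 0 (G (ZF 0 1 0 0) (ZF 0 0 0 0))) (Of A2 False) (Ax False) NoM,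
     En Small (At Sh) (Fr False 0 1 (G (ZF 0 0 0 (-1)) (ZF (-1) 0 1 0))) (Ax False) (Of A0 True) NoM,
     En Large (At Bl) (Fr False 3 1 (G (ZF 0 0 0 (-1)) (ZF (-1) 0 1 0))) (Of A2 False) NoM (Of A0 True),
     En Large (At Sh) (Fr False 1 1 (G (ZF 0 0 0 1) (ZF 0 0 (-1) 0))) (Of A2 True) (Of A1 True) NoM,
     En Small (At Bl) (Fr True 3 0 (G (ZF 0 0 0 1) (ZF 0 0 0 0))) (Of A1 True) NoM (Ax False)]"
| "entries C6 = [
     En Large (At Bl) (Fr False 2 1 (G (ZF (-1) 0 1 0) (ZF 0 0 0 1))) (Ax True) NoM (Of A0 True),
     En Large (At Sh) (Fr True 3 0 (G (ZF 0 0 0 0) (ZF 0 1 0 0))) (Of A0 False) (Of A1 False) NoM,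
     En Small (At Bl) (Fr False 1 1 (G (ZF 1 0 (-1) 0) (ZF 0 1 0 (-1)))) (Of A1 False) NoM (Of A3 True),
     En Large (At Sh) (Fr False 2 1 (G (ZF 0 0 1 0) (ZF 0 0 0 1))) (Ax True) (Of A3 True) NoM,
     En Large (At Sh) (Fr False 0 1 (G (ZF 0 0 (-1) 0) (ZF 0 0 0 (-1)))) (Ax False) (Of A1 True) NoM,
     En Small (At Bl) (Fr True 2 0 (G (ZF 0 0 0 0) (ZF 0 0 0 (-1)))) (Of A1 True) NoM (Of A3 False),
     En Large (At Sh) (Fr True 1 0 (G (ZF 0 0 0 0) (ZF 0 (-1) 0 0))) (Of A2 False) (Of A3 False) NoM,
     En Large (At Bl) (Fr True 3 0 (G (ZF 0 0 1 0) (ZF 0 0 0 0))) (Of A2 True) NoM (Ax False)]"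
| "entries C7 = [
     En Small (At Bl) (Fr True 1 0 (G (ZF 0 0 0 (-1)) (ZF 0 0 0 0))) (Of A1 True) NoM (Ax True),
     En Large (At Sh) (Fr False 3 1 (G (ZF 0 0 0 (-1)) (ZF 0 0 1 0))) (Of A2 True) (Of A1 True) NoM,
     En Large (At Bl) (Fr False 1 1 (G (ZF 0 0 0 1) (ZF 1 0 (-1) 0))) (Of A2 False) NoM (Of A0 True),
     En Large (At Sh) (Fr True 2 0 (G (ZF 0 1 0 0) (ZF 0 0 0 0))) (Of A0 False) (Ax False) NoM,
     En Large (At Sh) (Fr True 0 0 (G (ZF 0 (-1) 0 0) (ZF 0 0 0 0))) (Of A2 False) (Ax True) NoM,
     En Large (At Bl) (Fr True 2 0 (G (ZF 0 0 0 0) (ZF 0 0 (-1) 0))) (Of A2 True) NoM (Of A0 False),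
     En Large (At Sh) (Fr False 1 1 (G (ZF 0 0 0 1) (ZF 0 0 (-1) 0))) (Of A0 True) (Of A3 True) NoM,
     En Small (At Bl) (Fr False 0 1 (G (ZF 0 1 0 (-1)) (ZF (-1) 0 1 0))) (Ax False) NoM (Of A3 True)]"

fun mv :: "4 \<Rightarrow> bool \<Rightarrow> sm \<Rightarrow> 4 \<times> bool" where
  "mv l r (Of x b) = (lv x, b)" | "mv l r (Ax b) = (l, b = r)" | "mv l r NoM = (l, True)"

definition agr :: "4 \<Rightarrow> bool \<Rightarrow> sm \<Rightarrow> 4 \<times> bool \<Rightarrow> bool" where
  "agr l r x p \<longleftrightarrow> x = NoM \<or> p = mv l r x"

text \<open>A table entry as a tile of a star, for label \<open>l\<close> of the axis and direction \<open>r\<close>.\<close>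

definition estar :: "4 \<Rightarrow> bool \<Rightarrow> entry \<Rightarrow> star_tile" where
  "estar l r e = (tl (ek e) (evf (ef e)),
     \<lambda>s. if sat (ep e) s then Some (mk_mark (evf (ef e) \<circ> proto (ek e)) s (mv l r (em e s))) else None)"

subsection \<open>Placing tiles around a point\<close>

fun lz :: "kind \<Rightarrow> side \<Rightarrow> gs" where
  "lz Large Hyp = G (ZF 1 0 0 0) (ZF 0 0 0 0)" | "lz Large LLeg = G (ZF 0 1 0 0) (ZF 0 0 0 0)"
| "lz Large SLeg = G (ZF 0 0 1 0) (ZF 0 0 0 0)" | "lz Small Hyp = G (ZF 0 1 0 0) (ZF 0 0 0 0)"
| "lz Small LLeg = G (ZF 0 0 1 0) (ZF 0 0 0 0)" | "lz Small SLeg = G (ZF 0 0 0 1) (ZF 0 0 0 0)"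

lemma evg_lz: "evg (lz k s) = of_real (side_len k s)"
  by (cases k; cases s) (auto simp: complex_eq_iff)

definition sg :: "bool \<Rightarrow> int" where "sg e = (if e then 1 else -1)"

text \<open>The frame of a wedge with its first side in direction \<open>dirc a b\<close>, obtained by turning the corner to the origin.\<close>

fun pfr :: "bool \<Rightarrow> int \<Rightarrow> int \<Rightarrow> wedge \<Rightarrow> fr" where
  "pfr e a b (k, LLeg, SLeg) = Fr (\<not> e) (a mod 4) b (G (ZF 0 0 0 0) (ZF 0 0 0 0))"
| "pfr e a b (k, SLeg, LLeg) = Fr e ((a + sg e) mod 4) b (G (ZF 0 0 0 0) (ZF 0 0 0 0))"
| "pfr e a b (k, Hyp, LLeg) = Fr (\<not> e) ((a + 2) mod 4) (b + sg e) (grot a (b + sg e) (lz k LLeg))"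
| "pfr e a b (k, LLeg, Hyp) = Fr e ((a + 2) mod 4) b (grot a b (lz k LLeg))"
| "pfr e a b (k, Hyp, SLeg) = Fr e (a mod 4) (b - sg e) (grot (a + sg e) (b - sg e) (lz k SLeg))"
| "pfr e a b (k, SLeg, Hyp) = Fr (\<not> e) ((a + sg e) mod 4) b (grot a b (lz k SLeg))"
| "pfr e a b (k, x, y) = Fr False 0 0 (G (ZF 0 0 0 0) (ZF 0 0 0 0))"

fun nxd :: "bool \<Rightarrow> int \<Rightarrow> int \<Rightarrow> corner \<Rightarrow> int \<times> int" where
  "nxd e a b Rt = (a + sg e, b)" | "nxd e a b Sh = (a, b + sg e)" | "nxd e a b Bl = (a + sg e, b - sg e)"

lemma dirc_nxd:
  "dirc (fst (nxd e a b v)) (snd (nxd e a b v)) = dirc a b * cis ((if e then 1 else -1) * angle_at v)"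
  by (cases v) (auto simp: dirc_def cis_mult sg_def large_angle_eq algebra_simps diff_divide_distrib add_divide_distrib)

lemma dirc_steps:
  "dirc (a + 1) b = \<i> * dirc a b" "dirc (a - 1) b = - \<i> * dirc a b" "dirc (a + 2) b = - dirc a b"
  "dirc a (b + 1) = Complex phi (phi^2) * dirc a b" "dirc a (b - 1) = Complex phi (- (phi^2)) * dirc a b"
  using dirc_add[of a 1 b 0] dirc_add[of a "-1" b 0] dirc_add[of a 2 b 0] dirc_add[of a 0 b 1] dirc_add[of a 0 b "-1"]
  by (simp_all add: dirc_1 mult.commute)

lemma place_pfr:
  assumes "x \<noteq> y"
  shows "place (if e then 1 else -1) (dirc a b) (k, x, y) = tl k (evf (pfr e a b (k, x, y)))"
proof -
  define X Y where "X = Re (dirc a b)" and "Y = Im (dirc a b)"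
  have XY: "dirc a b = Complex X Y" by (simp add: X_def Y_def)
  have c: "cis (angle_at Rt) = \<i>" "cis (- angle_at Rt) = - \<i>"
     "cis small_angle = Complex phi (phi^2)" "cis (- small_angle) = Complex phi (- (phi^2))"
     "cis large_angle = Complex (phi^2) phi" "cis (- large_angle) = Complex (phi^2) (- phi)"
    by (simp_all add: cis.ctr large_angle_eq sin_small cos_small sin_diff cos_diff complex_eq_iff)
  have z: "Complex 0 0 = 0" by (simp add: complex_eq_iff)
  have "(\<lambda>v. if v = apex x y then 0 else if v \<in> corners x then of_real (side_len k x) * dirc a b
       else of_real (side_len k y) * (dirc a b * cis ((if e then 1 else -1) * angle_at (apex x y)))) v
       = evf (pfr e a b (k, x, y)) (proto k v)" for v
    using assms
    by (cases e; cases k; cases x; cases y; cases v;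
        simp add: iso_def dirc_mod sg_def evg_grot dirc_steps evg_lz c[simplified] z XY del: evg.simps lz.simps;
        simp add: complex_eq_iff phi_alg)
  then show ?thesis unfolding tl_def by (auto simp: fun_eq_iff)
qed

fun xfan :: "bool \<Rightarrow> int \<Rightarrow> int \<Rightarrow> wedge list \<Rightarrow> (kind \<times> fr) list" where
  "xfan e a b [] = []"
| "xfan e a b ((k, x, y) # ws) = (k, pfr e a b (k, x, y)) #
     (let d = nxd e a b (apex x y) in xfan e (fst d) (snd d) ws)"

lemma fan_xfan:
  "\<forall>(k, x, y)\<in>set ws. x \<noteq> y \<Longrightarrow>
   fan (if e then 1 else -1) (dirc a b) ws = (\<lambda>(k, F). tl k (evf F)) ` set (xfan e a b ws)"
proof (induction ws arbitrary: a b)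
  case (Cons w ws)
  obtain k x y where w: "w = (k, x, y)" by (cases w)
  show ?case using Cons by (simp add: w place_pfr dirc_nxd[symmetric] Let_def del: place.simps pfr.simps)
qed simp

fun uw :: "sn \<Rightarrow> wedge list" where
  "uw C1 = [Lba, Sba]" | "uw C2 = [Lha, Sbh, Lba]" | "uw C3 = [Sah, Lbh, Lha, Sbh]" | "uw C4 = [Lah, Lhb, Sah, Lbh]"
| "uw C5 = [Sha, Lbh, Lah, Lhb]" | "uw C6 = [Lha, Lhb, Sha, Lbh]" | "uw C7 = [Sah, Lbh, Lha, Lhb]"

fun lw :: "sn \<Rightarrow> wedge list" where
  "lw C1 = []" | "lw C2 = []" | "lw C3 = [Sab, Lab]" | "lw C4 = [Lab, Shb, Lah]"
| "lw C5 = [Shb, Lah, Lhb, Sha]" | "lw C6 = [Lhb, Sha, Lbh, Lha]" | "lw C7 = [Lbh, Lha, Lhb, Sah]"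

fun flat :: "sn \<Rightarrow> (kind \<times> fr) list" where
  "flat C1 = [(Large, Fr True 0 0 (G (ZF 0 (-1) 0 1) (ZF 0 0 0 0)))]"
| "flat C2 = [(Large, Fr False 0 1 (G (ZF 0 0 0 0) (ZF 0 0 0 (-1))))]"
| "flat n = []"

lemma entries_frames:
  "map (\<lambda>e. (ek e, ef e)) (entries n) = xfan False 2 0 (uw n) @ xfan True 2 0 (lw n) @ flat n"
  by (cases n; simp only:; code_simp)

lemma tiles_entries: "upper_tiles (num n) \<union> lower_tiles (num n) = (\<lambda>e. tl (ek e) (evf (ef e))) ` set (entries n)"
proof -
  have m1: "dirc 2 0 = -1" by (simp add: dirc_1)
  have u: "upper_tiles (num n) = (\<lambda>(k, F). tl k (evf F)) ` set (xfan False 2 0 (uw n))"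
    using fan_xfan[of "uw n" False 2 0]
    by (cases n) (simp_all add: upper_tiles_def m1 del: fan.simps(2) xfan.simps(2))
  have f1: "tl Large (evf (Fr True 0 0 (G (ZF 0 (-1) 0 1) (ZF 0 0 0 0)))) = \<lparr>kind = Large, vert =
            case_corner (Complex (- (phi ^ 5)) 0) (Complex (phi ^ 3) 0)
              (Complex (- (phi ^ 5)) (- (phi ^ 2)))\<rparr>"
    by (auto simp: tl_def fun_eq_iff all_corner iso_def complex_eq_iff phi_alg)
  have f2: "tl Large (evf (Fr False 0 1 (G (ZF 0 0 0 0) (ZF 0 0 0 (-1))))) = \<lparr>kind = Large, vert =
            case_corner (Complex 0 (- (phi ^ 3))) (Complex (phi ^ 2) 0) (Complex (- (phi ^ 4)) 0)\<rparr>"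
    by (auto simp: tl_def fun_eq_iff all_corner iso_def complex_eq_iff dirc_1 phi_alg)
  have l: "lower_tiles (num n) = (\<lambda>(k, F). tl k (evf F)) ` set (xfan True 2 0 (lw n) @ flat n)"
    using fan_xfan[of "lw n" True 2 0]
    by (cases n) (simp_all add: lower_tiles_def m1 f1 f2 del: fan.simps(2) xfan.simps(2) evf.simps)
  have "(\<lambda>e. tl (ek e) (evf (ef e))) ` set (entries n) = (\<lambda>(k, F). tl k (evf F)) ` set (map (\<lambda>e. (ek e, ef e)) (entries n))"
    by force
  then show ?thesis unfolding entries_frames u l by (simp add: image_Un)
qed

subsection \<open>The decoration\<close>

fun nlab :: "sn \<Rightarrow> lab" where
  "nlab C1 = A1" | "nlab C2 = A2" | "nlab C3 = A3" | "nlab C4 = A0" | "nlab C5 = A1" | "nlab C6 = A2" | "nlab C7 = A3"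

fun linc :: "lab \<Rightarrow> lab" where "linc A0 = A1" | "linc A1 = A2" | "linc A2 = A3" | "linc A3 = A0"

lemma lv_linc: "lv (linc x) = lv x + 1" by (cases x) auto

lemma lv_nlab: "lv (nlab n) = of_nat (num n)" by (cases n) auto

lemma lv_inj: "lv x = lv y \<longleftrightarrow> x = y" by (cases x; cases y) auto

definition xm :: "sn \<Rightarrow> bool \<Rightarrow> int \<Rightarrow> int \<Rightarrow> sm" where
  "xm n o' a b = (let x = nlab n in
     if b = 0 then (if a = 0 then Ax o' else if a = 2 then Ax (\<not> o')
                    else if a = 1 then Of (linc (linc (linc x))) o' else Of (linc x) o')
     else if a = 0 \<or> a = 2 then Of (if (a = 0) = (b = 1) then linc x else linc (linc (linc x))) (\<not> o')
     else Of (if a = 1 then linc (linc x) else x) (\<not> o'))"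

lemma dirc_vals:
  "dirc 0 0 = Complex 1 0" "dirc 1 0 = Complex 0 1" "dirc 2 0 = Complex (-1) 0" "dirc 3 0 = Complex 0 (-1)"
  "dirc 0 1 = Complex phi (phi^2)" "dirc 1 1 = Complex (- (phi^2)) phi" "dirc 2 1 = Complex (- phi) (- (phi^2))" "dirc 3 1 = Complex (phi^2) (- phi)"
  "dirc 0 (-1) = Complex phi (- (phi^2))" "dirc 1 (-1) = Complex (phi^2) phi" "dirc 2 (-1) = Complex (- phi) (phi^2)" "dirc 3 (-1) = Complex (- (phi^2)) (- phi)"
  using dirc_add[of 1 0 0 1] dirc_add[of 2 0 0 1] dirc_add[of 3 0 0 1]
    dirc_add[of 1 0 0 "-1"] dirc_add[of 2 0 0 "-1"] dirc_add[of 3 0 0 "-1"]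
  by (simp_all add: dirc_1 complex_eq_iff)

lemma angle_facts: "arccos phi = small_angle" "arccos (phi^2) = large_angle" "arccos 0 = pi / 2"
  "small_angle \<noteq> pi / 2" "large_angle \<noteq> pi / 2" "large_angle \<noteq> small_angle"
proof -
  show l: "arccos (phi^2) = large_angle" by (simp add: large_angle_def phi_sq)
  have "0 \<le> small_angle" "small_angle \<le> pi"
    using arcsin_nonneg[of "phi^2"] arcsin_ubound[of "phi^2"] phi_lt1 order_trans[of "-1" 0 "phi^2"] pi_ge_zero
    by (auto simp: small_angle_def phi_sq[symmetric] power_le_one)
  then show "arccos phi = small_angle" by (metis arccos_cos cos_small)
  show "arccos 0 = pi / 2" by (rule arccos_0)
  show "small_angle \<noteq> pi / 2" by (metis cos_pi_half cos_small phi_nz)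
  have cl: "cos large_angle = phi^2" by (simp add: large_angle_eq cos_diff sin_small)
  show "large_angle \<noteq> pi / 2" by (metis cos_pi_half cl power_not_zero phi_nz)
  show "large_angle \<noteq> small_angle"
  proof
    assume "large_angle = small_angle"
    then have "phi^2 = phi" using cl cos_small by simp
    then show False using phi_lt1 by (simp add: power2_eq_square)
  qed
qed

lemma legal_mark_axis:
  "Im p = 0 \<Longrightarrow> Im q = 0 \<Longrightarrow> legal_mark n l r p q =
     (if r \<longleftrightarrow> Re p < Re q then \<lparr>label = l, tail = p, head = q\<rparr> else \<lparr>label = l, tail = q, head = p\<rparr>)"
  by (simp add: legal_mark_def)

lemma legal_mark_off:
  assumes "Im w \<noteq> 0" "(p, q) = (if o' then (0, w) else (w, 0))"
  shows "axis_angle w = pi / 2 \<Longrightarrow> legal_mark n l r p q = \<lparr>label = of_nat n + (if Im w > 0 then 3 else 1), tail = 0, head = w\<rparr>"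
    "axis_angle w = small_angle \<Longrightarrow> legal_mark n l r p q = \<lparr>label = of_nat n + (if Im w > 0 then 1 else 3), tail = w, head = 0\<rparr>"
    "axis_angle w = large_angle \<Longrightarrow> legal_mark n l r p q = \<lparr>label = of_nat n + (if Im w > 0 then 2 else 0), tail = w, head = 0\<rparr>"
proof -
  have w0: "w \<noteq> 0" using assms(1) by auto
  have pw: "(if p = 0 then q else p) = w" using assms(2) w0 by (auto split: if_splits)
  have z: "(Im p = 0 \<and> Im q = 0) = False" using assms by (auto split: if_splits)
  have m1: "(- 1 :: 4) = 3" by simp
  show "axis_angle w = pi / 2 \<Longrightarrow> legal_mark n l r p q = \<lparr>label = of_nat n + (if Im w > 0 then 3 else 1), tail = 0, head = w\<rparr>"
    unfolding legal_mark_def z pw Let_def if_False by simp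
  show "axis_angle w = small_angle \<Longrightarrow> legal_mark n l r p q = \<lparr>label = of_nat n + (if Im w > 0 then 1 else 3), tail = w, head = 0\<rparr>"
    unfolding legal_mark_def z pw Let_def if_False m1 using angle_facts(4) by simp
  show "axis_angle w = large_angle \<Longrightarrow> legal_mark n l r p q = \<lparr>label = of_nat n + (if Im w > 0 then 2 else 0), tail = w, head = 0\<rparr>"
    unfolding legal_mark_def z pw Let_def if_False using angle_facts(5,6) by simp
qed

lemma legal_mark_dirc:
  assumes "\<rho> > 0" "a \<in> {0, 1, 2, 3}" "b \<in> {-1, 0, 1}" "w = of_real \<rho> * dirc a b"
    "(p, q) = (if o' then (0, w) else (w, 0))"
  shows "legal_mark (num n) l r p q =
    (let M = mv l r (xm n o' a b) in \<lparr>label = fst M, tail = if snd M then p else q, head = if snd M then q else p\<rparr>)"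
proof -
  have nw: "cmod w = \<rho>" using assms(1,4) by (simp add: norm_mult)
  have ax: "axis_angle w = arccos \<bar>Re (dirc a b)\<bar>"
    unfolding axis_angle_def nw using assms(1) by (simp add: assms(4) abs_mult)
  have re: "Re w = \<rho> * Re (dirc a b)" "Im w = \<rho> * Im (dirc a b)" by (simp_all add: assms(4))
  have pq: "p = (if o' then 0 else w)" "q = (if o' then w else 0)" using assms(5) by (auto split: if_splits)
  have nl: "of_nat (num n) = lv (nlab n)" by (rule lv_nlab[symmetric])
  have l3: "lv (linc x) = lv x + 1" "lv (linc (linc x)) = lv x + 2" "lv (linc (linc (linc x))) = lv x + 3" for x
    by (cases x; simp)+
  have p0: "0 < \<rho> * phi^2" "0 < \<rho> * phi" using assms(1) by simp_all
  have ab: "\<bar>- phi\<bar> = phi" "\<bar>phi\<bar> = phi" "\<bar>phi^2\<bar> = phi^2" "\<bar>- (phi^2)\<bar> = phi^2" "\<bar>0::real\<bar> = 0" by simp_all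
  have cases: "(b = 0 \<and> (a = 0 \<or> a = 2)) \<or> (b = 0 \<and> (a = 1 \<or> a = 3)) \<or> ((b = 1 \<or> b = -1) \<and> (a = 0 \<or> a = 2)) \<or> ((b = 1 \<or> b = -1) \<and> (a = 1 \<or> a = 3))"
    using assms(2,3) by auto
  then show ?thesis
  proof (elim disjE)
    assume c: "b = 0 \<and> (a = 0 \<or> a = 2)"
    then have i: "Im w = 0" by (auto simp: re dirc_vals)
    then have "Im p = 0" "Im q = 0" by (auto simp: pq)
    note lm = legal_mark_axis[OF this, of "num n" l r]
    show ?thesis unfolding lm using c assms(1) by (cases o') (auto simp: xm_def Let_def pq re dirc_vals)
  next
    assume c: "b = 0 \<and> (a = 1 \<or> a = 3)"
    then have i: "Im w = (if a = 1 then \<rho> else - \<rho>)" and A: "axis_angle w = pi / 2"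
      by (auto simp: re ax dirc_vals)
    have i0: "Im w \<noteq> 0" "(0 < Im w) = (a = 1)" using i assms(1) p0 by auto
    show ?thesis unfolding legal_mark_off(1)[OF i0(1) assms(5) A] i0 nl
      using c by (cases o') (auto simp: xm_def Let_def pq l3)
  next
    assume c: "(b = 1 \<or> b = -1) \<and> (a = 0 \<or> a = 2)"
    then have i: "Im w = (if (a = 0) = (b = 1) then \<rho> * phi^2 else - (\<rho> * phi^2))" and R: "\<bar>Re (dirc a b)\<bar> = phi"
      by (auto simp: re dirc_vals)
    have A: "axis_angle w = small_angle" unfolding ax R by (rule angle_facts)
    have i0: "Im w \<noteq> 0" "(0 < Im w) = ((a = 0) = (b = 1))" using i p0(1) by (smt (verit))+
    show ?thesis unfolding legal_mark_off(2)[OF i0(1) assms(5) A] i0 nl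
      using c by (cases o') (auto simp: xm_def Let_def pq l3)
  next
    assume c: "(b = 1 \<or> b = -1) \<and> (a = 1 \<or> a = 3)"
    then have i: "Im w = (if a = 1 then \<rho> * phi else - (\<rho> * phi))" and R: "\<bar>Re (dirc a b)\<bar> = phi^2"
      by (auto simp: re dirc_vals)
    have A: "axis_angle w = large_angle" unfolding ax R by (rule angle_facts)
    have i0: "Im w \<noteq> 0" "(0 < Im w) = (a = 1)" using i p0(2) by (smt (verit))+
    show ?thesis unfolding legal_mark_off(3)[OF i0(1) assms(5) A] i0 nl
      using c by (cases o') (auto simp: xm_def Let_def pq l3)
  qed
qed

text \<open>Direction of the side \<open>s\<close> of a tile with the given frame, seen from the endpoint \<open>c0 s\<close>
  or, if the flag is not set, from the endpoint \<open>c1 s\<close>.\<close>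

fun sxy :: "side \<Rightarrow> int \<times> int" where "sxy Hyp = (2, -1)" | "sxy LLeg = (0, 0)" | "sxy SLeg = (1, 0)"

fun sdir :: "fr \<Rightarrow> side \<Rightarrow> bool \<Rightarrow> int \<times> int" where
  "sdir (Fr cj a b z) s o' = (let x = (if o' then fst (sxy s) else fst (sxy s) + 2); y = snd (sxy s) in
      ((if cj then a - x else a + x) mod 4, if cj then b - y else b + y))"

lemma sdir:
  "evf F (proto k (if o' then c1 s else c0 s)) - evf F (proto k (if o' then c0 s else c1 s)) =
     of_real (side_len k s) * dirc (fst (sdir F s o')) (snd (sdir F s o'))"
proof -
  obtain cj a b z where F: "F = Fr cj a b z" by (cases F)
  define x y where "x = (if o' then fst (sxy s) else fst (sxy s) + 2)" and "y = snd (sxy s)"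
  have "proto k (c1 s) - proto k (c0 s) = of_real (side_len k s) * dirc (fst (sxy s)) (snd (sxy s))"
    by (cases s; cases k) (auto simp: dirc_vals complex_eq_iff phi_alg)
  then have d: "proto k (if o' then c1 s else c0 s) - proto k (if o' then c0 s else c1 s) = of_real (side_len k s) * dirc x y"
    unfolding x_def y_def using dirc_steps(3)[of "fst (sxy s)" "snd (sxy s)"] by (cases o') (simp_all add: algebra_simps)
  have e: "evf F X - evf F Y = dirc a b * (if cj then cnj (X - Y) else X - Y)" for X Y
    by (auto simp: F iso_def algebra_simps)
  show ?thesis unfolding e d unfolding F sdir.simps Let_def x_def[symmetric] y_def[symmetric]
    using dirc_add[of a "-x" b "-y"] dirc_add[of a x b y] by (cases cj) (auto simp: cnj_dirc dirc_mod)
qed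

fun gpt :: "kind \<Rightarrow> pos \<Rightarrow> gs" where
  "gpt k (At Rt) = G (ZF 0 0 0 0) (ZF 0 0 0 0)" | "gpt k (At Sh) = lz k LLeg" | "gpt k (At Bl) = gi (lz k SLeg)"
| "gpt k FB = G (ZF 0 1 0 (-1)) (ZF 0 0 0 0)" | "gpt k FH = G (ZF 0 1 0 (-1)) (ZF 1 0 (-1) 0)"

lemma evg_gpt: "evg (gpt k q) = ppt k q"
proof (cases q)
  case (At v)
  then show ?thesis by (cases v) (auto simp: evg_simps evg_lz complex_eq_iff simp del: evg.simps, simp_all)
qed (auto simp: complex_eq_iff foot0_def phi_alg)

fun fapp :: "fr \<Rightarrow> gs \<Rightarrow> gs" where "fapp (Fr c a b z) w = gadd z (grot a b (if c then gcnj w else w))"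

lemma evg_fapp: "evg (fapp F w) = evf F (evg w)"
  by (cases F) (auto simp: iso_def evg_simps evg_grot simp del: evg.simps)

lemma entries_check:
  "list_all (\<lambda>e. vpos (ek e) (ep e) \<and> fapp (ef e) (gpt (ek e) (ep e)) = G (ZF 0 0 0 0) (ZF 0 0 0 0) \<and>
     list_all (\<lambda>s. (em e s = NoM) = (\<not> sat (ep e) s)) [Hyp, LLeg, SLeg]) (entries n)"
  by (cases n; simp only:; code_simp)

lemma entries_marks_check:
  "list_all (\<lambda>e. list_all (\<lambda>s. case ep e of At v \<Rightarrow>
        v \<notin> corners s \<or> (let o' = (v = c0 s); d = sdir (ef e) s o' in
          (snd d = 0 \<or> snd d = 1 \<or> snd d = -1) \<and> em e s = xm n o' (fst d) (snd d))
      | FB \<Rightarrow> s \<noteq> LLeg \<or> em e s = Ax True \<and> ef e = Fr True 0 0 (G (ZF 0 (-1) 0 1) (ZF 0 0 0 0)) \<and> ek e = Large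
      | FH \<Rightarrow> s \<noteq> Hyp \<or> em e s = Ax False \<and> ef e = Fr False 0 1 (G (ZF 0 0 0 0) (ZF 0 0 0 (-1))) \<and> ek e = Large)
     [Hyp, LLeg, SLeg]) (entries n)"
  by (cases n; simp only:; code_simp)

lemma entry_ok:
  assumes "e \<in> set (entries n)"
  shows "vpos (ek e) (ep e)" "evf (ef e) (ppt (ek e) (ep e)) = 0" "em e s = NoM \<longleftrightarrow> \<not> sat (ep e) s"
proof -
  have c: "vpos (ek e) (ep e)" "fapp (ef e) (gpt (ek e) (ep e)) = G (ZF 0 0 0 0) (ZF 0 0 0 0)"
     "list_all (\<lambda>s. (em e s = NoM) = (\<not> sat (ep e) s)) [Hyp, LLeg, SLeg]"
    using entries_check[of n] assms unfolding list_all_iff by blast+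
  show "vpos (ek e) (ep e)" by (rule c(1))
  show "evf (ef e) (ppt (ek e) (ep e)) = 0"
    using arg_cong[OF c(2), of evg] by (simp add: evg_fapp evg_gpt complex_eq_iff del: evf.simps)
  show "em e s = NoM \<longleftrightarrow> \<not> sat (ep e) s" using c(3) by (cases s) auto
qed

lemma zero_in_side:
  assumes "e \<in> set (entries n)"
  shows "0 \<in> side_of (tl (ek e) (evf (ef e))) s \<longleftrightarrow> sat (ep e) s"
proof -
  note o = entry_ok[OF assms]
  have i: "evf (ef e) z = 0 \<longleftrightarrow> z = ppt (ek e) (ep e)" for z
    using o(2) isometry_inj[OF isometry_evf, of "ef e"] by (metis injD)
  have "0 \<in> side_of (tl (ek e) (evf (ef e))) s \<longleftrightarrow> ppt (ek e) (ep e) \<in> std (ek e) \<and> bary (ek e) (opp s) (ppt (ek e) (ep e)) = 0"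
    unfolding side_of_tl(1)[OF isometry_evf] using i by (auto simp: image_iff)
  then show ?thesis using ppt_std[OF o(1)] by blast
qed

lemma legal_mark_entry:
  assumes e: "e \<in> set (entries n)" and s: "sat (ep e) s"
  shows "legal_mark (num n) l r (evf (ef e) (proto (ek e) (c0 s))) (evf (ef e) (proto (ek e) (c1 s))) =
     mk_mark (evf (ef e) \<circ> proto (ek e)) s (mv l r (em e s))"
proof -
  note o = entry_ok[OF e]
  let ?P = "evf (ef e) (proto (ek e) (c0 s))" and ?Q = "evf (ef e) (proto (ek e) (c1 s))"
  have ch: "case ep e of At v \<Rightarrow>
        v \<notin> corners s \<or> (let o' = (v = c0 s); d = sdir (ef e) s o' in
          (snd d = 0 \<or> snd d = 1 \<or> snd d = -1) \<and> em e s = xm n o' (fst d) (snd d))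
      | FB \<Rightarrow> s \<noteq> LLeg \<or> em e s = Ax True \<and> ef e = Fr True 0 0 (G (ZF 0 (-1) 0 1) (ZF 0 0 0 0)) \<and> ek e = Large
      | FH \<Rightarrow> s \<noteq> Hyp \<or> em e s = Ax False \<and> ef e = Fr False 0 1 (G (ZF 0 0 0 0) (ZF 0 0 0 (-1))) \<and> ek e = Large"
    using entries_marks_check[of n] e unfolding list_all_iff by (cases s) auto
  show ?thesis
  proof (cases "ep e")
    case (At v)
    define o' where "o' = (v = c0 s)"
    define d where "d = sdir (ef e) s o'"
    have v: "v = (if o' then c0 s else c1 s)" using s At by (auto simp: o'_def corners_c)
    have c: "snd d \<in> {-1, 0, 1}" "em e s = xm n o' (fst d) (snd d)"
      using ch s At by (auto simp: Let_def o'_def d_def)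
    have fd: "fst d \<in> {0, 1, 2, 3}" by (cases "ef e") (auto simp: d_def Let_def)
    define w where "w = of_real (side_len (ek e) s) * dirc (fst d) (snd d)"
    have z: "evf (ef e) (proto (ek e) v) = 0" using o(2) At by simp
    have pq: "(?P, ?Q) = (if o' then (0, w) else (w, 0))"
      using sdir[of "ef e" "ek e" o' s] z v by (cases o') (simp_all add: w_def d_def)
    show ?thesis
      unfolding legal_mark_dirc[OF side_len_pos fd c(1) w_def pq] c(2) by (simp add: mk_mark_def Let_def)
  next
    case FB
    have pp: "phi * phi < 1" using mult_strict_right_mono[OF phi_lt1 phi_pos] phi_lt1 by linarith
    have "phi^5 = phi - phi^3" by (simp add: phi_alg)
    moreover have "0 < phi^5" "0 < phi^3" by simp_all
    ultimately have p: "0 < phi^5" "0 < phi^3" "phi^5 = phi - phi^3" by blast+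
    then have p3: "phi^3 < phi" by linarith

    from FB s have s': "s = LLeg" by simp
    from FB ch s' have e: "em e LLeg = Ax True" "ef e = Fr True 0 0 (G (ZF 0 (-1) 0 1) (ZF 0 0 0 0))" "ek e = Large" by auto
    have lt: "- (phi^5) < phi^3" using p(1,2) by linarith
    show ?thesis unfolding s' e using lt
      by (subst legal_mark_axis) (use p3 in \<open>auto simp: iso_def mk_mark_def\<close>)
  next
    case FH
    from FH s have s': "s = Hyp" by simp
    from FH ch s' have e: "em e Hyp = Ax False" "ef e = Fr False 0 1 (G (ZF 0 0 0 0) (ZF 0 0 0 (-1)))" "ek e = Large" by auto
    have p: "0 < phi^4" by simp
    show ?thesis unfolding s' e using p
      by (subst legal_mark_axis) (auto simp: iso_def mk_mark_def dirc_1 phi_alg)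
  qed
qed

lemma decorate_entry:
  assumes "e \<in> set (entries n)"
  shows "decorate (num n) l r (tl (ek e) (evf (ef e))) = estar l r e"
proof -
  have "(case s of Hyp \<Rightarrow> legal_mark (num n) l r (vert t Sh) (vert t Bl) | LLeg \<Rightarrow> legal_mark (num n) l r (vert t Rt) (vert t Sh)
          | SLeg \<Rightarrow> legal_mark (num n) l r (vert t Rt) (vert t Bl)) = legal_mark (num n) l r (vert t (c0 s)) (vert t (c1 s))" for s t
    by (cases s) auto
  note cs = this
  show ?thesis unfolding decorate_def estar_def zero_in_side[OF assms] cs
    using legal_mark_entry[OF assms] by (auto simp: fun_eq_iff simp del: evf.simps proto.simps)
qed

lemma C_star_entries: "C_star (num n) l r = estar l r ` set (entries n)"
  unfolding C_star_def tiles_entries image_image using decorate_entry by (intro image_cong) auto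

section \<open>Legal stars inside a tiling\<close>

text \<open>The image of the star \<open>n\<close> under \<open>h\<close> is the star of \<open>T\<close> at \<open>h 0\<close>. The last part says that no other tile contains the
  center; completeness of the star is a separate matter.\<close>

definition legalat :: "ctile set \<Rightarrow> sn \<Rightarrow> 4 \<Rightarrow> bool \<Rightarrow> (complex \<Rightarrow> complex) \<Rightarrow> bool" where
  "legalat T n l r h \<longleftrightarrow> isometry h \<and>
     (\<forall>e\<in>set (entries n). \<exists>m. ct (ek e) (h \<circ> evf (ef e)) m \<in> T \<and> (\<forall>s. agr l r (em e s) (m s))) \<and>
     (\<forall>X\<in>T. h 0 \<in> body (fst X) \<longrightarrow> (\<exists>e\<in>set (entries n). \<exists>m. X = ct (ek e) (h \<circ> evf (ef e)) m))"

definition valid_label :: "sn \<Rightarrow> 4 \<Rightarrow> bool" where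
  "valid_label n l \<longleftrightarrow> l \<in> {of_nat (num n), of_nat (num n) + 2}"

lemma num_surj: "(\<exists>k\<in>{1..7}. P k) \<longleftrightarrow> (\<exists>n. P (num n))"
proof
  assume "\<exists>k\<in>{1..7}. P k"
  then obtain k where k: "k \<in> {1..7}" "P k" by blast
  then have "k \<in> {1, 2, 3, 4, 5, 6, 7}" by auto
  then have "k = num C1 \<or> k = num C2 \<or> k = num C3 \<or> k = num C4 \<or> k = num C5 \<or> k = num C6 \<or> k = num C7" by auto
  then show "\<exists>n. P (num n)" using k(2) by metis
next
  assume "\<exists>n. P (num n)"
  then obtain n where "P (num n)" by blast
  moreover have "num n \<in> {1..7}" by (cases n) auto
  ultimately show "\<exists>k\<in>{1..7}. P k" by blast
qed

lemma image_side_of: "isometry f \<Longrightarrow> isometry g \<Longrightarrow> side_of (tl k (f \<circ> g)) s = f ` side_of (tl k g) s"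
  by (simp add: side_of_tl(1) isometry_comp image_comp)

lemma map_star_ct:
  assumes f: "isometry f" and g: "isometry g" and A: "f A = 0"
  shows "(case (tl k g, \<lambda>s. if A \<in> side_of (tl k g) s then Some (mk_mark (g \<circ> proto k) s (m s)) else None) of
     (t, \<kappa>) \<Rightarrow> (map_tile f t, map_option (map_mark f) \<circ> \<kappa>)) =
    (tl k (f \<circ> g), \<lambda>s. if 0 \<in> side_of (tl k (f \<circ> g)) s then Some (mk_mark (f \<circ> g \<circ> proto k) s (m s)) else None)"
proof -
  have "0 \<in> side_of (tl k (f \<circ> g)) s \<longleftrightarrow> A \<in> side_of (tl k g) s" for s
    unfolding image_side_of[OF f g] using A isometry_inj[OF f] by (metis inj_image_mem_iff)
  then show ?thesis by (auto simp: map_tile_def tl_def fun_eq_iff map_mark_mk comp_assoc)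
qed

text \<open>In a tiling the marks of a tile are determined by its frame, so equality of decorated stars amounts to
  the presence of all tiles of the table with suitable marks, and the absence of others.\<close>

lemma legal_star_iff:
  assumes T: "colored_tiling T"
  shows "legal_star A (star T A) \<longleftrightarrow> complete_star A (star T A) \<and>
    (\<exists>n l r h. valid_label n l \<and> h 0 = A \<and> legalat T n l r h)"
proof -
  have "(\<exists>f. isometry f \<and> f A = 0 \<and> map_star f (star T A) = C_star (num n) l r) \<longleftrightarrow>
        (\<exists>h. h 0 = A \<and> legalat T n l r h)" for n l r
  proof
    assume "\<exists>f. isometry f \<and> f A = 0 \<and> map_star f (star T A) = C_star (num n) l r"
    then obtain f where f: "isometry f" "f A = 0" and eq: "map_star f (star T A) = estar l r ` set (entries n)"
      unfolding C_star_entries by blast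
    define h where "h = inv f"
    have hf: "isometry h" "\<And>x. h (f x) = x" "\<And>x. f (h x) = x" "h \<circ> f = (\<lambda>z. z)" "f \<circ> h = (\<lambda>z. z)"
      unfolding h_def using isometry_inv[OF f(1)] isometry_inv_comp[OF f(1)] by auto
    have fr: "g = h \<circ> F" if "f \<circ> g = F" for g F
    proof -
      have "g = h \<circ> (f \<circ> g)" by (simp add: fun_eq_iff hf(2))
      then show ?thesis using that by simp
    qed
    have h0: "h 0 = A" using hf(2)[of A] f(2) by simp
    have "legalat T n l r h" unfolding legalat_def
    proof (intro conjI ballI impI)
      show "isometry h" by (rule hf(1))
    next
      fix e assume e: "e \<in> set (entries n)"
      then have "estar l r e \<in> map_star f (star T A)" using eq by blast
      then obtain t \<kappa> where t: "(t, \<kappa>) \<in> T" "A \<in> body t"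
        "estar l r e = (map_tile f t, map_option (map_mark f) \<circ> (\<lambda>s. if A \<in> side_of t s then Some (\<kappa> s) else None))"
        unfolding map_star_def star_def by auto
      obtain k g m where g: "isometry g" "(t, \<kappa>) = ct k g m" using colored_tileE[OF colored_tilingD(1)[OF T t(1)]] by metis
      have tk: "t = tl k g" "\<kappa> = (\<lambda>s. mk_mark (g \<circ> proto k) s (m s))" using g(2) by (auto simp: ct_def)
      have eq': "estar l r e = (tl k (f \<circ> g), \<lambda>s. if 0 \<in> side_of (tl k (f \<circ> g)) s then Some (mk_mark (f \<circ> g \<circ> proto k) s (m s)) else None)"
        unfolding t(3) tk using map_star_ct[OF f(1) g(1) f(2), of k m] by simp
      then have "tl (ek e) (evf (ef e)) = tl k (f \<circ> g)" unfolding estar_def by simp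
      from tl_eqD[OF isometry_evf isometry_comp[OF f(1) g(1)] this] have k: "k = ek e" and F: "f \<circ> g = evf (ef e)" by auto
      have "agr l r (em e s) (m s)" for s
      proof (cases "sat (ep e) s")
        case False then show ?thesis using entry_ok(3)[OF e, of s] by (simp add: agr_def)
      next
        case True
        have "snd (estar l r e) s = Some (mk_mark (f \<circ> g \<circ> proto k) s (m s))"
          unfolding eq' using True zero_in_side[OF e] F k by simp
        then have "mk_mark (evf (ef e) \<circ> proto (ek e)) s (mv l r (em e s)) = mk_mark (evf (ef e) \<circ> proto (ek e)) s (m s)"
          using True F k by (simp add: estar_def del: evf.simps)
        then show ?thesis using mk_mark_eqD[OF inj_vert[OF isometry_evf]] unfolding agr_def by metis
      qed
      moreover have "ct (ek e) (h \<circ> evf (ef e)) m \<in> T" using t(1) g(2) k fr[OF F] by simp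
      ultimately show "\<exists>m. ct (ek e) (h \<circ> evf (ef e)) m \<in> T \<and> (\<forall>s. agr l r (em e s) (m s))" by blast
    next
      fix X assume X: "X \<in> T" "h 0 \<in> body (fst X)"
      obtain k g m where g: "isometry g" "X = ct k g m" using colored_tileE[OF colored_tilingD(1)[OF T X(1)]] by metis
      have "(tl k g, \<lambda>s. if A \<in> side_of (tl k g) s then Some (mk_mark (g \<circ> proto k) s (m s)) else None) \<in> star T A"
        unfolding star_def using X h0 by (auto simp: g(2) ct_def)
      from imageI[OF this] have "(tl k (f \<circ> g), \<lambda>s. if 0 \<in> side_of (tl k (f \<circ> g)) s then Some (mk_mark (f \<circ> g \<circ> proto k) s (m s)) else None)
          \<in> map_star f (star T A)"
        unfolding map_star_def map_star_ct[OF f(1) g(1) f(2), of k m, symmetric] .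
      then obtain e where e: "e \<in> set (entries n)" "tl k (f \<circ> g) = tl (ek e) (evf (ef e))" unfolding eq estar_def by auto
      from tl_eqD[OF isometry_comp[OF f(1) g(1)] isometry_evf e(2)] have "k = ek e" and FF: "f \<circ> g = evf (ef e)" .
      moreover have "g = h \<circ> evf (ef e)" by (rule fr[OF FF])
      ultimately have "k = ek e" "g = h \<circ> evf (ef e)" by simp_all
      then show "\<exists>e\<in>set (entries n). \<exists>m. X = ct (ek e) (h \<circ> evf (ef e)) m" using e g(2) by blast
    qed
    then show "\<exists>h. h 0 = A \<and> legalat T n l r h" using h0 by blast
  next
    assume "\<exists>h. h 0 = A \<and> legalat T n l r h"
    then obtain h where h0: "h 0 = A" and L: "legalat T n l r h" by blast
    then have h: "isometry h"
      and L1: "\<And>e. e \<in> set (entries n) \<Longrightarrow> \<exists>m. ct (ek e) (h \<circ> evf (ef e)) m \<in> T \<and> (\<forall>s. agr l r (em e s) (m s))"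
      and L2: "\<And>X. X \<in> T \<Longrightarrow> A \<in> body (fst X) \<Longrightarrow> \<exists>e\<in>set (entries n). \<exists>m. X = ct (ek e) (h \<circ> evf (ef e)) m"
      unfolding legalat_def by blast+
    define f where "f = inv h"
    have f: "isometry f" "f A = 0" "\<And>g. f \<circ> (h \<circ> g) = g"
      unfolding f_def using isometry_inv[OF h] isometry_inv_comp[OF h] h0 by (auto simp: fun_eq_iff)
    have es: "estar l r e = (tl (ek e) (evf (ef e)), \<lambda>s. if 0 \<in> side_of (tl (ek e) (evf (ef e))) s then Some (mk_mark (evf (ef e) \<circ> proto (ek e)) s (m s)) else None)"
      if e: "e \<in> set (entries n)" and a: "\<And>s. agr l r (em e s) (m s)" for e m
      unfolding estar_def zero_in_side[OF e] using a entry_ok(3)[OF e] by (auto simp: agr_def fun_eq_iff simp del: evf.simps)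
    have ms: "(case (tl k (h \<circ> evf F), \<lambda>s. if A \<in> side_of (tl k (h \<circ> evf F)) s then Some (mk_mark (h \<circ> evf F \<circ> proto k) s (m s)) else None) of
        (t, \<kappa>) \<Rightarrow> (map_tile f t, map_option (map_mark f) \<circ> \<kappa>)) =
      (tl k (evf F), \<lambda>s. if 0 \<in> side_of (tl k (evf F)) s then Some (mk_mark (evf F \<circ> proto k) s (m s)) else None)" for k F m
      using map_star_ct[OF f(1) isometry_comp[OF h isometry_evf] f(2), of k F m] unfolding f(3) .
    have "map_star f (star T A) = estar l r ` set (entries n)"
    proof (intro equalityI subsetI)
      fix Z assume "Z \<in> map_star f (star T A)"
      then obtain t \<kappa> where t: "(t, \<kappa>) \<in> T" "A \<in> body t"
        "Z = (case (t, \<lambda>s. if A \<in> side_of t s then Some (\<kappa> s) else None) of (t, \<kappa>) \<Rightarrow> (map_tile f t, map_option (map_mark f) \<circ> \<kappa>))"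
        unfolding map_star_def star_def by auto
      obtain e m where e: "e \<in> set (entries n)" "(t, \<kappa>) = ct (ek e) (h \<circ> evf (ef e)) m" using L2[OF t(1)] t(2) by auto
      have tk: "t = tl (ek e) (h \<circ> evf (ef e))" "\<kappa> = (\<lambda>s. mk_mark (h \<circ> evf (ef e) \<circ> proto (ek e)) s (m s))"
        using e(2) by (auto simp: ct_def)
      obtain m' where m': "ct (ek e) (h \<circ> evf (ef e)) m' \<in> T" "\<And>s. agr l r (em e s) (m' s)" using L1[OF e(1)] by blast
      have mm: "m = m'" using colored_tiling_frame_unique[OF T isometry_comp[OF h isometry_evf]] m'(1) t(1) e(2) by metis
      have "Z = estar l r e" unfolding t(3) tk ms mm es[OF e(1) m'(2)] by (rule refl)
      then show "Z \<in> estar l r ` set (entries n)" using e(1) by blast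
    next
      fix Z assume "Z \<in> estar l r ` set (entries n)"
      then obtain e where e: "e \<in> set (entries n)" "Z = estar l r e" by blast
      obtain m where m: "ct (ek e) (h \<circ> evf (ef e)) m \<in> T" "\<And>s. agr l r (em e s) (m s)" using L1[OF e(1)] by blast
      have "A \<in> body (tl (ek e) (h \<circ> evf (ef e)))"
        unfolding body_tl[OF isometry_comp[OF h isometry_evf]]
        using ppt_std(1)[OF entry_ok(1)[OF e(1)]] entry_ok(2)[OF e(1)] h0 by (auto simp: image_iff intro!: bexI[of _ "ppt (ek e) (ep e)"] simp del: evf.simps)
      then have "(tl (ek e) (h \<circ> evf (ef e)), \<lambda>s. if A \<in> side_of (tl (ek e) (h \<circ> evf (ef e))) s then Some (mk_mark (h \<circ> evf (ef e) \<circ> proto (ek e)) s (m s)) else None) \<in> star T A"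
        unfolding star_def using m(1) by (auto simp: ct_def)
      from imageI[OF this, of "\<lambda>(t, \<kappa>). (map_tile f t, map_option (map_mark f) \<circ> \<kappa>)"]
      show "Z \<in> map_star f (star T A)"
        unfolding map_star_def ms e(2) es[OF e(1) m(2)] .
    qed
    then show "\<exists>f. isometry f \<and> f A = 0 \<and> map_star f (star T A) = C_star (num n) l r"
      unfolding C_star_entries using f(1,2) by blast
  qed
  note key = this
  have "(\<exists>f n l right. isometry f \<and> f A = 0 \<and> n \<in> {1..7} \<and> l \<in> {of_nat n, of_nat n + 2} \<and> map_star f (star T A) = C_star n l right)
    \<longleftrightarrow> (\<exists>n\<in>{1..7}. \<exists>l r. l \<in> {of_nat n, of_nat n + 2} \<and> (\<exists>f. isometry f \<and> f A = 0 \<and> map_star f (star T A) = C_star n l r))"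
    (is "?L \<longleftrightarrow> ?M") by blast
  also have "\<dots> \<longleftrightarrow> (\<exists>n l r. l \<in> {of_nat (num n), of_nat (num n) + 2} \<and> (\<exists>f. isometry f \<and> f A = 0 \<and> map_star f (star T A) = C_star (num n) l r))"
    by (rule num_surj)
  also have "\<dots> \<longleftrightarrow> (\<exists>n l r h. valid_label n l \<and> h 0 = A \<and> legalat T n l r h)"
    unfolding key valid_label_def by (simp only: ex_simps)
  finally show ?thesis unfolding legal_star_def by (simp only:)
qed

section \<open>Refuting patches of L-tilings\<close>

text \<open>A known tile: kind, frame relative to a base tile, and the known marks of its sides.\<close>

datatype ktile = KT kind fr "(lab \<times> bool) option" "(lab \<times> bool) option" "(lab \<times> bool) option"

fun conc :: "lab \<Rightarrow> bool \<Rightarrow> sm \<Rightarrow> (lab \<times> bool) option" where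
  "conc l r NoM = None" | "conc l r (Ax b) = Some (l, b = r)" | "conc l r (Of x b) = Some (x, b)"

fun okm :: "(lab \<times> bool) option \<Rightarrow> 4 \<times> bool \<Rightarrow> bool" where
  "okm None p = True" | "okm (Some (x, b)) p = (p = (lv x, b))"

lemma okm_conc: "agr (lv l) r x p \<longleftrightarrow> okm (conc l r x) p"
  by (cases x) (auto simp: agr_def)

definition kn :: "ctile set \<Rightarrow> (complex \<Rightarrow> complex) \<Rightarrow> ktile \<Rightarrow> bool" where
  "kn T f0 t \<longleftrightarrow> (case t of KT k F x y z \<Rightarrow>
     \<exists>m. ct k (f0 \<circ> evf F) m \<in> T \<and> okm x (m Hyp) \<and> okm y (m LLeg) \<and> okm z (m SLeg))"

fun comb :: "(lab \<times> bool) option \<Rightarrow> (lab \<times> bool) option \<Rightarrow> (lab \<times> bool) option option" where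
  "comb None y = Some y" | "comb x None = Some x" | "comb (Some p) (Some q) = (if p = q then Some (Some p) else None)"

lemma comb_None: "comb x y = None \<Longrightarrow> okm x p \<Longrightarrow> okm y p \<Longrightarrow> False"
  by (cases "(x, y)" rule: comb.cases) (auto simp: lv_inj split: if_splits)

lemma comb_Some: "comb x y = Some z \<Longrightarrow> okm x p \<Longrightarrow> okm y p \<Longrightarrow> okm z p"
  by (cases "(x, y)" rule: comb.cases) (auto split: if_splits)

text \<open>Equality of frames as a cascade of conditionals, which a simplifier evaluates lazily.\<close>

fun feq :: "fr \<Rightarrow> fr \<Rightarrow> bool" where
  "feq (Fr c a b (G (ZF p q r s) (ZF t u v w))) (Fr c' a' b' (G (ZF p' q' r' s') (ZF t' u' v' w'))) =
    (if q = q' then if u = u' then if p = p' then if t = t' then if a = a' then if b = b' then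
       c = c' \<and> r = r' \<and> s = s' \<and> v = v' \<and> w = w'
     else False else False else False else False else False else False)"

lemma feq_iff: "feq F F' \<longleftrightarrow> F = F'"
  by (cases "(F, F')" rule: feq.cases) auto

fun estart :: "fr \<Rightarrow> lab \<Rightarrow> bool \<Rightarrow> entry \<Rightarrow> ktile" where
  "estart h l r (En k p F x y z) = KT k (fcomp h F) (conc l r x) (conc l r y) (conc l r z)"

lemma kn_estart:
  assumes "legalat T n (lv l) r (f0 \<circ> evf h)" "e \<in> set (entries n)" shows "kn T f0 (estart h l r e)"
proof -
  obtain m where m: "ct (ek e) (f0 \<circ> evf h \<circ> evf (ef e)) m \<in> T" "\<And>s. agr (lv l) r (em e s) (m s)"
    using assms unfolding legalat_def by blast
  obtain k p F x y z where E: "e = En k p F x y z" by (cases e)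
  show ?thesis using m(1) m(2)[of Hyp] m(2)[of LLeg] m(2)[of SLeg]
    unfolding kn_def E okm_conc by (auto simp: evf_fcomp comp_assoc simp del: evf.simps fcomp.simps)
qed

text \<open>The stars that can be centered at the corner \<open>c\<close> of a tile of kind \<open>k\<close> with the known marks \<open>x\<close>, \<open>y\<close>, \<open>z\<close>.\<close>

definition compat :: "(lab \<times> bool) option \<Rightarrow> (lab \<times> bool) option \<Rightarrow> bool" where
  "compat x y \<longleftrightarrow> comb x y \<noteq> None"

fun mcomp :: "ktile \<Rightarrow> lab \<Rightarrow> bool \<Rightarrow> entry \<Rightarrow> bool" where
  "mcomp (KT k F x y z) l r (En k' p F' x' y' z') \<longleftrightarrow>
     compat x (conc l r x') \<and> compat y (conc l r y') \<and> compat z (conc l r z')"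

definition ce :: "ktile \<Rightarrow> sn \<Rightarrow> entry \<Rightarrow> (sn \<times> lab \<times> bool \<times> entry) list" where
  "ce t n e = filter (\<lambda>(n, l, r, e). mcomp t l r e)
     (let x = nlab n; y = linc (linc x) in [(n, x, True, e), (n, x, False, e), (n, y, True, e), (n, y, False, e)])"

fun knd :: "ktile \<Rightarrow> kind" where "knd (KT k F x y z) = k"
fun frm :: "ktile \<Rightarrow> fr" where "frm (KT k F x y z) = F"

definition cands :: "ktile \<Rightarrow> corner \<Rightarrow> (sn \<times> lab \<times> bool \<times> entry) list" where
  "cands t c = concat (map (\<lambda>n. concat (map (\<lambda>e. if ek e = knd t then if ep e = At c then ce t n e else [] else [])
     (entries n))) [C1, C2, C3, C4, C5, C6, C7])"

lemma ce_in: "l = nlab n \<or> l = linc (linc (nlab n)) \<Longrightarrow> mcomp t l r e \<Longrightarrow> (n, l, r, e) \<in> set (ce t n e)"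
  unfolding ce_def Let_def by (cases r) auto

lemma cands_in:
  assumes "e \<in> set (entries n)" "ek e = knd t" "ep e = At c" "l = nlab n \<or> l = linc (linc (nlab n))" "mcomp t l r e"
  shows "(n, l, r, e) \<in> set (cands t c)"
proof -
  have "n \<in> set [C1, C2, C3, C4, C5, C6, C7]" by (cases n) auto
  moreover have "(n, l, r, e) \<in> set (if ek e = knd t then if ep e = At c then ce t n e else [] else [])"
    using ce_in[OF assms(4,5)] assms(2,3) by simp
  then have "(n, l, r, e) \<in> set (concat (map (\<lambda>e. if ek e = knd t then if ep e = At c then ce t n e else [] else []) (entries n)))"
    unfolding set_concat set_map by (rule UN_I[OF imageI[OF assms(1)]])
  ultimately show ?thesis unfolding cands_def set_concat[of "map _ [C1, C2, C3, C4, C5, C6, C7]"] set_map[of _ "[C1, C2, C3, C4, C5, C6, C7]"]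
    by (rule UN_I[OF imageI])
qed

fun frot :: "fr \<Rightarrow> bool \<times> int \<times> int" where "frot (Fr c a b z) = (c, a, b)"

fun rcomp :: "bool \<times> int \<times> int \<Rightarrow> bool \<times> int \<times> int \<Rightarrow> bool \<times> int \<times> int" where
  "rcomp (c, a, b) (c', a', b') = (if c then (\<not> c', (a - a') mod 4, b - b') else (c', (a + a') mod 4, b + b'))"

fun rdiff :: "bool \<times> int \<times> int \<Rightarrow> bool \<times> int \<times> int \<Rightarrow> bool" where
  "rdiff (c, a, b) (c', a', b') \<longleftrightarrow> (if c = c' then if b = b' then (a - a') mod 4 \<noteq> 0 else False else True)"

lemma rdiff_sound:
  assumes "rdiff (frot F) (frot F')" shows "evf F \<noteq> evf F'"
proof
  assume e: "evf F = evf F'"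
  obtain c a b z where F: "F = Fr c a b z" by (cases F)
  obtain c' a' b' z' where F': "F' = Fr c' a' b' z'" by (cases F')
  have z: "evg z = evg z'" using fun_cong[OF e, of 0] by (cases c; cases c'; simp add: F F' iso_def)
  have d: "dirc a b = dirc a' b'" using fun_cong[OF e, of 1] z by (cases c; cases c'; simp add: F F' iso_def)
  have "dirc a b \<noteq> 0" using norm_dirc[of a b] by (metis norm_zero zero_neq_one)
  then have c: "c = c'" using fun_cong[OF e, of \<i>] z d
    by (cases c; cases c'; simp add: F F' iso_def complex_eq_iff)
  then have b: "b = b'" "(a - a') mod 4 \<noteq> 0" using assms by (auto simp: F F' split: if_splits)
  have "dirc ((a - a') mod 4) 0 = dirc a b * dirc (- a') (- b')"
    using dirc_add[of a "- a'" b "- b'"] b by (simp add: dirc_mod)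
  also have "\<dots> = 1" unfolding d by (rule dirc_inverse)
  finally have "dirc ((a - a') mod 4) 0 = 1" .
  moreover have "(a - a') mod 4 \<in> {1, 2, 3}" using b(2) by auto
  ultimately show False by (auto simp: dirc_1 complex_eq_iff)
qed

lemma frot_fcomp: "frot (fcomp F F') = rcomp (frot F) (frot F')"
  by (cases F; cases F') auto

text \<open>The star \<open>n\<close> placed by a frame with rotational part \<open>h\<close> has no tile of the given kind that
  has the corner \<open>c\<close> at the center and whose frame has the given rotational part.\<close>

fun lacks :: "kind \<times> corner \<times> bool \<times> int \<times> int \<Rightarrow> bool \<times> int \<times> int \<Rightarrow> sn \<Rightarrow> bool" where
  "lacks (k, c, f) h n \<longleftrightarrow> list_all (\<lambda>e. if ek e = k then if ep e = At c then rdiff f (rcomp h (frot (ef e))) else True else True) (entries n)"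

lemma lacks_sound:
  assumes "isometry f0" "legalat T n l r (f0 \<circ> evf h)" "kn T f0 (KT k F x y z)" "evg (fapp F (gpt k (At c))) = evf h 0"
    "lacks (k, c, frot F) (frot h) n"
  shows False
proof -
  obtain m where m: "ct k (f0 \<circ> evf F) m \<in> T" using assms(3) unfolding kn_def by auto
  have v: "evf F (proto k c) = evf h 0" using assms(4) by (simp add: evg_fapp evg_gpt)
  have i: "isometry (f0 \<circ> evf F)" by (rule isometry_comp[OF assms(1) isometry_evf])
  have "proto k c \<in> std k" using ppt_std(1)[of k "At c"] by simp
  then have "(f0 \<circ> evf h) 0 \<in> body (fst (ct k (f0 \<circ> evf F) m))" unfolding fst_ct body_tl[OF i] using v by (auto intro: image_eqI[of _ _ "proto k c"])
  then obtain e m' where e: "e \<in> set (entries n)" "ct k (f0 \<circ> evf F) m = ct (ek e) (f0 \<circ> evf h \<circ> evf (ef e)) m'"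
    using assms(2) m unfolding legalat_def by blast
  from ct_eqD[OF i isometry_comp[OF isometry_comp[OF assms(1) isometry_evf] isometry_evf] e(2)]
  have k: "k = ek e" and "f0 \<circ> evf F = f0 \<circ> evf h \<circ> evf (ef e)" by auto
  then have "f0 (evf F w) = f0 (evf h (evf (ef e) w))" for w by (simp add: fun_eq_iff)
  then have F: "evf F w = evf h (evf (ef e) w)" for w using isometry_inj[OF assms(1)] by (meson injD)
  then have Fe: "evf F = evf (fcomp h (ef e))" by (auto simp: evf_fcomp)
  have "evf (ef e) (ppt k (At c)) = 0" using F[of "proto k c"] v isometry_inj[OF isometry_evf, of h] by (simp add: inj_eq)
  then have "ppt k (At c) = ppt k (ep e)" using entry_ok(2)[OF e(1)] k isometry_inj[OF isometry_evf, of "ef e"] by (metis injD)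
  then have "ep e = At c" using ppt_inj[of k "At c" "ep e"] entry_ok(1)[OF e(1)] k by simp
  then have "rdiff (frot F) (frot (fcomp h (ef e)))" using assms(5) e(1) k unfolding lacks.simps list_all_iff frot_fcomp by (metis (full_types))
  then show False using rdiff_sound Fe by blast
qed

text \<open>A known star: frame, number, label and direction of the axis. A pair \<open>(a, b)\<close> refers to the \<open>b\<close>-th tile of the
  \<open>a\<close>-th known star.\<close>

datatype pstar = Pl fr sn lab bool

text \<open>A refutation \<open>Step ts c js cs\<close> looks at the star at the corner \<open>c\<close> of the tile to which all of \<open>ts\<close> refer. It is
  one of finitely many candidates. Those that do not contain the tiles \<open>js\<close>, which have the center of the star as a
  corner, are impossible, and \<open>cs\<close> are refutations for the others; \<open>Clash b i\<close> says that the \<open>b\<close>-th tile of the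
  candidate is the known tile \<open>i\<close> with contradicting marks.\<close>

datatype cert = Clash int "int \<times> int"
  | Step "(int \<times> int) list" corner "((int \<times> int) \<times> corner) list" "cert list"

fun nthi :: "'a list \<Rightarrow> int \<Rightarrow> 'a option" where
  "nthi [] i = None" | "nthi (x # xs) i = (if i = 0 then Some x else nthi xs (i - 1))"

lemma nthi_in: "nthi xs i = Some x \<Longrightarrow> x \<in> set xs"
  by (induction xs i rule: nthi.induct) (auto split: if_splits)

fun tref :: "pstar list \<Rightarrow> int \<times> int \<Rightarrow> ktile option" where
  "tref st (a, b) = (case nthi st a of None \<Rightarrow> None | Some (Pl h n l r) \<Rightarrow>
     (case nthi (entries n) b of None \<Rightarrow> None | Some e \<Rightarrow> Some (estart h l r e)))"

definition ks :: "ctile set \<Rightarrow> (complex \<Rightarrow> complex) \<Rightarrow> pstar \<Rightarrow> bool" where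
  "ks T f0 s \<longleftrightarrow> (case s of Pl h n l r \<Rightarrow> legalat T n (lv l) r (f0 \<circ> evf h))"

lemma tref_kn: "\<forall>s\<in>set st. ks T f0 s \<Longrightarrow> tref st i = Some t \<Longrightarrow> kn T f0 t"
  by (cases i) (auto simp: ks_def split: option.splits pstar.splits dest!: nthi_in intro!: kn_estart)

fun mrg :: "ktile \<Rightarrow> ktile \<Rightarrow> ktile option" where
  "mrg (KT k F x y z) (KT k' F' x' y' z') = (if feq F F' \<and> k = k' then
     (case comb x x' of None \<Rightarrow> None | Some x'' \<Rightarrow>
     (case comb y y' of None \<Rightarrow> None | Some y'' \<Rightarrow>
     (case comb z z' of None \<Rightarrow> None | Some z'' \<Rightarrow> Some (KT k F x'' y'' z'')))) else None)"

fun trefs :: "pstar list \<Rightarrow> (int \<times> int) list \<Rightarrow> ktile option" where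
  "trefs st [] = None"
| "trefs st [i] = tref st i"
| "trefs st (i # ts) = (case tref st i of None \<Rightarrow> None | Some t \<Rightarrow>
     (case trefs st ts of None \<Rightarrow> None | Some u \<Rightarrow> mrg t u))"

lemma kn_same:
  assumes "colored_tiling T" "isometry f0" "kn T f0 (KT k F x y z)" "kn T f0 (KT k F x' y' z')"
  shows "\<exists>m. ct k (f0 \<circ> evf F) m \<in> T \<and> okm x (m Hyp) \<and> okm x' (m Hyp) \<and> okm y (m LLeg) \<and> okm y' (m LLeg)
     \<and> okm z (m SLeg) \<and> okm z' (m SLeg)"
proof -
  obtain m where m: "ct k (f0 \<circ> evf F) m \<in> T" "okm x (m Hyp)" "okm y (m LLeg)" "okm z (m SLeg)"
    using assms(3) by (auto simp: kn_def)
  obtain m' where m': "ct k (f0 \<circ> evf F) m' \<in> T" "okm x' (m' Hyp)" "okm y' (m' LLeg)" "okm z' (m' SLeg)"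
    using assms(4) by (auto simp: kn_def)
  have "m' = m" using colored_tiling_frame_unique[OF assms(1) isometry_comp[OF assms(2) isometry_evf] m'(1) m(1)] .
  then show ?thesis using m m' by blast
qed

lemma mrg_kn:
  assumes "colored_tiling T" "isometry f0" "kn T f0 t" "kn T f0 u" "mrg t u = Some v" shows "kn T f0 v"
proof -
  obtain k F x y z where t: "t = KT k F x y z" by (cases t)
  obtain k' F' x' y' z' where u: "u = KT k' F' x' y' z'" by (cases u)
  have e: "F = F'" "k = k'" using assms(5) unfolding t u by (auto simp: feq_iff split: if_splits)
  obtain x'' y'' z'' where c: "comb x x' = Some x''" "comb y y' = Some y''" "comb z z' = Some z''" "v = KT k F x'' y'' z''"
    using assms(5) unfolding t u by (auto split: if_splits option.splits)
  obtain m where "ct k (f0 \<circ> evf F) m \<in> T" "okm x (m Hyp)" "okm x' (m Hyp)" "okm y (m LLeg)" "okm y' (m LLeg)"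
     "okm z (m SLeg)" "okm z' (m SLeg)"
    using kn_same[OF assms(1,2) assms(3)[unfolded t] assms(4)[unfolded u e[symmetric]]] by blast
  then show ?thesis unfolding c(4) kn_def ktile.case using comb_Some[OF c(1)] comb_Some[OF c(2)] comb_Some[OF c(3)] by blast
qed

lemma trefs_kn: "colored_tiling T \<Longrightarrow> isometry f0 \<Longrightarrow> \<forall>s\<in>set st. ks T f0 s \<Longrightarrow> trefs st ts = Some t \<Longrightarrow> kn T f0 t"
proof (induction st ts arbitrary: t rule: trefs.induct)
  case (2 st i)
  then show ?case using tref_kn by simp
next
  case (3 st i j js)
  obtain u v where u: "tref st i = Some u" "trefs st (j # js) = Some v" "mrg u v = Some t"
    using 3(5) by (auto split: option.splits)
  show ?case by (rule mrg_kn[OF 3(2,3) tref_kn[OF 3(4) u(1)] 3(1)[OF u(1) 3(2-4) u(2)] u(3)])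
qed simp

fun sel :: "((int \<times> int) \<times> corner) list \<Rightarrow> gs \<Rightarrow> pstar list \<Rightarrow> (kind \<times> corner \<times> bool \<times> int \<times> int) list option" where
  "sel [] v st = Some []"
| "sel ((j, c) # js) v st = (case tref st j of None \<Rightarrow> None
     | Some t \<Rightarrow> if fapp (frm t) (gpt (knd t) (At c)) = v
         then (case sel js v st of None \<Rightarrow> None | Some us \<Rightarrow> Some ((knd t, c, frot (frm t)) # us)) else None)"

lemma sel_sound: "sel js v st = Some us \<Longrightarrow> u \<in> set us \<Longrightarrow>
  \<exists>j t c. tref st j = Some t \<and> u = (knd t, c, frot (frm t)) \<and> fapp (frm t) (gpt (knd t) (At c)) = v"
proof (induction js v st arbitrary: us rule: sel.induct)
  case (2 j c js v st)
  obtain t us' where t: "tref st j = Some t" "fapp (frm t) (gpt (knd t) (At c)) = v" "sel js v st = Some us'"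
    "us = (knd t, c, frot (frm t)) # us'"
    using 2(2) by (auto split: option.splits if_splits)
  show ?case
  proof (cases "u \<in> set us'")
    case True then show ?thesis by (rule 2(1)[OF t(1,2,3)])
  next
    case False
    then have "u = (knd t, c, frot (frm t))" using 2(3) t(4) by simp
    then show ?thesis using t(1,2) by blast
  qed
qed simp

fun clash :: "ktile \<Rightarrow> ktile \<Rightarrow> bool" where
  "clash (KT k F x y z) (KT k' F' x' y' z') \<longleftrightarrow>
     (if feq F F' \<and> k = k' then \<not> compat x x' \<or> \<not> compat y y' \<or> \<not> compat z z' else False)"

lemma compat_okm: "okm x p \<Longrightarrow> okm y p \<Longrightarrow> compat x y"
  unfolding compat_def using comb_None by blast

lemma clash_kn:
  assumes "colored_tiling T" "isometry f0" "kn T f0 t" "kn T f0 u" "clash t u" shows False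
proof -
  obtain k F x y z where t: "t = KT k F x y z" by (cases t)
  obtain k' F' x' y' z' where u: "u = KT k' F' x' y' z'" by (cases u)
  have e: "F = F'" "k = k'" using assms(5) unfolding t u by (auto simp: feq_iff split: if_splits)
  obtain m where "ct k (f0 \<circ> evf F) m \<in> T" "okm x (m Hyp)" "okm x' (m Hyp)" "okm y (m LLeg)" "okm y' (m LLeg)"
     "okm z (m SLeg)" "okm z' (m SLeg)"
    using kn_same[OF assms(1,2) assms(3)[unfolded t] assms(4)[unfolded u e[symmetric]]] by blast
  then have "compat x x'" "compat y y'" "compat z z'" using compat_okm by blast+
  then show False using assms(5) unfolding t u by (simp split: if_splits)
qed

definition survivors :: "(kind \<times> corner \<times> bool \<times> int \<times> int) list \<Rightarrow> fr \<Rightarrow> (sn \<times> lab \<times> bool \<times> entry) list \<Rightarrow> (sn \<times> lab \<times> bool \<times> entry) list" where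
  "survivors us F cl = filter (\<lambda>(n, l, r, e). list_all (\<lambda>u. \<not> lacks u (rcomp (frot F) (frot (finv (ef e)))) n) us) cl"

function chk :: "cert \<Rightarrow> pstar list \<Rightarrow> bool" and
  chks :: "cert list \<Rightarrow> (sn \<times> lab \<times> bool \<times> entry) list \<Rightarrow> fr \<Rightarrow> pstar list \<Rightarrow> bool" where
  "chk (Clash b i) st = False"
| "chk (Step ts c js cs) st = (case trefs st ts of None \<Rightarrow> False
     | Some t \<Rightarrow> (case sel js (fapp (frm t) (gpt (knd t) (At c))) st of None \<Rightarrow> False
       | Some us \<Rightarrow> chks cs (survivors us (frm t) (cands t c)) (frm t) st))"
| "chks [] cl F st = (cl = [])"
| "chks (x # xs) cl F st = (case cl of [] \<Rightarrow> False | (n, l, r, e) # cl' \<Rightarrow>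
     (if (case x of
        Clash b i \<Rightarrow> (case nthi (entries n) b of None \<Rightarrow> False | Some e' \<Rightarrow>
          (case tref st i of None \<Rightarrow> False | Some u \<Rightarrow> clash (estart (fcomp F (finv (ef e))) l r e') u))
      | Step ts c js cs \<Rightarrow> chk (Step ts c js cs) (Pl (fcomp F (finv (ef e))) n l r # st))
     then chks xs cl' F st else False))"
  by pat_completeness auto
termination by (relation "Wellfounded.measure (\<lambda>x. case x of Inl (c, st) \<Rightarrow> size c | Inr (cs, _) \<Rightarrow> size_list size cs)") auto

text \<open>L-tilings have this property by \<open>legal_star_iff\<close>, and it is the property that composition preserves.\<close>

definition legal_tiling :: "ctile set \<Rightarrow> bool" where
  "legal_tiling T \<longleftrightarrow> colored_tiling T \<and>
     (\<forall>X\<in>T. \<forall>c. \<exists>n l r h. valid_label n l \<and> h 0 = vert (fst X) c \<and> legalat T n l r h)"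

lemma valid_label_lv: "valid_label n l \<longleftrightarrow> l = lv (nlab n) \<or> l = lv (linc (linc (nlab n)))"
  by (auto simp: valid_label_def lv_linc lv_nlab add.assoc)

text \<open>The star at a corner of a known tile contains this tile in one of the positions of the tables. Its frame then fixes
  the placement of the whole star, and the known marks restrict the number, label and direction.\<close>

lemma cands_sound:
  assumes T: "legal_tiling T" and f0: "isometry f0" and t: "kn T f0 t"
  shows "\<exists>n l r e. (n, l, r, e) \<in> set (cands t c) \<and> e \<in> set (entries n) \<and> ek e = knd t \<and> ep e = At c \<and>
     legalat T n (lv l) r (f0 \<circ> evf (fcomp (frm t) (finv (ef e)))) \<and>
     evg (fapp (frm t) (gpt (knd t) (At c))) = evf (fcomp (frm t) (finv (ef e))) 0"
proof -
  obtain k F x y z where tt: "t = KT k F x y z" by (cases t)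
  obtain m where m: "ct k (f0 \<circ> evf F) m \<in> T" "okm x (m Hyp)" "okm y (m LLeg)" "okm z (m SLeg)"
    using t unfolding kn_def tt by auto
  have i: "isometry (f0 \<circ> evf F)" by (rule isometry_comp[OF f0 isometry_evf])
  obtain n l' r h where L: "valid_label n l'" "h 0 = f0 (evf F (proto k c))" "legalat T n l' r h"
    using T m(1) unfolding legal_tiling_def by (metis fst_ct tl_sel(2) comp_apply)
  have h: "isometry h" using L(3) unfolding legalat_def by blast
  have "proto k c \<in> std k" using ppt_std(1)[of k "At c"] by simp
  then have "h 0 \<in> body (fst (ct k (f0 \<circ> evf F) m))" unfolding fst_ct body_tl[OF i] L(2) by auto
  then obtain e m' where e: "e \<in> set (entries n)" "ct k (f0 \<circ> evf F) m = ct (ek e) (h \<circ> evf (ef e)) m'"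
    using L(3) m(1) unfolding legalat_def by blast
  from ct_eqD[OF i isometry_comp[OF h isometry_evf] e(2)] have k: "k = ek e" and F: "f0 \<circ> evf F = h \<circ> evf (ef e)" and mm: "m = m'" by auto
  obtain m2 where m2: "ct (ek e) (h \<circ> evf (ef e)) m2 \<in> T" "\<And>s. agr l' r (em e s) (m2 s)" using L(3) e(1) unfolding legalat_def by blast
  have m2m: "m2 = m" using colored_tiling_frame_unique[of T "f0 \<circ> evf F" k m2 m] T i m(1) m2(1) k F unfolding legal_tiling_def by metis
  have hh: "h = f0 \<circ> evf (fcomp F (finv (ef e)))"
  proof -
    have "h = h \<circ> (evf (ef e) \<circ> evf (finv (ef e)))"
      unfolding evf_finv_inv isometry_inv_comp(4)[OF isometry_evf] by (simp add: comp_def)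
    also have "\<dots> = f0 \<circ> evf F \<circ> evf (finv (ef e))" unfolding F by (simp add: comp_assoc)
    finally show ?thesis by (simp add: evf_fcomp comp_assoc)
  qed
  have inj: "evf (ef e) (proto k c) = 0"
  proof -
    have "h (evf (ef e) (proto k c)) = h 0" using F L(2) by (metis comp_apply)
    then show ?thesis using isometry_inj[OF h] by (meson injD)
  qed
  then have "ppt k (At c) = ppt k (ep e)" using entry_ok(2)[OF e(1)] k isometry_inj[OF isometry_evf, of "ef e"] by (metis injD ppt.simps(1))
  then have pe: "ep e = At c" using ppt_inj[of k "At c" "ep e"] entry_ok(1)[OF e(1)] k by simp
  obtain l where l: "l' = lv l" "l = nlab n \<or> l = linc (linc (nlab n))" using L(1) unfolding valid_label_lv by blast
  have mc: "mcomp t l r e"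
  proof -
    obtain k' p F' x' y' z' where E: "e = En k' p F' x' y' z'" by (cases e)
    show ?thesis using m2(2)[of Hyp] m2(2)[of LLeg] m2(2)[of SLeg] m(2-4) compat_okm
      unfolding m2m l(1) okm_conc tt E by auto
  qed
  have "(n, l, r, e) \<in> set (cands t c)"
    using cands_in[OF e(1) _ pe l(2) mc] k tt by simp
  moreover have "evg (fapp F (gpt k (At c))) = evf (fcomp F (finv (ef e))) 0"
  proof -
    have "f0 (evf F (proto k c)) = f0 (evf (fcomp F (finv (ef e))) 0)" using L(2) hh by simp
    then have "evf F (proto k c) = evf (fcomp F (finv (ef e))) 0" using isometry_inj[OF f0] by (meson injD)
    then show ?thesis by (simp add: evg_fapp evg_gpt)
  qed
  moreover have "legalat T n (lv l) r (f0 \<circ> evf (fcomp F (finv (ef e))))" using L(3) unfolding hh l(1) .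
  ultimately show ?thesis using e(1) k pe unfolding tt frm.simps knd.simps by blast
qed

lemma survivors_sound:
  assumes f0: "isometry f0" and st: "\<forall>s\<in>set st. ks T f0 s" and us: "sel js v st = Some us"
    and c: "(n, l, r, e) \<in> set cl" and L: "legalat T n (lv l) r (f0 \<circ> evf (fcomp F (finv (ef e))))"
    and v: "evg v = evf (fcomp F (finv (ef e))) 0"
  shows "(n, l, r, e) \<in> set (survivors us F cl)"
proof -
  have "\<not> lacks u (rcomp (frot F) (frot (finv (ef e)))) n" if ui: "u \<in> set us" for u
  proof
    assume a: "lacks u (rcomp (frot F) (frot (finv (ef e)))) n"
    obtain j t c where t: "tref st j = Some t" "u = (knd t, c, frot (frm t))" "fapp (frm t) (gpt (knd t) (At c)) = v"
      using sel_sound[OF us ui] by blast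
    obtain k G x y z where tt: "t = KT k G x y z" by (cases t)
    have "kn T f0 (KT k G x y z)" using tref_kn[OF st t(1)] tt by simp
    from lacks_sound[OF f0 L this, of c] show False using t(2,3) v a unfolding tt by (simp add: frot_fcomp del: lacks.simps)
  qed
  then show ?thesis using c unfolding survivors_def by (auto simp: list_all_iff simp del: lacks.simps)
qed

text \<open>Induction along the refutation: each \<open>Step\<close> enumerates all legal stars at one corner, and each of them either contradicts
  a known tile or is refuted further with the star added to what is known.\<close>

lemma chk_sound:
  assumes T: "legal_tiling T" and f0: "isometry f0"
  shows "chk c st \<Longrightarrow> \<forall>s\<in>set st. ks T f0 s \<Longrightarrow> False"
    and "chks cs cl F st \<Longrightarrow> \<forall>s\<in>set st. ks T f0 s \<Longrightarrow> \<forall>(n, l, r, e)\<in>set cl.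
      \<not> legalat T n (lv l) r (f0 \<circ> evf (fcomp F (finv (ef e))))"
proof (induction c st and cs cl F st rule: chk_chks.induct)
  case (2 ts c js cs st)
  have tt: "colored_tiling T" using T unfolding legal_tiling_def by blast
  obtain t us where t: "trefs st ts = Some t" "sel js (fapp (frm t) (gpt (knd t) (At c))) st = Some us"
    "chks cs (survivors us (frm t) (cands t c)) (frm t) st"
    using 2(2) by (auto split: option.splits)
  have k: "kn T f0 t" by (rule trefs_kn[OF tt f0 2(3) t(1)])
  obtain n l r e where e: "(n, l, r, e) \<in> set (cands t c)" "legalat T n (lv l) r (f0 \<circ> evf (fcomp (frm t) (finv (ef e))))"
     "evg (fapp (frm t) (gpt (knd t) (At c))) = evf (fcomp (frm t) (finv (ef e))) 0"
    using cands_sound[OF T f0 k, of c] by blast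
  have "(n, l, r, e) \<in> set (survivors us (frm t) (cands t c))" by (rule survivors_sound[OF f0 2(3) t(2) e])
  then show ?case using 2(1)[OF t(1,2,3) 2(3)] e(2) by blast
next
  case (4 x xs cl F st)
  have tt: "colored_tiling T" using T unfolding legal_tiling_def by blast
  obtain n l r e cl' where cl: "cl = (n, l, r, e) # cl'" using 4(3) by (cases cl) auto
  let ?h = "fcomp F (finv (ef e))"
  have step: "case x of
        Clash b i \<Rightarrow> (case nthi (entries n) b of None \<Rightarrow> False | Some e' \<Rightarrow>
          (case tref st i of None \<Rightarrow> False | Some u \<Rightarrow> clash (estart ?h l r e') u))
      | Step ts c js cs \<Rightarrow> chk (Step ts c js cs) (Pl ?h n l r # st)"
    and rest: "chks xs cl' F st"
    using 4(3) unfolding cl chks.simps by (auto split: if_splits)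
  have "\<not> legalat T n (lv l) r (f0 \<circ> evf ?h)"
  proof
    assume L: "legalat T n (lv l) r (f0 \<circ> evf ?h)"
    show False
    proof (cases x)
      case (Clash b i)
      then obtain e' u where u: "nthi (entries n) b = Some e'" "tref st i = Some u" "clash (estart ?h l r e') u"
        using step by (auto split: option.splits)
      show ?thesis by (rule clash_kn[OF tt f0 kn_estart[OF L nthi_in[OF u(1)]] tref_kn[OF 4(4) u(2)] u(3)])
    next
      case (Step ts c js cs)
      have st': "\<forall>s\<in>set (Pl ?h n l r # st). ks T f0 s" using L 4(4) by (simp add: ks_def)
      have ch: "chk (Step ts c js cs) (Pl ?h n l r # st)" using step Step by simp
      show ?thesis by (rule 4(1)[OF cl refl refl refl Step ch st'])
    qed
  qed
  moreover have "\<forall>(n, l, r, e)\<in>set cl'. \<not> legalat T n (lv l) r (f0 \<circ> evf (fcomp F (finv (ef e))))"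
    by (rule 4(2)[OF cl refl refl refl _ rest 4(4)]) (rule step)
  ultimately show ?case unfolding cl by (simp only: list.set(2) ball_simps prod.case) blast
qed auto

subsection \<open>The role of a tile in a star\<close>

text \<open>For every tile of a star that has grown out of the previous star by decomposition, the kind of piece
  that it is; unknown for a tile of \<open>C_1\<close>, which has no previous star, and for a tile of \<open>C_6\<close>, which
  stems from \<open>C_5\<close> or \<open>C_7\<close>.\<close>

fun role :: "sn \<Rightarrow> pc option list" where
  "role C1 = [Some PL, Some PS, None]"
| "role C2 = [Some PL, Some PS, Some PU, Some PL]"
| "role C3 = [Some PS, Some PU, Some PL, Some PS, Some PS, Some PL]"
| "role C4 = [Some PU, Some PL, Some PS, Some PU, Some PU, Some PS, Some PL]"
| "role C5 = [Some PS, Some PL, Some PU, Some PL, Some PS, Some PL, Some PU, Some PS]"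
| "role C6 = [Some PU, Some PL, Some PS, Some PL, None, Some PS, Some PL, Some PU]"
| "role C7 = [Some PS, Some PL, Some PU, Some PL, Some PL, Some PU, Some PL, Some PS]"

definition sibling :: "sn \<Rightarrow> bool" where "sibling n \<longleftrightarrow> n = C1 \<or> n = C3"

text \<open>The certificate refutes every star at the right angle of the \<open>i\<close>-th tile of the star \<open>n\<close> that would give this tile the
  wrong role, where \<open>b\<close> tells whether the tile is half of a cut tile.\<close>

definition root_chk :: "sn \<Rightarrow> lab \<Rightarrow> bool \<Rightarrow> int \<Rightarrow> bool \<Rightarrow> cert list \<Rightarrow> bool" where
  "root_chk n l r i b cs = (case nthi (entries n) i of None \<Rightarrow> False | Some e \<Rightarrow>
     (let h = finv (ef e); t = estart h l r e in
        feq (frm t) (Fr False 0 0 (G (ZF 0 0 0 0) (ZF 0 0 0 0))) \<and>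
        chks cs (filter (\<lambda>(n, l, r, e). sibling n \<noteq> b) (cands t Rt)) (frm t) [Pl h n l r]))"

lemma root_chk_sound:
  assumes T: "legal_tiling T" and L: "legalat T n (lv l) r h" and i: "nthi (entries n) i = Some e"
    and c: "root_chk n l r i b cs"
  shows "\<exists>n' l' r' e'. sibling n' = b \<and> e' \<in> set (entries n') \<and> ek e' = ek e \<and> ep e' = At Rt \<and>
     legalat T n' (lv l') r' (h \<circ> evf (ef e) \<circ> evf (finv (ef e')))"
proof -
  have tt: "colored_tiling T" using T unfolding legal_tiling_def by blast
  have h: "isometry h" using L unfolding legalat_def by blast
  define f0 where "f0 = h \<circ> evf (ef e)"
  have f0: "isometry f0" unfolding f0_def by (rule isometry_comp[OF h isometry_evf])
  have "f0 \<circ> evf (finv (ef e)) = h"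
    unfolding f0_def evf_finv_inv comp_assoc isometry_inv_comp(4)[OF isometry_evf] by (simp add: comp_def)
  then have L': "legalat T n (lv l) r (f0 \<circ> evf (finv (ef e)))" using L by simp
  define t where "t = estart (finv (ef e)) l r e"
  have st: "\<forall>s\<in>set [Pl (finv (ef e)) n l r]. ks T f0 s" using L' by (simp add: ks_def)
  have t: "frm t = Fr False 0 0 (G (ZF 0 0 0 0) (ZF 0 0 0 0))"
      "chks cs (filter (\<lambda>(n, l, r, e). sibling n \<noteq> b) (cands t Rt)) (frm t) [Pl (finv (ef e)) n l r]"
    using c unfolding root_chk_def i option.case Let_def t_def[symmetric] feq_iff by blast+
  have kt: "knd t = ek e" by (cases e) (simp add: t_def)
  have k: "kn T f0 t" unfolding t_def by (rule kn_estart[OF L' nthi_in[OF i]])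
  obtain n' l' r' e' where e': "(n', l', r', e') \<in> set (cands t Rt)" "e' \<in> set (entries n')" "ek e' = knd t" "ep e' = At Rt"
     "legalat T n' (lv l') r' (f0 \<circ> evf (fcomp (frm t) (finv (ef e'))))"
    using cands_sound[OF T f0 k, of Rt] by blast
  have "sibling n' = b"
  proof (rule ccontr)
    assume "sibling n' \<noteq> b"
    then have "(n', l', r', e') \<in> set (filter (\<lambda>(n, l, r, e). sibling n \<noteq> b) (cands t Rt))" using e'(1) by simp
    then show False using chk_sound(2)[OF T f0 t(2) st] e'(5) by blast
  qed
  moreover have "evf (frm t) = (\<lambda>z. z)" unfolding t(1) by (simp add: iso_def complex_eq_iff fun_eq_iff)
  then have "evf (fcomp (frm t) (finv (ef e'))) = evf (finv (ef e'))" unfolding evf_fcomp by (simp add: comp_def)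
  ultimately show ?thesis using e'(2-5) kt unfolding f0_def by auto
qed

section \<open>Decomposing the legal stars\<close>

text \<open>Decomposition turns the star \<open>n\<close> into the star \<open>nx n\<close>; for \<open>C_7\<close> the result is \<open>C_6\<close> turned by a straight angle.\<close>

fun nx :: "sn \<Rightarrow> sn" where
  "nx C1 = C2" | "nx C2 = C3" | "nx C3 = C4" | "nx C4 = C5" | "nx C5 = C6" | "nx C6 = C7" | "nx C7 = C6"

fun rotn :: "sn \<Rightarrow> fr" where
  "rotn C7 = Fr False 2 0 (G (ZF 0 0 0 0) (ZF 0 0 0 0))" | "rotn n = Fr False 0 0 (G (ZF 0 0 0 0) (ZF 0 0 0 0))"

definition rr :: "sn \<Rightarrow> bool \<Rightarrow> bool" where "rr n r \<longleftrightarrow> (r \<noteq> (n = C7))"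

text \<open>The pieces that make up the star \<open>nx n\<close>, each with the number of its parent in the star \<open>n\<close>.\<close>

fun prd :: "sn \<Rightarrow> (pc \<times> int) list" where
  "prd C1 = [(PL, 0), (PS, 0), (PU, 1), (PL, 2)]"
| "prd C2 = [(PS, 0), (PU, 1), (PL, 2), (PS, 2), (PS, 3), (PL, 3)]"
| "prd C3 = [(PU, 0), (PL, 1), (PS, 2), (PU, 3), (PU, 4), (PS, 5), (PL, 5)]"
| "prd C4 = [(PS, 0), (PL, 1), (PU, 2), (PL, 3), (PS, 4), (PL, 4), (PU, 5), (PS, 6)]"
| "prd C5 = [(PU, 0), (PL, 1), (PS, 2), (PL, 3), (PU, 4), (PS, 5), (PL, 6), (PU, 7)]"
| "prd C6 = [(PS, 0), (PL, 1), (PU, 2), (PL, 3), (PL, 4), (PU, 5), (PL, 6), (PS, 7)]"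
| "prd C7 = [(PU, 7), (PL, 6), (PS, 5), (PL, 4), (PL, 3), (PS, 2), (PL, 1), (PU, 0)]"

text \<open>The side of the parent that contains the side \<open>s\<close> of a piece, if any, and whether the orientations of the
  two as sides of their tiles disagree.\<close>

fun src :: "pc \<Rightarrow> side \<Rightarrow> (side \<times> bool) option" where
  "src PL Hyp = Some (LLeg, True)" | "src PL LLeg = Some (Hyp, True)" | "src PL SLeg = None"
| "src PS Hyp = Some (SLeg, False)" | "src PS LLeg = None" | "src PS SLeg = Some (Hyp, False)"
| "src PU s = Some (s, False)"

lemma pm_src: "pm p m s = (case src p s of None \<Rightarrow> (0, True) | Some (s', f) \<Rightarrow> (fst (m s') + 1, snd (m s') \<noteq> f))"
  by (cases p; cases s) auto

fun smx :: "bool \<Rightarrow> sm \<Rightarrow> sm" where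
  "smx f NoM = NoM" | "smx f (Ax b) = Ax (b \<noteq> f)" | "smx f (Of x b) = Of (linc x) (b \<noteq> f)"

fun rax :: "sn \<Rightarrow> sm \<Rightarrow> sm" where
  "rax n (Ax b) = Ax (b \<noteq> (n = C7))" | "rax n x = x"

definition smp :: "sn \<Rightarrow> pc \<Rightarrow> entry \<Rightarrow> side \<Rightarrow> sm" where
  "smp n p e s = rax n (case src p s of None \<Rightarrow> Of A0 True | Some (s', f) \<Rightarrow> smx f (em e s'))"

lemma mv_smx: "x \<noteq> NoM \<Longrightarrow> mv (l + 1) r (smx f x) = (fst (mv l r x) + 1, snd (mv l r x) \<noteq> f)"
  by (cases x) (auto simp: lv_linc)

lemma mv_rax: "x \<noteq> NoM \<Longrightarrow> mv l (rr n r) (rax n x) = mv l r x"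
  by (cases x) (auto simp: rr_def)

lemma rax_NoM: "rax n x = NoM \<longleftrightarrow> x = NoM" by (cases x) auto
lemma smx_NoM: "smx f x = NoM \<longleftrightarrow> x = NoM" by (cases x) auto

lemma pm_smp:
  assumes "smp n p e s \<noteq> NoM"
  shows "pm p m s = mv (l + 1) (rr n r) (smp n p e s) \<longleftrightarrow>
    (case src p s of None \<Rightarrow> True | Some (s', f) \<Rightarrow> m s' = mv l r (em e s'))"
proof (cases "src p s")
  case None
  then show ?thesis unfolding smp_def pm_src by (simp add: mv_rax)
next
  case (Some a)
  obtain s' f where a: "a = (s', f)" by (cases a)
  have n: "em e s' \<noteq> NoM" using assms unfolding smp_def Some a by (auto simp: rax_NoM smx_NoM)
  then have "mv (l + 1) (rr n r) (smp n p e s) = (fst (mv l r (em e s')) + 1, snd (mv l r (em e s')) \<noteq> f)"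
    unfolding smp_def Some a by (simp add: mv_rax smx_NoM mv_smx)
  then show ?thesis unfolding pm_src Some a by (auto simp: prod_eq_iff)
qed

lemma prd_check:
  "list_all2 (\<lambda>e' (p, i). case nthi (entries n) i of None \<Rightarrow> False | Some e \<Rightarrow>
      ek e = par p \<and> ek e' = pk p \<and> cpos p (ep e) = Some (ep e') \<and>
      fcomp (fshrink (ef e)) (fdf p) = fcomp (rotn n) (ef e') \<and>
      list_all (\<lambda>s. em e' s = NoM \<or> em e' s = smp n p e s) [Hyp, LLeg, SLeg]) (entries (nx n)) (prd n)"
  by (cases n; simp only:; code_simp)

fun enum :: "int \<Rightarrow> 'a list \<Rightarrow> (int \<times> 'a) list" where
  "enum i [] = []" | "enum i (x # xs) = (i, x) # enum (i + 1) xs"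

lemma enum_nthi: "(j, x) \<in> set (enum i xs) \<longleftrightarrow> i \<le> j \<and> nthi xs (j - i) = Some x"
proof (induction xs arbitrary: i)
  case (Cons y ys)
  have neg: "nthi zs k = None" if "k < 0" for zs :: "'a list" and k
    using that by (induction zs k rule: nthi.induct) auto
  show ?case
  proof (cases "j = i")
    case True then show ?thesis using Cons[of "i + 1"] by (auto simp: neg)
  next
    case False then show ?thesis using Cons[of "i + 1"] by (auto simp: algebra_simps)
  qed
qed simp

lemma in_enum: "x \<in> set xs \<Longrightarrow> \<exists>j. (j, x) \<in> set (enum i xs)"
proof (induction xs arbitrary: i)
  case (Cons y ys)
  show ?case
  proof (cases "x = y")
    case False
    then obtain j where "(j, x) \<in> set (enum (i + 1) ys)" using Cons by auto
    then show ?thesis by auto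
  qed auto
qed simp

lemma prd_complete_check:
  "list_all (\<lambda>(i, e). list_all (\<lambda>p. par p = ek e \<longrightarrow> cpos p (ep e) \<noteq> None \<longrightarrow> (p, i) \<in> set (prd n)) [PL, PS, PU]) (enum 0 (entries n))"
  by (cases n; simp only:; code_simp)

text \<open>Every marked side of a tile of the star \<open>n\<close> contains a marked side of one of its pieces in the star \<open>nx n\<close>.\<close>

lemma prd_sides_check:
  "list_all (\<lambda>(i, e). list_all (\<lambda>s. em e s = NoM \<or>
      list_ex (\<lambda>(e', p, j). j = i \<and> list_ex (\<lambda>s'. em e' s' \<noteq> NoM \<and> map_option fst (src p s') = Some s) [Hyp, LLeg, SLeg])
        (zip (entries (nx n)) (prd n))) [Hyp, LLeg, SLeg]) (enum 0 (entries n))"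
  by (cases n; simp only:; code_simp)

lemma rotn_facts: "evf (rotn n) 0 = 0" "evf (rotn n) \<circ> evf (rotn n) = (\<lambda>z. z)" "lift c (h \<circ> evf (rotn n)) = lift c h \<circ> evf (rotn n)"
  "drop c (h \<circ> evf (rotn n)) = drop c h \<circ> evf (rotn n)"
proof -
  have z: "Complex 0 0 = 0" by (simp add: complex_eq_iff)
  have e: "evf (rotn n) = (if n = C7 then (\<lambda>z. - z) else (\<lambda>z. z))"
    by (cases n) (auto simp: iso_def dirc_1 z fun_eq_iff)
  show "evf (rotn n) 0 = 0" "evf (rotn n) \<circ> evf (rotn n) = (\<lambda>z. z)" "lift c (h \<circ> evf (rotn n)) = lift c h \<circ> evf (rotn n)"
    "drop c (h \<circ> evf (rotn n)) = drop c h \<circ> evf (rotn n)"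
    unfolding e by (auto simp: fun_eq_iff lift_def drop_def)
qed

text \<open>A piece in the star \<open>nx n\<close> and its parent in the star \<open>n\<close>.\<close>

definition prel :: "sn \<Rightarrow> entry \<Rightarrow> pc \<Rightarrow> entry \<Rightarrow> bool" where
  "prel n e' p e \<longleftrightarrow> e' \<in> set (entries (nx n)) \<and> e \<in> set (entries n) \<and> ek e = par p \<and> ek e' = pk p \<and> cpos p (ep e) = Some (ep e') \<and>
     fcomp (fshrink (ef e)) (fdf p) = fcomp (rotn n) (ef e') \<and> (\<forall>s. em e' s = NoM \<or> em e' s = smp n p e s)"

lemma list_all2_zip: "list_all2 P xs ys \<Longrightarrow> (x, y) \<in> set (zip xs ys) \<Longrightarrow> P x y"
  by (auto simp: list_all2_iff)

lemma prel_zip: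
  assumes "(e', p, i) \<in> set (zip (entries (nx n)) (prd n))"
  shows "\<exists>e. nthi (entries n) i = Some e \<and> prel n e' p e"
proof -
  have "case nthi (entries n) i of None \<Rightarrow> False | Some e \<Rightarrow>
      ek e = par p \<and> ek e' = pk p \<and> cpos p (ep e) = Some (ep e') \<and>
      fcomp (fshrink (ef e)) (fdf p) = fcomp (rotn n) (ef e') \<and>
      list_all (\<lambda>s. em e' s = NoM \<or> em e' s = smp n p e s) [Hyp, LLeg, SLeg]"
    using list_all2_zip[OF prd_check[of n] assms] by simp
  then obtain e where e: "nthi (entries n) i = Some e" "ek e = par p" "ek e' = pk p" "cpos p (ep e) = Some (ep e')"
      "fcomp (fshrink (ef e)) (fdf p) = fcomp (rotn n) (ef e')" "list_all (\<lambda>s. em e' s = NoM \<or> em e' s = smp n p e s) [Hyp, LLeg, SLeg]"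
    by (auto split: option.splits)
  have "em e' s = NoM \<or> em e' s = smp n p e s" for s using e(6) by (cases s) auto
  moreover have "e' \<in> set (entries (nx n))" using set_zip_leftD[OF assms] .
  ultimately show ?thesis using e nthi_in[OF e(1)] unfolding prel_def by blast
qed

lemma len_prd: "length (prd n) = length (entries (nx n))" by (cases n) auto

lemma prel_ex:
  assumes "e' \<in> set (entries (nx n))"
  shows "\<exists>p i e. (e', p, i) \<in> set (zip (entries (nx n)) (prd n)) \<and> prel n e' p e"
proof -
  obtain k where k: "k < length (entries (nx n))" "entries (nx n) ! k = e'" using assms by (auto simp: in_set_conv_nth)
  obtain p i where "prd n ! k = (p, i)" by (cases "prd n ! k")
  then have "(e', p, i) \<in> set (zip (entries (nx n)) (prd n))" using k len_prd[of n] by (auto simp: in_set_zip)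
  then show ?thesis using prel_zip by blast
qed

lemma prel_of_parent:
  assumes "e \<in> set (entries n)" "par p = ek e" "cpos p (ep e) \<noteq> None"
  shows "\<exists>e'. prel n e' p e"
proof -
  obtain i where i: "(i, e) \<in> set (enum 0 (entries n))" using in_enum[OF assms(1)] by blast
  then have "list_all (\<lambda>p. par p = ek e \<longrightarrow> cpos p (ep e) \<noteq> None \<longrightarrow> (p, i) \<in> set (prd n)) [PL, PS, PU]"
    using prd_complete_check[of n] unfolding list_all_iff by blast
  then have "(p, i) \<in> set (prd n)" using assms(2,3) by (cases p) auto
  then obtain k where k: "k < length (prd n)" "prd n ! k = (p, i)" by (auto simp: in_set_conv_nth)
  then have "(entries (nx n) ! k, p, i) \<in> set (zip (entries (nx n)) (prd n))" using len_prd[of n] by (auto simp: in_set_zip)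
  from prel_zip[OF this] obtain e2 where "nthi (entries n) i = Some e2" "prel n (entries (nx n) ! k) p e2" by blast
  moreover have "nthi (entries n) i = Some e" using i by (simp add: enum_nthi)
  ultimately show ?thesis by auto
qed

lemma prel_side:
  assumes "e \<in> set (entries n)" "em e s \<noteq> NoM"
  shows "\<exists>e' p s' f. prel n e' p e \<and> em e' s' \<noteq> NoM \<and> src p s' = Some (s, f)"
proof -
  obtain i where i: "(i, e) \<in> set (enum 0 (entries n))" using in_enum[OF assms(1)] by blast
  then have "list_all (\<lambda>s. em e s = NoM \<or>
      list_ex (\<lambda>(e', p, j). j = i \<and> list_ex (\<lambda>s'. em e' s' \<noteq> NoM \<and> map_option fst (src p s') = Some s) [Hyp, LLeg, SLeg])
        (zip (entries (nx n)) (prd n))) [Hyp, LLeg, SLeg]"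
    using prd_sides_check[of n] unfolding list_all_iff by blast
  then have "list_ex (\<lambda>(e', p, j). j = i \<and> list_ex (\<lambda>s'. em e' s' \<noteq> NoM \<and> map_option fst (src p s') = Some s) [Hyp, LLeg, SLeg])
        (zip (entries (nx n)) (prd n))" using assms(2) by (cases s) auto
  then obtain e' p s' where z: "(e', p, i) \<in> set (zip (entries (nx n)) (prd n))" "em e' s' \<noteq> NoM" "map_option fst (src p s') = Some s"
    unfolding list_ex_iff by blast
  obtain e2 where "nthi (entries n) i = Some e2" "prel n e' p e2" using prel_zip[OF z(1)] by blast
  moreover have "nthi (entries n) i = Some e" using i by (simp add: enum_nthi)
  ultimately show ?thesis using z by auto
qed

lemma prel_frame:
  assumes "prel n e' p e"
  shows "lift c (h \<circ> evf (ef e)) \<circ> df p = lift c h \<circ> evf (rotn n) \<circ> evf (ef e')"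
proof -
  have "lift c (h \<circ> evf (ef e)) \<circ> df p = lift c h \<circ> evf (fcomp (fshrink (ef e)) (fdf p))"
    unfolding lift_comp evf_fshrink[symmetric] evf_fdf[symmetric] evf_fcomp by (simp add: comp_assoc)
  also have "\<dots> = lift c h \<circ> evf (fcomp (rotn n) (ef e'))" using assms unfolding prel_def by simp
  finally show ?thesis by (simp add: evf_fcomp comp_assoc)
qed

text \<open>The part of \<open>legalat\<close> that asserts the presence of tiles.\<close>

definition has_star :: "ctile set \<Rightarrow> sn \<Rightarrow> 4 \<Rightarrow> bool \<Rightarrow> (complex \<Rightarrow> complex) \<Rightarrow> bool" where
  "has_star Q n l r h \<longleftrightarrow> (\<forall>e\<in>set (entries n). \<exists>m. ct (ek e) (h \<circ> evf (ef e)) m \<in> Q \<and> (\<forall>s. agr l r (em e s) (m s)))"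

lemma sigma_mono: "P \<subseteq> Q \<Longrightarrow> sigma c P \<subseteq> sigma c Q"
  unfolding sigma_def by blast

lemma piece_in_sigma: "isometry f \<Longrightarrow> colored_tile (ct (par p) f m) \<Longrightarrow> ct (par p) f m \<in> Q \<Longrightarrow> piece c p f m \<in> sigma c Q"
  using sigma_mono[of "{ct (par p) f m}" Q c] sigma_ct[of "{ct (par p) f m}" c] by blast

lemma has_star_sigma:
  assumes Q: "colored_tiling Q" and h: "isometry h" and L: "has_star Q n l r h"
  shows "has_star (sigma c Q) (nx n) (l + 1) (rr n r) (lift c h \<circ> evf (rotn n))"
  unfolding has_star_def
proof
  fix e' assume "e' \<in> set (entries (nx n))"
  then obtain p e where pe: "prel n e' p e" using prel_ex by blast
  then have e: "e \<in> set (entries n)" "ek e = par p" "ek e' = pk p" "\<And>s. em e' s = NoM \<or> em e' s = smp n p e s" unfolding prel_def by auto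
  obtain m where m: "ct (ek e) (h \<circ> evf (ef e)) m \<in> Q" "\<And>s. agr l r (em e s) (m s)" using L e(1) unfolding has_star_def by blast
  have i: "isometry (h \<circ> evf (ef e))" by (intro isometry_comp h isometry_evf)
  have "piece c p (h \<circ> evf (ef e)) m \<in> sigma c Q"
    by (rule piece_in_sigma[OF i]) (use colored_tilingD(1)[OF Q m(1)] m(1) e(2) in simp_all)
  then have "ct (ek e') (lift c h \<circ> evf (rotn n) \<circ> evf (ef e')) (pm p m) \<in> sigma c Q"
    unfolding piece_def prel_frame[OF pe] e(3) .
  moreover have "agr (l + 1) (rr n r) (em e' s) (pm p m s)" for s
  proof (cases "em e' s = NoM")
    case False
    then have s: "em e' s = smp n p e s" "smp n p e s \<noteq> NoM" using e(4)[of s] by auto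
    have "case src p s of None \<Rightarrow> True | Some (s', f) \<Rightarrow> m s' = mv l r (em e s')"
    proof (cases "src p s")
      case (Some a)
      obtain s' f where a: "a = (s', f)" by (cases a)
      have "em e s' \<noteq> NoM" using s(2) unfolding smp_def Some a by (auto simp: rax_NoM smx_NoM)
      then show ?thesis using m(2)[of s'] unfolding Some a by (simp add: agr_def)
    qed simp
    then show ?thesis using pm_smp[OF s(2), of m l r] s(1) unfolding agr_def by simp
  qed (simp add: agr_def)
  ultimately show "\<exists>m. ct (ek e') (lift c h \<circ> evf (rotn n) \<circ> evf (ef e')) m \<in> sigma c Q \<and> (\<forall>s. agr (l + 1) (rr n r) (em e' s) (m s))" by blast
qed

lemma homothety_h0: "lift c h 0 = homothety c (1 / phi) (h 0)" by (simp add: lift_def)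

text \<open>A tile of the new star is a piece of a tile that contains the center, so the table \<open>prd\<close> lists all of them; inherited marks
  agree by \<open>pm_smp\<close>, and altitudes through the center have the mark prescribed by the star.\<close>

lemma legalat_sigma:
  assumes Q: "colored_tiling Q" and L: "legalat Q n l r h"
  shows "legalat (sigma c Q) (nx n) (l + 1) (rr n r) (lift c h \<circ> evf (rotn n))"
proof -
  have h: "isometry h"
    and L1: "\<And>e. e \<in> set (entries n) \<Longrightarrow> \<exists>m. ct (ek e) (h \<circ> evf (ef e)) m \<in> Q \<and> (\<forall>s. agr l r (em e s) (m s))"
    and L2: "\<And>X. X \<in> Q \<Longrightarrow> h 0 \<in> body (fst X) \<Longrightarrow> \<exists>e\<in>set (entries n). \<exists>m. X = ct (ek e) (h \<circ> evf (ef e)) m"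
    using L unfolding legalat_def by blast+
  note S = sigma_ct[OF colored_tilingD(1)[OF Q], of Q c, simplified]
  show ?thesis unfolding legalat_def
  proof (intro conjI ballI impI)
    show "isometry (lift c h \<circ> evf (rotn n))" by (intro isometry_comp isometry_lift h isometry_evf)
  next
    fix e' assume "e' \<in> set (entries (nx n))"
    then show "\<exists>m. ct (ek e') (lift c h \<circ> evf (rotn n) \<circ> evf (ef e')) m \<in> sigma c Q \<and> (\<forall>s. agr (l + 1) (rr n r) (em e' s) (m s))"
      using has_star_sigma[OF Q h, of n l r c] L1 unfolding has_star_def by blast
  next
    fix Y assume Y: "Y \<in> sigma c Q" "(lift c h \<circ> evf (rotn n)) 0 \<in> body (fst Y)"
    then obtain p f m where p: "Y = piece c p f m" "isometry f" "ct (par p) f m \<in> Q" unfolding S by blast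
    have b: "homothety c (1 / phi) (h 0) \<in> body (fst (piece c p f m))" using Y(2) p(1) by (simp add: rotn_facts homothety_h0)
    then have "homothety c (1 / phi) (h 0) \<in> homothety c (1 / phi) ` body (tl (par p) f)" using body_piece_subset[OF p(2)] by blast
    then have "h 0 \<in> body (tl (par p) f)" using homothety_inj[of c] by (auto simp: inj_eq)
    then obtain e m' where e: "e \<in> set (entries n)" "ct (par p) f m = ct (ek e) (h \<circ> evf (ef e)) m'" using L2[OF p(3)] by auto
    from ct_eqD[OF p(2) isometry_comp[OF h isometry_evf] e(2)] have k: "par p = ek e" and f: "f = h \<circ> evf (ef e)" by auto
    obtain w where w: "w \<in> std (pk p)" "f (emb p w) = h 0"
      using b homothety_inj[of c] unfolding body_piece[OF p(2)] by (auto simp: inj_eq)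
    have "f (emb p w) = f (ppt (ek e) (ep e))" using w(2) entry_ok(2)[OF e(1)] f by simp
    then have "emb p w = ppt (par p) (ep e)" using isometry_inj[OF p(2)] k by (metis injD)
    then have "cpos p (ep e) \<noteq> None" using cpos_None[of p "ep e"] entry_ok(1)[OF e(1)] k w(1) by (metis imageI)
    then obtain e' where pe: "prel n e' p e" using prel_of_parent[OF e(1) k] by blast
    then have "Y = ct (ek e') (lift c h \<circ> evf (rotn n) \<circ> evf (ef e')) (pm p m)"
      unfolding p(1) piece_def f prel_frame[OF pe] by (simp add: prel_def)
    moreover have "e' \<in> set (entries (nx n))" using pe unfolding prel_def by blast
    ultimately show "\<exists>e\<in>set (entries (nx n)). \<exists>m. Y = ct (ek e) (lift c h \<circ> evf (rotn n) \<circ> evf (ef e)) m" by blast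
  qed
qed

text \<open>Conversely, if in a decomposed tiling every tile around a star \<open>nx n\<close> is the piece that one expects, then
  there was a star \<open>n\<close> before.\<close>

lemma legalat_compose:
  assumes T: "colored_tiling T" and L: "legalat (sigma c T) (nx n) (l + 1) (rr n r) h"
    and ex: "\<And>e' p i. (e', p, i) \<in> set (zip (entries (nx n)) (prd n)) \<Longrightarrow>
       \<exists>f m. isometry f \<and> ct (par p) f m \<in> T \<and> lift c f \<circ> df p = h \<circ> evf (ef e')"
  shows "legalat T n l r (drop c h \<circ> evf (rotn n))"
proof -
  have h: "isometry h"
    and L1: "\<And>e. e \<in> set (entries (nx n)) \<Longrightarrow> \<exists>m. ct (ek e) (h \<circ> evf (ef e)) m \<in> sigma c T \<and> (\<forall>s. agr (l + 1) (rr n r) (em e s) (m s))"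
    and L2: "\<And>X. X \<in> sigma c T \<Longrightarrow> h 0 \<in> body (fst X) \<Longrightarrow> \<exists>e\<in>set (entries (nx n)). \<exists>m. X = ct (ek e) (h \<circ> evf (ef e)) m"
    using L unfolding legalat_def by blast+
  note S = sigma_ct[OF colored_tilingD(1)[OF T], of T c, simplified]
  define g where "g = drop c h \<circ> evf (rotn n)"
  have g: "isometry g" unfolding g_def by (intro isometry_comp isometry_drop h isometry_evf)
  have lg: "lift c g \<circ> evf (rotn n) = h" unfolding g_def rotn_facts(3) lift_drop comp_assoc rotn_facts(2) by (simp add: comp_def)
  have ldf: "f = f'" if "isometry f" "isometry f'" "lift c f \<circ> df p = lift c f' \<circ> df p" for f f' p
  proof -
    have "lift c f = lift c f'"
    proof
      fix z
      obtain w where "df p w = z" using isometry_surj[OF isometry_df, of p] by (metis surjD)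
      then show "lift c f z = lift c f' z" using fun_cong[OF that(3), of w] by auto
    qed
    then show ?thesis by (metis lift_drop(2))
  qed
  have par: "\<exists>m. ct (ek e) (g \<circ> evf (ef e)) m \<in> T" if pe: "prel n e' p e" and z: "(e', p, i) \<in> set (zip (entries (nx n)) (prd n))" for e' p e i
  proof -
    obtain f m where f: "isometry f" "ct (par p) f m \<in> T" "lift c f \<circ> df p = h \<circ> evf (ef e')" using ex[OF z] by blast
    have "lift c (g \<circ> evf (ef e)) \<circ> df p = h \<circ> evf (ef e')" unfolding prel_frame[OF pe] lg ..
    then have "f = g \<circ> evf (ef e)" using ldf[OF f(1) isometry_comp[OF g isometry_evf]] f(3) by metis
    then show ?thesis using f(2) pe unfolding prel_def by auto
  qed
  have zip_ex: "\<exists>e'' i. prel n e' p e \<and> (e', p, i) \<in> set (zip (entries (nx n)) (prd n))"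
    if "(e', p, i) \<in> set (zip (entries (nx n)) (prd n))" "prel n e' p e" for e' p e i using that by blast
  have parz: "\<exists>p e i. (e', p, i) \<in> set (zip (entries (nx n)) (prd n)) \<and> prel n e' p e" if "e' \<in> set (entries (nx n))" for e'
    using prel_ex[OF that] by blast
  show ?thesis unfolding legalat_def g_def[symmetric]
  proof (intro conjI ballI impI)
    show "isometry g" by (rule g)
  next
    fix e assume e: "e \<in> set (entries n)"
    obtain i where i: "(i, e) \<in> set (enum 0 (entries n))" using in_enum[OF e] by blast
    have "\<exists>s. em e s \<noteq> NoM"
    proof -
      have "\<exists>s. sat (ep e) s"
      proof (cases "ep e")
        case (At v) then show ?thesis by (cases v) (auto intro: exI[of _ Hyp] exI[of _ LLeg])
      qed auto
      then show ?thesis using entry_ok(3)[OF e] by blast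
    qed
    have own: "\<exists>m. ct (ek e) (g \<circ> evf (ef e)) m \<in> T"
    proof -
      have ld: "list_all (\<lambda>s. em e s = NoM \<or>
      list_ex (\<lambda>(e', p, j). j = i \<and> list_ex (\<lambda>s'. em e' s' \<noteq> NoM \<and> map_option fst (src p s') = Some s) [Hyp, LLeg, SLeg])
        (zip (entries (nx n)) (prd n))) [Hyp, LLeg, SLeg]"
        using i prd_sides_check[of n] unfolding list_all_iff by blast
      obtain s where "em e s \<noteq> NoM" using \<open>\<exists>s. em e s \<noteq> NoM\<close> by blast
      then have "list_ex (\<lambda>(e', p, j). j = i \<and> list_ex (\<lambda>s'. em e' s' \<noteq> NoM \<and> map_option fst (src p s') = Some s) [Hyp, LLeg, SLeg])
        (zip (entries (nx n)) (prd n))" using ld by (cases s) auto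
      then obtain e' p where z: "(e', p, i) \<in> set (zip (entries (nx n)) (prd n))" unfolding list_ex_iff by blast
      obtain e2 where e2: "nthi (entries n) i = Some e2" "prel n e' p e2" using prel_zip[OF z] by blast
      moreover have "nthi (entries n) i = Some e" using i by (simp add: enum_nthi)
      ultimately show ?thesis using par[OF _ z] by auto
    qed
    then obtain m where m: "ct (ek e) (g \<circ> evf (ef e)) m \<in> T" by blast
    have ig: "isometry (g \<circ> evf (ef e))" by (intro isometry_comp g isometry_evf)
    have "agr l r (em e s) (m s)" for s
    proof (cases "em e s = NoM")
      case False
      then obtain e' p s' f where p: "prel n e' p e" "em e' s' \<noteq> NoM" "src p s' = Some (s, f)" using prel_side[OF e] by blast
      have e': "e' \<in> set (entries (nx n))" "ek e = par p" "ek e' = pk p" "em e' s' = smp n p e s'" using p(1,2) unfolding prel_def by auto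
      obtain m' where m': "ct (ek e') (h \<circ> evf (ef e')) m' \<in> sigma c T" "\<And>s. agr (l + 1) (rr n r) (em e' s) (m' s)" using L1[OF e'(1)] by blast
      have "piece c p (g \<circ> evf (ef e)) m \<in> sigma c T" unfolding S using m e'(2) ig by auto
      then have "ct (ek e') (h \<circ> evf (ef e')) (pm p m) \<in> sigma c T" unfolding piece_def prel_frame[OF p(1)] lg e'(3) .
      then have "m' = pm p m" using colored_tiling_frame_unique[OF colored_tiling_sigma[OF T] isometry_comp[OF h isometry_evf] m'(1)] by blast
      then have "pm p m s' = mv (l + 1) (rr n r) (smp n p e s')" using m'(2)[of s'] p(2) e'(4) unfolding agr_def by simp
      then have "m s = mv l r (em e s)" using pm_smp[of n p e s' m l r] p(2,3) e'(4) by simp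
      then show ?thesis by (simp add: agr_def)
    qed (simp add: agr_def)
    then show "\<exists>m. ct (ek e) (g \<circ> evf (ef e)) m \<in> T \<and> (\<forall>s. agr l r (em e s) (m s))" using m by blast
  next
    fix X assume X: "X \<in> T" "g 0 \<in> body (fst X)"
    obtain k f m where f: "isometry f" "X = ct k f m" using colored_tileE[OF colored_tilingD(1)[OF T X(1)]] by metis
    have h0: "homothety c (1 / phi) (g 0) = h 0" using fun_cong[OF lg, of 0] rotn_facts(1) homothety_h0[of c g] by simp
    then have "h 0 \<in> homothety c (1 / phi) ` body (tl k f)" using X(2) f(2) by (metis fst_ct imageI)
    then obtain p where p: "par p = k" "h 0 \<in> body (fst (piece c p f m))" using homothety_image_body[OF f(1), of c k m] by auto
    have "piece c p f m \<in> sigma c T" unfolding S using X(1) f p(1) by blast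
    then obtain e' m' where e': "e' \<in> set (entries (nx n))" "piece c p f m = ct (ek e') (h \<circ> evf (ef e')) m'" using L2 p(2) by blast
    obtain p' e i where z: "(e', p', i) \<in> set (zip (entries (nx n)) (prd n))" "prel n e' p' e" using parz[OF e'(1)] by blast
    obtain m2 where m2: "ct (ek e) (g \<circ> evf (ef e)) m2 \<in> T" using par[OF z(2,1)] by blast
    have e: "e \<in> set (entries n)" "ek e = par p'" "ek e' = pk p'" using z(2) unfolding prel_def by auto
    have ig: "isometry (g \<circ> evf (ef e))" by (intro isometry_comp g isometry_evf)
    have "fst (piece c p' (g \<circ> evf (ef e)) m2) = fst (piece c p f m)"
      unfolding e'(2) unfolding piece_def prel_frame[OF z(2)] lg e(3)[symmetric] by simp
    then have "interior (body (fst (piece c p f m))) \<subseteq> homothety c (1 / phi) ` interior (body (tl (par p') (g \<circ> evf (ef e))))"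
      using interior_piece_subset[OF ig, of c p' m2] by simp
    moreover have "interior (body (fst (piece c p f m))) \<subseteq> homothety c (1 / phi) ` interior (body (tl k f))"
      using interior_piece_subset[OF f(1), of c p m] p(1) by simp
    moreover have "interior (body (fst (piece c p f m))) \<noteq> {}" unfolding piece_def fst_ct by (rule ct_interior_nonempty[OF isometry_piece[OF f(1)]])
    ultimately have "interior (body (tl (par p') (g \<circ> evf (ef e)))) \<inter> interior (body (tl k f)) \<noteq> {}"
      using homothety_inj[of c] by (fastforce simp: inj_eq)
    then have "ct (ek e) (g \<circ> evf (ef e)) m2 = X" using colored_tilingD(2)[OF T m2 X(1)] e(2) f(2) by simp
    then show "\<exists>e\<in>set (entries n). \<exists>m. X = ct (ek e) (g \<circ> evf (ef e)) m" using e(1) by blast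
  qed
qed

text \<open>The cases in which the known tile alone excludes all stars at its right angle that would give it the wrong role.\<close>

definition easy_roots :: "(sn \<times> lab \<times> bool \<times> int \<times> bool) list" where
  "easy_roots =
  [(C4, A0, False, 0, False), (C4, A2, True, 0, False), (C4, A2, False, 0, False), (C4, A0, True, 1, True), (C4, A0, False, 1, True),
   (C4, A2, True, 1, True), (C4, A2, False, 1, True), (C5, A1, True, 1, True), (C5, A1, False, 1, True), (C5, A3, True, 1, True),
   (C5, A3, False, 1, True), (C5, A1, True, 2, False), (C5, A1, False, 2, False), (C5, A3, True, 2, False), (C5, A3, False, 2, False),
   (C5, A1, True, 3, True), (C5, A3, True, 3, True), (C5, A3, False, 3, True), (C6, A2, True, 1, True), (C6, A2, False, 1, True),
   (C6, A0, True, 1, True), (C6, A0, False, 1, True), (C6, A2, True, 3, True), (C6, A2, False, 3, True), (C6, A0, True, 3, True),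
   (C6, A0, False, 3, True), (C6, A2, True, 6, True), (C6, A2, False, 6, True), (C6, A0, True, 6, True), (C6, A0, False, 6, True),
   (C6, A2, True, 7, False), (C6, A2, False, 7, False), (C6, A0, True, 7, False), (C7, A3, True, 3, True), (C7, A3, False, 3, True),
   (C7, A1, True, 3, True), (C7, A3, True, 4, True), (C7, A3, False, 4, True), (C7, A1, False, 4, True), (C7, A3, True, 5, False),
   (C7, A3, False, 5, False), (C7, A1, True, 5, False), (C7, A1, False, 5, False), (C7, A3, True, 6, True), (C7, A3, False, 6, True),
   (C7, A1, True, 6, True), (C7, A1, False, 6, True)]"

text \<open>The cases that need a search through neighboring stars.\<close>

definition hard_roots :: "(sn \<times> lab \<times> bool \<times> int \<times> bool) list" where
  "hard_roots =
  [(C2, A2, True, 0, True), (C2, A2, False, 0, True), (C2, A0, True, 0, True), (C2, A0, False, 0, True), (C2, A2, True, 3, True),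
   (C2, A2, False, 3, True), (C2, A0, True, 3, True), (C2, A0, False, 3, True), (C3, A3, True, 1, False), (C3, A3, False, 1, False),
   (C3, A1, True, 1, False), (C3, A1, False, 1, False), (C3, A3, True, 2, True), (C3, A3, False, 2, True), (C3, A1, True, 2, True),
   (C3, A1, False, 2, True), (C4, A0, True, 0, False), (C4, A0, True, 3, False), (C4, A0, False, 3, False), (C4, A2, True, 3, False),
   (C4, A2, False, 3, False), (C4, A0, True, 6, True), (C4, A0, False, 6, True), (C4, A2, True, 6, True), (C4, A2, False, 6, True),
   (C5, A1, False, 3, True), (C5, A1, True, 5, True), (C5, A1, False, 5, True), (C5, A3, True, 5, True), (C5, A3, False, 5, True),
   (C5, A1, True, 6, False), (C5, A1, False, 6, False), (C5, A3, True, 6, False), (C5, A3, False, 6, False), (C6, A2, True, 0, False),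
   (C6, A2, False, 0, False), (C6, A0, True, 0, False), (C6, A0, False, 0, False), (C6, A0, False, 7, False), (C7, A3, True, 1, True),
   (C7, A3, False, 1, True), (C7, A1, True, 1, True), (C7, A1, False, 1, True), (C7, A3, True, 2, False), (C7, A3, False, 2, False),
   (C7, A1, True, 2, False), (C7, A1, False, 2, False), (C7, A1, False, 3, True), (C7, A1, True, 4, True)]"

text \<open>Short forms for the most frequent steps: one or two references to the inspected tile, and at most one tile that rules
  out candidates.\<close>

abbreviation (input) "St a b v cs \<equiv> Step [(a, b)] v [] cs"
abbreviation (input) "Sx a b v x y w cs \<equiv> Step [(a, b)] v [((x, y), w)] cs"
abbreviation (input) "Su a b a' b' v cs \<equiv> Step [(a, b), (a', b')] v [] cs"
abbreviation (input) "Sy a b a' b' v x y w cs \<equiv> Step [(a, b), (a', b')] v [((x, y), w)] cs"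

text \<open>The refutations have been found by a search; here only their validity is proved. The largest one belongs to the second tile
  of \<open>C_7\<close>, whose role becomes visible only at some distance from the center.\<close>

lemma root_easy: "list_all (\<lambda>(n, l, r, i, b). root_chk n l r i b []) easy_roots"
  by code_simp

lemma root_C2_0_A2_T: "root_chk C2 A2 True 0 True [Sx 1 1 Bl 0 3 Rt [], Sx 0 2 Rt 1 1 Bl [Sy 0 1 2 2 Bl 2 3 Sh [Sx 0 5
  Rt 2 0 Sh [Sx 0 3 Bl 2 3 Bl []]]]]"
  by code_simp

lemma root_C2_0_A2_F: "root_chk C2 A2 False 0 True [Sx 1 1 Bl 0 3 Rt [], Sy 0 4 1 0 Sh 0 5 Bl [Su 0 2 1 5 Rt [Sy 0 0 2
  6 Sh 2 3 Bl [], Sy 0 5 2 6 Sh 0 3 Bl []], Su 0 5 1 5 Rt [Sy 0 0 2 6 Sh 2 3 Bl [], Sy 0 5 2 6 Sh 0 3 Bl []]]]"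
  by code_simp

lemma root_C2_0_A0_T: "root_chk C2 A0 True 0 True [Sx 1 1 Bl 0 3 Rt [], Su 0 4 1 0 Sh [Su 0 2 1 5 Rt [Sy 0 0 2 6 Sh 2
  3 Bl [], Sy 0 5 2 6 Sh 0 3 Bl []], Su 0 5 1 5 Rt [Sy 0 0 2 6 Sh 2 3 Bl [], Sy 0 5 2 6 Sh 0 3 Bl []]]]"
  by code_simp

lemma root_C2_0_A0_F: "root_chk C2 A0 False 0 True [Sx 1 1 Bl 0 3 Rt [], St 0 1 Rt [Sx 1 3 Bl 1 6 Sh [Step [(0, 3),
  (2, 6)] Rt [((2, 5), Rt), ((0, 2), Sh)] [Su 0 4 3 5 Bl [Clash 1 (4, 0), Clash 6 (4, 0), Clash 1 (4, 0)]], Step [(0,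
  4), (2, 6)] Rt [((2, 5), Rt), ((0, 5), Sh)] [Su 0 4 3 5 Bl [Clash 1 (4, 0), Clash 6 (4, 0), Clash 1 (4, 0)]]], Sx 1 3
  Bl 1 6 Sh [Step [(0, 3), (2, 6)] Rt [((2, 5), Rt), ((0, 2), Sh)] [Su 0 4 3 5 Bl [Clash 1 (4, 0), Clash 6 (4, 0), Clash
  1 (4, 0)]], Step [(0, 4), (2, 6)] Rt [((2, 5), Rt), ((0, 5), Sh)] [Su 0 4 3 5 Bl [Clash 1 (4, 0), Clash 6 (4, 0),
  Clash 1 (4, 0)]]]]]"
  by code_simp

lemma root_C2_3_A2_T: "root_chk C2 A2 True 3 True [Su 0 2 1 3 Bl [], Su 0 2 1 3 Bl [], Sy 0 2 1 3 Sh 1 2 Bl [], Su 0 2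
  1 3 Bl [], Su 0 4 1 3 Bl [], Sy 0 4 1 3 Bl 0 0 Rt [], Su 0 4 1 3 Bl [], Su 0 4 1 3 Bl []]"
  by code_simp

lemma root_C2_3_A2_F: "root_chk C2 A2 False 3 True [Sy 0 2 1 3 Sh 1 2 Bl [], Sy 0 2 1 3 Sh 1 2 Bl [], Sy 0 2 1 3 Sh 1
  2 Bl [], Sy 0 2 1 3 Sh 1 2 Bl [], Sy 0 4 1 3 Sh 1 2 Bl [], Sy 0 4 1 3 Sh 1 2 Bl [], Sy 0 4 1 3 Sh 1 2 Bl [], Sy 0 4 1
  3 Sh 1 2 Bl []]"
  by code_simp

lemma root_C2_3_A0_T: "root_chk C2 A0 True 3 True [Su 0 2 1 3 Bl [], Su 0 2 1 3 Bl [], Sy 0 2 1 3 Bl 0 3 Sh [Sx 0 5 Rt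
  2 0 Rt []], Su 0 2 1 3 Bl [], Su 0 4 1 3 Bl [], Sy 0 4 1 3 Bl 0 0 Rt [], Su 0 4 1 3 Bl [], Su 0 4 1 3 Bl []]"
  by code_simp

lemma root_C2_3_A0_F: "root_chk C2 A0 False 3 True [Su 0 2 1 3 Bl [], Su 0 2 1 3 Bl [], Sy 0 2 1 3 Sh 1 2 Bl [], Su 0
  2 1 3 Bl [], Su 0 4 1 3 Bl [], Sy 0 4 1 3 Bl 0 0 Rt [], Su 0 4 1 3 Bl [], Su 0 4 1 3 Bl []]"
  by code_simp

lemma root_C3_1_A3_T: "root_chk C3 A3 True 1 False [Sx 1 3 Bl 1 5 Sh [Step [(1, 0), (2, 1)] Bl [((1, 1), Sh), ((2, 2),
  Sh)] [Sy 0 3 3 2 Rt 1 7 Rt [Clash 1 (1, 7), Clash 4 (1, 7)]]], Sy 0 3 1 0 Rt 1 4 Bl [Sy 0 5 1 2 Sh 0 3 Bl []]]"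
  by code_simp

lemma root_C3_1_A3_F: "root_chk C3 A3 False 1 False [Sx 1 3 Bl 1 5 Sh [Step [(1, 0), (2, 1)] Bl [((1, 1), Sh), ((2,
  2), Sh)] [Sy 0 3 3 2 Rt 1 7 Rt [Clash 1 (1, 7), Clash 4 (1, 7)]]], Sy 0 3 1 0 Rt 1 4 Bl [Sy 0 5 1 2 Sh 0 3 Bl []]]"
  by code_simp

lemma root_C3_1_A1_T: "root_chk C3 A1 True 1 False [Sx 1 0 Rt 1 4 Bl [St 1 2 Rt [Sx 0 0 Sh 2 1 Bl [St 0 2 Rt [Sx 0 0
  Rt 3 3 Bl [], Sx 0 5 Rt 3 3 Bl []], St 0 5 Rt [Sx 0 0 Rt 3 3 Bl [], Sx 0 5 Rt 3 3 Bl []]], Sx 0 3 Bl 2 1 Bl []]], Sy 0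
  3 1 0 Rt 1 4 Bl [Sy 0 5 1 2 Sh 0 3 Bl []]]"
  by code_simp

lemma root_C3_1_A1_F: "root_chk C3 A1 False 1 False [Step [(0, 0), (1, 1)] Bl [((0, 1), Sh), ((1, 2), Sh)] [Step [(0,
  3), (2, 2)] Rt [((2, 3), Rt), ((0, 2), Sh)] [Su 0 4 3 3 Bl []]], Step [(0, 5), (1, 1)] Bl [((0, 4), Sh), ((1, 2), Sh)]
  [Step [(0, 3), (2, 2)] Rt [((2, 3), Rt), ((0, 2), Sh)] [Su 0 4 3 3 Bl []]]]"
  by code_simp

lemma root_C3_2_A3_T: "root_chk C3 A3 True 2 True [Sx 1 3 Bl 0 3 Rt [], Sx 0 2 Rt 1 3 Bl [Clash 0 (1, 3)]]"
  by code_simp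

lemma root_C3_2_A3_F: "root_chk C3 A3 False 2 True [Sx 1 3 Bl 0 3 Rt [], Sx 0 2 Rt 1 3 Bl [Clash 0 (1, 3)]]"
  by code_simp

lemma root_C3_2_A1_T: "root_chk C3 A1 True 2 True [Sx 1 3 Bl 0 3 Rt [], Sy 0 4 1 2 Sh 0 5 Bl [Su 0 2 1 5 Rt [Sy 0 0 2
  6 Sh 2 3 Bl [], Sy 0 5 2 6 Sh 0 3 Bl []], Su 0 5 1 5 Rt [Sy 0 0 2 6 Sh 2 3 Bl [], Sy 0 5 2 6 Sh 0 3 Bl []]]]"
  by code_simp

lemma root_C3_2_A1_F: "root_chk C3 A1 False 2 True [Sx 1 3 Bl 0 3 Rt [], Sx 0 2 Rt 1 3 Bl [Clash 0 (1, 3)]]"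
  by code_simp

lemma root_C4_0_A0_T: "root_chk C4 A0 True 0 False [Su 0 0 1 0 Sh [], St 0 2 Rt [Sy 1 0 2 0 Sh 0 1 Bl [], Sx 0 3 Bl 1
  1 Bl []], Su 0 0 1 0 Sh [], Sy 0 0 1 0 Sh 1 1 Bl [], Sy 0 5 1 0 Sh 0 3 Bl [], Su 0 5 1 0 Sh [], Sx 0 0 Rt 0 4 Bl [Sx 0
  1 Bl 2 5 Rt []], Su 0 5 1 0 Sh []]"
  by code_simp

lemma root_C4_3_A0_T: "root_chk C4 A0 True 3 False [Step [(0, 0), (1, 3)] Bl [((0, 1), Sh), ((1, 6), Sh)] [Sx 0 0 Rt 0
  4 Bl [Step [(1, 3), (3, 6)] Rt [((3, 5), Rt), ((1, 2), Sh)] [Su 0 3 2 2 Rt [St 3 1 Rt [St 3 2 Rt [Sy 2 0 3 2 Sh 3 1 Bl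
  [Step [(0, 7), (2, 1)] Sh [((5, 4), Sh), ((0, 6), Rt)] [Sy 0 0 6 5 Rt 0 4 Bl [Sy 0 5 7 6 Sh 7 3 Bl []], Clash 3 (6,
  0), Clash 3 (6, 0), Su 0 2 6 5 Rt [Sy 0 0 7 6 Sh 7 3 Bl [], Sy 0 5 7 6 Sh 7 3 Bl []], Clash 3 (6, 0)], Step [(0, 0),
  (2, 1)] Sh [((5, 4), Sh), ((0, 1), Rt)] [Sy 0 0 6 5 Rt 0 4 Bl [Sy 0 5 7 6 Sh 7 3 Bl []], Clash 3 (6, 0), Clash 3 (6,
  0), Su 0 2 6 5 Rt [Sy 0 0 7 6 Sh 7 3 Bl [], Sy 0 5 7 6 Sh 7 3 Bl []], Clash 3 (6, 0)]], Sy 2 0 3 2 Sh 3 1 Bl [Step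
  [(0, 7), (2, 1)] Sh [((5, 4), Sh), ((0, 6), Rt)] [Sy 0 0 6 5 Rt 0 4 Bl [Sy 0 5 7 6 Sh 7 3 Bl []], Clash 3 (6, 0),
  Clash 3 (6, 0), Su 0 2 6 5 Rt [Sy 0 0 7 6 Sh 7 3 Bl [], Sy 0 5 7 6 Sh 7 3 Bl []], Clash 3 (6, 0)], Step [(0, 0), (2,
  1)] Sh [((5, 4), Sh), ((0, 1), Rt)] [Sy 0 0 6 5 Rt 0 4 Bl [Sy 0 5 7 6 Sh 7 3 Bl []], Clash 3 (6, 0), Clash 3 (6, 0),
  Su 0 2 6 5 Rt [Sy 0 0 7 6 Sh 7 3 Bl [], Sy 0 5 7 6 Sh 7 3 Bl []], Clash 3 (6, 0)]]], Sy 1 0 2 2 Sh 0 0 Rt []], Sx 0 1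
  Bl 2 5 Rt []]]]], Step [(0, 5), (1, 3)] Bl [((0, 4), Sh), ((1, 6), Sh)] [Sx 0 0 Rt 0 4 Bl [Step [(1, 3), (3, 6)] Rt
  [((3, 5), Rt), ((1, 2), Sh)] [Su 0 3 2 2 Rt [St 3 1 Rt [St 3 2 Rt [Sy 2 0 3 2 Sh 3 1 Bl [Step [(0, 7), (2, 1)] Sh
  [((5, 4), Sh), ((0, 6), Rt)] [Sy 0 0 6 5 Rt 0 4 Bl [Sy 0 5 7 6 Sh 7 3 Bl []], Clash 3 (6, 0), Clash 3 (6, 0), Su 0 2 6
  5 Rt [Sy 0 0 7 6 Sh 7 3 Bl [], Sy 0 5 7 6 Sh 7 3 Bl []], Clash 3 (6, 0)], Step [(0, 0), (2, 1)] Sh [((5, 4), Sh), ((0,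
  1), Rt)] [Sy 0 0 6 5 Rt 0 4 Bl [Sy 0 5 7 6 Sh 7 3 Bl []], Clash 3 (6, 0), Clash 3 (6, 0), Su 0 2 6 5 Rt [Sy 0 0 7 6 Sh
  7 3 Bl [], Sy 0 5 7 6 Sh 7 3 Bl []], Clash 3 (6, 0)]], Sy 2 0 3 2 Sh 3 1 Bl [Step [(0, 7), (2, 1)] Sh [((5, 4), Sh),
  ((0, 6), Rt)] [Sy 0 0 6 5 Rt 0 4 Bl [Sy 0 5 7 6 Sh 7 3 Bl []], Clash 3 (6, 0), Clash 3 (6, 0), Su 0 2 6 5 Rt [Sy 0 0 7
  6 Sh 7 3 Bl [], Sy 0 5 7 6 Sh 7 3 Bl []], Clash 3 (6, 0)], Step [(0, 0), (2, 1)] Sh [((5, 4), Sh), ((0, 1), Rt)] [Sy 0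
  0 6 5 Rt 0 4 Bl [Sy 0 5 7 6 Sh 7 3 Bl []], Clash 3 (6, 0), Clash 3 (6, 0), Su 0 2 6 5 Rt [Sy 0 0 7 6 Sh 7 3 Bl [], Sy
  0 5 7 6 Sh 7 3 Bl []], Clash 3 (6, 0)]]], Sy 1 0 2 2 Sh 0 0 Rt []], Sx 0 1 Bl 2 5 Rt []]]]]]"
  by code_simp

lemma root_C4_3_A0_F: "root_chk C4 A0 False 3 False [Step [(0, 0), (1, 3)] Bl [((0, 1), Sh), ((1, 6), Sh)] [Sx 0 0 Rt
  0 4 Bl [Step [(1, 3), (3, 6)] Rt [((3, 5), Rt), ((1, 2), Sh)] [Su 0 3 2 2 Rt [St 3 1 Rt [St 3 2 Rt [Sy 2 0 3 2 Sh 3 1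
  Bl [Step [(0, 7), (2, 1)] Sh [((5, 4), Sh), ((0, 6), Rt)] [Sy 0 0 6 5 Rt 0 4 Bl [Su 0 5 7 6 Sh []], Clash 3 (6, 0),
  Clash 3 (6, 0), Su 0 2 6 5 Rt [Sy 0 0 7 6 Sh 7 3 Bl [], Sy 0 5 7 6 Sh 0 3 Bl []], Clash 3 (6, 0)], Step [(0, 0), (2,
  1)] Sh [((5, 4), Sh), ((0, 1), Rt)] [Sy 0 0 6 5 Rt 0 4 Bl [Su 0 5 7 6 Sh []], Clash 3 (6, 0), Clash 3 (6, 0), Su 0 2 6
  5 Rt [Sy 0 0 7 6 Sh 7 3 Bl [], Sy 0 5 7 6 Sh 0 3 Bl []], Clash 3 (6, 0)]], Sy 2 0 3 2 Sh 3 1 Bl [Step [(0, 7), (2, 1)]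
  Sh [((5, 4), Sh), ((0, 6), Rt)] [Sy 0 0 6 5 Rt 0 4 Bl [Su 0 5 7 6 Sh []], Clash 3 (6, 0), Clash 3 (6, 0), Su 0 2 6 5
  Rt [Sy 0 0 7 6 Sh 7 3 Bl [], Sy 0 5 7 6 Sh 0 3 Bl []], Clash 3 (6, 0)], Step [(0, 0), (2, 1)] Sh [((5, 4), Sh), ((0,
  1), Rt)] [Sy 0 0 6 5 Rt 0 4 Bl [Su 0 5 7 6 Sh []], Clash 3 (6, 0), Clash 3 (6, 0), Su 0 2 6 5 Rt [Sy 0 0 7 6 Sh 7 3 Bl
  [], Sy 0 5 7 6 Sh 0 3 Bl []], Clash 3 (6, 0)]]], Sy 1 0 2 2 Sh 0 0 Rt []], Sx 0 1 Bl 2 5 Rt []]]]], Step [(0, 5), (1,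
  3)] Bl [((0, 4), Sh), ((1, 6), Sh)] [Sx 0 0 Rt 0 4 Bl [Step [(1, 3), (3, 6)] Rt [((3, 5), Rt), ((1, 2), Sh)] [Su 0 3 2
  2 Rt [St 3 1 Rt [St 3 2 Rt [Sy 2 0 3 2 Sh 3 1 Bl [Step [(0, 7), (2, 1)] Sh [((5, 4), Sh), ((0, 6), Rt)] [Sy 0 0 6 5 Rt
  0 4 Bl [Su 0 5 7 6 Sh []], Clash 3 (6, 0), Clash 3 (6, 0), Su 0 2 6 5 Rt [Sy 0 0 7 6 Sh 7 3 Bl [], Sy 0 5 7 6 Sh 0 3
  Bl []], Clash 3 (6, 0)], Step [(0, 0), (2, 1)] Sh [((5, 4), Sh), ((0, 1), Rt)] [Sy 0 0 6 5 Rt 0 4 Bl [Su 0 5 7 6 Sh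
  []], Clash 3 (6, 0), Clash 3 (6, 0), Su 0 2 6 5 Rt [Sy 0 0 7 6 Sh 7 3 Bl [], Sy 0 5 7 6 Sh 0 3 Bl []], Clash 3 (6,
  0)]], Sy 2 0 3 2 Sh 3 1 Bl [Step [(0, 7), (2, 1)] Sh [((5, 4), Sh), ((0, 6), Rt)] [Sy 0 0 6 5 Rt 0 4 Bl [Su 0 5 7 6 Sh
  []], Clash 3 (6, 0), Clash 3 (6, 0), Su 0 2 6 5 Rt [Sy 0 0 7 6 Sh 7 3 Bl [], Sy 0 5 7 6 Sh 0 3 Bl []], Clash 3 (6,
  0)], Step [(0, 0), (2, 1)] Sh [((5, 4), Sh), ((0, 1), Rt)] [Sy 0 0 6 5 Rt 0 4 Bl [Su 0 5 7 6 Sh []], Clash 3 (6, 0),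
  Clash 3 (6, 0), Su 0 2 6 5 Rt [Sy 0 0 7 6 Sh 7 3 Bl [], Sy 0 5 7 6 Sh 0 3 Bl []], Clash 3 (6, 0)]]], Sy 1 0 2 2 Sh 0 0
  Rt []], Sx 0 1 Bl 2 5 Rt []]]]]]"
  by code_simp

lemma root_C4_3_A2_T: "root_chk C4 A2 True 3 False [Sx 1 0 Rt 1 4 Bl [Sx 2 1 Rt 1 2 Bl [Step [(2, 0), (3, 3)] Bl [((2,
  1), Sh), ((3, 6), Sh)] [Step [(0, 3), (4, 6)] Rt [((4, 5), Rt), ((0, 2), Sh)] [Sy 0 4 5 5 Bl 0 0 Rt [Sx 3 0 Rt 3 4 Bl
  [Su 4 2 6 2 Rt [St 8 2 Rt [St 7 2 Rt [Su 4 2 8 1 Rt [Step [(8, 5), (11, 1)] Bl [((4, 1), Rt), ((9, 4), Sh)] [Clash 3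
  (4, 0), Clash 3 (4, 0), Sy 0 0 10 5 Rt 0 4 Bl [Su 0 5 11 6 Sh []], Clash 3 (4, 0), Su 0 2 10 5 Rt [Sy 0 0 11 6 Sh 11 3
  Bl [], Sy 0 5 11 6 Sh 0 3 Bl []]], Sy 0 4 5 3 Bl 0 0 Rt []], St 0 3 Bl [Clash 1 (4, 5), Clash 6 (4, 5)]], Sx 0 1 Bl 7
  5 Rt []], Sy 3 3 4 2 Rt 0 1 Bl []]]]]]]], Sx 1 0 Rt 1 4 Bl [Step [(1, 5), (2, 3)] Bl [((1, 4), Sh), ((2, 6), Sh)]
  [Step [(0, 3), (3, 6)] Rt [((3, 5), Rt), ((0, 2), Sh)] [Sy 0 4 4 5 Bl 0 0 Rt [Su 4 3 5 2 Rt [St 6 1 Rt [St 5 2 Rt [Su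
  3 2 6 1 Rt [Su 5 3 6 2 Rt [St 7 1 Rt [Sy 5 0 10 2 Sh 10 1 Bl [Step [(0, 7), (5, 1)] Sh [((10, 4), Sh), ((0, 6), Rt)]
  [Sy 0 0 11 5 Rt 0 4 Bl [Su 0 5 12 6 Sh []], Clash 3 (12, 0), Clash 3 (12, 0), Su 0 2 11 5 Rt [Sy 0 0 12 6 Sh 12 3 Bl
  [], Sy 0 5 12 6 Sh 0 3 Bl []], Clash 3 (12, 0)], Step [(0, 0), (5, 1)] Sh [((10, 4), Sh), ((0, 1), Rt)] [Sy 0 0 11 5
  Rt 0 4 Bl [Su 0 5 12 6 Sh []], Clash 3 (12, 0), Clash 3 (12, 0), Su 0 2 11 5 Rt [Sy 0 0 12 6 Sh 12 3 Bl [], Sy 0 5 12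
  6 Sh 0 3 Bl []], Clash 3 (12, 0)]], Sy 6 4 7 0 Sh 0 0 Sh []], Sy 0 5 6 2 Sh 0 3 Bl []], Sy 0 4 4 3 Bl 0 0 Rt []], St 0
  3 Bl [Clash 1 (3, 5), Clash 6 (3, 5)]], Sy 1 0 6 2 Sh 0 0 Rt []], Sx 0 1 Bl 4 5 Rt []]]]]]]"
  by code_simp

lemma root_C4_3_A2_F: "root_chk C4 A2 False 3 False [St 0 2 Rt [Sx 0 0 Sh 1 1 Bl [Sx 0 0 Sh 0 4 Bl [Step [(1, 7), (3,
  1)] Sh [((4, 6), Sh), ((1, 6), Rt)] [Step [(0, 5), (2, 6)] Bl [((0, 4), Sh), ((2, 5), Sh)] [Sy 0 3 3 5 Rt 2 0 Rt
  [Clash 1 (2, 0), Clash 4 (2, 0)]], Clash 3 (4, 6), Clash 3 (4, 6), Sy 0 4 2 6 Bl 0 0 Rt [Step [(1, 3), (6, 6)] Rt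
  [((6, 5), Rt), ((1, 2), Sh)] [Su 0 3 2 2 Rt [St 3 1 Rt [St 3 2 Rt [Sy 2 0 3 2 Sh 3 1 Bl [Step [(0, 7), (2, 1)] Sh
  [((5, 4), Sh), ((0, 6), Rt)] [Sy 0 0 6 5 Rt 0 4 Bl [Su 0 5 7 6 Sh []], Clash 3 (6, 0), Clash 3 (6, 0), Su 0 2 6 5 Rt
  [Sy 0 0 7 6 Sh 7 3 Bl [], Sy 0 5 7 6 Sh 0 3 Bl []], Clash 3 (6, 0)], Step [(0, 0), (2, 1)] Sh [((5, 4), Sh), ((0, 1),
  Rt)] [Sy 0 0 6 5 Rt 0 4 Bl [Su 0 5 7 6 Sh []], Clash 3 (6, 0), Clash 3 (6, 0), Su 0 2 6 5 Rt [Sy 0 0 7 6 Sh 7 3 Bl [],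
  Sy 0 5 7 6 Sh 0 3 Bl []], Clash 3 (6, 0)]], Sy 2 0 3 2 Sh 3 1 Bl [Step [(0, 7), (2, 1)] Sh [((5, 4), Sh), ((0, 6),
  Rt)] [Sy 0 0 6 5 Rt 0 4 Bl [Su 0 5 7 6 Sh []], Clash 3 (6, 0), Clash 3 (6, 0), Su 0 2 6 5 Rt [Sy 0 0 7 6 Sh 7 3 Bl [],
  Sy 0 5 7 6 Sh 0 3 Bl []], Clash 3 (6, 0)], Step [(0, 0), (2, 1)] Sh [((5, 4), Sh), ((0, 1), Rt)] [Sy 0 0 6 5 Rt 0 4 Bl
  [Su 0 5 7 6 Sh []], Clash 3 (6, 0), Clash 3 (6, 0), Su 0 2 6 5 Rt [Sy 0 0 7 6 Sh 7 3 Bl [], Sy 0 5 7 6 Sh 0 3 Bl []],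
  Clash 3 (6, 0)]]], Sy 1 0 2 2 Sh 0 0 Rt []], Sx 0 1 Bl 2 5 Rt []]]], Clash 3 (4, 6)]], Step [(0, 0), (2, 1)] Sh [((3,
  6), Sh), ((0, 1), Rt)] [Sx 0 0 Rt 0 4 Bl [Sy 0 4 1 0 Sh 5 5 Rt [Sy 0 2 1 5 Sh 1 3 Bl []]], Clash 3 (3, 6), Clash 3 (3,
  6), Sy 0 4 1 1 Bl 0 0 Rt [St 1 2 Rt [St 2 1 Rt [St 2 2 Rt [Sx 0 0 Sh 5 3 Rt [], Sx 0 3 Bl 5 3 Rt []], Sx 0 0 Rt 1 0 Sh
  []], Sx 0 1 Bl 1 5 Rt []]], Clash 3 (3, 6)]], Sx 0 0 Sh 2 5 Rt []], Sx 0 0 Rt 0 4 Bl [Step [(0, 0), (1, 4)] Sh [((2,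
  6), Sh), ((0, 1), Rt)] [Sx 0 0 Rt 0 4 Bl [Sy 0 4 1 0 Sh 4 5 Rt [Sy 0 2 1 5 Sh 1 3 Bl []]], Clash 3 (2, 6), Clash 3 (2,
  6), Sy 0 4 1 1 Bl 0 0 Rt [Step [(1, 3), (4, 6)] Rt [((4, 5), Rt), ((1, 2), Sh)] [Su 0 3 2 2 Rt [St 3 1 Rt [St 3 2 Rt
  [Sy 2 0 3 2 Sh 3 1 Bl [Step [(0, 7), (2, 1)] Sh [((5, 4), Sh), ((0, 6), Rt)] [Sy 0 0 6 5 Rt 0 4 Bl [Su 0 5 7 6 Sh []],
  Clash 3 (6, 0), Clash 3 (6, 0), Su 0 2 6 5 Rt [Sy 0 0 7 6 Sh 7 3 Bl [], Sy 0 5 7 6 Sh 0 3 Bl []], Clash 3 (6, 0)],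
  Step [(0, 0), (2, 1)] Sh [((5, 4), Sh), ((0, 1), Rt)] [Sy 0 0 6 5 Rt 0 4 Bl [Su 0 5 7 6 Sh []], Clash 3 (6, 0), Clash
  3 (6, 0), Su 0 2 6 5 Rt [Sy 0 0 7 6 Sh 7 3 Bl [], Sy 0 5 7 6 Sh 0 3 Bl []], Clash 3 (6, 0)]], Sy 2 0 3 2 Sh 3 1 Bl
  [Step [(0, 7), (2, 1)] Sh [((5, 4), Sh), ((0, 6), Rt)] [Sy 0 0 6 5 Rt 0 4 Bl [Su 0 5 7 6 Sh []], Clash 3 (6, 0), Clash
  3 (6, 0), Su 0 2 6 5 Rt [Sy 0 0 7 6 Sh 7 3 Bl [], Sy 0 5 7 6 Sh 0 3 Bl []], Clash 3 (6, 0)], Step [(0, 0), (2, 1)] Sh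
  [((5, 4), Sh), ((0, 1), Rt)] [Sy 0 0 6 5 Rt 0 4 Bl [Su 0 5 7 6 Sh []], Clash 3 (6, 0), Clash 3 (6, 0), Su 0 2 6 5 Rt
  [Sy 0 0 7 6 Sh 7 3 Bl [], Sy 0 5 7 6 Sh 0 3 Bl []], Clash 3 (6, 0)]]], Sy 1 0 2 2 Sh 0 0 Rt []], Sx 0 1 Bl 2 5 Rt
  []]]], Clash 3 (2, 6)]]]"
  by code_simp

lemma root_C4_6_A0_T: "root_chk C4 A0 True 6 True [Sx 1 4 Sh 0 3 Rt [], Sy 0 4 1 6 Sh 1 3 Bl [Su 0 2 1 5 Rt [Sy 0 0 2
  6 Sh 2 3 Bl [], Sy 0 5 2 6 Sh 0 3 Bl []], Su 0 5 1 5 Rt [Sy 0 0 2 6 Sh 2 3 Bl [], Sy 0 5 2 6 Sh 0 3 Bl []]]]"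
  by code_simp

lemma root_C4_6_A0_F: "root_chk C4 A0 False 6 True [Sx 1 4 Sh 0 3 Rt [], Su 0 4 1 6 Sh [Su 0 2 1 5 Rt [Sy 0 0 2 6 Sh 2
  3 Bl [], Sy 0 5 2 6 Sh 0 3 Bl []], Su 0 5 1 5 Rt [Sy 0 0 2 6 Sh 2 3 Bl [], Sy 0 5 2 6 Sh 0 3 Bl []]]]"
  by code_simp

lemma root_C4_6_A2_T: "root_chk C4 A2 True 6 True [Sx 1 4 Sh 0 3 Rt [], Sy 0 4 1 6 Sh 0 5 Bl [Su 0 2 1 5 Rt [Sy 0 0 2
  6 Sh 2 3 Bl [], Sy 0 5 2 6 Sh 0 3 Bl []], Su 0 5 1 5 Rt [Sy 0 0 2 6 Sh 2 3 Bl [], Sy 0 5 2 6 Sh 0 3 Bl []]]]"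
  by code_simp

lemma root_C4_6_A2_F: "root_chk C4 A2 False 6 True [Sx 1 4 Sh 0 3 Rt [], Sx 0 2 Rt 1 4 Sh [Sy 0 1 2 4 Bl 2 0 Rt [Sx 0
  2 Rt 2 0 Sh [Sx 0 3 Bl 2 3 Bl []]]]]"
  by code_simp

lemma root_C5_3_A1_F: "root_chk C5 A1 False 3 True [Su 0 2 1 3 Bl [], Su 0 2 1 3 Bl [], St 1 7 Rt [Sx 0 0 Sh 1 3 Rt
  [], Sx 0 3 Bl 1 3 Rt []], Su 0 2 1 3 Bl [], Su 0 4 1 3 Bl [], Sy 0 4 1 3 Bl 0 0 Rt [], Su 0 4 1 3 Bl [], Su 0 4 1 3 Bl
  []]"
  by code_simp

lemma root_C5_5_A1_T: "root_chk C5 A1 True 5 True [Step [(1, 0)] Sh [((1, 4), Bl), ((0, 3), Rt)] [], Sx 0 2 Rt 1 0 Sh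
  []]"
  by code_simp

lemma root_C5_5_A1_F: "root_chk C5 A1 False 5 True [Step [(1, 0)] Sh [((0, 3), Rt), ((1, 4), Bl)] [], Sx 0 2 Rt 1 0 Sh
  []]"
  by code_simp

lemma root_C5_5_A3_T: "root_chk C5 A3 True 5 True [Step [(1, 0)] Sh [((0, 3), Rt), ((1, 4), Bl)] [], Sx 0 2 Rt 1 0 Sh
  []]"
  by code_simp

lemma root_C5_5_A3_F: "root_chk C5 A3 False 5 True [Step [(1, 0)] Sh [((0, 3), Rt), ((1, 4), Bl)] [], Sx 0 2 Rt 1 0 Sh
  []]"
  by code_simp

lemma root_C5_6_A1_T: "root_chk C5 A1 True 6 False [Sx 1 0 Sh 1 4 Bl [Step [(1, 0), (2, 6)] Bl [((1, 1), Sh), ((2, 5),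
  Sh)] [Sy 0 3 3 5 Rt 1 0 Rt [Clash 1 (1, 0), Clash 4 (1, 0)]]], Sx 1 0 Sh 1 4 Bl [Step [(1, 5), (2, 6)] Bl [((1, 4),
  Sh), ((2, 5), Sh)] [Sy 0 3 3 5 Rt 1 0 Rt [Clash 1 (1, 0), Clash 4 (1, 0)]]]]"
  by code_simp

lemma root_C5_6_A1_F: "root_chk C5 A1 False 6 False [Sx 1 0 Sh 1 4 Bl [Step [(1, 0), (2, 6)] Bl [((1, 1), Sh), ((2,
  5), Sh)] [Sy 0 3 3 5 Rt 1 0 Rt [Clash 1 (1, 0), Clash 4 (1, 0)]]], Sx 1 0 Sh 1 4 Bl [Step [(1, 5), (2, 6)] Bl [((1,
  4), Sh), ((2, 5), Sh)] [Sy 0 3 3 5 Rt 1 0 Rt [Clash 1 (1, 0), Clash 4 (1, 0)]]]]"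
  by code_simp

lemma root_C5_6_A3_T: "root_chk C5 A3 True 6 False [Sx 1 0 Sh 1 4 Bl [Step [(1, 0), (2, 6)] Bl [((1, 1), Sh), ((2, 5),
  Sh)] [Sy 0 3 3 5 Rt 1 0 Rt [Clash 1 (1, 0), Clash 4 (1, 0)]]], Sx 1 0 Sh 1 4 Bl [Step [(1, 5), (2, 6)] Bl [((1, 4),
  Sh), ((2, 5), Sh)] [Sy 0 3 3 5 Rt 1 0 Rt [Clash 1 (1, 0), Clash 4 (1, 0)]]]]"
  by code_simp

lemma root_C5_6_A3_F: "root_chk C5 A3 False 6 False [Sx 1 0 Sh 1 4 Bl [Step [(1, 0), (2, 6)] Bl [((1, 1), Sh), ((2,
  5), Sh)] [Sy 0 3 3 5 Rt 1 0 Rt [Clash 1 (1, 0), Clash 4 (1, 0)]]], Sx 1 0 Sh 1 4 Bl [Step [(1, 5), (2, 6)] Bl [((1,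
  4), Sh), ((2, 5), Sh)] [Sy 0 3 3 5 Rt 1 0 Rt [Clash 1 (1, 0), Clash 4 (1, 0)]]]]"
  by code_simp

lemma root_C6_0_A2_T: "root_chk C6 A2 True 0 False [Sx 0 1 Bl 1 1 Rt [], Sx 0 1 Bl 1 1 Rt [], Sx 0 1 Bl 1 1 Rt [], Sx
  0 1 Bl 1 1 Rt [], Sx 0 0 Rt 1 1 Rt [], Sx 0 0 Rt 1 1 Rt [], Sx 0 0 Rt 1 1 Rt [], Sx 0 0 Rt 1 1 Rt []]"
  by code_simp

lemma root_C6_0_A2_F: "root_chk C6 A2 False 0 False [Sx 0 1 Bl 1 1 Rt [], Sx 0 1 Bl 1 1 Rt [], Sx 0 1 Bl 1 1 Rt [], Sx
  0 1 Bl 1 1 Rt [], Sx 0 0 Rt 1 1 Rt [], Sx 0 0 Rt 1 1 Rt [], Sx 0 0 Rt 1 1 Rt [], Sx 0 0 Rt 1 1 Rt []]"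
  by code_simp

lemma root_C6_0_A0_T: "root_chk C6 A0 True 0 False [Sx 0 1 Bl 1 1 Rt [], Sx 0 1 Bl 1 1 Rt [], Sx 0 1 Bl 1 1 Rt [], Sx
  0 1 Bl 1 1 Rt [], Sx 0 0 Rt 1 1 Rt [], Sx 0 0 Rt 1 1 Rt [], Sx 0 0 Rt 1 1 Rt [], Sx 0 0 Rt 1 1 Rt []]"
  by code_simp

lemma root_C6_0_A0_F: "root_chk C6 A0 False 0 False [Sx 0 1 Bl 1 1 Rt [], Sx 0 1 Bl 1 1 Rt [], Sx 0 1 Bl 1 1 Rt [], Sx
  0 1 Bl 1 1 Rt [], Sx 0 0 Rt 1 1 Rt [], Sx 0 0 Rt 1 1 Rt [], Sx 0 0 Rt 1 1 Rt [], Sx 0 0 Rt 1 1 Rt []]"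
  by code_simp

lemma root_C6_7_A0_F: "root_chk C6 A0 False 7 False [Sx 0 1 Bl 1 3 Rt [], Sx 0 1 Bl 1 3 Rt [], Sx 0 1 Bl 1 3 Rt [], Sx
  0 1 Bl 1 3 Rt [], Sx 0 0 Rt 1 3 Rt [], Sx 0 0 Rt 1 3 Rt [], Sx 0 0 Rt 1 3 Rt [], Sx 0 0 Rt 1 3 Rt []]"
  by code_simp

lemma root_C7_1_A3_T: "root_chk C7 A3 True 1 True [Sy 0 2 1 1 Bl 0 3 Sh [St 0 2 Rt [St 1 3 Rt [Su 3 1 4 0 Rt [Su 0 0 4
  0 Sh [], Su 0 5 4 0 Sh []], Sx 0 0 Rt 1 0 Sh []], Sy 2 1 3 0 Rt 0 1 Bl []]], Sy 0 2 1 1 Bl 0 3 Sh [St 0 2 Rt [St 1 3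
  Rt [Sy 0 0 2 3 Bl 0 1 Sh [Sx 0 2 Bl 0 3 Sh [Su 0 3 5 0 Rt [Clash 1 (6, 0), Clash 4 (6, 0)]], Sy 4 1 5 0 Rt 0 2 Rt []],
  Sx 0 0 Rt 1 0 Sh []], Sy 2 1 3 0 Rt 0 1 Bl []]], Sy 0 2 1 1 Bl 0 3 Sh [Sx 0 1 Rt 0 2 Sh [Sy 0 5 1 1 Bl 0 4 Sh [Su 3 1
  4 0 Rt [Su 0 0 4 0 Sh [], Su 0 5 4 0 Sh []], Sy 3 1 4 0 Rt 0 2 Rt []]], St 0 2 Rt [St 1 3 Rt [Sy 0 0 2 3 Bl 0 1 Sh [Su
  4 1 5 0 Rt [Su 0 0 5 0 Sh [], Su 0 5 5 0 Sh []], Sy 4 1 5 0 Rt 0 2 Rt []], Sx 0 0 Rt 1 0 Sh []], Sy 2 1 3 0 Rt 0 1 Bl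
  []]], Sx 1 3 Rt 1 7 Sh [Sx 0 0 Rt 0 4 Bl [Sx 0 3 Bl 0 5 Sh [Su 3 1 4 0 Rt [Su 0 0 4 0 Sh [Sx 0 6 Rt 1 2 Bl [Sx 0 0 Rt
  0 4 Bl [Sx 0 3 Bl 0 5 Sh [Su 7 3 9 7 Rt [Sy 1 3 2 5 Bl 2 4 Sh [Su 4 2 11 4 Rt [St 12 6 Rt [Sx 7 2 Rt 12 3 Bl [Su 11 0
  12 4 Sh [Clash 0 (14, 3), Clash 0 (14, 3), Clash 0 (14, 3), Sx 0 3 Bl 15 2 Rt [Sy 0 2 16 2 Sh 0 1 Bl [Clash 6 (15, 2),
  Clash 0 (15, 2)], Sy 0 4 16 2 Sh 0 5 Bl [Clash 6 (15, 2), Clash 0 (15, 2)]], Clash 2 (14, 3), Sy 0 4 12 1 Bl 0 0 Rt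
  [Sy 3 0 16 6 Bl 3 1 Sh [St 11 7 Rt [St 3 2 Rt [Su 2 1 6 1 Bl [Clash 1 (10, 2), Clash 3 (10, 2), Clash 3 (10, 2), Clash
  3 (10, 2), Su 0 0 18 1 Rt [Clash 0 (16, 3), Clash 6 (16, 3)], Clash 5 (10, 1), Su 0 7 18 1 Rt [Clash 0 (16, 3), Clash
  6 (16, 3)], Clash 0 (10, 1), Clash 0 (10, 1), Clash 0 (10, 1), Clash 1 (10, 2)], Sx 0 1 Bl 3 5 Rt []], St 3 2 Rt [Su 2
  1 6 1 Bl [Clash 1 (10, 2), Clash 3 (10, 2), Clash 3 (10, 2), Clash 3 (10, 2), Su 0 0 18 1 Rt [Clash 0 (16, 3), Clash 6
  (16, 3)], Clash 5 (10, 1), Su 0 7 18 1 Rt [Clash 0 (16, 3), Clash 6 (16, 3)], Clash 0 (10, 1), Clash 0 (10, 1), Clash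
  0 (10, 1), Clash 1 (10, 2)], Sx 0 1 Bl 3 5 Rt []]], Sx 0 0 Sh 8 6 Rt []]], Clash 6 (14, 3), Clash 6 (14, 3), Clash 6
  (14, 3), Clash 5 (14, 3)], Clash 2 (12, 3), Clash 2 (12, 3), Clash 2 (12, 3), Clash 2 (12, 3), Sy 13 2 14 1 Bl 0 3 Bl
  []], Sy 3 0 11 2 Sh 0 0 Rt []], Sx 0 1 Bl 11 3 Rt []], Sx 0 2 Rt 1 2 Rt []], Sy 0 5 8 2 Sh 0 3 Bl []]]]]], Sx 0 0 Sh 5
  5 Rt []]]]], St 0 2 Rt [Su 1 5 2 0 Rt [Sy 0 0 2 6 Sh 2 3 Bl [], Sy 0 5 2 6 Sh 2 3 Bl []], Su 1 5 2 0 Rt [Sy 0 0 2 6 Sh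
  2 3 Bl [], Sy 0 5 2 6 Sh 2 3 Bl []]], St 0 2 Rt [Su 1 5 2 0 Rt [Su 0 0 2 6 Sh [], Su 0 5 2 6 Sh []], Su 1 5 2 0 Rt [Su
  0 0 2 6 Sh [], Su 0 5 2 6 Sh []]], Sy 0 4 1 1 Bl 0 0 Rt [Sx 2 3 Rt 2 7 Sh [St 1 2 Rt [Sy 1 5 4 3 Bl 1 4 Sh [Sy 3 1 5 2
  Rt 0 3 Bl [Clash 2 (0, 3)], Sx 0 0 Sh 3 3 Bl [Clash 6 (3, 6)]], Sy 3 5 4 0 Rt 0 1 Bl []]]], St 0 2 Rt [Su 1 5 2 0 Rt
  [Su 0 0 2 6 Sh [], Su 0 5 2 6 Sh []], Su 1 5 2 0 Rt [Su 0 0 2 6 Sh [], Su 0 5 2 6 Sh []]]]"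
  by code_simp

lemma root_C7_1_A3_F: "root_chk C7 A3 False 1 True [Sy 0 2 1 1 Bl 0 3 Sh [Sx 2 3 Rt 2 7 Sh [St 1 5 Rt [Sy 1 5 4 3 Bl 1
  4 Sh [Sy 3 6 5 2 Rt 0 3 Bl [Clash 2 (0, 3)], Step [(0, 0)] Sh [((3, 4), Bl), ((0, 1), Bl)] []], Sy 3 1 4 0 Rt 0 1 Bl
  []]]], Sy 0 2 1 1 Bl 0 3 Sh [Sx 2 3 Rt 2 7 Sh [St 1 5 Rt [Sy 1 5 4 3 Bl 1 4 Sh [Sy 3 6 5 2 Rt 0 3 Bl [Clash 2 (0, 3)],
  Sx 0 0 Sh 3 4 Bl [Clash 6 (3, 0)]], Sy 3 1 4 0 Rt 0 1 Bl []]]], Sx 1 3 Rt 1 7 Sh [Sx 0 0 Rt 0 4 Bl [Sx 0 3 Bl 0 5 Sh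
  [Sy 3 2 4 1 Bl 3 3 Sh [St 0 5 Rt [St 1 7 Rt [St 2 6 Rt [St 3 2 Rt [Su 6 0 7 4 Sh [Clash 0 (9, 3), Clash 0 (9, 3),
  Clash 0 (9, 3), Sy 4 0 0 3 Bl 4 1 Sh [St 6 3 Rt [Sy 0 0 7 3 Bl 0 1 Sh [Sx 0 2 Bl 0 3 Sh [Sx 0 1 Rt 0 2 Sh [Su 1 3 8 0
  Rt [Step [(0, 1), (9, 1)] Bl [((8, 1), Sh), ((0, 2), Sh)] [Clash 3 (11, 7), Clash 3 (11, 7), Step [(0, 5), (9, 1)] Bl
  [((7, 2), Bl), ((0, 4), Sh)] [Su 0 3 1 4 Bl []], Clash 3 (11, 7), Sy 0 4 9 1 Bl 0 0 Sh [St 0 7 Rt [Clash 0 (14, 6),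
  Clash 5 (14, 6)]]], Step [(0, 4), (9, 1)] Bl [((0, 0), Rt), ((1, 1), Bl)] []]]], Sx 0 2 Rt 6 0 Rt []], Sx 0 0 Rt 3 0
  Sh []], Sy 0 6 5 0 Sh 0 3 Bl []], Clash 2 (9, 3), Sy 2 0 5 6 Bl 0 1 Bl [], Clash 6 (9, 3), Clash 6 (9, 3), Clash 6 (9,
  3), Clash 5 (9, 3)], Sx 0 1 Bl 2 0 Rt []], Sx 0 0 Rt 2 0 Sh []], Sx 0 2 Rt 2 3 Rt []], Sx 0 0 Sh 1 7 Rt []], Sx 0 0 Sh
  0 4 Bl [Step [(0, 6), (1, 4)] Rt [((0, 5), Rt), ((1, 5), Sh)] [Sy 0 4 1 5 Bl 4 1 Bl []], Sy 3 0 4 4 Sh 0 1 Bl [Clash 0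
  (0, 1), Clash 0 (0, 1), Clash 0 (0, 1), Clash 0 (0, 1), Clash 2 (0, 1)]]]]]], Sx 1 3 Rt 1 7 Sh [Sx 0 0 Rt 0 4 Bl [Sx 0
  3 Bl 0 5 Sh [Su 3 1 4 0 Rt [Su 3 3 5 7 Rt [St 6 5 Rt [St 7 4 Rt [Sy 3 0 7 0 Sh 0 1 Bl [Sy 0 2 1 1 Sh 0 1 Rt [Sy 0 0 3
  1 Rt 0 4 Bl [St 11 6 Rt [Sx 3 7 Rt 11 3 Bl [Su 10 0 11 4 Sh [Clash 0 (13, 3), Clash 0 (13, 3), Clash 0 (13, 3), Sx 0 3
  Bl 14 2 Rt [Sy 0 2 15 2 Sh 0 1 Bl [Clash 6 (14, 2), Clash 0 (14, 2)], Sy 0 4 15 2 Sh 0 5 Bl [Clash 6 (14, 2), Clash 0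
  (14, 2)]], Clash 2 (13, 3), Sy 0 4 11 1 Bl 0 0 Rt [Sy 3 0 15 6 Bl 3 1 Sh [Sy 5 5 9 0 Sh 0 2 Bl [St 3 2 Rt [Su 1 2 2 2
  Sh [Su 0 0 17 1 Rt [Clash 0 (15, 3), Clash 6 (15, 3)], Clash 5 (16, 1), Su 0 7 17 1 Rt [Clash 0 (15, 3), Clash 6 (15,
  3)], Clash 1 (16, 2)], Sx 0 1 Bl 3 5 Rt []]], Sy 5 5 9 0 Sh 0 0 Rt []]], Clash 6 (13, 3), Clash 6 (13, 3), Clash 6
  (13, 3), Clash 5 (13, 3)], Clash 2 (11, 3), Clash 2 (11, 3), Clash 2 (11, 3), Clash 2 (11, 3), Sy 12 2 13 1 Bl 0 3 Bl
  []], Sy 6 0 10 2 Sh 0 0 Rt []]]]], Sy 3 0 7 0 Sh 0 0 Rt []], Sx 0 2 Rt 1 2 Rt []], Sy 0 5 4 2 Sh 0 3 Bl []], Sx 0 0 Sh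
  5 5 Rt []]]]], St 0 2 Rt [Su 1 5 2 0 Rt [Sy 0 0 2 6 Sh 2 3 Bl [], Sy 0 5 2 6 Sh 2 3 Bl []], Su 1 5 2 0 Rt [Sy 0 0 2 6
  Sh 2 3 Bl [], Sy 0 5 2 6 Sh 2 3 Bl []]], St 0 2 Rt [Su 1 5 2 0 Rt [Sy 0 0 2 6 Sh 2 3 Bl [], Sy 0 5 2 6 Sh 0 3 Bl []],
  Su 1 5 2 0 Rt [Sy 0 0 2 6 Sh 2 3 Bl [], Sy 0 5 2 6 Sh 0 3 Bl []]], Sy 0 4 1 1 Bl 0 0 Rt [Sx 2 3 Rt 2 7 Sh [St 1 2 Rt
  [Sy 1 5 4 3 Bl 1 4 Sh [Sy 3 1 5 2 Rt 0 3 Bl [Clash 2 (0, 3)], Sx 0 0 Sh 3 3 Bl [Clash 6 (3, 6)]], Sy 3 5 4 0 Rt 0 1 Bl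
  []]]], St 0 2 Rt [Su 1 5 2 0 Rt [Sy 0 0 2 6 Sh 2 3 Bl [], Sy 0 5 2 6 Sh 0 3 Bl []], Su 1 5 2 0 Rt [Sy 0 0 2 6 Sh 2 3
  Bl [], Sy 0 5 2 6 Sh 0 3 Bl []]]]"
  by code_simp

lemma root_C7_1_A1_T: "root_chk C7 A1 True 1 True [Sy 0 2 1 1 Bl 0 3 Sh [St 0 2 Rt [St 1 3 Rt [Su 3 1 4 0 Rt [Su 0 0 4
  0 Sh [], Su 0 5 4 0 Sh []], Sx 0 0 Rt 1 0 Sh []], Sy 2 1 3 0 Rt 0 1 Bl []]], Sy 0 2 1 1 Bl 0 3 Sh [St 0 2 Rt [St 1 3
  Rt [Sy 0 0 2 3 Bl 0 1 Sh [Sx 0 2 Bl 0 3 Sh [Su 0 3 5 0 Rt [Clash 1 (6, 0), Clash 4 (6, 0)]], Sy 4 1 5 0 Rt 0 2 Rt []],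
  Sx 0 0 Rt 1 0 Sh []], Sy 2 1 3 0 Rt 0 1 Bl []]], Sy 0 2 1 1 Bl 0 3 Sh [Sx 0 1 Rt 0 2 Sh [Sy 0 5 1 1 Bl 0 4 Sh [Su 3 1
  4 0 Rt [Su 0 0 4 0 Sh [], Su 0 5 4 0 Sh []], Sy 3 1 4 0 Rt 0 2 Rt []]], St 0 2 Rt [St 1 3 Rt [Sy 0 0 2 3 Bl 0 1 Sh [Su
  4 1 5 0 Rt [Su 0 0 5 0 Sh [], Su 0 5 5 0 Sh []], Sy 4 1 5 0 Rt 0 2 Rt []], Sx 0 0 Rt 1 0 Sh []], Sy 2 1 3 0 Rt 0 1 Bl
  []]], Sx 1 3 Rt 1 7 Sh [Sx 0 0 Rt 0 4 Bl [Su 0 0 1 4 Sh [Clash 0 (3, 3), Clash 0 (3, 3), Clash 0 (3, 3), Sx 0 3 Bl 4 2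
  Rt [Sy 0 2 5 2 Sh 0 1 Bl [Clash 6 (4, 2), Clash 0 (4, 2)], Sy 0 4 5 2 Sh 0 5 Bl [Clash 6 (4, 2), Clash 0 (4, 2)]],
  Clash 2 (3, 3), Sy 0 4 1 1 Bl 0 0 Rt [St 1 1 Rt [St 0 2 Rt [Su 6 1 7 0 Rt [Su 6 3 8 7 Rt [St 9 5 Rt [St 5 2 Rt [St 11
  6 Rt [Su 7 1 9 2 Rt [Sy 1 0 13 6 Bl 1 1 Sh [Sx 9 3 Bl 9 6 Sh [Step [(0, 3), (10, 6)] Rt [((10, 5), Rt), ((0, 2), Sh)]
  [Sy 0 4 11 5 Bl 0 0 Rt [Step [(2, 6), (12, 3)] Rt [((2, 5), Rt), ((4, 2), Bl)] [St 3 1 Rt [Su 3 2 0 2 Rt [Sy 0 0 4 2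
  Sh 4 1 Bl [Sx 0 0 Sh 0 4 Bl [Su 1 2 6 1 Rt [St 2 1 Rt [Sy 0 0 3 1 Bl 0 1 Sh [Su 3 5 1 2 Rt [Su 8 2 15 0 Sh [St 26 3 Bl
  [Su 5 0 11 5 Sh [Sy 28 2 29 1 Bl 0 7 Rt [], Sy 28 2 29 1 Bl 0 7 Rt [], Sy 28 2 29 1 Bl 0 7 Rt [], Sy 28 2 29 1 Bl 0 7
  Rt [], Sy 28 2 29 1 Bl 0 5 Rt []], Sy 27 2 28 1 Bl 0 3 Bl [], Sy 27 2 28 1 Bl 0 4 Bl []], Clash 1 (23, 5), St 26 3 Bl
  [Su 5 0 11 5 Sh [Sy 28 2 29 1 Bl 0 7 Rt [], Sy 28 2 29 1 Bl 0 7 Rt [], Sy 28 2 29 1 Bl 0 7 Rt [], Sy 28 2 29 1 Bl 0 7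
  Rt [], Sy 28 2 29 1 Bl 0 5 Rt []], Sy 27 2 28 1 Bl 0 3 Bl [], Sy 27 2 28 1 Bl 0 4 Bl []]], Sy 0 5 4 5 Sh 0 3 Bl []],
  Sy 2 0 8 5 Sh 0 0 Rt []], Sx 0 0 Rt 2 5 Sh []], Sy 0 6 6 5 Sh 0 3 Bl []]], Sx 0 3 Rt 0 7 Sh [Su 1 5 6 1 Rt [St 2 6 Rt
  [Sy 0 0 3 6 Bl 0 1 Sh [Su 3 2 1 2 Rt [Su 8 2 15 0 Sh [St 26 3 Bl [Su 5 0 11 5 Sh [Sy 28 2 29 1 Bl 0 7 Rt [], Sy 28 2
  29 1 Bl 0 7 Rt [], Sy 28 2 29 1 Bl 0 7 Rt [], Sy 28 2 29 1 Bl 0 7 Rt [], Sy 28 2 29 1 Bl 0 5 Rt []], Sy 27 2 28 1 Bl 0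
  3 Bl [], Sy 27 2 28 1 Bl 0 4 Bl []], Clash 1 (23, 5), St 26 3 Bl [Su 5 0 11 5 Sh [Sy 28 2 29 1 Bl 0 7 Rt [], Sy 28 2
  29 1 Bl 0 7 Rt [], Sy 28 2 29 1 Bl 0 7 Rt [], Sy 28 2 29 1 Bl 0 7 Rt [], Sy 28 2 29 1 Bl 0 5 Rt []], Sy 27 2 28 1 Bl 0
  3 Bl [], Sy 27 2 28 1 Bl 0 4 Bl []]], Sy 0 5 4 2 Sh 0 3 Bl []], Sy 2 0 8 5 Sh 0 0 Rt []], Sx 0 0 Rt 2 1 Bl []], Sy 0 6
  6 5 Sh 0 3 Bl []]]], Sy 0 5 4 2 Sh 0 3 Bl []], Sy 2 4 3 0 Sh 0 0 Sh []]]]], Step [(0, 4), (10, 6)] Rt [((10, 5), Rt),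
  ((0, 5), Sh)] [Sy 0 4 11 5 Bl 0 0 Rt [St 2 6 Rt [Su 2 2 0 2 Rt [Sy 0 0 3 2 Sh 3 1 Bl [Sx 0 0 Sh 0 4 Bl [Su 1 2 5 1 Rt
  [St 2 1 Rt [Sy 0 0 3 1 Bl 0 1 Sh [Su 3 5 1 2 Rt [St 24 3 Bl [Sy 11 0 21 3 Rt 13 2 Bl [Sy 0 0 16 0 Sh 24 5 Sh [Clash 1
  (24, 5), Clash 3 (24, 5), Clash 3 (24, 5), Clash 3 (24, 5), Sy 0 3 25 5 Bl 25 4 Sh [St 1 5 Rt [Sx 1 3 Bl 2 2 Rt [Sy 2
  2 29 1 Bl 0 0 Sh [Clash 3 (22, 0), Clash 3 (22, 0), St 0 0 Rt [Su 11 0 16 5 Sh [Sy 33 2 34 1 Bl 0 7 Rt [], Sy 33 2 34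
  1 Bl 0 7 Rt [], Sy 33 2 34 1 Bl 0 7 Rt [], Sy 33 2 34 1 Bl 0 7 Rt [], Sy 33 2 34 1 Bl 0 5 Rt []], Su 11 0 16 5 Sh [Sy
  33 2 34 1 Bl 0 7 Rt [], Sy 33 2 34 1 Bl 0 7 Rt [], Sy 33 2 34 1 Bl 0 7 Rt [], Sy 33 2 34 1 Bl 0 7 Rt [], Sy 33 2 34 1
  Bl 0 5 Rt []]], Clash 3 (22, 0), St 0 2 Rt [Su 11 0 16 5 Sh [Sy 33 2 34 1 Bl 0 7 Rt [], Sy 33 2 34 1 Bl 0 7 Rt [], Sy
  33 2 34 1 Bl 0 7 Rt [], Sy 33 2 34 1 Bl 0 7 Rt [], Sy 33 2 34 1 Bl 0 5 Rt []], Su 11 0 16 5 Sh [Sy 33 2 34 1 Bl 0 7 Rt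
  [], Sy 33 2 34 1 Bl 0 7 Rt [], Sy 33 2 34 1 Bl 0 7 Rt [], Sy 33 2 34 1 Bl 0 7 Rt [], Sy 33 2 34 1 Bl 0 5 Rt []]],
  Clash 0 (19, 1), St 0 7 Rt [Su 11 0 16 5 Sh [Sy 33 2 34 1 Bl 0 7 Rt [], Sy 33 2 34 1 Bl 0 7 Rt [], Sy 33 2 34 1 Bl 0 7
  Rt [], Sy 33 2 34 1 Bl 0 7 Rt [], Sy 33 2 34 1 Bl 0 5 Rt []], Su 11 0 16 5 Sh [Sy 33 2 34 1 Bl 0 7 Rt [], Sy 33 2 34 1
  Bl 0 7 Rt [], Sy 33 2 34 1 Bl 0 7 Rt [], Sy 33 2 34 1 Bl 0 7 Rt [], Sy 33 2 34 1 Bl 0 5 Rt []]], Clash 0 (19, 1),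
  Clash 0 (19, 1)], Sy 2 2 29 1 Bl 0 3 Bl []], St 0 1 Rt [Sx 2 3 Bl 3 2 Rt [Sy 3 2 30 1 Bl 0 0 Sh [Clash 3 (23, 0),
  Clash 3 (23, 0), St 0 0 Rt [Su 12 0 17 5 Sh [Sy 34 2 35 1 Bl 0 7 Rt [], Sy 34 2 35 1 Bl 0 7 Rt [], Sy 34 2 35 1 Bl 0 7
  Rt [], Sy 34 2 35 1 Bl 0 7 Rt [], Sy 34 2 35 1 Bl 0 5 Rt []], Su 12 0 17 5 Sh [Sy 34 2 35 1 Bl 0 7 Rt [], Sy 34 2 35 1
  Bl 0 7 Rt [], Sy 34 2 35 1 Bl 0 7 Rt [], Sy 34 2 35 1 Bl 0 7 Rt [], Sy 34 2 35 1 Bl 0 5 Rt []]], Clash 3 (23, 0), St 0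
  2 Rt [Su 12 0 17 5 Sh [Sy 34 2 35 1 Bl 0 7 Rt [], Sy 34 2 35 1 Bl 0 7 Rt [], Sy 34 2 35 1 Bl 0 7 Rt [], Sy 34 2 35 1
  Bl 0 7 Rt [], Sy 34 2 35 1 Bl 0 5 Rt []], Su 12 0 17 5 Sh [Sy 34 2 35 1 Bl 0 7 Rt [], Sy 34 2 35 1 Bl 0 7 Rt [], Sy 34
  2 35 1 Bl 0 7 Rt [], Sy 34 2 35 1 Bl 0 7 Rt [], Sy 34 2 35 1 Bl 0 5 Rt []]], Clash 0 (20, 1), St 0 7 Rt [Su 12 0 17 5
  Sh [Sy 34 2 35 1 Bl 0 7 Rt [], Sy 34 2 35 1 Bl 0 7 Rt [], Sy 34 2 35 1 Bl 0 7 Rt [], Sy 34 2 35 1 Bl 0 7 Rt [], Sy 34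
  2 35 1 Bl 0 5 Rt []], Su 12 0 17 5 Sh [Sy 34 2 35 1 Bl 0 7 Rt [], Sy 34 2 35 1 Bl 0 7 Rt [], Sy 34 2 35 1 Bl 0 7 Rt
  [], Sy 34 2 35 1 Bl 0 7 Rt [], Sy 34 2 35 1 Bl 0 5 Rt []]], Clash 0 (20, 1), Clash 0 (20, 1)], Sy 3 2 30 1 Bl 0 3 Bl
  []], Sx 2 3 Bl 3 2 Rt [Sy 3 2 30 1 Bl 0 0 Sh [Clash 3 (23, 0), Clash 3 (23, 0), St 0 0 Rt [Su 12 0 17 5 Sh [Sy 34 2 35
  1 Bl 0 7 Rt [], Sy 34 2 35 1 Bl 0 7 Rt [], Sy 34 2 35 1 Bl 0 7 Rt [], Sy 34 2 35 1 Bl 0 7 Rt [], Sy 34 2 35 1 Bl 0 5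
  Rt []], Su 12 0 17 5 Sh [Sy 34 2 35 1 Bl 0 7 Rt [], Sy 34 2 35 1 Bl 0 7 Rt [], Sy 34 2 35 1 Bl 0 7 Rt [], Sy 34 2 35 1
  Bl 0 7 Rt [], Sy 34 2 35 1 Bl 0 5 Rt []]], Clash 3 (23, 0), St 0 2 Rt [Su 12 0 17 5 Sh [Sy 34 2 35 1 Bl 0 7 Rt [], Sy
  34 2 35 1 Bl 0 7 Rt [], Sy 34 2 35 1 Bl 0 7 Rt [], Sy 34 2 35 1 Bl 0 7 Rt [], Sy 34 2 35 1 Bl 0 5 Rt []], Su 12 0 17 5
  Sh [Sy 34 2 35 1 Bl 0 7 Rt [], Sy 34 2 35 1 Bl 0 7 Rt [], Sy 34 2 35 1 Bl 0 7 Rt [], Sy 34 2 35 1 Bl 0 7 Rt [], Sy 34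
  2 35 1 Bl 0 5 Rt []]], Clash 0 (20, 1), St 0 7 Rt [Su 12 0 17 5 Sh [Sy 34 2 35 1 Bl 0 7 Rt [], Sy 34 2 35 1 Bl 0 7 Rt
  [], Sy 34 2 35 1 Bl 0 7 Rt [], Sy 34 2 35 1 Bl 0 7 Rt [], Sy 34 2 35 1 Bl 0 5 Rt []], Su 12 0 17 5 Sh [Sy 34 2 35 1 Bl
  0 7 Rt [], Sy 34 2 35 1 Bl 0 7 Rt [], Sy 34 2 35 1 Bl 0 7 Rt [], Sy 34 2 35 1 Bl 0 7 Rt [], Sy 34 2 35 1 Bl 0 5 Rt
  []]], Clash 0 (20, 1), Clash 0 (20, 1)], Sy 3 2 30 1 Bl 0 3 Bl []]]], St 1 5 Rt [Su 8 0 13 5 Sh [Sy 30 2 31 1 Bl 0 7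
  Rt [], Sy 30 2 31 1 Bl 0 7 Rt [], Sy 30 2 31 1 Bl 0 7 Rt [], Sy 30 2 31 1 Bl 0 7 Rt [], Sy 30 2 31 1 Bl 0 5 Rt []], St
  0 1 Rt [Su 9 0 14 5 Sh [Sy 31 2 32 1 Bl 0 7 Rt [], Sy 31 2 32 1 Bl 0 7 Rt [], Sy 31 2 32 1 Bl 0 7 Rt [], Sy 31 2 32 1
  Bl 0 7 Rt [], Sy 31 2 32 1 Bl 0 5 Rt []], Su 9 0 14 5 Sh [Sy 31 2 32 1 Bl 0 7 Rt [], Sy 31 2 32 1 Bl 0 7 Rt [], Sy 31
  2 32 1 Bl 0 7 Rt [], Sy 31 2 32 1 Bl 0 7 Rt [], Sy 31 2 32 1 Bl 0 5 Rt []]]]]], St 12 1 Bl [Clash 3 (0, 2), Sy 1 2 17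
  0 Sh 0 0 Rt [], Sy 1 2 17 0 Sh 0 7 Rt []], Sy 0 6 16 0 Sh 0 3 Bl []], Sy 25 2 26 1 Bl 0 3 Bl [], Sy 25 2 26 1 Bl 0 4
  Bl []], Sy 0 5 4 5 Sh 0 3 Bl []], Sy 2 0 7 5 Sh 0 0 Rt []], Sx 0 0 Rt 2 5 Sh []], Sy 0 6 5 5 Sh 0 3 Bl []]], Sx 0 3 Rt
  0 7 Sh [Su 1 5 5 1 Rt [St 2 6 Rt [Sy 0 0 3 6 Bl 0 1 Sh [Su 3 2 1 2 Rt [St 24 3 Bl [Sy 11 0 21 3 Rt 13 2 Bl [Sy 0 0 16
  0 Sh 24 5 Sh [Clash 1 (24, 5), Clash 3 (24, 5), Clash 3 (24, 5), Clash 3 (24, 5), Sy 0 3 25 5 Bl 25 4 Sh [St 1 5 Rt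
  [Sx 1 3 Bl 2 2 Rt [Sy 2 2 29 1 Bl 0 0 Sh [Clash 3 (22, 0), Clash 3 (22, 0), St 0 0 Rt [Su 11 0 16 5 Sh [Sy 33 2 34 1
  Bl 0 7 Rt [], Sy 33 2 34 1 Bl 0 7 Rt [], Sy 33 2 34 1 Bl 0 7 Rt [], Sy 33 2 34 1 Bl 0 7 Rt [], Sy 33 2 34 1 Bl 0 5 Rt
  []], Su 11 0 16 5 Sh [Sy 33 2 34 1 Bl 0 7 Rt [], Sy 33 2 34 1 Bl 0 7 Rt [], Sy 33 2 34 1 Bl 0 7 Rt [], Sy 33 2 34 1 Bl
  0 7 Rt [], Sy 33 2 34 1 Bl 0 5 Rt []]], Clash 3 (22, 0), St 0 2 Rt [Su 11 0 16 5 Sh [Sy 33 2 34 1 Bl 0 7 Rt [], Sy 33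
  2 34 1 Bl 0 7 Rt [], Sy 33 2 34 1 Bl 0 7 Rt [], Sy 33 2 34 1 Bl 0 7 Rt [], Sy 33 2 34 1 Bl 0 5 Rt []], Su 11 0 16 5 Sh
  [Sy 33 2 34 1 Bl 0 7 Rt [], Sy 33 2 34 1 Bl 0 7 Rt [], Sy 33 2 34 1 Bl 0 7 Rt [], Sy 33 2 34 1 Bl 0 7 Rt [], Sy 33 2
  34 1 Bl 0 5 Rt []]], Clash 0 (19, 1), St 0 7 Rt [Su 11 0 16 5 Sh [Sy 33 2 34 1 Bl 0 7 Rt [], Sy 33 2 34 1 Bl 0 7 Rt
  [], Sy 33 2 34 1 Bl 0 7 Rt [], Sy 33 2 34 1 Bl 0 7 Rt [], Sy 33 2 34 1 Bl 0 5 Rt []], Su 11 0 16 5 Sh [Sy 33 2 34 1 Bl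
  0 7 Rt [], Sy 33 2 34 1 Bl 0 7 Rt [], Sy 33 2 34 1 Bl 0 7 Rt [], Sy 33 2 34 1 Bl 0 7 Rt [], Sy 33 2 34 1 Bl 0 5 Rt
  []]], Clash 0 (19, 1), Clash 0 (19, 1)], Sy 2 2 29 1 Bl 0 3 Bl []], St 0 1 Rt [Sx 2 3 Bl 3 2 Rt [Sy 3 2 30 1 Bl 0 0 Sh
  [Clash 3 (23, 0), Clash 3 (23, 0), St 0 0 Rt [Su 12 0 17 5 Sh [Sy 34 2 35 1 Bl 0 7 Rt [], Sy 34 2 35 1 Bl 0 7 Rt [],
  Sy 34 2 35 1 Bl 0 7 Rt [], Sy 34 2 35 1 Bl 0 7 Rt [], Sy 34 2 35 1 Bl 0 5 Rt []], Su 12 0 17 5 Sh [Sy 34 2 35 1 Bl 0 7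
  Rt [], Sy 34 2 35 1 Bl 0 7 Rt [], Sy 34 2 35 1 Bl 0 7 Rt [], Sy 34 2 35 1 Bl 0 7 Rt [], Sy 34 2 35 1 Bl 0 5 Rt []]],
  Clash 3 (23, 0), St 0 2 Rt [Su 12 0 17 5 Sh [Sy 34 2 35 1 Bl 0 7 Rt [], Sy 34 2 35 1 Bl 0 7 Rt [], Sy 34 2 35 1 Bl 0 7
  Rt [], Sy 34 2 35 1 Bl 0 7 Rt [], Sy 34 2 35 1 Bl 0 5 Rt []], Su 12 0 17 5 Sh [Sy 34 2 35 1 Bl 0 7 Rt [], Sy 34 2 35 1
  Bl 0 7 Rt [], Sy 34 2 35 1 Bl 0 7 Rt [], Sy 34 2 35 1 Bl 0 7 Rt [], Sy 34 2 35 1 Bl 0 5 Rt []]], Clash 0 (20, 1), St 0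
  7 Rt [Su 12 0 17 5 Sh [Sy 34 2 35 1 Bl 0 7 Rt [], Sy 34 2 35 1 Bl 0 7 Rt [], Sy 34 2 35 1 Bl 0 7 Rt [], Sy 34 2 35 1
  Bl 0 7 Rt [], Sy 34 2 35 1 Bl 0 5 Rt []], Su 12 0 17 5 Sh [Sy 34 2 35 1 Bl 0 7 Rt [], Sy 34 2 35 1 Bl 0 7 Rt [], Sy 34
  2 35 1 Bl 0 7 Rt [], Sy 34 2 35 1 Bl 0 7 Rt [], Sy 34 2 35 1 Bl 0 5 Rt []]], Clash 0 (20, 1), Clash 0 (20, 1)], Sy 3 2
  30 1 Bl 0 3 Bl []], Sx 2 3 Bl 3 2 Rt [Sy 3 2 30 1 Bl 0 0 Sh [Clash 3 (23, 0), Clash 3 (23, 0), St 0 0 Rt [Su 12 0 17 5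
  Sh [Sy 34 2 35 1 Bl 0 7 Rt [], Sy 34 2 35 1 Bl 0 7 Rt [], Sy 34 2 35 1 Bl 0 7 Rt [], Sy 34 2 35 1 Bl 0 7 Rt [], Sy 34
  2 35 1 Bl 0 5 Rt []], Su 12 0 17 5 Sh [Sy 34 2 35 1 Bl 0 7 Rt [], Sy 34 2 35 1 Bl 0 7 Rt [], Sy 34 2 35 1 Bl 0 7 Rt
  [], Sy 34 2 35 1 Bl 0 7 Rt [], Sy 34 2 35 1 Bl 0 5 Rt []]], Clash 3 (23, 0), St 0 2 Rt [Su 12 0 17 5 Sh [Sy 34 2 35 1
  Bl 0 7 Rt [], Sy 34 2 35 1 Bl 0 7 Rt [], Sy 34 2 35 1 Bl 0 7 Rt [], Sy 34 2 35 1 Bl 0 7 Rt [], Sy 34 2 35 1 Bl 0 5 Rt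
  []], Su 12 0 17 5 Sh [Sy 34 2 35 1 Bl 0 7 Rt [], Sy 34 2 35 1 Bl 0 7 Rt [], Sy 34 2 35 1 Bl 0 7 Rt [], Sy 34 2 35 1 Bl
  0 7 Rt [], Sy 34 2 35 1 Bl 0 5 Rt []]], Clash 0 (20, 1), St 0 7 Rt [Su 12 0 17 5 Sh [Sy 34 2 35 1 Bl 0 7 Rt [], Sy 34
  2 35 1 Bl 0 7 Rt [], Sy 34 2 35 1 Bl 0 7 Rt [], Sy 34 2 35 1 Bl 0 7 Rt [], Sy 34 2 35 1 Bl 0 5 Rt []], Su 12 0 17 5 Sh
  [Sy 34 2 35 1 Bl 0 7 Rt [], Sy 34 2 35 1 Bl 0 7 Rt [], Sy 34 2 35 1 Bl 0 7 Rt [], Sy 34 2 35 1 Bl 0 7 Rt [], Sy 34 2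
  35 1 Bl 0 5 Rt []]], Clash 0 (20, 1), Clash 0 (20, 1)], Sy 3 2 30 1 Bl 0 3 Bl []]]], St 1 5 Rt [Su 8 0 13 5 Sh [Sy 30
  2 31 1 Bl 0 7 Rt [], Sy 30 2 31 1 Bl 0 7 Rt [], Sy 30 2 31 1 Bl 0 7 Rt [], Sy 30 2 31 1 Bl 0 7 Rt [], Sy 30 2 31 1 Bl
  0 5 Rt []], St 0 1 Rt [Su 9 0 14 5 Sh [Sy 31 2 32 1 Bl 0 7 Rt [], Sy 31 2 32 1 Bl 0 7 Rt [], Sy 31 2 32 1 Bl 0 7 Rt
  [], Sy 31 2 32 1 Bl 0 7 Rt [], Sy 31 2 32 1 Bl 0 5 Rt []], Su 9 0 14 5 Sh [Sy 31 2 32 1 Bl 0 7 Rt [], Sy 31 2 32 1 Bl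
  0 7 Rt [], Sy 31 2 32 1 Bl 0 7 Rt [], Sy 31 2 32 1 Bl 0 7 Rt [], Sy 31 2 32 1 Bl 0 5 Rt []]]]]], St 12 1 Bl [Clash 3
  (0, 2), Sy 1 2 17 0 Sh 0 0 Rt [], Sy 1 2 17 0 Sh 0 7 Rt []], Sy 0 6 16 0 Sh 0 3 Bl []], Sy 25 2 26 1 Bl 0 3 Bl [], Sy
  25 2 26 1 Bl 0 4 Bl []], Sy 0 5 4 2 Sh 0 3 Bl []], Sy 2 0 7 5 Sh 0 0 Rt []], Sx 0 0 Rt 2 1 Bl []], Sy 0 6 5 5 Sh 0 3
  Bl []]]], Sy 0 5 3 2 Sh 0 3 Bl []], Sy 1 4 2 0 Sh 0 0 Sh []]]]], Sx 0 2 Rt 4 0 Rt []], Step [(0, 4), (10, 3)] Bl [((0,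
  0), Rt), ((2, 0), Sh)] []], Sy 9 4 10 0 Sh 0 0 Sh []], St 0 3 Bl [Clash 1 (8, 5), Clash 6 (8, 5)]], Sx 0 2 Rt 1 2 Rt
  []], Sy 0 5 7 2 Sh 0 3 Bl []], Sx 0 0 Sh 8 5 Rt []], Sx 0 3 Bl 1 1 Bl []], Sx 0 0 Rt 0 4 Bl [Sx 0 3 Bl 0 5 Sh [St 4 2
  Rt [Sy 1 3 2 5 Bl 2 4 Sh [Sx 0 3 Bl 2 2 Rt [Step [(5, 5), (7, 1)] Bl [((4, 1), Rt), ((6, 4), Sh)] [Clash 3 (4, 0),
  Clash 3 (4, 0), Sy 0 0 7 5 Rt 0 4 Bl [Su 0 5 8 6 Sh []], Clash 3 (4, 0), Sy 0 4 5 1 Bl 0 0 Rt [Su 12 1 13 0 Rt [Su 1 1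
  7 2 Rt [St 7 6 Rt [Su 4 2 11 5 Rt [Sy 0 0 12 6 Sh 12 3 Bl [], Sx 0 1 Bl 4 5 Rt []], Su 4 2 11 5 Rt [Sy 0 0 12 6 Sh 12
  3 Bl [], Sx 0 1 Bl 4 5 Rt []]], St 2 2 Rt [Su 4 2 11 5 Rt [Sy 0 0 12 6 Sh 12 3 Bl [], Sx 0 1 Bl 4 5 Rt []], Su 4 2 11
  5 Rt [Sy 0 0 12 6 Sh 12 3 Bl [], Sx 0 1 Bl 4 5 Rt []]]], Sx 0 0 Sh 14 5 Rt []]]], Step [(10, 2), (11, 1)] Bl [((0, 3),
  Rt), ((10, 3), Sh)] []], Step [(4, 5), (6, 1)] Bl [((3, 1), Rt), ((5, 4), Sh)] [Clash 3 (3, 0), Clash 3 (3, 0), Sy 0 0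
  6 5 Rt 0 4 Bl [Su 0 5 7 6 Sh []], Clash 3 (3, 0), Sy 0 4 4 1 Bl 0 0 Rt [St 2 2 Rt [Su 12 1 13 0 Rt [Su 2 1 7 2 Rt [St
  7 6 Rt [St 6 1 Rt [Su 6 2 12 5 Rt [Sy 0 0 13 6 Sh 13 3 Bl [], Sx 0 1 Bl 6 5 Rt []], Sx 0 1 Bl 9 0 Sh []], St 6 1 Rt
  [Su 6 2 12 5 Rt [Sy 0 0 13 6 Sh 13 3 Bl [], Sx 0 1 Bl 6 5 Rt []], Sx 0 1 Bl 9 0 Sh []]], St 3 2 Rt [St 6 1 Rt [Su 6 2
  12 5 Rt [Sy 0 0 13 6 Sh 13 3 Bl [], Sx 0 1 Bl 6 5 Rt []], Sx 0 1 Bl 9 0 Sh []], St 6 1 Rt [Su 6 2 12 5 Rt [Sy 0 0 13 6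
  Sh 13 3 Bl [], Sx 0 1 Bl 6 5 Rt []], Sx 0 1 Bl 9 0 Sh []]]], Sx 0 0 Sh 14 5 Rt []], Sx 0 3 Bl 0 5 Sh [Sx 0 2 Rt 6 2 Sh
  [Clash 1 (6, 2), Clash 1 (6, 2), Clash 1 (6, 2), Clash 1 (6, 2), Clash 3 (6, 2)]]]]]], Sx 0 1 Bl 4 5 Rt []]]]]], Clash
  6 (3, 3), Clash 6 (3, 3), Clash 6 (3, 3), Clash 5 (3, 3)]]], St 0 2 Rt [Su 1 5 2 0 Rt [Sy 0 0 2 6 Sh 2 3 Bl [], Sy 0 5
  2 6 Sh 2 3 Bl []], Su 1 5 2 0 Rt [Sy 0 0 2 6 Sh 2 3 Bl [], Sy 0 5 2 6 Sh 2 3 Bl []]], St 0 2 Rt [Su 1 5 2 0 Rt [Su 0 0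
  2 6 Sh [], Su 0 5 2 6 Sh []], Su 1 5 2 0 Rt [Su 0 0 2 6 Sh [], Su 0 5 2 6 Sh []]], Sy 0 4 1 1 Bl 0 0 Rt [Sx 2 3 Rt 2 7
  Sh [St 1 2 Rt [Sy 1 5 4 3 Bl 1 4 Sh [Sy 3 1 5 2 Rt 0 3 Bl [Clash 2 (0, 3)], Sx 0 0 Sh 3 3 Bl [Clash 6 (3, 6)]], Sy 3 5
  4 0 Rt 0 1 Bl []]]], St 0 2 Rt [Su 1 5 2 0 Rt [Su 0 0 2 6 Sh [], Su 0 5 2 6 Sh []], Su 1 5 2 0 Rt [Su 0 0 2 6 Sh [],
  Su 0 5 2 6 Sh []]]]"
  by code_simp

lemma root_C7_1_A1_F: "root_chk C7 A1 False 1 True [Sy 0 2 1 1 Bl 0 3 Sh [Su 1 1 2 0 Rt [St 3 7 Rt [Su 2 6 4 2 Rt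
  [Step [(1, 1), (5, 7)] Sh [((0, 1), Bl), ((5, 3), Rt)] [], Sy 1 1 5 7 Sh 0 0 Rt []], Su 2 6 4 2 Rt [Step [(1, 4), (5,
  7)] Sh [((0, 1), Bl), ((5, 3), Rt)] [], Sy 1 4 5 7 Sh 0 0 Rt []]], Sx 0 0 Sh 3 5 Rt []]], Sy 0 2 1 1 Bl 0 3 Sh [St 0 2
  Rt [St 1 3 Rt [Sy 0 0 2 3 Bl 0 1 Sh [Sx 0 2 Bl 0 3 Sh [Su 0 3 5 0 Rt [Clash 1 (6, 0), Clash 4 (6, 0)]], Sy 4 1 5 0 Rt
  0 2 Rt []], Sx 0 0 Rt 1 0 Sh []], Sy 2 1 3 0 Rt 0 1 Bl []]], Sy 0 2 1 1 Bl 0 3 Sh [Sx 0 1 Rt 0 2 Sh [Sy 0 5 1 1 Bl 0 4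
  Sh [Su 3 1 4 0 Rt [Sy 0 0 4 0 Sh 1 2 Bl [], Sy 0 5 4 0 Sh 1 2 Bl []], Sy 3 1 4 0 Rt 0 2 Rt []]], St 0 2 Rt [St 1 3 Rt
  [Sy 0 0 2 3 Bl 0 1 Sh [Su 4 1 5 0 Rt [Sy 0 0 5 0 Sh 1 2 Bl [], Sy 0 5 5 0 Sh 1 2 Bl []], Sy 4 1 5 0 Rt 0 2 Rt []], Sx
  0 0 Rt 1 0 Sh []], Sy 2 1 3 0 Rt 0 1 Bl []]], Su 0 1 1 0 Rt [St 2 4 Rt [Sy 1 0 2 0 Sh 0 1 Bl [], Sx 0 1 Bl 2 3 Rt []],
  St 2 4 Rt [Sy 1 5 2 0 Sh 0 1 Bl [], Sx 0 1 Bl 2 3 Rt []]], Sy 0 4 1 1 Bl 0 0 Rt [Su 1 5 2 0 Rt [St 3 7 Rt [Su 2 1 4 2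
  Rt [Step [(1, 1), (5, 7)] Sh [((0, 1), Bl), ((5, 3), Rt)] [], Sy 1 1 5 7 Sh 0 0 Rt []], Su 2 1 4 2 Rt [Step [(1, 4),
  (5, 7)] Sh [((0, 1), Bl), ((5, 3), Rt)] [], Sy 1 4 5 7 Sh 0 0 Rt []]], Sx 0 0 Sh 3 5 Rt []]], Sy 0 4 1 1 Bl 0 0 Rt [Su
  1 5 2 0 Rt [St 3 7 Rt [Su 2 1 4 2 Rt [Step [(1, 1), (5, 7)] Sh [((0, 1), Bl), ((5, 3), Rt)] [], Sy 1 1 5 7 Sh 0 0 Rt
  []], Su 2 1 4 2 Rt [Step [(1, 4), (5, 7)] Sh [((0, 1), Bl), ((5, 3), Rt)] [], Sy 1 4 5 7 Sh 0 0 Rt []]], Sx 0 0 Sh 3 5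
  Rt []]], Sy 0 4 1 1 Bl 0 0 Rt [Su 1 5 2 0 Rt [St 3 7 Rt [Su 2 1 4 2 Rt [Step [(1, 1), (5, 7)] Sh [((0, 1), Bl), ((5,
  3), Rt)] [], Sy 1 1 5 7 Sh 0 0 Rt []], Su 2 1 4 2 Rt [Step [(1, 4), (5, 7)] Sh [((0, 1), Bl), ((5, 3), Rt)] [], Sy 1 4
  5 7 Sh 0 0 Rt []]], Sx 0 0 Sh 3 5 Rt []]], Sy 0 4 1 1 Bl 0 0 Rt [Su 1 5 2 0 Rt [St 3 7 Rt [Su 2 1 4 2 Rt [Step [(1,
  1), (5, 7)] Sh [((0, 1), Bl), ((5, 3), Rt)] [], Sy 1 1 5 7 Sh 0 0 Rt []], Su 2 1 4 2 Rt [Step [(1, 4), (5, 7)] Sh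
  [((0, 1), Bl), ((5, 3), Rt)] [], Sy 1 4 5 7 Sh 0 0 Rt []]], Sx 0 0 Sh 3 5 Rt []]]]"
  by code_simp

lemma root_C7_2_A3_T: "root_chk C7 A3 True 2 False [Sx 0 1 Bl 1 3 Rt [], Sx 0 1 Bl 1 3 Rt [], Sx 0 1 Bl 1 3 Rt [], Sx
  0 1 Bl 1 3 Rt [], Sx 0 0 Rt 1 3 Rt [], Sx 0 0 Rt 1 3 Rt [], Sx 0 0 Rt 1 3 Rt [], Sx 0 0 Rt 1 3 Rt []]"
  by code_simp

lemma root_C7_2_A3_F: "root_chk C7 A3 False 2 False [Sx 0 1 Bl 1 3 Rt [], Sx 0 1 Bl 1 3 Rt [], Sx 0 1 Bl 1 3 Rt [], Sx
  0 1 Bl 1 3 Rt [], Sx 0 0 Rt 1 3 Rt [], Sx 0 0 Rt 1 3 Rt [], Sx 0 0 Rt 1 3 Rt [], Sx 0 0 Rt 1 3 Rt []]"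
  by code_simp

lemma root_C7_2_A1_T: "root_chk C7 A1 True 2 False [Sx 0 1 Bl 1 3 Rt [], Sx 0 1 Bl 1 3 Rt [], Sx 0 1 Bl 1 3 Rt [], Sx
  0 1 Bl 1 3 Rt [], Sx 0 0 Rt 1 3 Rt [], Sx 0 0 Rt 1 3 Rt [], Sx 0 0 Rt 1 3 Rt [], Sx 0 0 Rt 1 3 Rt []]"
  by code_simp

lemma root_C7_2_A1_F: "root_chk C7 A1 False 2 False [Sx 0 1 Bl 1 3 Rt [], Sx 0 1 Bl 1 3 Rt [], Sx 0 1 Bl 1 3 Rt [], Sx
  0 1 Bl 1 3 Rt [], Sx 0 0 Rt 1 3 Rt [], Sx 0 0 Rt 1 3 Rt [], Sx 0 0 Rt 1 3 Rt [], Sx 0 0 Rt 1 3 Rt []]"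
  by code_simp

lemma root_C7_3_A1_F: "root_chk C7 A1 False 3 True [Su 0 2 1 3 Bl [], Su 0 2 1 3 Bl [], Sy 0 2 1 3 Bl 0 3 Sh [Sx 0 1
  Rt 0 2 Sh [Sy 0 5 1 1 Bl 0 4 Sh [Su 3 1 4 7 Rt [Su 0 0 4 0 Sh [], Su 0 5 4 0 Sh []], Sy 3 1 4 7 Rt 0 2 Rt []]]], Su 0
  2 1 3 Bl [], Su 0 4 1 3 Bl [], Sy 0 4 1 3 Bl 0 0 Rt [], Su 0 4 1 3 Bl [], Su 0 4 1 3 Bl []]"
  by code_simp

lemma root_C7_4_A1_T: "root_chk C7 A1 True 4 True [Su 0 2 1 4 Bl [], Su 0 2 1 4 Bl [], St 1 0 Rt [Sx 0 0 Sh 1 3 Rt [],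
  Sx 0 3 Bl 1 3 Rt []], Su 0 2 1 4 Bl [], Su 0 4 1 4 Bl [], Sy 0 4 1 4 Bl 0 0 Rt [], Su 0 4 1 4 Bl [], Su 0 4 1 4 Bl
  []]"
  by code_simp

lemmas root_hard = root_C2_0_A2_T root_C2_0_A2_F root_C2_0_A0_T root_C2_0_A0_F root_C2_3_A2_T root_C2_3_A2_F root_C2_3_A0_T root_C2_3_A0_F root_C3_1_A3_T root_C3_1_A3_F root_C3_1_A1_T root_C3_1_A1_F root_C3_2_A3_T root_C3_2_A3_F root_C3_2_A1_T root_C3_2_A1_F root_C4_0_A0_T root_C4_3_A0_T root_C4_3_A0_F root_C4_3_A2_T root_C4_3_A2_F root_C4_6_A0_T root_C4_6_A0_F root_C4_6_A2_T root_C4_6_A2_F root_C5_3_A1_F root_C5_5_A1_T root_C5_5_A1_F root_C5_5_A3_T root_C5_5_A3_F root_C5_6_A1_T root_C5_6_A1_F root_C5_6_A3_T root_C5_6_A3_F root_C6_0_A2_T root_C6_0_A2_F root_C6_0_A0_T root_C6_0_A0_F root_C6_7_A0_F root_C7_1_A3_T root_C7_1_A3_F root_C7_1_A1_T root_C7_1_A1_F root_C7_2_A3_T root_C7_2_A3_F root_C7_2_A1_T root_C7_2_A1_F root_C7_3_A1_F root_C7_4_A1_T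

lemma roots_sound: "(n, l, r, i, b) \<in> set (easy_roots @ hard_roots) \<Longrightarrow> \<exists>cs. root_chk n l r i b cs"
proof -
  assume "(n, l, r, i, b) \<in> set (easy_roots @ hard_roots)"
  then consider "(n, l, r, i, b) \<in> set easy_roots" | "(n, l, r, i, b) \<in> set hard_roots" by auto
  then show ?thesis
  proof cases
    case 1 then show ?thesis using root_easy unfolding list_all_iff by blast
  next
    case 2 then show ?thesis unfolding hard_roots_def list.set insert_iff empty_iff prod.inject
      by (elim disjE) (simp_all only:, (rule exI, rule root_hard)+)
  qed
qed

text \<open>No tile with a determined role, other than those with the right angle at the center, is left out.\<close>

lemma roots_complete:
  "list_all (\<lambda>n. list_all (\<lambda>(j, e). case nthi (role n) j of Some (Some p) \<Rightarrow> ek e = Small \<or> ep e = At Rt \<or>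
      list_all (\<lambda>l. list_all (\<lambda>r. n = C1 \<or> (n, l, r, j, p = PL) \<in> set (easy_roots @ hard_roots)) [True, False]) [nlab n, linc (linc (nlab n))]
    | _ \<Rightarrow> True) (enum 0 (entries n))) [C1, C2, C3, C4, C5, C6, C7]"
  by code_simp

text \<open>The role of a tile is decided by the star at its right angle; where that is not the center, a refutation
  excludes the wrong role.\<close>

lemma root_exists:
  assumes "nthi (entries n) j = Some e" "0 \<le> j" "nthi (role n) j = Some (Some p)" "ek e = Large" "ep e \<noteq> At Rt" "n \<noteq> C1"
    "l = nlab n \<or> l = linc (linc (nlab n))"
  shows "\<exists>cs. root_chk n l r j (p = PL) cs"
proof -
  have "(j, e) \<in> set (enum 0 (entries n))" using assms(1,2) by (simp add: enum_nthi)
  moreover have "n \<in> set [C1, C2, C3, C4, C5, C6, C7]" by (cases n) auto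
  ultimately have "case nthi (role n) j of Some (Some p) \<Rightarrow> ek e = Small \<or> ep e = At Rt \<or>
      list_all (\<lambda>l. list_all (\<lambda>r. n = C1 \<or> (n, l, r, j, p = PL) \<in> set (easy_roots @ hard_roots)) [True, False]) [nlab n, linc (linc (nlab n))]
    | _ \<Rightarrow> True" using roots_complete unfolding list_all_iff by blast
  then have "(n, l, r, j, p = PL) \<in> set (easy_roots @ hard_roots)"
    using assms(3-) by (cases r) auto
  then show ?thesis by (rule roots_sound)
qed

section \<open>Composing legal tilings\<close>

fun sib_index :: "sn \<Rightarrow> int \<times> int" where
  "sib_index C1 = (0, 1)" | "sib_index C3 = (5, 4)" | "sib_index n = (0, 0)"

lemma sib_check:
  "list_all (\<lambda>n. case sib_index n of (i, j) \<Rightarrow> case nthi (entries n) i of None \<Rightarrow> False | Some x \<Rightarrow> case nthi (entries n) j of None \<Rightarrow> False | Some y \<Rightarrow>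
     ek x = Large \<and> ek y = Small \<and>
     fcomp (fcomp (ef y) (finv (fdf PS))) (fdf PL) = ef x \<and> em x SLeg = Of A0 True \<and> em y LLeg = Of A0 True \<and>
     (case em x LLeg of Ax b \<Rightarrow> (case em y SLeg of Ax b' \<Rightarrow> b = (\<not> b') | _ \<Rightarrow> False) | _ \<Rightarrow> False) \<and>
     list_all (\<lambda>e. ep e \<noteq> At Rt \<or> e = x \<or> e = y) (entries n)) [C1, C3]"
  by code_simp

lemma rt_small: "e \<in> set (entries n) \<Longrightarrow> ep e = At Rt \<Longrightarrow> ek e = Small \<Longrightarrow> sibling n"
  by (cases n) (auto simp: sibling_def)

lemma sib_facts:
  assumes "sibling n"
  obtains x y where "x \<in> set (entries n)" "y \<in> set (entries n)" "ek x = Large" "ek y = Small"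
    "fcomp (fcomp (ef y) (finv (fdf PS))) (fdf PL) = ef x" "em x SLeg = Of A0 True" "em y LLeg = Of A0 True"
    "\<And>l r. mv l r (em x LLeg) = (fst (mv l r (em y SLeg)), \<not> snd (mv l r (em y SLeg)))" "em x LLeg \<noteq> NoM" "em y SLeg \<noteq> NoM"
    "\<And>e. e \<in> set (entries n) \<Longrightarrow> ep e = At Rt \<Longrightarrow> ek e = Large \<Longrightarrow> e = x"
    "\<And>e. e \<in> set (entries n) \<Longrightarrow> ep e = At Rt \<Longrightarrow> ek e = Small \<Longrightarrow> e = y"
proof -
  have n: "n \<in> set [C1, C3]" using assms unfolding sibling_def by auto
  obtain i j where ij: "sib_index n = (i, j)" by (cases "sib_index n")
  note sc = bspec[OF sib_check[unfolded list_all_iff[of _ "[C1, C3]"]] n, unfolded ij prod.case]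
  obtain x where x: "nthi (entries n) i = Some x" using sc by (cases "nthi (entries n) i") (simp_all only: option.case)
  note sx = sc[unfolded x option.case]
  obtain y where y: "nthi (entries n) j = Some y" using sx by (cases "nthi (entries n) j") (simp_all only: option.case)
  note c0 = sx[unfolded y option.case]
  have c: "ek x = Large" "ek y = Small" "x \<in> set (entries n)" "y \<in> set (entries n)"
     "fcomp (fcomp (ef y) (finv (fdf PS))) (fdf PL) = ef x" "em x SLeg = Of A0 True" "em y LLeg = Of A0 True"
     "case em x LLeg of Ax b \<Rightarrow> (case em y SLeg of Ax b' \<Rightarrow> b = (\<not> b') | _ \<Rightarrow> False) | _ \<Rightarrow> False"
     "\<forall>e\<in>set (entries n). ep e = At Rt \<longrightarrow> e = x \<or> e = y"
    using c0 nthi_in[OF x] nthi_in[OF y] unfolding list_all_iff by blast+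
  obtain b where b: "em x LLeg = Ax (\<not> b)" "em y SLeg = Ax b"
    using c(8) by (cases "em x LLeg"; cases "em y SLeg") auto
  show thesis
  proof (rule that[OF c(3,4,1,2,5,6,7)])
    show "mv l r (em x LLeg) = (fst (mv l r (em y SLeg)), \<not> snd (mv l r (em y SLeg)))" for l r unfolding b by auto
    show "em x LLeg \<noteq> NoM" "em y SLeg \<noteq> NoM" unfolding b by auto
    show "e = x" if "e \<in> set (entries n)" "ep e = At Rt" "ek e = Large" for e using c(2,9) that by auto
    show "e = y" if "e \<in> set (entries n)" "ep e = At Rt" "ek e = Small" for e using c(1,9) that by auto
  qed
qed

text \<open>The tile \<open>Z\<close> and a small tile of \<open>T\<close> are the two pieces of some large tile.\<close>

definition sibp :: "complex \<Rightarrow> ctile set \<Rightarrow> ctile \<Rightarrow> bool" where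
  "sibp c T Z \<longleftrightarrow> (\<exists>f m. isometry f \<and> parity_ok Large m \<and> piece c PL f m = Z \<and> piece c PS f m \<in> T)"

text \<open>The composition: each large tile whose two parts are both present is restored, and all other large tiles become small
  ones.\<close>

definition compo :: "complex \<Rightarrow> ctile set \<Rightarrow> ctile set" where
  "compo c T = {ct Large f m | f m. isometry f \<and> parity_ok Large m \<and> piece c PL f m \<in> T \<and> piece c PS f m \<in> T} \<union>
     {ct Small f m | f m. isometry f \<and> parity_ok Small m \<and> piece c PU f m \<in> T \<and> \<not> sibp c T (piece c PU f m)}"

lemma four_shift: "(x::4) \<in> {1, 3} \<Longrightarrow> x - 1 \<in> {0, 2}" "(x::4) \<in> {0, 2} \<Longrightarrow> x - 1 \<in> {1, 3}"
  by auto

text \<open>A star \<open>C_1\<close> or \<open>C_3\<close> contains two tiles with the right angle at its center, and they are siblings.\<close>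

lemma siblings_in_star:
  assumes T: "colored_tiling T" and L: "legalat T n l r h" and n: "sibling n"
  shows "\<exists>f m. isometry f \<and> parity_ok Large m \<and> piece c PL f m \<in> T \<and> piece c PS f m \<in> T \<and>
    (\<forall>e\<in>set (entries n). ep e = At Rt \<longrightarrow> ek e = Large \<longrightarrow> tl Large (h \<circ> evf (ef e)) = fst (piece c PL f m)) \<and>
    (\<forall>e\<in>set (entries n). ep e = At Rt \<longrightarrow> ek e = Small \<longrightarrow> tl Small (h \<circ> evf (ef e)) = fst (piece c PS f m))"
proof -
  obtain x y where xy: "x \<in> set (entries n)" "y \<in> set (entries n)" "ek x = Large" "ek y = Small"
    "fcomp (fcomp (ef y) (finv (fdf PS))) (fdf PL) = ef x" "em x SLeg = Of A0 True" "em y LLeg = Of A0 True"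
    "\<And>l r. mv l r (em x LLeg) = (fst (mv l r (em y SLeg)), \<not> snd (mv l r (em y SLeg)))" "em x LLeg \<noteq> NoM" "em y SLeg \<noteq> NoM"
    "\<And>e. e \<in> set (entries n) \<Longrightarrow> ep e = At Rt \<Longrightarrow> ek e = Large \<Longrightarrow> e = x"
    "\<And>e. e \<in> set (entries n) \<Longrightarrow> ep e = At Rt \<Longrightarrow> ek e = Small \<Longrightarrow> e = y"
    by (rule sib_facts[OF n]) (rule that; assumption)
  have h: "isometry h" using L unfolding legalat_def by blast
  obtain mx where mx: "ct Large (h \<circ> evf (ef x)) mx \<in> T" "\<And>s. agr l r (em x s) (mx s)" using L xy(1) unfolding legalat_def xy(3)[symmetric] by blast
  obtain my where my: "ct Small (h \<circ> evf (ef y)) my \<in> T" "\<And>s. agr l r (em y s) (my s)" using L xy(2) unfolding legalat_def xy(4)[symmetric] by blast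
  define P where "P = fcomp (ef y) (finv (fdf PS))"
  define f where "f = drop c (h \<circ> evf P)"
  have f: "isometry f" unfolding f_def by (intro isometry_drop isometry_comp h isometry_evf)
  have lf: "lift c f = h \<circ> evf P" by (simp add: f_def)
  have fx: "lift c f \<circ> df PL = h \<circ> evf (ef x)"
    unfolding lf evf_fdf[symmetric] comp_assoc evf_fcomp[symmetric] P_def xy(5) ..
  have fy: "lift c f \<circ> df PS = h \<circ> evf (ef y)"
    unfolding lf evf_fdf[symmetric] comp_assoc P_def evf_fcomp
    unfolding evf_finv by (simp add: comp_def)
  have px: "parity_ok Large mx" and py: "parity_ok Small my"
    using colored_tilingD(1)[OF T mx(1)] colored_tilingD(1)[OF T my(1)] colored_tile_ct isometry_comp[OF h isometry_evf] by blast+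
  define m where "m s = (case s of Hyp \<Rightarrow> (fst (my SLeg) - 1, snd (my SLeg)) | LLeg \<Rightarrow> (fst (mx Hyp) - 1, \<not> snd (mx Hyp))
     | SLeg \<Rightarrow> (fst (my Hyp) - 1, snd (my Hyp)))" for s
  have e1: "mx SLeg = (0, True)" "my LLeg = (0, True)" using mx(2)[of SLeg] my(2)[of LLeg] xy(6,7) by (auto simp: agr_def)
  have e2: "mx LLeg = (fst (my SLeg), \<not> snd (my SLeg))"
    using mx(2)[of LLeg] my(2)[of SLeg] xy(8-10) by (simp add: agr_def)
  have mL: "pm PL m = mx"
  proof
    fix s show "pm PL m s = mx s" using e1(1) e2 by (cases s) (auto simp: m_def prod_eq_iff)
  qed
  have mS: "pm PS m = my"
  proof
    fix s show "pm PS m s = my s" using e1(2) by (cases s) (auto simp: m_def prod_eq_iff)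
  qed
  have p3: "fst (my SLeg) \<in> {1, 3}" "fst (mx Hyp) \<in> {0, 2}" "fst (my Hyp) \<in> {1, 3}"
    using px py unfolding parity_ok_def all_side by simp_all
  have "parity_ok Large m"
    unfolding parity_ok_def all_side m_def using four_shift(1)[OF p3(1)] four_shift(2)[OF p3(2)] four_shift(1)[OF p3(3)] by simp
  moreover have pL: "piece c PL f m = ct Large (h \<circ> evf (ef x)) mx" and pS: "piece c PS f m = ct Small (h \<circ> evf (ef y)) my"
    unfolding piece_def mL mS fx fy by simp_all
  ultimately show ?thesis using f mx(1) my(1) xy(11,12) by (intro exI[of _ f] exI[of _ m]) auto
qed

lemma ct_same_tile:
  assumes "colored_tiling T" "X \<in> T" "Y \<in> T" "fst X = fst Y" shows "X = Y"
proof -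
  obtain k f m where f: "isometry f" "X = ct k f m" using colored_tileE[OF colored_tilingD(1)[OF assms(1,2)]] by metis
  have "interior (body (fst X)) \<noteq> {}" using ct_interior_nonempty[OF f(1)] f(2) by simp
  then show ?thesis using colored_tilingD(2)[OF assms(1-3)] assms(4) by simp
qed

text \<open>The small part has the right angle at the same vertex, on the other side of the altitude. Among the legal stars exactly
  \<open>C_1\<close> and \<open>C_3\<close> contain such a small tile, and there the marks match those of a cut tile.\<close>

lemma sibp_iff:
  assumes T: "colored_tiling T" and L: "legalat T n l r h" and e: "e \<in> set (entries n)" "ep e = At Rt" "ek e = Large"
    and Z: "ct Large (h \<circ> evf (ef e)) m \<in> T"
  shows "sibp c T (ct Large (h \<circ> evf (ef e)) m) \<longleftrightarrow> sibling n"
proof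
  have h: "isometry h" using L unfolding legalat_def by blast
  {
    assume "sibling n"
    then obtain f m' where f: "isometry f" "parity_ok Large m'" "piece c PL f m' \<in> T" "piece c PS f m' \<in> T"
      "tl Large (h \<circ> evf (ef e)) = fst (piece c PL f m')"
      using siblings_in_star[OF T L] e by blast
    have "ct Large (h \<circ> evf (ef e)) m = piece c PL f m'" by (rule ct_same_tile[OF T Z f(3)]) (simp add: f(5))
    then show "sibp c T (ct Large (h \<circ> evf (ef e)) m)" unfolding sibp_def using f by metis
  next
    assume "sibp c T (ct Large (h \<circ> evf (ef e)) m)"
    then obtain f m' where f: "isometry f" "piece c PL f m' = ct Large (h \<circ> evf (ef e)) m" "piece c PS f m' \<in> T"
      unfolding sibp_def by blast
    have "lift c f \<circ> df PL = h \<circ> evf (ef e)"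
      by (rule ct_eqD(2)[OF isometry_piece[OF f(1)] isometry_comp[OF h isometry_evf] f(2)[unfolded piece_def]])
    then have "lift c f (df PL 0) = h (evf (ef e) 0)" by (metis comp_apply)
    then have 0: "lift c f (df PS 0) = h 0" using entry_ok(2)[OF e(1)] e(2) by (simp add: iso_def)
    have i: "isometry (lift c f \<circ> df PS)" by (rule isometry_piece[OF f(1)])
    have "0 \<in> std Small" using ppt_std(1)[of Small "At Rt"] by simp
    then have "h 0 \<in> body (fst (piece c PS f m'))" unfolding piece_def fst_ct body_tl[OF i] using 0 by (auto intro!: image_eqI[of _ _ 0])
    then obtain e' m2 where e': "e' \<in> set (entries n)" "piece c PS f m' = ct (ek e') (h \<circ> evf (ef e')) m2"
      using L f(3) unfolding legalat_def by blast
    then have k: "ek e' = Small" and g: "lift c f \<circ> df PS = h \<circ> evf (ef e')"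
      using ct_eqD(1,2)[OF i isometry_comp[OF h isometry_evf] e'(2)[unfolded piece_def]] by simp_all
    have "h (evf (ef e') 0) = h 0" using g 0 by (metis comp_apply)
    then have "evf (ef e') 0 = evf (ef e') (ppt Small (ep e'))" using entry_ok(2)[OF e'(1)] k isometry_inj[OF h] by (metis injD)
    then have "ppt Small (At Rt) = ppt Small (ep e')" using isometry_inj[OF isometry_evf, of "ef e'"] by (metis injD ppt.simps(1) proto.simps(1))
    then have "ep e' = At Rt" using ppt_inj[of Small "At Rt" "ep e'"] entry_ok(1)[OF e'(1)] k by simp
    then show "sibling n" using rt_small[OF e'(1)] k by blast
  }
qed

lemma lift_df_eq:
  assumes "isometry f" "isometry f'" "lift c f \<circ> df p = lift c f' \<circ> df p" shows "f = f'"
proof -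
  have "lift c f = lift c f'"
  proof
    fix z
    obtain w where "df p w = z" using isometry_surj[OF isometry_df, of p] by (metis surjD)
    then show "lift c f z = lift c f' z" using fun_cong[OF assms(3), of w] by auto
  qed
  then show ?thesis by (metis lift_drop(2))
qed

lemma piece_eqD:
  assumes "isometry f" "isometry g" "piece c p f m = piece c q g m'"
  shows "pk p = pk q" "lift c f \<circ> df p = lift c g \<circ> df q" "pm p m = pm q m'"
  by (rule ct_eqD[OF isometry_piece[OF assms(1)] isometry_piece[OF assms(2)] assms(3)[unfolded piece_def]])+

lemma pm_inj_Large: "pm PL m = pm PL m' \<Longrightarrow> pm PS m = pm PS m' \<Longrightarrow> m = m'"
proof
  fix s assume a: "pm PL m = pm PL m'" "pm PS m = pm PS m'"
  show "m s = m' s" using fun_cong[OF a(1), of Hyp] fun_cong[OF a(2), of Hyp] fun_cong[OF a(2), of SLeg]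
    by (cases s) (auto simp: prod_eq_iff)
qed

lemma pm_inj_Small: "pm PU m = pm PU m' \<Longrightarrow> m = m'"
proof
  fix s assume a: "pm PU m = pm PU m'"
  show "m s = m' s" using fun_cong[OF a, of s] by (auto simp: prod_eq_iff)
qed

lemma compo_ct:
  assumes "isometry f"
  shows "ct Large f m \<in> compo c T \<longleftrightarrow> parity_ok Large m \<and> piece c PL f m \<in> T \<and> piece c PS f m \<in> T"
    "ct Small f m \<in> compo c T \<longleftrightarrow> parity_ok Small m \<and> piece c PU f m \<in> T \<and> \<not> sibp c T (piece c PU f m)"
proof -
  have e: "ct k f m = ct k' g m' \<longleftrightarrow> k = k' \<and> f = g \<and> m = m'" if "isometry g" for k k' g m'
    using ct_eqD[OF assms that] by blast
  show "ct Large f m \<in> compo c T \<longleftrightarrow> parity_ok Large m \<and> piece c PL f m \<in> T \<and> piece c PS f m \<in> T"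
    "ct Small f m \<in> compo c T \<longleftrightarrow> parity_ok Small m \<and> piece c PU f m \<in> T \<and> \<not> sibp c T (piece c PU f m)"
    unfolding compo_def using e assms by auto
qed

lemma compo_pieces:
  assumes "isometry f" "ct k f m \<in> compo c T" "par p = k" shows "piece c p f m \<in> T"
  using assms compo_ct[OF assms(1), of m c T] by (cases p) auto

lemma compo_colored: "X \<in> compo c T \<Longrightarrow> colored_tile X"
  unfolding compo_def using colored_tile_ct by auto

lemma overlap_pieces:
  assumes f: "isometry f" and g: "isometry g"
    and o: "interior (body (tl k f)) \<inter> interior (body (tl k' g)) \<noteq> {}"
  shows "\<exists>p q. par p = k \<and> par q = k' \<and> interior (body (fst (piece c p f m))) \<inter> interior (body (fst (piece c q g m'))) \<noteq> {}"
proof -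
  have fin: "finite {p. par p = k}" for k
    by (rule finite_subset[of _ "{PL, PS, PU}"]) (auto, metis pc.exhaust)
  let ?H = "homothety c (1 / phi)"
  define W where "W = ?H ` (interior (body (tl k f)) \<inter> interior (body (tl k' g)))"
  have W: "open W" "W \<noteq> {}" unfolding W_def using o by (auto intro: open_homothety_image)
  have "W \<subseteq> \<Union>((\<lambda>p. body (fst (piece c p f m))) ` {p. par p = k})"
    using homothety_image_body[OF f, of c k m] interior_subset[of "body (tl k f)"] unfolding W_def by blast
  from open_subset_finite_Union_meets_interior[OF finite_imageI[OF fin] W this]
  obtain p where p: "par p = k" "W \<inter> interior (body (fst (piece c p f m))) \<noteq> {}" using body_compact by (blast intro: compact_imp_closed)
  have "W \<inter> interior (body (fst (piece c p f m))) \<subseteq> \<Union>((\<lambda>p. body (fst (piece c p g m'))) ` {p. par p = k'})"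
    using homothety_image_body[OF g, of c k' m'] interior_subset[of "body (tl k' g)"] unfolding W_def by blast
  moreover have "open (W \<inter> interior (body (fst (piece c p f m))))" using W by blast
  ultimately obtain q where q: "par q = k'" "(W \<inter> interior (body (fst (piece c p f m)))) \<inter> interior (body (fst (piece c q g m'))) \<noteq> {}"
    using open_subset_finite_Union_meets_interior[OF finite_imageI[OF fin[of k']] _ p(2), of "\<lambda>p. body (fst (piece c p g m'))"]
      body_compact by (blast intro: compact_imp_closed)
  then show ?thesis using p(1) by blast
qed

text \<open>Overlapping tiles would have overlapping pieces (\<open>overlap_pieces\<close>), that is, a common piece. A piece determines
  its parent: if it is a half of a cut tile, the tile it comes from is recovered from the frame.\<close>

lemma colored_tiling_compo:
  assumes T: "colored_tiling T" shows "colored_tiling (compo c T)"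
  unfolding colored_tiling_def
proof (intro conjI ballI pairwiseI)
  fix X assume "X \<in> compo c T" then show "colored_tile X" by (rule compo_colored)
next
  fix X Y assume X: "X \<in> compo c T" and Y: "Y \<in> compo c T" and ne: "X \<noteq> Y"
  obtain k f m where f: "isometry f" "X = ct k f m" using colored_tileE[OF compo_colored[OF X]] by metis
  obtain k' g m' where g: "isometry g" "Y = ct k' g m'" using colored_tileE[OF compo_colored[OF Y]] by metis
  show "disjnt (interior (body (fst X))) (interior (body (fst Y)))"
  proof (rule ccontr)
    assume "\<not> ?thesis"
    then have "interior (body (tl k f)) \<inter> interior (body (tl k' g)) \<noteq> {}" unfolding f(2) g(2) fst_ct disjnt_def .
    from overlap_pieces[OF f(1) g(1) this, of c m m'] obtain p q where pq: "par p = k" "par q = k'"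
      "interior (body (fst (piece c p f m))) \<inter> interior (body (fst (piece c q g m'))) \<noteq> {}" by blast
    have Zp: "piece c p f m \<in> T" and Zq: "piece c q g m' \<in> T"
      using compo_pieces[OF f(1) X[unfolded f(2)] pq(1)] compo_pieces[OF g(1) Y[unfolded g(2)] pq(2)] by auto
    have eq: "piece c p f m = piece c q g m'" by (rule colored_tilingD(2)[OF T Zp Zq pq(3)])
    note d = piece_eqD[OF f(1) g(1) eq]
    have large: "X = Y" if "p = q" "par p = Large"
    proof -
      have fg: "f = g" using lift_df_eq[OF f(1) g(1)] d(2) that by metis
      have "piece c PL f m \<in> T" "piece c PS f m \<in> T" "piece c PL f m' \<in> T" "piece c PS f m' \<in> T"
        using compo_ct(1)[OF f(1)] X Y f(2) g(2) fg pq that by auto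
      then have "piece c PL f m = piece c PL f m'" "piece c PS f m = piece c PS f m'"
        using ct_same_tile[OF T] by (auto simp: piece_def)
      then have "pm PL m = pm PL m'" "pm PS m = pm PS m'" using piece_eqD(3)[OF f(1) f(1)] by blast+
      then have "m = m'" by (rule pm_inj_Large)
      then show ?thesis using f(2) g(2) fg pq that by simp
    qed
    have sib: "sibp c T (piece c PL f m)" if "ct Large f m \<in> compo c T" "isometry f" for f m
      unfolding sibp_def using compo_ct(1)[OF that(2)] that by blast
    show False
    proof (cases "p = q")
      case True
      show ?thesis
      proof (cases "par p")
        case Large then show ?thesis using large True ne by blast
      next
        case Small
        then have p: "p = PU" "q = PU" using True by (cases p; simp)+
        have "f = g" by (rule lift_df_eq[OF f(1) g(1) d(2)[unfolded p]])
        moreover have "m = m'" by (rule pm_inj_Small[OF d(3)[unfolded p]])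
        ultimately have "f = g" "m = m'" by simp_all
        then show ?thesis using ne f(2) g(2) pq True by simp
      qed
    next
      case False
      then consider "p = PL" "q = PU" | "p = PU" "q = PL" using d(1) by (cases p; cases q) auto
      then show ?thesis
      proof cases
        case 1
        then have "sibp c T (piece c PL f m)" "\<not> sibp c T (piece c PU g m')"
          using sib[of f m] X f pq compo_ct(2)[OF g(1)] Y g(2) by auto
        then show ?thesis using eq 1 by simp
      next
        case 2
        then have "sibp c T (piece c PL g m')" "\<not> sibp c T (piece c PU f m)"
          using sib[of g m'] Y g pq compo_ct(2)[OF f(1)] X f(2) by auto
        then show ?thesis using eq 2 by simp
      qed
    qed
  qed
qed

lemma star_at_corner:
  assumes T: "legal_tiling T" and Z: "ct k g m \<in> T" and g: "isometry g"
  shows "\<exists>n l r h e. valid_label n l \<and> legalat T n l r h \<and> h 0 = g (proto k v) \<and> e \<in> set (entries n) \<and> ek e = k \<and> ep e = At v \<and> g = h \<circ> evf (ef e)"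
proof -
  obtain n l r h where L: "valid_label n l" "h 0 = g (proto k v)" "legalat T n l r h"
    using T Z unfolding legal_tiling_def by (metis fst_ct tl_sel(2) comp_apply)
  have h: "isometry h" using L(3) unfolding legalat_def by blast
  have "proto k v \<in> std k" using ppt_std(1)[of k "At v"] by simp
  then have "h 0 \<in> body (fst (ct k g m))" unfolding fst_ct body_tl[OF g] L(2) by blast
  then obtain e m' where e: "e \<in> set (entries n)" "ct k g m = ct (ek e) (h \<circ> evf (ef e)) m'"
    using L(3) Z unfolding legalat_def by blast
  from ct_eqD[OF g isometry_comp[OF h isometry_evf] e(2)] have k: "k = ek e" and F: "g = h \<circ> evf (ef e)" by auto
  have "h (evf (ef e) (proto k v)) = h (evf (ef e) (ppt k (ep e)))" using F L(2) entry_ok(2)[OF e(1)] k by (metis comp_apply)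
  then have "ppt k (At v) = ppt k (ep e)" using isometry_inj[OF h] isometry_inj[OF isometry_evf, of "ef e"] by (metis injD ppt.simps(1))
  then have "ep e = At v" using ppt_inj[of k "At v" "ep e"] entry_ok(1)[OF e(1)] k by simp
  then show ?thesis using L e k F by blast
qed

text \<open>A small tile has a star \<open>C_1\<close> or \<open>C_3\<close> at its right angle, so it is half of a cut tile. A large tile is either such a half or it
  is composed to a small tile.\<close>

lemma compo_covers:
  assumes T: "legal_tiling T" and Z: "Z \<in> T"
  shows "\<exists>p f m. isometry f \<and> ct (par p) f m \<in> compo c T \<and> Z = piece c p f m"
proof -
  have tt: "colored_tiling T" using T unfolding legal_tiling_def by blast
  obtain k g m where g: "isometry g" "Z = ct k g m" "parity_ok k m" using colored_tileE[OF colored_tilingD(1)[OF tt Z]] by metis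
  show ?thesis
  proof (cases k)
    case Small
    obtain n l r h e where L: "legalat T n l r h" "e \<in> set (entries n)" "ek e = k" "ep e = At Rt" "g = h \<circ> evf (ef e)"
      using star_at_corner[OF T Z[unfolded g(2)] g(1), of Rt] by blast
    have "sibling n" using rt_small L Small by blast
    from siblings_in_star[OF tt L(1) this, of c] obtain f m' where f: "isometry f" "parity_ok Large m'" "piece c PL f m' \<in> T" "piece c PS f m' \<in> T"
      "tl Small (h \<circ> evf (ef e)) = fst (piece c PS f m')" using L Small by blast
    have "Z = piece c PS f m'" by (rule ct_same_tile[OF tt Z f(4)]) (simp add: g(2) Small f(5)[symmetric] L(5))
    moreover have "ct (par PS) f m' \<in> compo c T" using compo_ct(1)[OF f(1)] f by simp
    ultimately show ?thesis using f(1) by blast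
  next
    case Large
    show ?thesis
    proof (cases "sibp c T Z")
      case True
      then obtain f m' where f: "isometry f" "parity_ok Large m'" "piece c PL f m' = Z" "piece c PS f m' \<in> T" unfolding sibp_def by blast
      then have "ct (par PL) f m' \<in> compo c T" using compo_ct(1)[OF f(1)] Z by simp
      then show ?thesis using f by blast
    next
      case False
      define f where "f = drop c g"
      define m' where "m' s = (fst (m s) - 1, snd (m s))" for s
      have f: "isometry f" unfolding f_def by (rule isometry_drop[OF g(1)])
      have "pm PU m' = m" by (auto simp: m'_def fun_eq_iff)
      then have p: "piece c PU f m' = Z" unfolding piece_def f_def g(2) Large by (simp add: comp_def)
      have "parity_ok Small m'" using g(3) Large unfolding parity_ok_def all_side m'_def by (auto simp: four_shift)
      then have "ct (par PU) f m' \<in> compo c T" using compo_ct(2)[OF f] p Z False by simp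
      then show ?thesis using f p by metis
    qed
  qed
qed

lemma sigma_compo:
  assumes T: "legal_tiling T" shows "sigma c (compo c T) = T"
proof -
  have S: "sigma c (compo c T) = {piece c p f m | p f m. isometry f \<and> ct (par p) f m \<in> compo c T}"
    by (rule sigma_ct) (rule compo_colored)
  show ?thesis unfolding S using compo_covers[OF T, of _ c] compo_pieces[of _ _ _ c T] by blast
qed

lemma role_rt_check:
  "list_all (\<lambda>(j, e). case nthi (role n) j of Some (Some p) \<Rightarrow> ek e = Small \<or> ep e \<noteq> At Rt \<or> sibling n = (p = PL) | _ \<Rightarrow> True)
     (enum 0 (entries n))"
  by (cases n) (simp_all add: sibling_def)

text \<open>At the center of the star the role can be read off directly, elsewhere it is forced by \<open>root_exists\<close>.\<close>

lemma role_sound: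
  assumes T: "legal_tiling T" and L: "legalat T n l r h" "valid_label n l" "n \<noteq> C1"
    and j: "(j, e) \<in> set (enum 0 (entries n))" "ek e = Large" "nthi (role n) j = Some (Some p)"
    and Z: "ct Large (h \<circ> evf (ef e)) m \<in> T"
  shows "sibp c T (ct Large (h \<circ> evf (ef e)) m) \<longleftrightarrow> p = PL"
proof -
  have tt: "colored_tiling T" using T unfolding legal_tiling_def by blast
  have h: "isometry h" using L(1) unfolding legalat_def by blast
  have jn: "nthi (entries n) j = Some e" "0 \<le> j" using j(1) by (simp_all add: enum_nthi)
  have e: "e \<in> set (entries n)" by (rule nthi_in[OF jn(1)])
  show ?thesis
  proof (cases "ep e = At Rt")
    case True
    have "case nthi (role n) j of Some (Some p) \<Rightarrow> ek e = Small \<or> ep e \<noteq> At Rt \<or> sibling n = (p = PL) | _ \<Rightarrow> True"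
      using role_rt_check[of n] j(1) unfolding list_all_iff by blast
    then have "sibling n = (p = PL)" using j True by simp
    then show ?thesis using sibp_iff[OF tt L(1) e True j(2) Z] by simp
  next
    case False
    obtain l0 where l0: "l = lv l0" "l0 = nlab n \<or> l0 = linc (linc (nlab n))" using L(2) unfolding valid_label_lv by blast
    obtain cs where cs: "root_chk n l0 r j (p = PL) cs" using root_exists[OF jn j(3,2) False L(3) l0(2)] by blast
    from root_chk_sound[OF T L(1)[unfolded l0(1)] jn(1) cs] obtain n' l' r' e' where e': "sibling n' = (p = PL)" "e' \<in> set (entries n')"
      "ek e' = ek e" "ep e' = At Rt" "legalat T n' (lv l') r' (h \<circ> evf (ef e) \<circ> evf (finv (ef e')))" by blast
    have g: "h \<circ> evf (ef e) \<circ> evf (finv (ef e')) \<circ> evf (ef e') = h \<circ> evf (ef e)"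
      unfolding comp_assoc evf_finv by (simp add: comp_def)
    show ?thesis using sibp_iff[OF tt e'(5,2,4), of m c] e'(1,3) j(2) Z unfolding g by simp
  qed
qed

text \<open>The star before \<open>n\<close> under decomposition. Only \<open>C_6\<close> has two predecessors; they differ in the role of its fifth tile, which
  \<open>b\<close> describes.\<close>

fun pre :: "sn \<Rightarrow> bool \<Rightarrow> sn" where
  "pre C2 b = C1" | "pre C3 b = C2" | "pre C4 b = C3" | "pre C5 b = C4" | "pre C6 b = (if b then C7 else C5)"
| "pre C7 b = C6" | "pre C1 b = C1"

lemma nx_pre: "n \<noteq> C1 \<Longrightarrow> nx (pre n b) = n" by (cases n) auto

lemma pre_check:
  "n \<noteq> C1 \<Longrightarrow> list_all2 (\<lambda>q (p, i). case q of Some p' \<Rightarrow> p = p' | None \<Rightarrow> p = (if b then PL else PU)) (role n) (prd (pre n b))"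
  by (cases n; cases b) simp_all

lemma role_small_check:
  "n \<noteq> C1 \<Longrightarrow> list_all2 (\<lambda>q e. (q = None) = (n = C6 \<and> e = entries C6 ! 4) \<and> (q = Some PS) = (ek e = Small)) (role n) (entries n)"
  by (cases n) simp_all

lemma C1_no_acute: "e \<in> set (entries C1) \<Longrightarrow> ep e \<noteq> At Sh \<and> ep e \<noteq> At Bl"
  by auto

lemma valid_label_pre:
  assumes "valid_label n l" "n \<noteq> C1" shows "valid_label (pre n b) (l - 1)"
proof -
  have "of_nat (num (pre n b)) \<in> {of_nat (num n) - 1, of_nat (num n) + (1::4)}" using assms(2) by (cases n; cases b) auto
  moreover have "x + 1 - 2 = x - (1::4)" "x - 1 + 2 = x + (1::4)" "x + 1 + 2 = x - (1::4)" for x :: 4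
  proof -
    have "(3::4) = - 1" by simp
    then show "x + 1 - 2 = x - (1::4)" "x - 1 + 2 = x + (1::4)" "x + 1 + 2 = x - (1::4)" by (auto simp: add.assoc)
  qed
  ultimately show ?thesis using assms(1) unfolding valid_label_def by (auto simp: add.commute add.left_commute diff_add_eq)
qed

lemma rr_rr [simp]: "rr n (rr n r) = r" by (auto simp: rr_def)

lemma list_all2_nthi:
  "list_all2 P xs ys \<Longrightarrow> nthi xs j = Some x \<Longrightarrow> nthi ys j = Some y \<Longrightarrow> P x y"
proof (induction xs ys arbitrary: j rule: list_all2_induct)
  case (Cons x' xs y' ys)
  then show ?case by (cases "j = 0") auto
qed simp

lemma zip_nthi: "length xs = length ys \<Longrightarrow> (x, y) \<in> set (zip xs ys) \<Longrightarrow> \<exists>j. 0 \<le> j \<and> nthi xs j = Some x \<and> nthi ys j = Some y"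
proof (induction xs ys rule: list_induct2)
  case (Cons x' xs y' ys)
  then consider "x = x'" "y = y'" | "(x, y) \<in> set (zip xs ys)" by auto
  then show ?case
  proof cases
    case 1 then show ?thesis by (intro exI[of _ 0]) auto
  next
    case 2
    then obtain j where "0 \<le> j" "nthi xs j = Some x" "nthi ys j = Some y" using Cons.IH by blast
    then show ?thesis by (intro exI[of _ "j + 1"]) auto
  qed
qed simp

lemma nthi_length: "length xs = length ys \<Longrightarrow> nthi xs j = Some x \<Longrightarrow> \<exists>y. nthi ys j = Some y"
  by (induction xs ys arbitrary: j rule: list_induct2) (auto split: if_splits)

text \<open>A vertex of the composition is a vertex of \<open>T\<close> at which the star is not \<open>C_1\<close>, because at a \<open>C_1\<close> the only corners are
  right angles of two halves of a cut tile. All roles in the star are those of a decomposed star, so \<open>legalat_compose\<close> applies.\<close>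

theorem legal_tiling_compo:
  assumes T: "legal_tiling T" shows "legal_tiling (compo c T)"
  unfolding legal_tiling_def
proof (intro conjI ballI allI)
  have tt: "colored_tiling T" using T unfolding legal_tiling_def by blast
  show ctc: "colored_tiling (compo c T)" by (rule colored_tiling_compo[OF tt])
  note SC = sigma_compo[OF T, of c]
  fix X v assume X: "X \<in> compo c T"
  obtain k f m where f: "isometry f" "X = ct k f m" using colored_tileE[OF compo_colored[OF X]] by metis
  obtain p v' where pv: "par p = k" "cpos p (At v) = Some (At v')" "v' = Rt \<longrightarrow> p = PU"
    using that[of PL] that[of PS] that[of PU] by (cases k; cases v) auto
  have Z: "piece c p f m \<in> T" by (rule compo_pieces[OF f(1) X[unfolded f(2)] pv(1)])
  have ig: "isometry (lift c f \<circ> df p)" by (rule isometry_piece[OF f(1)])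
  obtain n l r h e where L: "valid_label n l" "legalat T n l r h" "h 0 = (lift c f \<circ> df p) (proto (pk p) v')"
     "e \<in> set (entries n)" "ek e = pk p" "ep e = At v'" "lift c f \<circ> df p = h \<circ> evf (ef e)"
    using star_at_corner[OF T Z[unfolded piece_def] ig, of v'] by blast
  have h: "isometry h" using L(2) unfolding legalat_def by blast
  have h0: "h 0 = homothety c (1 / phi) (f (proto k v))"
    using L(3) cpos_Some(1)[of p "At v" "At v'"] pv(1,2) by (simp add: lift_df emb_def del: df.simps)
  have n1: "n \<noteq> C1"
  proof
    assume n: "n = C1"
    have "\<not> (ep e = At Sh \<or> ep e = At Bl)" using C1_no_acute L(4) n by blast
    then have v': "v' = Rt" using L(6) by (cases v') auto
    then have p: "p = PU" using pv(3) by simp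
    have k: "k = Small" using p pv(1) by simp
    have "sibp c T (piece c PU f m)"
      using sibp_iff[OF tt L(2,4), of "pm PU m" c] L(5-7) v' p Z n unfolding piece_def by (simp add: sibling_def)
    then show False using compo_ct(2)[OF f(1)] X f(2) k by simp
  qed
  define b where "b \<longleftrightarrow> (\<exists>m. sibp c T (ct Large (h \<circ> evf (ef (entries C6 ! 4))) m) \<and> ct Large (h \<circ> evf (ef (entries C6 ! 4))) m \<in> T)"
  define n0 where "n0 = pre n b"
  have nn: "nx n0 = n" unfolding n0_def by (rule nx_pre[OF n1])
  have "legalat (compo c T) n0 (l - 1) (rr n0 r) (drop c h \<circ> evf (rotn n0))"
  proof (rule legalat_compose[OF ctc])
    show "legalat (sigma c (compo c T)) (nx n0) (l - 1 + 1) (rr n0 (rr n0 r)) h" using L(2) unfolding SC nn by simp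
    fix e' p' i assume z: "(e', p', i) \<in> set (zip (entries (nx n0)) (prd n0))"
    have e': "e' \<in> set (entries n)" using set_zip_leftD[OF z] nn by simp
    obtain j where j: "0 \<le> j" "nthi (entries n) j = Some e'" "nthi (prd n0) j = Some (p', i)"
      using zip_nthi[OF len_prd[symmetric] z] nn by auto
    have rl: "list_all2 (\<lambda>q (p, i). case q of Some p' \<Rightarrow> p = p' | None \<Rightarrow> p = (if b then PL else PU)) (role n) (prd n0)"
      unfolding n0_def by (rule pre_check[OF n1])
    have rs: "list_all2 (\<lambda>q e. (q = None) = (n = C6 \<and> e = entries C6 ! 4) \<and> (q = Some PS) = (ek e = Small)) (role n) (entries n)"
      by (rule role_small_check[OF n1])
    obtain q where q: "nthi (role n) j = Some q" using nthi_length[OF list_all2_lengthD[OF rl, symmetric] j(3)] by blast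
    have qp: "case q of Some p'' \<Rightarrow> p' = p'' | None \<Rightarrow> p' = (if b then PL else PU)" using list_all2_nthi[OF rl q j(3)] by simp
    have qe: "(q = None) = (n = C6 \<and> e' = entries C6 ! 4)" "(q = Some PS) = (ek e' = Small)" using list_all2_nthi[OF rs q j(2)] by blast+
    have pk: "pk p' = ek e'" using prel_zip[OF z] unfolding prel_def by auto
    obtain m' where m': "ct (ek e') (h \<circ> evf (ef e')) m' \<in> T" using L(2) e' unfolding legalat_def by blast
    obtain p2 f2 m2 where p2: "isometry f2" "ct (par p2) f2 m2 \<in> compo c T" "ct (ek e') (h \<circ> evf (ef e')) m' = piece c p2 f2 m2"
      using compo_covers[OF T m', of c] by blast
    from ct_eqD[OF isometry_comp[OF h isometry_evf] isometry_piece[OF p2(1)] p2(3)[unfolded piece_def]]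
    have k2: "ek e' = pk p2" and g2: "h \<circ> evf (ef e') = lift c f2 \<circ> df p2" by auto
    have "p2 = p'"
    proof (cases "ek e'")
      case Small then show ?thesis using pk k2 by (cases p2; cases p') auto
    next
      case Large
      have s2: "sibp c T (ct Large (h \<circ> evf (ef e')) m') \<longleftrightarrow> p2 = PL"
      proof -
        have "p2 = PL \<or> p2 = PU" using Large k2 by (cases p2) auto
        then show ?thesis
        proof
          assume p: "p2 = PL"
          then have "sibp c T (piece c PL f2 m2)" unfolding sibp_def using compo_ct(1)[OF p2(1)] p2 by auto
          then show ?thesis using p p2(3) Large by simp
        next
          assume p: "p2 = PU"
          then have "\<not> sibp c T (piece c PU f2 m2)" using compo_ct(2)[OF p2(1)] p2 by auto
          then show ?thesis using p p2(3) Large by simp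
        qed
      qed
      have "sibp c T (ct Large (h \<circ> evf (ef e')) m') \<longleftrightarrow> p' = PL"
      proof (cases q)
        case (Some q')
        then have "q' = p'" using qp by simp
        then have "nthi (role n) j = Some (Some p')" using q Some by simp
        moreover have "(j, e') \<in> set (enum 0 (entries n))" using j by (simp add: enum_nthi)
        ultimately show ?thesis using role_sound[OF T L(2,1) n1 _ Large _ m'[unfolded Large], of j p' c] by blast
      next
        case None
        then have e4: "e' = entries C6 ! 4" using qe by simp
        have "b \<longleftrightarrow> sibp c T (ct Large (h \<circ> evf (ef e')) m')"
        proof
          assume b
          then obtain m3 where m3: "sibp c T (ct Large (h \<circ> evf (ef e')) m3)" "ct Large (h \<circ> evf (ef e')) m3 \<in> T" unfolding b_def e4 by blast
          have "m3 = m'" using colored_tiling_frame_unique[OF tt isometry_comp[OF h isometry_evf] m3(2)] m' Large by simp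
          then show "sibp c T (ct Large (h \<circ> evf (ef e')) m')" using m3(1) by simp
        next
          assume "sibp c T (ct Large (h \<circ> evf (ef e')) m')" then show b unfolding b_def using m' Large e4 by auto
        qed
        then show ?thesis using qp None by auto
      qed
      then have "p2 = PL \<longleftrightarrow> p' = PL" using s2 by simp
      then show ?thesis using Large k2 pk by (cases p2; cases p') auto
    qed
    then show "\<exists>f m. isometry f \<and> ct (par p') f m \<in> compo c T \<and> lift c f \<circ> df p' = h \<circ> evf (ef e')"
      using p2 g2 by metis
  qed
  moreover have "valid_label n0 (l - 1)" unfolding n0_def by (rule valid_label_pre[OF L(1) n1])
  moreover have "(drop c h \<circ> evf (rotn n0)) 0 = vert (fst X) v"
    using h0 f(2) by (simp add: rotn_facts(1) drop_def del: evf.simps)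
  ultimately show "\<exists>n l r h. valid_label n l \<and> h 0 = vert (fst X) v \<and> legalat (compo c T) n l r h" by blast
qed

section \<open>Local structure of a tiling\<close>

text \<open>A ball around the centroid fits into every tile. This makes centroids of different tiles keep a fixed distance.\<close>

lemma inradius:
  obtains \<rho> where "\<rho> > 0" "\<And>k z. dist z (centroid k) < \<rho> \<Longrightarrow> z \<in> interior (std k)"
proof -
  have c: "centroid k \<in> interior (std k)" for k unfolding interior_std by simp
  obtain \<rho>1 where r1: "\<rho>1 > 0" "ball (centroid Large) \<rho>1 \<subseteq> interior (std Large)" by (rule openE[OF open_interior c])
  obtain \<rho>2 where r2: "\<rho>2 > 0" "ball (centroid Small) \<rho>2 \<subseteq> interior (std Small)" by (rule openE[OF open_interior c])
  have in_int: "z \<in> interior (std k)" if "dist z (centroid k) < min \<rho>1 \<rho>2" for k z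
  proof (cases k)
    case Large
    then have "z \<in> ball (centroid Large) \<rho>1" using that by (simp add: dist_commute)
    then show ?thesis using r1(2) Large by blast
  next
    case Small
    then have "z \<in> ball (centroid Small) \<rho>2" using that by (simp add: dist_commute)
    then show ?thesis using r2(2) Small by blast
  qed
  show thesis
  proof (rule that)
    show "0 < min \<rho>1 \<rho>2" using r1(1) r2(1) by simp
  qed (rule in_int)
qed

lemma std_bounded: "z \<in> std k \<Longrightarrow> dist z (centroid k) \<le> 2"
proof -
  have P: "dist (proto k v) (proto k w) \<le> 2" for k v w
  proof -
    have "cmod (proto k v) \<le> 1" for v
      using phi_lt1 power_le_one[of phi 2] power_le_one[of phi 3] power_le_one[of phi 4] power_le_one[of phi 6] by (cases k; cases v) (auto simp: complex_norm abs_of_nonneg less_imp_le)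
    then show ?thesis using norm_triangle_ineq4[of "proto k v" "proto k w"] unfolding dist_norm by (smt (verit))
  qed
  assume z: "z \<in> std k"
  have c: "centroid k \<in> std k" by (simp add: std_def)
  have "std k \<subseteq> cball (proto k v) 2" for v
    unfolding convex_hull_proto[symmetric] by (rule hull_minimal) (use P in \<open>auto simp: convex_cball\<close>)
  then have "dist (proto k v) z \<le> 2" for v using z by (meson mem_cball subsetD)
  then have "range (proto k) \<subseteq> cball z 2" by (auto simp: dist_commute)
  then have "std k \<subseteq> cball z 2" unfolding convex_hull_proto[symmetric] by (rule hull_minimal) (rule convex_cball)
  then show ?thesis using c by auto
qed

text \<open>The centroids of the tiles in question form a bounded set of points with a fixed minimal distance.\<close>

lemma finitely_many_tiles_meet_ball:
  assumes T: "colored_tiling T"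
  shows "finite {X \<in> T. body (fst X) \<inter> cball z r \<noteq> {}}" (is "finite ?F")
proof -
  obtain \<rho> where \<rho>: "\<rho> > 0" "\<And>k z. dist z (centroid k) < \<rho> \<Longrightarrow> z \<in> interior (std k)" by (rule inradius) (rule that; assumption)
  have "\<forall>X\<in>T. \<exists>p. \<exists>k f m. isometry f \<and> X = ct k f m \<and> p = f (centroid k)"
  proof
    fix X assume "X \<in> T"
    show "\<exists>p. \<exists>k f m. isometry f \<and> X = ct k f m \<and> p = f (centroid k)"
      by (rule colored_tileE[OF colored_tilingD(1)[OF T \<open>X \<in> T\<close>]]) blast
  qed
  from bchoice[OF this] obtain p where p: "\<And>X. X \<in> T \<Longrightarrow> \<exists>k f m. isometry f \<and> X = ct k f m \<and> p X = f (centroid k)" by blast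
  have inner: "w \<in> interior (body (fst X))" if X: "X \<in> T" and w: "dist w (p X) < \<rho>" for X w
  proof -
    obtain k f m where f: "isometry f" "X = ct k f m" "p X = f (centroid k)" using p[OF X] by blast
    have "dist (inv f w) (centroid k) = dist (f (inv f w)) (f (centroid k))" using f(1) unfolding isometry_def by simp
    then have "dist (inv f w) (centroid k) < \<rho>" using w unfolding isometry_inv_comp(2)[OF f(1)] f(3) by simp
    then have "inv f w \<in> interior (std k)" by (rule \<rho>(2))
    then have "f (inv f w) \<in> f ` interior (std k)" by (rule imageI)
    then show ?thesis unfolding isometry_inv_comp(2)[OF f(1)] f(2) fst_ct body_tl[OF f(1)] isometry_interior[OF f(1)] .
  qed
  have sep: "X = Y" if "X \<in> T" "Y \<in> T" "dist (p X) (p Y) < \<rho>" for X Y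
  proof (rule colored_tilingD(2)[OF T that(1,2)])
    have "p X \<in> interior (body (fst X))" using inner[OF that(1), of "p X"] \<rho>(1) by simp
    moreover have "p X \<in> interior (body (fst Y))" by (rule inner[OF that(2,3)])
    ultimately show "interior (body (fst X)) \<inter> interior (body (fst Y)) \<noteq> {}" by blast
  qed
  have "uniform_discrete (p ` ?F)"
    unfolding uniform_discrete_def using sep \<rho>(1) by (intro exI[of _ \<rho>]) auto
  moreover have "bounded (p ` ?F)"
    unfolding bounded_def
  proof (intro exI[of _ z] exI[of _ "r + 2"] ballI)
      fix x assume "x \<in> p ` ?F"
      then obtain X where X0: "X \<in> T" "x = p X" "body (fst X) \<inter> cball z r \<noteq> {}" by blast
      from X0(3) obtain w where "w \<in> body (fst X)" "w \<in> cball z r" by blast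
      note X = X0(1,2) this(1) this(2)[unfolded mem_cball]
      obtain k f m where f: "isometry f" "X = ct k f m" "p X = f (centroid k)" using p[OF X(1)] by blast
      obtain v where v: "v \<in> std k" "w = f v" using X(3) f by (auto simp: body_tl)
      have "dist w x = dist v (centroid k)" using f(1) unfolding v(2) X(2) f(3) isometry_def by simp
      then have "dist w x \<le> 2" using std_bounded[OF v(1)] by simp
      then show "dist z x \<le> r + 2" using X(4) dist_triangle[of z x w] by linarith
  qed
  ultimately have "finite (p ` ?F)" using uniform_discrete_finite_iff by blast
  moreover have "inj_on p ?F" using sep \<rho>(1) by (intro inj_onI) auto
  ultimately show ?thesis by (rule finite_imageD)
qed

text \<open>Finitely many tiles come near the point, and those that do not contain it have a positive distance.\<close>

lemma ball_meets_only_tiles_containing: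
  assumes T: "colored_tiling T"
  obtains e where "e > 0" "\<And>X. X \<in> T \<Longrightarrow> body (fst X) \<inter> ball z e \<noteq> {} \<Longrightarrow> z \<in> body (fst X)"
proof -
  define F where "F = {X \<in> T. body (fst X) \<inter> cball z 1 \<noteq> {} \<and> z \<notin> body (fst X)}"
  have fin: "finite F" unfolding F_def by (rule finite_subset[OF _ finitely_many_tiles_meet_ball[OF T, of z 1]]) auto
  have "closed (\<Union>X\<in>F. body (fst X))" using fin body_compact by (auto intro: compact_imp_closed)
  moreover have "z \<notin> (\<Union>X\<in>F. body (fst X))" unfolding F_def by auto
  ultimately obtain e where e: "e > 0" "ball z e \<inter> (\<Union>X\<in>F. body (fst X)) = {}"
    by (metis Compl_iff closed_def disjoint_eq_subset_Compl open_contains_ball)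
  show thesis
  proof (rule that[of "min e 1"])
    fix X assume X: "X \<in> T" "body (fst X) \<inter> ball z (min e 1) \<noteq> {}"
    show "z \<in> body (fst X)"
    proof (rule ccontr)
      assume "z \<notin> body (fst X)"
      moreover have "body (fst X) \<inter> cball z 1 \<noteq> {}" using X(2) by force
      ultimately have "X \<in> F" using X(1) unfolding F_def by blast
      then show False using e(2) X(2) by force
    qed
  qed (use e in auto)
qed

lemma complete_star_iff:
  assumes "colored_tiling T"
  shows "complete_star A (star T A) \<longleftrightarrow> A \<in> interior (support T)"
proof -
  have U: "(\<Union>X\<in>star T A. body (fst X)) = (\<Union>X\<in>{X\<in>T. A \<in> body (fst X)}. body (fst X))"
    unfolding star_def by force
  obtain e where e: "e > 0" "\<And>X. X \<in> T \<Longrightarrow> body (fst X) \<inter> ball A e \<noteq> {} \<Longrightarrow> A \<in> body (fst X)"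
    using ball_meets_only_tiles_containing[OF assms] by blast
  have "A \<in> interior (\<Union>X\<in>{X\<in>T. A \<in> body (fst X)}. body (fst X))" if "A \<in> interior (support T)"
  proof -
    have "interior (support T) \<inter> ball A e \<subseteq> (\<Union>X\<in>{X\<in>T. A \<in> body (fst X)}. body (fst X))"
      using e(2) interior_subset[of "support T"] unfolding support_def by blast
    then have "interior (support T) \<inter> ball A e \<subseteq> interior (\<Union>X\<in>{X\<in>T. A \<in> body (fst X)}. body (fst X))"
      by (rule interior_maximal) auto
    then show ?thesis using that e(1) by auto
  qed
  moreover have "(\<Union>X\<in>{X\<in>T. A \<in> body (fst X)}. body (fst X)) \<subseteq> support T" unfolding support_def by blast
  ultimately show ?thesis unfolding complete_star_def U using interior_mono by blast
qed

text \<open>A further tile at the point would have interior points in the neighborhood that the patch covers, so it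
  would overlap a tile of the patch.\<close>

lemma tiles_at_point_in_patch:
  assumes T: "colored_tiling T" and P: "P \<subseteq> T" "finite P" and A: "A \<in> interior (support P)" and X: "X \<in> T" "A \<in> body (fst X)"
  shows "X \<in> P"
proof -
  obtain k f m where f: "isometry f" "X = ct k f m" using colored_tileE[OF colored_tilingD(1)[OF T X(1)]] by metis
  define W where "W = interior (support P) \<inter> interior (body (fst X))"
  have "W \<noteq> {}" unfolding W_def using open_meets_interior[OF f(1) open_interior, of "support P" k] A X(2) f(2) by auto
  moreover have "W \<subseteq> \<Union>((\<lambda>X. body (fst X)) ` P)" unfolding W_def support_def using interior_subset by blast
  moreover have "open W" unfolding W_def by auto
  ultimately obtain Y where Y: "Y \<in> P" "W \<inter> interior (body (fst Y)) \<noteq> {}"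
    using open_subset_finite_Union_meets_interior[OF finite_imageI[OF P(2)], of W "\<lambda>X. body (fst X)"] body_compact by (blast intro: compact_imp_closed)
  then have "X = Y" using colored_tilingD(2)[OF T X(1), of Y] P(1) unfolding W_def by blast
  then show ?thesis using Y by simp
qed

text \<open>The relative interior of a side.\<close>

definition on_side :: "kind \<Rightarrow> side \<Rightarrow> complex \<Rightarrow> bool" where
  "on_side k s z \<longleftrightarrow> bary k (opp s) z = 0 \<and> (\<forall>v. v \<noteq> opp s \<longrightarrow> 0 < bary k v z)"

lemma std_cases:
  assumes "z \<in> std k"
  obtains "z \<in> interior (std k)" | s where "on_side k s z" | v where "z = proto k v"
proof (cases "z \<in> interior (std k)")
  case False
  have nn: "0 \<le> bary k v z" for v using assms by (simp add: std_def)
  have S: "bary k Rt z + bary k Sh z + bary k Bl z = 1" by (rule bary_sum)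
  note C = bary_combine[of z k]
  have "(\<exists>s. on_side k s z) \<or> (\<exists>v. z = proto k v)"
  proof (cases "bary k Rt z = 0"; cases "bary k Sh z = 0"; cases "bary k Bl z = 0")
    assume "bary k Rt z = 0" "bary k Sh z = 0" "bary k Bl z = 0" then show ?thesis using S by linarith
  next
    assume a: "bary k Rt z = 0" "bary k Sh z = 0" "bary k Bl z \<noteq> 0"
    then have "bary k Bl z = 1" using S by linarith
    then have "z = proto k Bl" using C a(1,2) by (metis add_0 scaleR_one scaleR_zero_left)
    then show ?thesis by blast
  next
    assume a: "bary k Rt z = 0" "bary k Sh z \<noteq> 0" "bary k Bl z = 0"
    then have "bary k Sh z = 1" using S by linarith
    then have "z = proto k Sh" using C a(1,3) by (metis add_0 add_0_right scaleR_one scaleR_zero_left)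
    then show ?thesis by blast
  next
    assume a: "bary k Rt z \<noteq> 0" "bary k Sh z = 0" "bary k Bl z = 0"
    then have "bary k Rt z = 1" using S by linarith
    then have "z = proto k Rt" using C a(2,3) by (metis add_0_right scaleR_one scaleR_zero_left)
    then show ?thesis by blast
  next
    assume a: "bary k Rt z = 0" "bary k Sh z \<noteq> 0" "bary k Bl z \<noteq> 0"
    then have "on_side k Hyp z" using nn unfolding on_side_def all_corner opp.simps by (metis less_le)
    then show ?thesis by blast
  next
    assume a: "bary k Rt z \<noteq> 0" "bary k Sh z = 0" "bary k Bl z \<noteq> 0"
    then have "on_side k SLeg z" using nn unfolding on_side_def all_corner opp.simps by (metis less_le)
    then show ?thesis by blast
  next
    assume a: "bary k Rt z \<noteq> 0" "bary k Sh z \<noteq> 0" "bary k Bl z = 0"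
    then have "on_side k LLeg z" using nn unfolding on_side_def all_corner opp.simps by (metis less_le)
    then show ?thesis by blast
  next
    assume a: "bary k Rt z \<noteq> 0" "bary k Sh z \<noteq> 0" "bary k Bl z \<noteq> 0"
    then have "0 < bary k v z" for v using nn by (cases v) (simp_all add: less_le del: bary.simps)
    then show ?thesis using False by (simp add: interior_std)
  qed
  then show thesis using that by blast
qed (use that in blast)

text \<open>The gradient of a barycentric coordinate.\<close>

definition nrm :: "kind \<Rightarrow> corner \<Rightarrow> complex" where
  "nrm k v = (case v of Rt \<Rightarrow> Complex (- 1 / side_len k LLeg) (- 1 / side_len k SLeg)
     | Sh \<Rightarrow> Complex (1 / side_len k LLeg) 0 | Bl \<Rightarrow> Complex 0 (1 / side_len k SLeg))"

lemma bary_nrm: "bary k v w = bary k v z + nrm k v \<bullet> (w - z)"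
  by (cases v) (auto simp: nrm_def inner_complex_def add_divide_distrib diff_divide_distrib algebra_simps)

text \<open>Near a relatively interior point of a side only one of the three inequalities matters.\<close>

lemma half_plane:
  assumes f: "isometry f" and z: "on_side k s z"
  obtains n e where "n \<noteq> 0" "e > 0" "\<And>w. dist w (f z) < e \<Longrightarrow> w \<in> body (tl k f) \<longleftrightarrow> 0 \<le> n \<bullet> (w - f z)"
    "\<And>w. dist w (f z) < e \<Longrightarrow> w \<in> interior (body (tl k f)) \<longleftrightarrow> 0 < n \<bullet> (w - f z)"
    "\<And>w. dist w (f z) < e \<Longrightarrow> w \<in> side_of (tl k f) s \<longleftrightarrow> 0 = n \<bullet> (w - f z)"
    "\<And>w. w \<in> side_of (tl k f) s \<Longrightarrow> 0 = n \<bullet> (w - f z)"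
proof -
  define g where "g = inv f"
  have g: "isometry g" "\<And>w. f (g w) = w" "\<And>w. g (f w) = w" unfolding g_def by (rule isometry_inv[OF f], rule isometry_inv_comp(2)[OF f], rule isometry_inv_comp(1)[OF f])
  define m where "m = nrm k (opp s)"
  obtain n where n: "\<And>x. m \<bullet> ilin g x = n \<bullet> x" 
  proof -
    have lin: "linear (\<lambda>x. m \<bullet> ilin g x)"
      by (rule linear_compose[OF isometry_linear(1)[OF g(1)] bounded_linear.linear[OF bounded_linear_inner_right], unfolded comp_def])
    define n where "n = Complex (m \<bullet> ilin g 1) (m \<bullet> ilin g \<i>)"
    have "m \<bullet> ilin g x = n \<bullet> x" for x
    proof -
      have "m \<bullet> ilin g (Re x *\<^sub>R 1 + Im x *\<^sub>R \<i>) = Re x * (m \<bullet> ilin g 1) + Im x * (m \<bullet> ilin g \<i>)"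
        using linear_add[OF lin, of "Re x *\<^sub>R 1" "Im x *\<^sub>R \<i>"] linear_scale[OF lin, of "Re x" 1] linear_scale[OF lin, of "Im x" \<i>] by simp
      moreover have "Re x *\<^sub>R 1 + Im x *\<^sub>R \<i> = x" by (simp add: complex_eq_iff)
      ultimately have "m \<bullet> ilin g x = Re x * (m \<bullet> ilin g 1) + Im x * (m \<bullet> ilin g \<i>)" by simp
      then show ?thesis by (simp add: n_def inner_complex_def mult.commute)
    qed
    then show thesis by (rule that)
  qed
  have gd: "g w - g u = ilin g (w - u)" for w u
  proof -
    have "g w = g 0 + ilin g w" "g u = g 0 + ilin g u" by (simp_all add: ilin_def)
    then show ?thesis using linear_diff[OF isometry_linear(1)[OF g(1)], of w u] by simp
  qed
  have B: "bary k (opp s) (g w) = n \<bullet> (w - f z)" for w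
    using bary_nrm[of k "opp s" "g w" z] z gd[of w "f z"] n g(3) unfolding on_side_def m_def by simp
  have n0: "n \<noteq> 0"
  proof
    assume "n = 0"
    then have "bary k (opp s) (g (f (centroid k))) = 0" unfolding B by simp
    then show False unfolding g(3) by simp
  qed
  define V where "V = {w. \<forall>v. v \<noteq> opp s \<longrightarrow> 0 < bary k v w}"
  have "open V"
  proof -
    have "V = (\<Inter>v\<in>-{opp s}. {w. 0 < bary k v w})" unfolding V_def by auto
    moreover have "open {w. 0 < bary k v w}" for v by (intro open_Collect_less continuous_on_const continuous_bary)
    moreover have "finite (-{opp s})" by (rule finite_subset[OF subset_UNIV]) (simp add: corner_UNIV)
    ultimately show ?thesis by (simp add: open_INT)
  qed
  moreover have "z \<in> V" using z unfolding V_def on_side_def by auto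
  ultimately obtain e where e: "e > 0" "ball z e \<subseteq> V" by (rule openE)
  have near: "\<forall>v. v \<noteq> opp s \<longrightarrow> 0 < bary k v (g w)" if "dist w (f z) < e" for w
  proof -
    have "dist (g w) (g (f z)) = dist w (f z)" using g(1) unfolding isometry_def by simp
    then have "g w \<in> ball z e" using that unfolding g(3) by (simp add: dist_commute)
    then show ?thesis using e(2) unfolding V_def by blast
  qed
  have mem: "w \<in> f ` S \<longleftrightarrow> g w \<in> S" for w S
  proof
    assume "w \<in> f ` S" then show "g w \<in> S" using g(3) by auto
  next
    assume "g w \<in> S" then have "f (g w) \<in> f ` S" by (rule imageI) then show "w \<in> f ` S" unfolding g(2) .
  qed
  have nonneg: "(\<forall>c. 0 \<le> b c) \<longleftrightarrow> 0 \<le> b d" if "\<forall>v. v \<noteq> d \<longrightarrow> 0 < b v" for b :: "corner \<Rightarrow> real" and d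
    using that by (metis less_imp_le)
  have pos: "(\<forall>c. 0 < b c) \<longleftrightarrow> 0 < b d" if "\<forall>v. v \<noteq> d \<longrightarrow> 0 < b v" for b :: "corner \<Rightarrow> real" and d
    using that by metis
  show thesis
  proof (rule that[OF n0 e(1)])
    fix w assume d: "dist w (f z) < e"
    show "w \<in> body (tl k f) \<longleftrightarrow> 0 \<le> n \<bullet> (w - f z)"
      unfolding body_tl[OF f] mem B[symmetric] std_def mem_Collect_eq by (rule nonneg[OF near[OF d]])
    show "w \<in> interior (body (tl k f)) \<longleftrightarrow> 0 < n \<bullet> (w - f z)"
      unfolding interior_body[OF f] mem B[symmetric] mem_Collect_eq by (rule pos[OF near[OF d]])
    show "w \<in> side_of (tl k f) s \<longleftrightarrow> 0 = n \<bullet> (w - f z)"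
      unfolding side_of_tl(1)[OF f] mem B[symmetric] mem_Collect_eq std_def nonneg[OF near[OF d]] by auto
  next
    fix w assume "w \<in> side_of (tl k f) s"
    then show "0 = n \<bullet> (w - f z)" unfolding side_of_tl(1)[OF f] mem B[symmetric] mem_Collect_eq by simp
  qed
qed

lemma opposite_half_planes:
  fixes n m :: complex
  assumes "n \<noteq> 0" "m \<noteq> 0" and d: "\<And>w. 0 < n \<bullet> w \<Longrightarrow> 0 < m \<bullet> w \<Longrightarrow> False"
  shows "n \<bullet> w = 0 \<Longrightarrow> m \<bullet> w = 0" "n \<bullet> w < 0 \<Longrightarrow> 0 < m \<bullet> w" "0 < n \<bullet> w \<Longrightarrow> m \<bullet> w < 0"
proof -
  have nn: "0 < n \<bullet> n" using assms(1) by simp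
  have par0: "\<not> 0 < m \<bullet> w" if "n \<bullet> w = 0" for w
  proof
    assume a: "0 < m \<bullet> w"
    obtain t where t: "t = (1 + \<bar>m \<bullet> n\<bar>) / (m \<bullet> w)" by simp
    have "m \<bullet> (t *\<^sub>R w + n) = 1 + \<bar>m \<bullet> n\<bar> + m \<bullet> n" using a t by (simp add: inner_add_right)
    moreover have "n \<bullet> (t *\<^sub>R w + n) = n \<bullet> n" using that by (simp add: inner_add_right)
    ultimately show False using d[of "t *\<^sub>R w + n"] nn by (smt (verit))
  qed
  have par: "m \<bullet> w = 0" if "n \<bullet> w = 0" for w
    using par0[OF that] par0[of "- w"] that by (simp add: not_less)
  then show "n \<bullet> w = 0 \<Longrightarrow> m \<bullet> w = 0" .
  define \<alpha> where "\<alpha> = (m \<bullet> n) / (n \<bullet> n)"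
  have al: "m \<bullet> w = \<alpha> * (n \<bullet> w)" for w
  proof -
    have "n \<bullet> (w - ((n \<bullet> w) / (n \<bullet> n)) *\<^sub>R n) = 0" using nn by (simp add: inner_diff_right)
    from par[OF this] show ?thesis unfolding \<alpha>_def by (simp add: inner_diff_right field_simps)
  qed
  have "\<alpha> \<noteq> 0" using al[of m] assms(2) by auto
  moreover have "\<not> \<alpha> > 0" using d[OF nn] al[of n] nn by (metis mult_pos_pos)
  ultimately have "\<alpha> < 0" by linarith
  then show "n \<bullet> w < 0 \<Longrightarrow> 0 < m \<bullet> w" "0 < n \<bullet> w \<Longrightarrow> m \<bullet> w < 0" unfolding al by (auto simp: mult_neg_neg mult_neg_pos)
qed

definition isvert :: "ctile set \<Rightarrow> complex \<Rightarrow> bool" where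
  "isvert T A \<longleftrightarrow> (\<exists>X\<in>T. A \<in> range (vert (fst X)))"

text \<open>Near the point each tile is a half-plane whose boundary contains the point. Disjoint open half-planes with a common
  boundary point are opposite to each other, so there are at most two tiles, and one alone does not cover a neighborhood.\<close>

lemma tile_across:
  assumes T: "colored_tiling T" and A: "A \<in> interior (support T)" "\<not> isvert T A"
    and X: "ct k f m \<in> T" "isometry f" "A = f z" "on_side k s z"
  obtains k' f' m' s' z' where "ct k' f' m' \<in> T" "isometry f'" "A = f' z'" "on_side k' s' z'" "ct k' f' m' \<noteq> ct k f m"
    "\<And>Y. Y \<in> T \<Longrightarrow> A \<in> body (fst Y) \<Longrightarrow> Y = ct k f m \<or> Y = ct k' f' m'"
    "\<exists>n e. n \<noteq> 0 \<and> e > 0 \<and> (\<forall>w. dist w A < e \<longrightarrow> (w \<in> side_of (tl k f) s \<longleftrightarrow> n \<bullet> (w - A) = 0) \<and> (w \<in> side_of (tl k' f') s' \<longleftrightarrow> n \<bullet> (w - A) = 0))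
       \<and> (\<forall>w. w \<in> side_of (tl k f) s \<or> w \<in> side_of (tl k' f') s' \<longrightarrow> n \<bullet> (w - A) = 0)"
proof -
  obtain n e where n: "n \<noteq> 0" "e > 0" "\<And>w. dist w A < e \<Longrightarrow> w \<in> body (tl k f) \<longleftrightarrow> 0 \<le> n \<bullet> (w - A)"
    "\<And>w. dist w A < e \<Longrightarrow> w \<in> interior (body (tl k f)) \<longleftrightarrow> 0 < n \<bullet> (w - A)"
    "\<And>w. dist w A < e \<Longrightarrow> w \<in> side_of (tl k f) s \<longleftrightarrow> 0 = n \<bullet> (w - A)"
    "\<And>w. w \<in> side_of (tl k f) s \<Longrightarrow> 0 = n \<bullet> (w - A)"
    by (rule half_plane[OF X(2,4), folded X(3)]) (rule that; assumption)
  define G where "G Y k' f' m' s' z' n' e' \<longleftrightarrow> Y = ct k' f' m' \<and> isometry f' \<and> A = f' z' \<and> on_side k' s' z' \<and> e' > 0 \<and>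
      (\<forall>w. dist w A < e' \<longrightarrow> (w \<in> interior (body (tl k' f')) \<longleftrightarrow> 0 < n' \<bullet> (w - A)) \<and> (w \<in> side_of (tl k' f') s' \<longleftrightarrow> 0 = n' \<bullet> (w - A))) \<and>
      (\<forall>w. w \<in> side_of (tl k' f') s' \<longrightarrow> 0 = n' \<bullet> (w - A)) \<and>
      (\<forall>w. (n \<bullet> w = 0 \<longrightarrow> n' \<bullet> w = 0) \<and> (n \<bullet> w < 0 \<longrightarrow> 0 < n' \<bullet> w) \<and> (0 < n \<bullet> w \<longrightarrow> n' \<bullet> w < 0))"
    for Y :: ctile and k' f' m' s' z' and n' :: complex and e' :: real
  have other: "\<exists>k' f' m' s' z' n' e'. G Y k' f' m' s' z' n' e'"
    if Y: "Y \<in> T" "A \<in> body (fst Y)" "Y \<noteq> ct k f m" for Y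
  proof -
    obtain k' f' m' where f': "isometry f'" "Y = ct k' f' m'" using colored_tileE[OF colored_tilingD(1)[OF T Y(1)]] by metis
    obtain z' where z': "z' \<in> std k'" "A = f' z'" using Y(2) f' by (auto simp: body_tl)
    have disj: "False" if "u \<in> interior (body (tl k f))" "u \<in> interior (body (tl k' f'))" for u
      using colored_tilingD(2)[OF T X(1) Y(1)] that Y(3) f'(2) by auto
    have "\<exists>s'. on_side k' s' z'"
    proof (cases rule: std_cases[OF z'(1)])
      case 1
      then have "A \<in> interior (body (tl k' f'))" using f'(1) z'(2) by (simp add: body_tl isometry_interior)
      moreover have "A \<in> body (tl k f)" using n(2) n(3)[of A] by simp
      ultimately show ?thesis using open_meets_interior[OF X(2) open_interior, of "body (tl k' f')" k] disj by blast
    next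
      case (3 v) then show ?thesis using A(2) Y(1) f'(2) z'(2) unfolding isvert_def by auto
    qed blast
    then obtain s' where s': "on_side k' s' z'" by blast
    obtain n' e' where n': "n' \<noteq> 0" "e' > 0" "\<And>w. dist w A < e' \<Longrightarrow> w \<in> interior (body (tl k' f')) \<longleftrightarrow> 0 < n' \<bullet> (w - A)"
      "\<And>w. dist w A < e' \<Longrightarrow> w \<in> side_of (tl k' f') s' \<longleftrightarrow> 0 = n' \<bullet> (w - A)"
      "\<And>w. w \<in> side_of (tl k' f') s' \<Longrightarrow> 0 = n' \<bullet> (w - A)"
      by (rule half_plane[OF f'(1) s', folded z'(2)]) (rule that; assumption)
    have "False" if w: "0 < n \<bullet> w" "0 < n' \<bullet> w" for w
    proof -
      define t where "t = min e e' / (2 * norm w)"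
      have w0: "norm w > 0" using w by auto
      have t: "t > 0" "t * norm w < e" "t * norm w < e'" using w0 n(2) n'(2) by (auto simp: t_def min_def)
      show False using disj[of "A + t *\<^sub>R w"] n(4)[of "A + t *\<^sub>R w"] n'(3)[of "A + t *\<^sub>R w"] t w by (simp add: dist_norm)
    qed
    note o = opposite_half_planes[OF n(1) n'(1) this]
    have "G Y k' f' m' s' z' n' e'" unfolding G_def
      by (intro conjI allI impI) (fact f' z'(2) s' n'(2) | rule n' o; assumption)+
    then show ?thesis by blast
  qed
  have "\<exists>Y\<in>T. A \<in> body (fst Y) \<and> Y \<noteq> ct k f m"
  proof -
    obtain e1 where e1: "e1 > 0" "\<And>X. X \<in> T \<Longrightarrow> body (fst X) \<inter> ball A e1 \<noteq> {} \<Longrightarrow> A \<in> body (fst X)"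
      using ball_meets_only_tiles_containing[OF T] by blast
    obtain e2 where e2: "e2 > 0" "ball A e2 \<subseteq> support T" using A(1) by (auto simp: mem_interior)
    define t where "t = min e (min e1 e2) / (2 * norm n)"
    have n0: "norm n > 0" using n(1) by simp
    have t: "t > 0" "t * norm n < e" "t * norm n < e1" "t * norm n < e2" using n0 n(2) e1(1) e2(1) by (auto simp: t_def min_def)
    define w where "w = A - t *\<^sub>R n"
    have dw: "dist w A = t * norm n" using t(1) by (simp add: w_def dist_norm)
    then have "w \<in> support T" using e2(2) t(4) by (auto simp: dist_commute)
    then obtain Y where Y: "Y \<in> T" "w \<in> body (fst Y)" unfolding support_def by blast
    have "w \<in> ball A e1" using dw t(3) by (simp add: dist_commute)
    then have "A \<in> body (fst Y)" using e1(2)[OF Y(1)] Y(2) by blast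
    moreover have "n \<bullet> (w - A) < 0" using t(1) n(1) by (simp add: w_def)
    then have "w \<notin> body (tl k f)" using n(3)[of w] dw t(2) by simp
    then have "Y \<noteq> ct k f m" using Y(2) by auto
    ultimately show ?thesis using Y(1) by blast
  qed
  then obtain Y where Y: "Y \<in> T" "A \<in> body (fst Y)" "Y \<noteq> ct k f m" by blast
  obtain k' f' m' s' z' n' e' where g: "G Y k' f' m' s' z' n' e'" using other[OF Y] by blast
  have y1: "Y = ct k' f' m'" using g unfolding G_def by (elim conjE)
  have y2: "isometry f'" using g unfolding G_def by (elim conjE)
  have y3: "A = f' z'" using g unfolding G_def by (elim conjE)
  have y4: "on_side k' s' z'" using g unfolding G_def by (elim conjE)
  have y5: "e' > 0" using g unfolding G_def by (elim conjE)
  have near': "\<forall>w. dist w A < e' \<longrightarrow> (w \<in> interior (body (tl k' f')) \<longleftrightarrow> 0 < n' \<bullet> (w - A)) \<and> (w \<in> side_of (tl k' f') s' \<longleftrightarrow> 0 = n' \<bullet> (w - A))" using g unfolding G_def by (elim conjE)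
  have line': "\<forall>w. w \<in> side_of (tl k' f') s' \<longrightarrow> 0 = n' \<bullet> (w - A)" using g unfolding G_def by (elim conjE)
  have dir': "\<forall>w. (n \<bullet> w = 0 \<longrightarrow> n' \<bullet> w = 0) \<and> (n \<bullet> w < 0 \<longrightarrow> 0 < n' \<bullet> w) \<and> (0 < n \<bullet> w \<longrightarrow> n' \<bullet> w < 0)" using g unfolding G_def by (elim conjE)
  note Y' = y1 y2 y3 y4 y5 near'[rule_format, THEN conjunct1] near'[rule_format, THEN conjunct2] line'[rule_format] dir'[THEN spec]
  have zero: "n' \<bullet> w = 0 \<longleftrightarrow> n \<bullet> w = 0" for w using Y'(9)[of w] by (cases "n \<bullet> w" "0::real" rule: linorder_cases) auto
  show thesis
  proof (rule that[of k' f' m' z' s'])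
    show "ct k' f' m' \<in> T" "ct k' f' m' \<noteq> ct k f m" using Y(1,3) Y'(1) by auto
    show "isometry f'" "A = f' z'" "on_side k' s' z'" by fact+
    fix Z assume Z: "Z \<in> T" "A \<in> body (fst Z)"
    show "Z = ct k f m \<or> Z = ct k' f' m'"
    proof (rule ccontr)
      assume a: "\<not> ?thesis"
      then obtain k2 f2 m2 s2 z2 n2 e2 where g2: "G Z k2 f2 m2 s2 z2 n2 e2" using other[OF Z] by blast
  have w1: "Z = ct k2 f2 m2" using g2 unfolding G_def by (elim conjE)
  have w2: "e2 > 0" using g2 unfolding G_def by (elim conjE)
  have near2: "\<forall>w. dist w A < e2 \<longrightarrow> (w \<in> interior (body (tl k2 f2)) \<longleftrightarrow> 0 < n2 \<bullet> (w - A)) \<and> (w \<in> side_of (tl k2 f2) s2 \<longleftrightarrow> 0 = n2 \<bullet> (w - A))" using g2 unfolding G_def by (elim conjE)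
  have dir2: "\<forall>w. (n \<bullet> w = 0 \<longrightarrow> n2 \<bullet> w = 0) \<and> (n \<bullet> w < 0 \<longrightarrow> 0 < n2 \<bullet> w) \<and> (0 < n \<bullet> w \<longrightarrow> n2 \<bullet> w < 0)" using g2 unfolding G_def by (elim conjE)
      note Z2 = w1 w2 near2[rule_format, THEN conjunct1] dir2[THEN spec, THEN conjunct2, THEN conjunct1]
      have n0: "norm n > 0" using n(1) by simp
      define t where "t = min e' e2 / (2 * norm n)"
      have t: "t > 0" "t * norm n < e'" "t * norm n < e2" using n0 Y'(5) Z2(2) by (auto simp: t_def min_def)
      define w where "w = A - t *\<^sub>R n"
      have dw: "dist w A = t * norm n" using t(1) by (simp add: w_def dist_norm)
      have neg: "n \<bullet> (w - A) < 0" using t(1) n(1) by (simp add: w_def)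
      have "dist w A < e2" "dist w A < e'" using dw t by simp_all
      moreover have "0 < n2 \<bullet> (w - A)" "0 < n' \<bullet> (w - A)" using neg Z2(4)[of "w - A"] Y'(9)[of "w - A"] by blast+
      ultimately have "w \<in> interior (body (fst Z)) \<inter> interior (body (fst Y))"
        using Z2(3)[of w] Y'(6)[of w] unfolding Z2(1) Y'(1) fst_ct by blast
      then have "Z = Y" using colored_tilingD(2)[OF T Z(1) Y(1)] by blast
      then show False using a Y'(1) by simp
    qed
  next
    show "\<exists>n e. n \<noteq> 0 \<and> e > 0 \<and> (\<forall>w. dist w A < e \<longrightarrow> (w \<in> side_of (tl k f) s \<longleftrightarrow> n \<bullet> (w - A) = 0) \<and> (w \<in> side_of (tl k' f') s' \<longleftrightarrow> n \<bullet> (w - A) = 0))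
       \<and> (\<forall>w. w \<in> side_of (tl k f) s \<or> w \<in> side_of (tl k' f') s' \<longrightarrow> n \<bullet> (w - A) = 0)"
    proof (rule exI[of _ n], rule exI[of _ "min e e'"], intro conjI allI impI)
      show "n \<noteq> 0" by (rule n(1))
      show "0 < min e e'" using n(2) Y'(5) by simp
      fix w
      show "w \<in> side_of (tl k f) s \<longleftrightarrow> n \<bullet> (w - A) = 0" if "dist w A < min e e'" using n(5)[of w] that by auto
      show "w \<in> side_of (tl k' f') s' \<longleftrightarrow> n \<bullet> (w - A) = 0" if "dist w A < min e e'"
        using Y'(7)[of w] zero[of "w - A"] that by auto
      show "n \<bullet> (w - A) = 0" if "w \<in> side_of (tl k f) s \<or> w \<in> side_of (tl k' f') s'"
        using that n(6)[of w] Y'(8)[of w] zero[of "w - A"] by auto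
    qed
  qed
qed

section \<open>Tiles that share a piece of a side\<close>

text \<open>A bound of \<open>1000000 * evz z\<close> from decimal bounds of the powers of \<open>phi\<close>. It decides all signs that are needed here,
  except for zero itself.\<close>

fun zub :: "zf \<Rightarrow> int" where
  "zub (ZF a b c d) = a * 1000000 + b * (if b > 0 then 786200 else 786000) + c * (if c > 0 then 618111 else 617796)
     + d * (if d > 0 then 485959 else 485587)"

lemma phi_powers_bounds: "0.617796 \<le> phi^2" "phi^2 \<le> 0.618111" "0.485587 \<le> phi^3" "phi^3 \<le> 0.485959"
proof -
  have b: "0.786 \<le> phi" "phi \<le> 0.7862" "0 \<le> phi" using phi_bounds by auto
  have "0.786^2 \<le> phi^2" "phi^2 \<le> 0.7862^2" "0.786^3 \<le> phi^3" "phi^3 \<le> 0.7862^3"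
    using b by (auto intro: power_mono)
  then show "0.617796 \<le> phi^2" "phi^2 \<le> 0.618111" "0.485587 \<le> phi^3" "phi^3 \<le> 0.485959"
    by (auto simp: power2_eq_square power3_eq_cube)
qed

lemma mult_upper: "lo \<le> x \<Longrightarrow> x \<le> hi \<Longrightarrow> of_int b * x \<le> of_int b * (if b > 0 then hi else lo)" for x :: real
  by (auto intro: mult_left_mono mult_left_mono_neg)

lemma zub: "evz z * 1000000 \<le> of_int (zub z)"
proof -
  obtain a b c d where z: "z = ZF a b c d" by (cases z)
  have "of_int b * phi \<le> of_int b * (if b > 0 then 0.7862 else 0.786)" by (rule mult_upper) (use phi_bounds in auto)
  moreover have "of_int c * phi^2 \<le> of_int c * (if c > 0 then 0.618111 else 0.617796)" by (rule mult_upper) (use phi_powers_bounds in auto)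
  moreover have "of_int d * phi^3 \<le> of_int d * (if d > 0 then 0.485959 else 0.485587)" by (rule mult_upper) (use phi_powers_bounds in auto)
  moreover have "(a + x + y + w) * 1000000 \<le> 1000000 * (a + x' + y' + w')" if "x \<le> x'" "y \<le> y'" "w \<le> w'" for a x y w x' y' w' :: real
  proof -
    have "a + x + y + w \<le> a + x' + y' + w'" by (intro add_mono order_refl that)
    then show ?thesis by simp
  qed
  moreover have "of_int (zub z) = 1000000 * (of_int a + of_int b * (if b > 0 then 0.7862 else 0.786) +
      of_int c * (if c > 0 then 0.618111 else 0.617796) + of_int d * (if d > 0 then 0.485959 else 0.485587 :: real))"
    unfolding z by simp
  ultimately show ?thesis unfolding z evz.simps by metis
qed

definition zle :: "zf \<Rightarrow> bool" where "zle z \<longleftrightarrow> z = ZF 0 0 0 0 \<or> zub z \<le> 0"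

lemma zle: "zle z \<Longrightarrow> evz z \<le> 0"
  using zub[of z] unfolding zle_def by (auto simp: of_int_le_0_iff[symmetric] simp del: zub.simps of_int_le_0_iff)

fun zb :: "kind \<Rightarrow> corner \<Rightarrow> gs \<Rightarrow> zf" where
  "zb Large Rt (G x y) = zadd (ZF 1 0 0 0) (zneg (zadd (zpi x) (zpi (zpi y))))"
| "zb Large Sh (G x y) = zpi x" | "zb Large Bl (G x y) = zpi (zpi y)"
| "zb Small Rt (G x y) = zadd (ZF 1 0 0 0) (zneg (zadd (zpi (zpi x)) (zpi (zpi (zpi y)))))"
| "zb Small Sh (G x y) = zpi (zpi x)" | "zb Small Bl (G x y) = zpi (zpi (zpi y))"

lemma evz_zb: "evz (zb k v z) = bary k v (evg z)"
proof -
  have "evz (ZF 1 0 0 0) = 1" by simp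
  then show ?thesis
    by (cases z; cases k; cases v) (simp_all add: evz power2_eq_square power3_eq_cube del: evz.simps zadd.simps zneg.simps zpi.simps)
qed

text \<open>An endpoint of the first side separates the two sides: both ends of the second side have a nonpositive barycentric
  coordinate with respect to it.\<close>

definition apart :: "kind \<Rightarrow> side \<Rightarrow> kind \<Rightarrow> side \<Rightarrow> fr \<Rightarrow> bool" where
  "apart k s k' s' F \<longleftrightarrow> list_ex (\<lambda>v. zle (zb k v (fapp F (gpt k' (At (c0 s'))))) \<and> zle (zb k v (fapp F (gpt k' (At (c1 s')))))) [c0 s, c1 s]"

lemma two_bary_eq:
  assumes "bary k (opp s) x = 0" "bary k v x = 0" "bary k (opp s) y = 0" "bary k v y = 0" "v \<in> corners s"
  shows "x = y"
proof -
  have "v \<noteq> opp s" using assms(5) by (cases s) auto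
  then have "bary k c x = bary k c y" for c
    using assms(1-4) bary_sum[of k x] bary_sum[of k y] by (cases "opp s"; cases v; cases c) (simp_all del: bary.simps)
  then have e: "bary k c x = bary k c y" for c .
  have "x = bary k Rt x *\<^sub>R proto k Rt + bary k Sh x *\<^sub>R proto k Sh + bary k Bl x *\<^sub>R proto k Bl" by (rule bary_combine)
  also have "\<dots> = y" unfolding e by (rule bary_combine[symmetric])
  finally show ?thesis .
qed

lemma apart_sound:
  assumes f: "isometry f" and a: "apart k s k' s' F"
    and x: "x \<in> side_of (tl k f) s" "x \<in> side_of (tl k' (f \<circ> evf F)) s'" and y: "y \<in> side_of (tl k f) s" "y \<in> side_of (tl k' (f \<circ> evf F)) s'"
  shows "x = y"
proof -
  obtain v where v: "v \<in> {c0 s, c1 s}" "zle (zb k v (fapp F (gpt k' (At (c0 s')))))" "zle (zb k v (fapp F (gpt k' (At (c1 s')))))"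
    using a unfolding apart_def by auto
  have b: "bary k v (evf F (proto k' (c0 s'))) \<le> 0" "bary k v (evf F (proto k' (c1 s'))) \<le> 0"
    using zle[OF v(2)] zle[OF v(3)] unfolding evz_zb evg_fapp evg_gpt ppt.simps .
  have key: "\<exists>u. w = f u \<and> bary k (opp s) u = 0 \<and> bary k v u = 0"
    if w: "w \<in> side_of (tl k f) s" "w \<in> side_of (tl k' (f \<circ> evf F)) s'" for w
  proof -
    obtain u where u: "w = f u" "u \<in> std k" "bary k (opp s) u = 0" using w(1) unfolding side_of_tl(1)[OF f] by blast
    have "w \<in> f ` closed_segment (evf F (proto k' (c0 s'))) (evf F (proto k' (c1 s')))"
      using w(2) unfolding side_of_tl(2)[OF isometry_comp[OF f isometry_evf]] isometry_segment[OF f] by simp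
    then have "u \<in> closed_segment (evf F (proto k' (c0 s'))) (evf F (proto k' (c1 s')))"
      using u(1) isometry_inj[OF f] by (auto dest: injD)
    then obtain t where t: "0 \<le> t" "t \<le> 1" "u = (1 - t) *\<^sub>R evf F (proto k' (c0 s')) + t *\<^sub>R evf F (proto k' (c1 s'))"
      unfolding closed_segment_def by blast
    have "bary k v u \<le> 0" unfolding t(3) bary_affine using b t(1,2) by (simp add: mult_nonneg_nonpos add_nonpos_nonpos)
    moreover have "0 \<le> bary k v u" using u(2) unfolding std_def by blast
    ultimately show ?thesis using u by force
  qed
  have vc: "v \<in> corners s" using v(1) unfolding corners_c(1) .
  show ?thesis using key[OF x] key[OF y] two_bary_eq[OF _ _ _ _ vc] by blast
qed

text \<open>All relative positions of two tiles along a common piece of a side: a tile of the first kind with frame \<open>f\<close> has along the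
  given side a tile of the second kind with frame \<open>f \<circ> evf F\<close>. The last component tells whether the two sides, each in its
  canonical direction, point in opposite directions. The list is the closure of the first two pairs, the halves of a cut
  tile, under decomposition.\<close>

definition pair_types :: "(kind \<times> side \<times> kind \<times> side \<times> fr \<times> bool) list" where
  "pair_types = [
     (Large, SLeg, Small, LLeg, (Fr False 1 0 (G (ZF 0 0 0 0) (ZF 0 0 0 0))), False),
     (Small, LLeg, Large, SLeg, (Fr False 3 0 (G (ZF 0 0 0 0) (ZF 0 0 0 0))), False),
     (Small, Hyp, Large, LLeg, (Fr True 2 (-1) (G (ZF 0 0 1 0) (ZF 0 0 0 0))), False),
     (Large, LLeg, Small, Hyp, (Fr True 2 (-1) (G (ZF 0 0 0 1) (ZF (-1) 0 1 0))), False),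
     (Large, Hyp, Large, Hyp, (Fr False 2 0 (G (ZF 0 1 0 0) (ZF 0 0 1 0))), True),
     (Large, LLeg, Large, LLeg, (Fr False 2 0 (G (ZF 0 1 0 (-1)) (ZF 0 0 0 0))), True),
     (Large, LLeg, Small, SLeg, (Fr False 3 0 (G (ZF 0 1 0 (-1)) (ZF 0 0 0 0))), False),
     (Small, SLeg, Large, LLeg, (Fr False 1 0 (G (ZF 0 0 0 0) (ZF 0 (-1) 0 1))), False),
     (Large, Hyp, Large, Hyp, (Fr False 2 0 (G (ZF 0 1 0 (-1)) (ZF 1 0 0 0))), True),
     (Large, Hyp, Large, SLeg, (Fr True 1 (-1) (G (ZF 0 1 0 (-1)) (ZF 1 0 (-1) 0))), True),
     (Large, SLeg, Large, Hyp, (Fr True 1 (-1) (G (ZF 0 0 0 (-1)) (ZF 0 0 0 0))), True),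
     (Small, SLeg, Small, SLeg, (Fr False 2 0 (G (ZF 0 0 0 0) (ZF 0 0 0 1))), True),
     (Large, SLeg, Large, SLeg, (Fr False 2 0 (G (ZF 0 0 0 0) (ZF 0 0 1 0))), True),
     (Small, Hyp, Small, Hyp, (Fr False 2 0 (G (ZF 0 0 1 0) (ZF 0 0 0 1))), True)]"

text \<open>The position of the piece \<open>q\<close> of the second tile relative to the piece \<open>p\<close> of the first one.\<close>

definition subframe :: "pc \<Rightarrow> pc \<Rightarrow> fr \<Rightarrow> fr" where
  "subframe p q F = fcomp (finv (fdf p)) (fcomp (fshrink F) (fdf q))"

lemma pair_types_closed:
  "list_all (\<lambda>(k, a, k', b, F, fl). list_all (\<lambda>p. par p \<noteq> k \<or> list_all (\<lambda>q. par q \<noteq> k' \<or>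
     list_all (\<lambda>s. list_all (\<lambda>s'. case src p s of None \<Rightarrow> True | Some (a', f1) \<Rightarrow> a' \<noteq> a \<or>
       (case src q s' of None \<Rightarrow> True | Some (b', f2) \<Rightarrow> b' \<noteq> b \<or>
         apart (pk p) s (pk q) s' (subframe p q F) \<or> (pk p, s, pk q, s', subframe p q F, (fl \<noteq> f1) \<noteq> f2) \<in> set pair_types))
       [Hyp, LLeg, SLeg]) [Hyp, LLeg, SLeg]) [PL, PS, PU]) [PL, PS, PU]) pair_types"
  by code_simp

definition sibframe :: "pc \<Rightarrow> pc \<Rightarrow> fr" where "sibframe p q = fcomp (finv (fdf p)) (fdf q)"

lemma sibling_pair_types:
  "list_all (\<lambda>s. list_all (\<lambda>s'. apart (pk p) s (pk q) s' (sibframe p q) \<or> apart (pk q) s' (pk p) s (sibframe q p) \<or>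
      src p s = None \<and> src q s' = None \<and> (pk p, s, pk q, s', sibframe p q, False) \<in> set pair_types) [Hyp, LLeg, SLeg]) [Hyp, LLeg, SLeg]"
  (is "?P p q") if pq: "p = PL \<and> q = PS \<or> p = PS \<and> q = PL"
proof -
  have "?P PL PS" by code_simp
  moreover have "?P PS PL" by code_simp
  ultimately show ?thesis using pq by (elim disjE conjE) (simp_all only:)
qed

lemma pair_types_directions:
  "list_all (\<lambda>(k, s, k', s', F, fl). list_all (\<lambda>b. sdir F s' (b \<noteq> fl) = sdir (Fr False 0 0 (G (ZF 0 0 0 0) (ZF 0 0 0 0))) s b) [True, False]) pair_types"
  by code_simp

text \<open>Two different tiles that share two points of sides, hence a segment, are in one of the listed positions with equal colors on
  the common piece.\<close>

definition paired :: "ctile set \<Rightarrow> bool" where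
  "paired Q \<longleftrightarrow> (\<forall>k f m k' g m' s s' x y. isometry f \<longrightarrow> isometry g \<longrightarrow> ct k f m \<in> Q \<longrightarrow> ct k' g m' \<in> Q \<longrightarrow> ct k f m \<noteq> ct k' g m' \<longrightarrow>
     x \<noteq> y \<longrightarrow> {x, y} \<subseteq> side_of (tl k f) s \<inter> side_of (tl k' g) s' \<longrightarrow>
     (\<exists>F fl. (k, s, k', s', F, fl) \<in> set pair_types \<and> g = f \<circ> evf F \<and> m' s' = (fst (m s), snd (m s) \<noteq> fl)))"

lemma pairedD:
  assumes "paired Q" "isometry f" "isometry g" "ct k f m \<in> Q" "ct k' g m' \<in> Q" "ct k f m \<noteq> ct k' g m'" "x \<noteq> y"
    "x \<in> side_of (tl k f) s" "x \<in> side_of (tl k' g) s'" "y \<in> side_of (tl k f) s" "y \<in> side_of (tl k' g) s'"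
  shows "\<exists>F fl. (k, s, k', s', F, fl) \<in> set pair_types \<and> g = f \<circ> evf F \<and> m' s' = (fst (m s), snd (m s) \<noteq> fl)"
proof -
  have "{x, y} \<subseteq> side_of (tl k f) s \<inter> side_of (tl k' g) s'" using assms by blast
  then show ?thesis by (rule assms(1)[unfolded paired_def, rule_format, OF assms(2-7)])
qed

lemma altitude_inside: "src p s = None \<Longrightarrow> on_side (pk p) s u \<Longrightarrow> 0 < bary (par p) v (emb p u)"
  unfolding on_side_def all_corner
  by (cases p; cases s; cases v) (auto simp: bary_emb simp del: bary.simps intro!: add_nonneg_pos)

lemma side_in_parent:
  assumes "src p s = Some (a, b)" "u \<in> std (pk p)" "bary (pk p) (opp s) u = 0"
  shows "emb p u \<in> std (par p)" "bary (par p) (opp a) (emb p u) = 0"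
proof -
  show "emb p u \<in> std (par p)" using emb_std[of p] assms(2) by blast
  show "bary (par p) (opp a) (emb p u) = 0" using assms(1,3) by (cases p; cases s) (auto simp: bary_emb simp del: bary.simps)
qed

lemma midpoint_on_side:
  assumes x: "x \<in> std k" "bary k (opp s) x = 0" and y: "y \<in> std k" "bary k (opp s) y = 0" and ne: "x \<noteq> y"
  shows "on_side k s ((1 - 1/2) *\<^sub>R x + (1/2) *\<^sub>R y)"
  unfolding on_side_def bary_affine
proof (intro conjI allI impI)
  show "(1 - 1/2) * bary k (opp s) x + (1/2) * bary k (opp s) y = 0" using x(2) y(2) by simp
  fix v assume v: "v \<noteq> opp s"
  then have vc: "v \<in> corners s" by (cases s; cases v) auto
  have "0 \<le> bary k v x" "0 \<le> bary k v y" using x(1) y(1) unfolding std_def by blast+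
  moreover have "\<not> (bary k v x = 0 \<and> bary k v y = 0)" using two_bary_eq[OF x(2) _ y(2) _ vc] ne by blast
  ultimately show "0 < (1 - 1/2) * bary k v x + (1/2) * bary k v y" by auto
qed

lemma piece_side_point:
  assumes f: "isometry f" and x: "x \<in> side_of (tl (pk p) (lift c f \<circ> df p)) s"
  obtains u where "x = homothety c (1 / phi) (f (emb p u))" "u \<in> std (pk p)" "bary (pk p) (opp s) u = 0"
  using x unfolding side_of_tl(1)[OF isometry_piece[OF f]] by (auto simp: lift_df emb_def simp del: df.simps)

text \<open>An altitude runs through the interior of the parent, so no piece of another tile reaches its relative interior.\<close>

lemma paired_sigma_distinct_parents:
  assumes Q: "colored_tiling Q" and f: "isometry f" and g: "isometry g"
    and P: "ct (par p) f m \<in> Q" "ct (par q) g m' \<in> Q" "ct (par p) f m \<noteq> ct (par q) g m'"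
    and x: "x \<in> side_of (tl (pk p) (lift c f \<circ> df p)) s" "x \<in> body (tl (pk q) (lift c g \<circ> df q))"
    and y: "y \<in> side_of (tl (pk p) (lift c f \<circ> df p)) s" "y \<in> body (tl (pk q) (lift c g \<circ> df q))"
    and ne: "x \<noteq> y"
  shows "src p s \<noteq> None"
proof
  assume n: "src p s = None"
  let ?H = "homothety c (1 / phi)"
  have ip: "isometry (lift c f \<circ> df p)" by (rule isometry_piece[OF f])
  obtain u where u: "x = (lift c f \<circ> df p) u" "u \<in> std (pk p)" "bary (pk p) (opp s) u = 0" using x(1) unfolding side_of_tl(1)[OF ip] by blast
  obtain v where v: "y = (lift c f \<circ> df p) v" "v \<in> std (pk p)" "bary (pk p) (opp s) v = 0" using y(1) unfolding side_of_tl(1)[OF ip] by blast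
  define w where "w = (1 - 1/2) *\<^sub>R u + (1/2) *\<^sub>R v"
  have os: "on_side (pk p) s w" unfolding w_def by (rule midpoint_on_side[OF u(2,3) v(2,3)]) (use ne u(1) v(1) in auto)
  have "(lift c f \<circ> df p) w = (1 - 1/2) *\<^sub>R x + (1/2) *\<^sub>R y"
    unfolding w_def isometry_affine[OF ip] u(1) v(1) ..
  moreover have "convex (body (tl (pk q) (lift c g \<circ> df q)))" unfolding body_def by (rule convex_convex_hull)
  ultimately have "(lift c f \<circ> df p) w \<in> body (tl (pk q) (lift c g \<circ> df q))"
    using x(2) y(2) convexD_alt[of "body (tl (pk q) (lift c g \<circ> df q))" x y "1/2"] by simp
  then have "(lift c f \<circ> df p) w \<in> ?H ` body (tl (par q) g)"
    using body_piece_subset[OF g, of c q m'] unfolding piece_def fst_ct by blast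
  moreover have "(lift c f \<circ> df p) w = ?H (f (emb p w))" by (simp add: lift_df emb_def del: df.simps)
  ultimately have "f (emb p w) \<in> body (tl (par q) g)" using homothety_inj[of c] by (auto simp: inj_eq)
  moreover have "f (emb p w) \<in> interior (body (tl (par p) f))" unfolding interior_body[OF f] using altitude_inside[OF n os] by blast
  ultimately have "interior (body (tl (par p) f)) \<inter> interior (body (tl (par q) g)) \<noteq> {}"
    using open_meets_interior[OF g open_interior, of "body (tl (par p) f)" "par q"] by blast
  then show False using colored_tilingD(2)[OF Q P(1,2)] P(3) by simp
qed

lemma side_in_body: "isometry f \<Longrightarrow> side_of (tl k f) s \<subseteq> body (tl k f)"
  by (auto simp: side_of_tl(1) body_tl)

lemma subframe:
  assumes "g = f \<circ> evf F"
  shows "lift c g \<circ> df q = lift c f \<circ> df p \<circ> evf (subframe p q F)"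
proof -
  have e: "df p \<circ> evf (finv (fdf p)) = (\<lambda>z. z)" unfolding evf_finv_inv evf_fdf by (rule isometry_inv_comp(4)[OF isometry_df])
  have "lift c f \<circ> df p \<circ> evf (subframe p q F) = lift c f \<circ> (df p \<circ> evf (finv (fdf p))) \<circ> (shrink (evf F) \<circ> df q)"
    unfolding subframe_def evf_fcomp evf_fshrink evf_fdf by (simp add: comp_assoc)
  also have "\<dots> = lift c f \<circ> shrink (evf F) \<circ> df q" unfolding e by (simp add: comp_def)
  finally show ?thesis unfolding assms lift_comp by simp
qed

lemma sibframe: "lift c f \<circ> df q = lift c f \<circ> df p \<circ> evf (sibframe p q)"
proof -
  have e: "df p \<circ> evf (finv (fdf p)) = (\<lambda>z. z)" unfolding evf_finv_inv evf_fdf by (rule isometry_inv_comp(4)[OF isometry_df])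
  have "lift c f \<circ> df p \<circ> evf (sibframe p q) = lift c f \<circ> (df p \<circ> evf (finv (fdf p))) \<circ> df q"
    unfolding sibframe_def evf_fcomp evf_fdf by (simp add: comp_assoc)
  then show ?thesis unfolding e by (simp add: comp_def)
qed

lemma all_sides_list: "list_all P [Hyp, LLeg, SLeg] \<Longrightarrow> P s" by (cases s) auto
lemma all_pc_list: "list_all P [PL, PS, PU] \<Longrightarrow> P p" by (cases p) auto

lemma pair_types_step:
  assumes "(par p, a, par q, b, F, fl) \<in> set pair_types" "src p s = Some (a, f1)" "src q s' = Some (b, f2)"
  shows "apart (pk p) s (pk q) s' (subframe p q F) \<or> (pk p, s, pk q, s', subframe p q F, (fl \<noteq> f1) \<noteq> f2) \<in> set pair_types"
proof -
  have 1: "list_all (\<lambda>p'. par p' \<noteq> par p \<or> list_all (\<lambda>q'. par q' \<noteq> par q \<or>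
     list_all (\<lambda>s. list_all (\<lambda>s'. case src p' s of None \<Rightarrow> True | Some (a', f1) \<Rightarrow> a' \<noteq> a \<or>
       (case src q' s' of None \<Rightarrow> True | Some (b', f2) \<Rightarrow> b' \<noteq> b \<or>
         apart (pk p') s (pk q') s' (subframe p' q' F) \<or> (pk p', s, pk q', s', subframe p' q' F, (fl \<noteq> f1) \<noteq> f2) \<in> set pair_types))
       [Hyp, LLeg, SLeg]) [Hyp, LLeg, SLeg]) [PL, PS, PU]) [PL, PS, PU]"
    using bspec[OF pair_types_closed[unfolded list_all_iff[of _ pair_types]] assms(1)] unfolding prod.case .
  from all_pc_list[OF this, of p] have 2: "list_all (\<lambda>q'. par q' \<noteq> par q \<or>
     list_all (\<lambda>s. list_all (\<lambda>s'. case src p s of None \<Rightarrow> True | Some (a', f1) \<Rightarrow> a' \<noteq> a \<or>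
       (case src q' s' of None \<Rightarrow> True | Some (b', f2) \<Rightarrow> b' \<noteq> b \<or>
         apart (pk p) s (pk q') s' (subframe p q' F) \<or> (pk p, s, pk q', s', subframe p q' F, (fl \<noteq> f1) \<noteq> f2) \<in> set pair_types))
       [Hyp, LLeg, SLeg]) [Hyp, LLeg, SLeg]) [PL, PS, PU]" by blast
  from all_pc_list[OF this, of q] have 3: "list_all (\<lambda>s. list_all (\<lambda>s'. case src p s of None \<Rightarrow> True | Some (a', f1) \<Rightarrow> a' \<noteq> a \<or>
       (case src q s' of None \<Rightarrow> True | Some (b', f2) \<Rightarrow> b' \<noteq> b \<or>
         apart (pk p) s (pk q) s' (subframe p q F) \<or> (pk p, s, pk q, s', subframe p q F, (fl \<noteq> f1) \<noteq> f2) \<in> set pair_types))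
       [Hyp, LLeg, SLeg]) [Hyp, LLeg, SLeg]" by blast
  from all_sides_list[OF all_sides_list[OF 3, of s], of s'] show ?thesis using assms(2,3) by simp
qed

text \<open>Pieces of different parents touch along sides inherited from the parents, which share a segment before the
  decomposition. Pieces of the same parent can only share the altitude.\<close>

lemma paired_sigma:
  assumes Q: "colored_tiling Q" and pr: "paired Q"
  shows "paired (sigma c Q)"
  unfolding paired_def
proof (intro allI impI)
  fix k f m k' g m' s s' x y
  assume f: "isometry f" and g: "isometry g" and X: "ct k f m \<in> sigma c Q" and Y: "ct k' g m' \<in> sigma c Q"
    and XY: "ct k f m \<noteq> ct k' g m'" and ne: "x \<noteq> y" and xy: "{x, y} \<subseteq> side_of (tl k f) s \<inter> side_of (tl k' g) s'"
  note S = sigma_ct[OF colored_tilingD(1)[OF Q], of Q c, simplified]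
  obtain p f0 m0 where p: "isometry f0" "ct (par p) f0 m0 \<in> Q" "ct k f m = piece c p f0 m0" using X unfolding S by blast
  obtain q g0 n0 where q: "isometry g0" "ct (par q) g0 n0 \<in> Q" "ct k' g m' = piece c q g0 n0" using Y unfolding S by blast
  note ep = ct_eqD[OF f isometry_piece[OF p(1)] p(3)[unfolded piece_def]]
  note eq = ct_eqD[OF g isometry_piece[OF q(1)] q(3)[unfolded piece_def]]
  have x: "x \<in> side_of (tl (pk p) (lift c f0 \<circ> df p)) s" "x \<in> side_of (tl (pk q) (lift c g0 \<circ> df q)) s'"
    and y: "y \<in> side_of (tl (pk p) (lift c f0 \<circ> df p)) s" "y \<in> side_of (tl (pk q) (lift c g0 \<circ> df q)) s'"
    using xy unfolding ep(1,2) eq(1,2) by auto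
  note ip = isometry_piece[OF p(1), of c p] and iq = isometry_piece[OF q(1), of c q]
  show "\<exists>F fl. (k, s, k', s', F, fl) \<in> set pair_types \<and> g = f \<circ> evf F \<and> m' s' = (fst (m s), snd (m s) \<noteq> fl)"
  proof (cases "ct (par p) f0 m0 = ct (par q) g0 n0")
    case True
    note e = ct_eqD[OF p(1) q(1) True]
    have "p \<noteq> q" using XY p(3) q(3) e by auto
    then have pq: "p = PL \<and> q = PS \<or> p = PS \<and> q = PL" using e(1) by (cases p; cases q) auto
    have fg: "lift c g0 \<circ> df q = lift c f0 \<circ> df p \<circ> evf (sibframe p q)" unfolding e(2)[symmetric] by (rule sibframe)
    have gf: "lift c f0 \<circ> df p = lift c g0 \<circ> df q \<circ> evf (sibframe q p)" unfolding e(2) by (rule sibframe)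
    have "\<not> apart (pk p) s (pk q) s' (sibframe p q)"
      using apart_sound[OF ip _ x(1) x(2)[unfolded fg] y(1) y(2)[unfolded fg]] ne by blast
    moreover have "\<not> apart (pk q) s' (pk p) s (sibframe q p)"
      using apart_sound[OF iq _ x(2) x(1)[unfolded gf] y(2) y(1)[unfolded gf]] ne by blast
    ultimately have "src p s = None" "src q s' = None" "(pk p, s, pk q, s', sibframe p q, False) \<in> set pair_types"
      using all_sides_list[OF all_sides_list[OF sibling_pair_types[OF pq], of s], of s'] by blast+
    moreover have "pm q n0 s' = (fst (pm p m0 s), snd (pm p m0 s) \<noteq> False)" using calculation(1,2) by (simp add: pm_src)
    ultimately show ?thesis using fg unfolding ep eq by blast
  next
    case False
    note ne' = False[symmetric]
    have xb: "x \<in> body (tl (pk p) (lift c f0 \<circ> df p))" "x \<in> body (tl (pk q) (lift c g0 \<circ> df q))"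
      "y \<in> body (tl (pk p) (lift c f0 \<circ> df p))" "y \<in> body (tl (pk q) (lift c g0 \<circ> df q))"
      using x y side_in_body[OF ip] side_in_body[OF iq] by blast+
    obtain a f1 where a: "src p s = Some (a, f1)"
      using paired_sigma_distinct_parents[OF Q p(1) q(1) p(2) q(2) False x(1) xb(2) y(1) xb(4) ne] by (cases "src p s") auto
    obtain b f2 where b: "src q s' = Some (b, f2)"
      using paired_sigma_distinct_parents[OF Q q(1) p(1) q(2) p(2) ne' x(2) xb(1) y(2) xb(3) ne] by (cases "src q s'") auto
    let ?H = "homothety c (1 / phi)"
    have pt: "\<exists>w. z = ?H w \<and> w \<in> side_of (tl (par r) h) d" if z: "z \<in> side_of (tl (pk r) (lift c h \<circ> df r)) s" and r: "src r s = Some (d, e)" and h: "isometry h" for r h s d e z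
    proof -
      obtain u where u: "z = ?H (h (emb r u))" "u \<in> std (pk r)" "bary (pk r) (opp s) u = 0"
        by (rule piece_side_point[OF h z])
      show ?thesis unfolding side_of_tl(1)[OF h] using u(1) side_in_parent[OF r u(2,3)] by blast
    qed
    have inj: "u = v" if "?H u = ?H v" for u v using that homothety_inj[of c] by (simp add: inj_eq)
    obtain x0 where x0: "x = ?H x0" "x0 \<in> side_of (tl (par p) f0) a" using pt[OF x(1) a p(1)] by blast
    obtain x1 where x1: "x = ?H x1" "x1 \<in> side_of (tl (par q) g0) b" using pt[OF x(2) b q(1)] by blast
    obtain y0 where y0: "y = ?H y0" "y0 \<in> side_of (tl (par p) f0) a" using pt[OF y(1) a p(1)] by blast
    obtain y1 where y1: "y = ?H y1" "y1 \<in> side_of (tl (par q) g0) b" using pt[OF y(2) b q(1)] by blast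
    have "x1 = x0" "y1 = y0" using inj x0(1) x1(1) y0(1) y1(1) by auto
    then obtain F fl where F: "(par p, a, par q, b, F, fl) \<in> set pair_types" "g0 = f0 \<circ> evf F" "n0 b = (fst (m0 a), snd (m0 a) \<noteq> fl)"
      using pairedD[OF pr p(1) q(1) p(2) q(2) False _ x0(2) _ y0(2), of b] x1(2) y1(2) ne x0(1) y0(1) by blast
    have fg: "lift c g0 \<circ> df q = lift c f0 \<circ> df p \<circ> evf (subframe p q F)" by (rule subframe[OF F(2)])
    have "\<not> apart (pk p) s (pk q) s' (subframe p q F)"
      using apart_sound[OF ip _ x(1) x(2)[unfolded fg] y(1) y(2)[unfolded fg]] ne by blast
    then have "(pk p, s, pk q, s', subframe p q F, (fl \<noteq> f1) \<noteq> f2) \<in> set pair_types" using pair_types_step[OF F(1) a b] by blast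
    moreover have "pm q n0 s' = (fst (pm p m0 s), snd (pm p m0 s) \<noteq> ((fl \<noteq> f1) \<noteq> f2))"
      unfolding pm_src a b option.case prod.case F(3) by auto
    ultimately show ?thesis using fg unfolding ep eq by blast
  qed
qed

lemma paired_singleton: "paired {X}" unfolding paired_def by auto

text \<open>The positions in the list determine the directions of both sides in the same coordinates.\<close>

lemma paired_sides_match:
  assumes Q: "colored_tiling Q" and pr: "paired Q" shows "sides_match Q"
  unfolding sides_match_def
proof (intro ballI allI impI, clarify)
  fix t \<kappa> t' \<kappa>' s s' x y
  assume X: "(t, \<kappa>) \<in> Q" and Y: "(t', \<kappa>') \<in> Q" and ne: "x \<noteq> y" and seg: "closed_segment x y \<subseteq> side_of t s \<inter> side_of t' s'"
  obtain k f m where f: "isometry f" "(t, \<kappa>) = ct k f m" using colored_tileE[OF colored_tilingD(1)[OF Q X]] by metis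
  obtain k' g m' where g: "isometry g" "(t', \<kappa>') = ct k' g m'" using colored_tileE[OF colored_tilingD(1)[OF Q Y]] by metis
  have t: "t = tl k f" "t' = tl k' g" "\<kappa> = (\<lambda>s. mk_mark (f \<circ> proto k) s (m s))" "\<kappa>' = (\<lambda>s. mk_mark (g \<circ> proto k') s (m' s))"
    using f(2) g(2) by (auto simp: ct_def)
  have xy: "x \<in> side_of (tl k f) s" "x \<in> side_of (tl k' g) s'" "y \<in> side_of (tl k f) s" "y \<in> side_of (tl k' g) s'"
    using seg t by auto
  show "label (\<kappa> s) = label (\<kappa>' s') \<and> sgn (head (\<kappa> s) - tail (\<kappa> s)) = sgn (head (\<kappa>' s') - tail (\<kappa>' s'))"
  proof (cases "(t, \<kappa>) = (t', \<kappa>')")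
    case True
    then have e: "k = k'" "f = g" "m = m'" using ct_eqD[OF f(1) g(1)] f(2) g(2) by auto
    have "s = s'"
    proof (rule ccontr)
      assume s: "s \<noteq> s'"
      then have v: "opp s' \<in> corners s" by (cases s; cases s') auto
      obtain u where u: "x = f u" "bary k (opp s) u = 0" "bary k (opp s') u = 0"
        using xy(1,2) isometry_inj[OF f(1)] unfolding e(1,2)[symmetric] side_of_tl(1)[OF f(1)] by (auto dest: injD)
      obtain w where w: "y = f w" "bary k (opp s) w = 0" "bary k (opp s') w = 0"
        using xy(3,4) isometry_inj[OF f(1)] unfolding e(1,2)[symmetric] side_of_tl(1)[OF f(1)] by (auto dest: injD)
      show False using two_bary_eq[OF u(2,3) w(2,3) v] u(1) w(1) ne by simp
    qed
    then show ?thesis using True by simp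
  next
    case False
    obtain F fl where F: "(k, s, k', s', F, fl) \<in> set pair_types" "g = f \<circ> evf F" "m' s' = (fst (m s), snd (m s) \<noteq> fl)"
      using pairedD[OF pr f(1) g(1) _ _ _ ne xy] X Y False f(2) g(2) by metis
    define b where "b = snd (m s)"
    have d: "sdir F s' (b \<noteq> fl) = sdir (Fr False 0 0 (G (ZF 0 0 0 0) (ZF 0 0 0 0))) s b"
      using bspec[OF pair_types_directions[unfolded list_all_iff[of _ pair_types]] F(1)] by (cases b) simp_all
    define e where "e = dirc (fst (sdir F s' (b \<noteq> fl))) (snd (sdir F s' (b \<noteq> fl)))"
    have z: "Complex 0 0 = 0" by (simp add: complex_eq_iff)
    have id: "evf (Fr False 0 0 (G (ZF 0 0 0 0) (ZF 0 0 0 0))) = (\<lambda>z. z)" by (simp add: iso_def fun_eq_iff z)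
    note lin = isometry_linear[OF f(1)]
    have il: "f u - f w = ilin f (u - w)" for u w using lin(1,3) by (metis add_diff_cancel_left linear_diff)
    have sc: "sgn (ilin f (of_real r * e)) = sgn (ilin f e)" if "r > 0" for r
      using that linear_scale[OF lin(1), of r e] by (simp add: scaleR_conv_of_real[symmetric] sgn_scaleR)
    have "sgn (head (\<kappa>' s') - tail (\<kappa>' s')) = sgn (ilin f e)"
      unfolding t mk_mark_def F(3) mark.select_convs fst_conv snd_conv b_def[symmetric] F(2) comp_apply
      using sdir[of F k' "b \<noteq> fl" s'] sc[of "side_len k' s'"] unfolding e_def[symmetric] il by simp
    moreover have "sgn (head (\<kappa> s) - tail (\<kappa> s)) = sgn (ilin f e)"
      unfolding t mk_mark_def mark.select_convs b_def[symmetric] comp_apply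
      using sdir[of "Fr False 0 0 (G (ZF 0 0 0 0) (ZF 0 0 0 0))" k b s, folded d] sc[of "side_len k s"] unfolding e_def[symmetric] il id by simp
    ultimately show ?thesis unfolding t by (simp add: mk_mark_def F(3))
  qed
qed

section \<open>The stars of supertiles\<close>

definition across :: fr where "across = Fr False 2 0 (G (ZF 0 1 0 0) (ZF 0 0 1 0))"

text \<open>If the foot of the altitude of a tile is interior to a side of the tile across, then that tile is the first one turned
  around the midpoint of the hypotenuse.\<close>

lemma foot_pair_types:
  "list_all (\<lambda>(k, s, k', s', F, fl). k \<noteq> Large \<or> s \<noteq> Hyp \<or> (k' = Large \<and> s' = Hyp \<and> F = across \<and> fl) \<or>
     list_ex (\<lambda>v. zle (zb k' v (fapp (finv F) (gpt Large FH)))) [c0 s', c1 s']) pair_types"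
  by code_simp

lemma C1_frames:
  "case entries C1 of [x, y, z] \<Rightarrow> ef y = fcomp (ef x) (sibframe PL PS) \<and> ef z = fcomp (ef x) (subframe PL PL across) | _ \<Rightarrow> False"
  by code_simp

lemma foot_across_not_small: "evf (finv across) foot0 \<notin> emb PS ` std Small"
proof
  assume "evf (finv across) foot0 \<in> emb PS ` std Small"
  then obtain w where w: "evf (finv across) foot0 = emb PS w" "w \<in> std Small" by blast
  have "bary Large Sh (evf (finv across) foot0) = phi^2"
    using evz_zb[of Large Sh "fapp (finv across) (gpt Large FH)"]
    unfolding evg_fapp evg_gpt ppt.simps across_def by (simp add: grot_def gia_def phi_alg)
  moreover have "bary Large Sh (emb PS w) = phi^4 * bary Small Rt w" by (simp add: bary_emb del: bary.simps)
  moreover have "bary Small Rt w \<le> 1" "0 \<le> bary Small Rt w" using w(2) bary_sum[of Small w] unfolding std_def all_corner mem_Collect_eq by linarith+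
  moreover have "phi^4 < phi^2" using phi_powers_bounds phi_4 by simp
  ultimately show False using w(1) mult_left_le[of "bary Small Rt w" "phi^4"] by (simp del: bary.simps)
qed

lemma emb_foot: "emb PL 0 = foot0" "emb PS 0 = foot0"
  using df_proto(1,4) unfolding emb_def by simp_all

text \<open>The foot is not a vertex, so there is exactly one tile across the hypotenuse. Of the possible positions only the one
  turned around the midpoint of the hypotenuse has the foot in the interior of its side; the two halves of the one tile and
  the large half of the other one form the star \<open>C_1\<close>.\<close>

lemma new_vertex_legal:
  assumes Q: "colored_tiling Q" and pr: "paired Q" and f: "isometry f" and X: "ct Large f m \<in> Q"
    and A: "f foot0 \<in> interior (support Q)" "\<not> isvert Q (f foot0)"
  shows "\<exists>l r h. valid_label C1 l \<and> h 0 = homothety c (1 / phi) (f foot0) \<and> legalat (sigma c Q) C1 l r h"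
proof -
  let ?H = "homothety c (1 / phi)"
  have bf: "bary Large v foot0 = (case v of Rt \<Rightarrow> 0 | Sh \<Rightarrow> phi^4 | Bl \<Rightarrow> phi^2)" for v
    using bary_ppt(2)[of v] unfolding ppt.simps .
  have os: "on_side Large Hyp foot0" unfolding on_side_def all_corner opp.simps bf by simp
  obtain k' g m' s' z' where Y: "ct k' g m' \<in> Q" "isometry g" "f foot0 = g z'" "on_side k' s' z'" "ct k' g m' \<noteq> ct Large f m"
    "\<And>Y. Y \<in> Q \<Longrightarrow> f foot0 \<in> body (fst Y) \<Longrightarrow> Y = ct Large f m \<or> Y = ct k' g m'"
    "\<exists>n e. n \<noteq> 0 \<and> e > 0 \<and> (\<forall>w. dist w (f foot0) < e \<longrightarrow> (w \<in> side_of (tl Large f) Hyp \<longleftrightarrow> n \<bullet> (w - f foot0) = 0) \<and> (w \<in> side_of (tl k' g) s' \<longleftrightarrow> n \<bullet> (w - f foot0) = 0))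
       \<and> (\<forall>w. w \<in> side_of (tl Large f) Hyp \<or> w \<in> side_of (tl k' g) s' \<longrightarrow> n \<bullet> (w - f foot0) = 0)"
    by (rule tile_across[OF Q A X f refl os]) (rule that; assumption)
  obtain n e where n: "n \<noteq> 0" "e > 0" "\<And>w. dist w (f foot0) < e \<Longrightarrow> n \<bullet> (w - f foot0) = 0 \<Longrightarrow> w \<in> side_of (tl Large f) Hyp \<and> w \<in> side_of (tl k' g) s'"
    using Y(7) by blast
  define y where "y = f foot0 + (e / (2 * norm n)) *\<^sub>R (\<i> * n)"
  have y: "dist y (f foot0) < e" "n \<bullet> (y - f foot0) = 0" "y \<noteq> f foot0"
    using n(1,2) by (auto simp: y_def dist_norm norm_mult inner_complex_def)
  have f0: "f foot0 \<in> side_of (tl Large f) Hyp" "f foot0 \<in> side_of (tl k' g) s'" using n(3)[of "f foot0"] n(2) by simp_all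
  have yy: "y \<in> side_of (tl Large f) Hyp" "y \<in> side_of (tl k' g) s'" using n(3)[OF y(1,2)] by blast+
  obtain F fl where F: "(Large, Hyp, k', s', F, fl) \<in> set pair_types" "g = f \<circ> evf F" "m' s' = (fst (m Hyp), snd (m Hyp) \<noteq> fl)"
    using pairedD[OF pr f Y(2) X Y(1) Y(5)[symmetric] y(3)[symmetric] f0 yy] by blast
  have "z' = evf (finv F) foot0"
  proof -
    have "f foot0 = f (evf F z')" using Y(3) F(2) by simp
    then have "foot0 = evf F z'" using isometry_inj[OF f] by (auto dest: injD)
    then show ?thesis using fun_cong[OF evf_finv[of F], of z'] by simp
  qed
  then have zb: "evz (zb k' v (fapp (finv F) (gpt Large FH))) = bary k' v z'" for v unfolding evz_zb evg_fapp evg_gpt by simp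
  have "\<not> zle (zb k' v (fapp (finv F) (gpt Large FH)))" if "v \<in> {c0 s', c1 s'}" for v
  proof
    assume "zle (zb k' v (fapp (finv F) (gpt Large FH)))"
    then have "bary k' v z' \<le> 0" using zle zb by metis
    moreover have "v \<noteq> opp s'" using that by (cases s') auto
    ultimately show False using Y(4) unfolding on_side_def by force
  qed
  then have t: "k' = Large" "s' = Hyp" "F = across" fl
    using bspec[OF foot_pair_types[unfolded list_all_iff[of _ pair_types]] F(1)] by auto
  obtain e1 e2 e3 where E: "entries C1 = [e1, e2, e3]" "ek e1 = Large" "ek e2 = Small" "ek e3 = Large"
     "em e1 Hyp = NoM" "em e1 LLeg = Ax False" "em e1 SLeg = Of A0 True" "em e2 Hyp = NoM" "em e2 LLeg = Of A0 True" "em e2 SLeg = Ax True"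
     "em e3 Hyp = NoM" "em e3 LLeg = Ax True" "em e3 SLeg = NoM" by simp
  have ef: "ef e2 = fcomp (ef e1) (sibframe PL PS)" "ef e3 = fcomp (ef e1) (subframe PL PL across)"
    using C1_frames unfolding E(1) by simp_all
  define h where "h = lift c f \<circ> df PL \<circ> evf (finv (ef e1))"
  have hi: "isometry h" unfolding h_def by (intro isometry_comp isometry_lift[OF f] isometry_df isometry_evf)
  have h1: "h \<circ> evf (ef e1) = lift c f \<circ> df PL" unfolding h_def comp_assoc evf_finv by (simp add: comp_def)
  have h2: "h \<circ> evf (ef e2) = lift c f \<circ> df PS"
    unfolding ef evf_fcomp comp_assoc[symmetric] h1 by (rule sibframe[symmetric])
  have h3: "h \<circ> evf (ef e3) = lift c g \<circ> df PL"
    unfolding ef evf_fcomp comp_assoc[symmetric] h1 by (rule subframe[symmetric]) (simp add: F(2) t(3))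
  define l where "l = fst (m Hyp) + 1"
  define r where "r = snd (m Hyp)"
  note S = sigma_ct[OF colored_tilingD(1)[OF Q], of Q c, simplified]
  have pieceI: "piece c p h m \<in> sigma c Q" if "isometry h" "ct (par p) h m \<in> Q" for p h m unfolding S using that by blast
  have P: "piece c PL f m \<in> sigma c Q" "piece c PS f m \<in> sigma c Q" "piece c PL g m' \<in> sigma c Q"
    using pieceI[OF f, of PL m] pieceI[OF f, of PS m] pieceI[OF Y(2), of PL m'] X Y(1) unfolding t(1) by simp_all
  have h0: "h 0 = ?H (f foot0)"
  proof -
    have "h 0 = h (evf (ef e1) (ppt Large (ep e1)))" using entry_ok(2)[of e1 C1] E by simp
    also have "ep e1 = At Rt" using E(1) by auto
    finally have "h 0 = (h \<circ> evf (ef e1)) 0" by simp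
    then show ?thesis unfolding h1 using emb_foot(1) by (simp add: lift_df emb_def del: df.simps)
  qed
  have mY: "m' Hyp = (fst (m Hyp), \<not> snd (m Hyp))" using F(3) t by simp
  have "legalat (sigma c Q) C1 l r h"
    unfolding legalat_def
  proof (intro conjI ballI impI)
    fix e assume "e \<in> set (entries C1)"
    then consider "e = e1" | "e = e2" | "e = e3" unfolding E(1) by auto
    then show "\<exists>m. ct (ek e) (h \<circ> evf (ef e)) m \<in> sigma c Q \<and> (\<forall>s. agr l r (em e s) (m s))"
    proof cases
      case 1
      have "agr l r (em e1 s) (pm PL m s)" for s unfolding agr_def by (cases s) (auto simp: E l_def r_def)
      then show ?thesis unfolding 1 h1 E using P(1) unfolding piece_def by auto
    next
      case 2
      have "agr l r (em e2 s) (pm PS m s)" for s unfolding agr_def by (cases s) (auto simp: E l_def r_def)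
      then show ?thesis unfolding 2 h2 E using P(2) unfolding piece_def by auto
    next
      case 3
      have "agr l r (em e3 s) (pm PL m' s)" for s unfolding agr_def by (cases s) (auto simp: E l_def r_def mY)
      then show ?thesis unfolding 3 h3 E using P(3) unfolding piece_def by auto
    qed
  next
    fix Z assume Z: "Z \<in> sigma c Q" "h 0 \<in> body (fst Z)"
    obtain p f0 m0 where p: "Z = piece c p f0 m0" "isometry f0" "ct (par p) f0 m0 \<in> Q" using Z(1) unfolding S by blast
    have "?H (f foot0) \<in> ?H ` f0 ` emb p ` std (pk p)" using Z(2) unfolding h0 p(1) body_piece[OF p(2)] .
    then obtain w where w: "f foot0 = f0 (emb p w)" "w \<in> std (pk p)" using homothety_inj[of c] by (auto simp: inj_eq)
    have "f foot0 \<in> body (tl (par p) f0)" unfolding w(1) body_tl[OF p(2)] using w(2) emb_std[of p] by blast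
    then have "ct (par p) f0 m0 = ct Large f m \<or> ct (par p) f0 m0 = ct k' g m'" using Y(6)[OF p(3)] by simp
    then show "\<exists>e\<in>set (entries C1). \<exists>m. Z = ct (ek e) (h \<circ> evf (ef e)) m"
    proof
      assume "ct (par p) f0 m0 = ct Large f m"
      from ct_eqD[OF p(2) f this] have e: "par p = Large" "f0 = f" "m0 = m" .
      have "p = PL \<or> p = PS" using e(1) by (cases p) auto
      then show ?thesis
      proof
        assume "p = PL" then show ?thesis using h1 p(1) e(2,3) E(1,2) unfolding piece_def by (auto simp del: df.simps entries.simps)
      next
        assume "p = PS" then show ?thesis using h2 p(1) e(2,3) E(1,3) unfolding piece_def by (auto simp del: df.simps entries.simps)
      qed
    next
      assume "ct (par p) f0 m0 = ct k' g m'"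
      from ct_eqD[OF p(2) Y(2) this] have e: "par p = k'" "f0 = g" "m0 = m'" .
      have "p \<noteq> PS"
      proof
        assume ps: "p = PS"
        have "g z' = g (emb p w)" using w(1) Y(3) e(2) by simp
        then have "z' = emb p w" using isometry_inj[OF Y(2)] by (auto dest: injD)
        then show False using foot_across_not_small \<open>z' = evf (finv F) foot0\<close> t(3) w(2) ps by auto
      qed
      then have "p = PL" using e(1) t(1) by (cases p) auto
      then show ?thesis using h3 p(1) e(2,3) E(1,4) unfolding piece_def by (auto simp del: df.simps entries.simps)
    qed
  qed (rule hi)
  moreover have "valid_label C1 l"
    using colored_tilingD(1)[OF Q X] unfolding colored_tile_ct[OF f] parity_ok_def all_side valid_label_def l_def by auto
  ultimately show ?thesis using h0 by blast
qed

lemma valid_label_nx: "valid_label n l \<Longrightarrow> valid_label (nx n) (l + 1)"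
  unfolding valid_label_def by (cases n) auto

text \<open>On the boundary of a patch stars are not complete, so nothing is claimed there.\<close>

definition stars_legal :: "ctile set \<Rightarrow> bool" where
  "stars_legal Q \<longleftrightarrow> (\<forall>A. isvert Q A \<longrightarrow> A \<in> interior (support Q) \<longrightarrow> (\<exists>n l r h. valid_label n l \<and> h 0 = A \<and> legalat Q n l r h))"

text \<open>Decomposition creates new vertices only at the feet of altitudes.\<close>

lemma vertex_of_sigma:
  assumes Q: "colored_tiling Q" and B: "isvert (sigma c Q) B"
  obtains A where "B = homothety c (1 / phi) A" "isvert Q A"
  | f m where "B = homothety c (1 / phi) (f foot0)" "isometry f" "ct Large f m \<in> Q"
proof -
  note S = sigma_ct[OF colored_tilingD(1)[OF Q], of Q c, simplified]
  obtain p f m v where p: "isometry f" "ct (par p) f m \<in> Q" "B = (lift c f \<circ> df p) (proto (pk p) v)"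
  proof -
    obtain Y where Y: "Y \<in> sigma c Q" "B \<in> range (vert (fst Y))" using B unfolding isvert_def by blast
    obtain p f m where p: "isometry f" "ct (par p) f m \<in> Q" "Y = piece c p f m" using Y(1) unfolding S by blast
    obtain v where "B = vert (fst Y) v" using Y(2) by blast
    then have "B = (lift c f \<circ> df p) (proto (pk p) v)" unfolding p(3) piece_def fst_ct tl_sel by simp
    then show thesis using that p(1,2) by blast
  qed
  have B: "B = homothety c (1 / phi) (f (phi *\<^sub>R df p (proto (pk p) v)))" unfolding p(3) by (simp add: lift_df del: df.simps)
  have "(\<exists>w. phi *\<^sub>R df p (proto (pk p) v) = proto (par p) w) \<or> (phi *\<^sub>R df p (proto (pk p) v) = foot0 \<and> par p = Large)"
    by (cases p; cases v; simp only: pk.simps par.simps df_proto; blast)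
  then show thesis
  proof
    assume "\<exists>w. phi *\<^sub>R df p (proto (pk p) v) = proto (par p) w"
    then obtain w where "phi *\<^sub>R df p (proto (pk p) v) = proto (par p) w" by blast
    moreover have "isvert Q (f (proto (par p) w))" unfolding isvert_def using p(2) by force
    ultimately show thesis using that(1) B by metis
  next
    assume "phi *\<^sub>R df p (proto (pk p) v) = foot0 \<and> par p = Large"
    then show thesis using that(2)[of f m] B p(1,2) by simp
  qed
qed

lemma stars_legal_sigma:
  assumes Q: "colored_tiling Q" and pr: "paired Q" and L: "stars_legal Q"
  shows "stars_legal (sigma c Q)"
  unfolding stars_legal_def
proof (intro allI impI)
  fix B assume B: "isvert (sigma c Q) B" "B \<in> interior (support (sigma c Q))"
  have in0: "A \<in> interior (support Q)" if "B = homothety c (1 / phi) A" for A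
  proof -
    have "support (sigma c Q) = homothety c (1 / phi) ` support Q" by (rule support_sigma) (rule colored_tilingD(1)[OF Q])
    then have "homothety c (1 / phi) A \<in> homothety c (1 / phi) ` interior (support Q)" using B(2) unfolding that by (simp only: interior_homothety)
    then show ?thesis unfolding inj_image_mem_iff[OF homothety_inj] .
  qed
  have old: "\<exists>n l r h. valid_label n l \<and> h 0 = B \<and> legalat (sigma c Q) n l r h" if A: "B = homothety c (1 / phi) A" "isvert Q A" for A
  proof -
    obtain n l r h where h: "valid_label n l" "h 0 = A" "legalat Q n l r h" using L A(2) in0[OF A(1)] unfolding stars_legal_def by blast
    have "(lift c h \<circ> evf (rotn n)) 0 = B" using h(2) A(1) by (simp add: rotn_facts homothety_h0)
    then show ?thesis using legalat_sigma[OF Q h(3), of c] valid_label_nx[OF h(1)] by blast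
  qed
  show "\<exists>n l r h. valid_label n l \<and> h 0 = B \<and> legalat (sigma c Q) n l r h"
  proof (cases rule: vertex_of_sigma[OF Q B(1)])
    case (1 A) then show ?thesis by (rule old)
  next
    case (2 f m)
    show ?thesis
    proof (cases "isvert Q (f foot0)")
      case True then show ?thesis using old[OF 2(1)] by blast
    next
      case False
      show ?thesis using new_vertex_legal[OF Q pr 2(2,3) in0[OF 2(1)] False, of c] 2(1) by metis
    qed
  qed
qed

text \<open>A single tile has no vertex in its interior and no pairs of tiles; both properties persist under decomposition.\<close>

lemma supertile_invariant:
  assumes "colored_supertile c n Q"
  shows "colored_tiling Q \<and> paired Q \<and> stars_legal Q \<and> finite Q"
proof -
  obtain X where X: "colored_tile X" "kind (fst X) = Large" and Q: "Q = (sigma c ^^ n) {X}"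
    using assms unfolding colored_supertile_def by blast
  have base: "colored_tiling {X}" using X(1) unfolding colored_tiling_def by (simp add: pairwise_def)
  have "stars_legal {X}" unfolding stars_legal_def
  proof (intro allI impI)
    fix A assume A: "isvert {X} A" "A \<in> interior (support {X})"
    obtain k f m where f: "isometry f" "X = ct k f m" using colored_tileE[OF X(1)] by metis
    obtain v where v: "A = f (proto k v)" using A(1) f(2) unfolding isvert_def by auto
    have "A \<in> f ` {z. \<forall>c. 0 < bary k c z}" using A(2) interior_body[OF f(1), of k] f(2) unfolding support_def by simp
    then have "\<forall>c. 0 < bary k c (proto k v)" unfolding v inj_image_mem_iff[OF isometry_inj[OF f(1)]] by (rule CollectD)
    then have False unfolding bary_proto all_corner by (cases v) auto
    then show "\<exists>n l r h. valid_label n l \<and> h 0 = A \<and> legalat {X} n l r h" ..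
  qed
  moreover have "finite (sigma c P)" if "finite P" for P :: "ctile set"
  proof -
    have "finite (decompose Y)" for Y by (cases Y) (auto simp: decompose_def Let_def split: kind.splits)
    then show ?thesis unfolding sigma_def using that by auto
  qed
  ultimately show ?thesis unfolding Q
    by (induction n) (auto simp: base paired_singleton colored_tiling_sigma paired_sigma stars_legal_sigma)
qed

text \<open>Matching of sides concerns two tiles, and a star finitely many. A supertile that contains all tiles at a vertex has
  no others there, since the vertex is interior to their union.\<close>

theorem substitution_imp_L_tiling:
  assumes T: "colored_tiling_of_plane T" and sub: "substitution_tiling c T"
  shows "L_tiling T"
proof -
  have tt: "colored_tiling T" and UT: "support T = UNIV" using T unfolding colored_tiling_of_plane_def by auto
  have cover: "\<exists>n Q. colored_supertile c n Q \<and> P \<subseteq> Q" if "finite P" "P \<subseteq> T" for P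
    using sub that unfolding substitution_tiling_def by blast
  have "sides_match T" unfolding sides_match_def
  proof (intro ballI, clarify)
    fix t \<kappa> t' \<kappa>' s s' x y assume X: "(t, \<kappa>) \<in> T" and Y: "(t', \<kappa>') \<in> T"
    assume xy: "x \<noteq> y" "closed_segment x y \<subseteq> side_of t s \<inter> side_of t' s'"
    obtain n Q where Q: "colored_supertile c n Q" "{(t, \<kappa>), (t', \<kappa>')} \<subseteq> Q" using cover[of "{(t, \<kappa>), (t', \<kappa>')}"] X Y by auto
    then have sm: "sides_match Q" using supertile_invariant[OF Q(1)] paired_sides_match by blast
    have q: "(t, \<kappa>) \<in> Q" "(t', \<kappa>') \<in> Q" using Q(2) by auto
    show "label (\<kappa> s) = label (\<kappa>' s') \<and> sgn (head (\<kappa> s) - tail (\<kappa> s)) = sgn (head (\<kappa>' s') - tail (\<kappa>' s'))"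
      by (rule sm[unfolded sides_match_def, THEN bspec, OF q(1), unfolded prod.case, THEN bspec, OF q(2), unfolded prod.case, rule_format])
        (use xy in blast)
  qed
  moreover have "legal_star A (star T A)" if v: "\<exists>X\<in>T. A \<in> range (vert (fst X))" for A
  proof -
    define P where "P = {X \<in> T. A \<in> body (fst X)}"
    have Pf: "finite P" "P \<subseteq> T" unfolding P_def
      by (rule finite_subset[OF _ finitely_many_tiles_meet_ball[OF tt, of A 0]]) auto
    obtain n Q where Q: "colored_supertile c n Q" "P \<subseteq> Q" using cover[OF Pf] by blast
    note iQ = supertile_invariant[OF Q(1)]
    have cT: "complete_star A (star T A)" unfolding complete_star_iff[OF tt] UT by simp
    have "(\<Union>X\<in>star T A. body (fst X)) = support P" unfolding star_def P_def support_def by force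
    then have AP: "A \<in> interior (support P)" using cT unfolding complete_star_def by simp
    have "support P \<subseteq> support Q" using Q(2) unfolding support_def by blast
    then have AQ: "A \<in> interior (support Q)" using AP interior_mono by blast
    have "X \<in> P" if "X \<in> Q" "A \<in> body (fst X)" for X
      by (rule tiles_at_point_in_patch[OF _ Q(2) Pf(1) AP that]) (use iQ in blast)
    then have "\<And>X. A \<in> body (fst X) \<Longrightarrow> X \<in> Q \<longleftrightarrow> X \<in> T" using Q(2) unfolding P_def by blast
    then have st: "star T A = star Q A" unfolding star_def by (metis (no_types, lifting) fst_conv)
    obtain X where X: "X \<in> T" "A \<in> range (vert (fst X))" using v by blast
    have "A \<in> body (fst X)" using X(2) unfolding body_def by (rule hull_inc)
    then have "isvert Q A" using X Q(2) unfolding isvert_def P_def by blast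
    then obtain n l r h where "valid_label n l" "h 0 = A" "legalat Q n l r h" using iQ AQ unfolding stars_legal_def by blast
    then show ?thesis unfolding st using legal_star_iff[of Q A] iQ complete_star_iff[of Q A] AQ by blast
  qed
  ultimately show ?thesis unfolding L_tiling_def using T by blast
qed

section \<open>Every legal star occurs in a supertile\<close>

text \<open>Following one piece through repeated decompositions, in exact coordinates.\<close>

type_synonym xmarks = "(lab \<times> bool) \<times> (lab \<times> bool) \<times> (lab \<times> bool)"

fun xmark :: "xmarks \<Rightarrow> side \<Rightarrow> lab \<times> bool" where
  "xmark (h, b, a) Hyp = h" | "xmark (h, b, a) LLeg = b" | "xmark (h, b, a) SLeg = a"

definition marks :: "xmarks \<Rightarrow> side \<Rightarrow> 4 \<times> bool" where "marks M s = (lv (fst (xmark M s)), snd (xmark M s))"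

fun next_mark :: "(lab \<times> bool) \<Rightarrow> bool \<Rightarrow> lab \<times> bool" where "next_mark (l, b) f = (linc l, b \<noteq> f)"

fun next_marks :: "pc \<Rightarrow> xmarks \<Rightarrow> xmarks" where
  "next_marks PL (h, b, a) = (next_mark b True, next_mark h True, (A0, True))"
| "next_marks PS (h, b, a) = (next_mark a False, (A0, True), next_mark h False)"
| "next_marks PU (h, b, a) = (next_mark h False, next_mark b False, next_mark a False)"

lemma marks_next: "marks (next_marks p M) = pm p (marks M)"
proof
  fix s
  obtain hl hb bl bb al ab where M: "M = ((hl, hb), (bl, bb), (al, ab))" by (cases M) auto
  show "marks (next_marks p M) s = pm p (marks M) s"
    unfolding M by (cases p; cases s) (simp_all add: marks_def lv_linc)
qed

text \<open>The piece reached by the given choices of pieces, with its frame and marks relative to the starting tile.\<close>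

fun walk :: "pc list \<Rightarrow> kind \<Rightarrow> fr \<Rightarrow> xmarks \<Rightarrow> (kind \<times> fr \<times> xmarks) option" where
  "walk [] k F M = Some (k, F, M)"
| "walk (p # ps) k F M = (if par p = k then walk ps (pk p) (fcomp (fshrink F) (fdf p)) (next_marks p M) else None)"

lemma walk_sound:
  assumes "walk ps k F M = Some (k', F', M')" "colored_tiling Q" "isometry g" "ct k (g \<circ> evf F) (marks M) \<in> Q"
  shows "ct k' ((lift c ^^ length ps) g \<circ> evf F') (marks M') \<in> (sigma c ^^ length ps) Q"
  using assms
proof (induction ps arbitrary: k F M Q g)
  case (Cons p ps)
  have p: "par p = k" "walk ps (pk p) (fcomp (fshrink F) (fdf p)) (next_marks p M) = Some (k', F', M')"
    using Cons.prems(1) by (simp_all split: if_splits)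
  have i: "isometry (g \<circ> evf F)" by (intro isometry_comp Cons.prems(3) isometry_evf)
  have "piece c p (g \<circ> evf F) (marks M) \<in> sigma c Q"
    by (rule piece_in_sigma[OF i]; unfold p(1)) (rule colored_tilingD(1)[OF Cons.prems(2,4)], rule Cons.prems(4))
  then have "ct (pk p) (lift c g \<circ> evf (fcomp (fshrink F) (fdf p))) (marks (next_marks p M)) \<in> sigma c Q"
    unfolding piece_def marks_next lift_comp evf_fcomp evf_fshrink evf_fdf comp_assoc .
  from Cons.IH[OF p(2) colored_tiling_sigma[OF Cons.prems(2)] isometry_lift[OF Cons.prems(3)] this]
  show ?case by (simp add: funpow_swap1)
qed simp

definition frame_id :: fr where "frame_id = Fr False 0 0 (G (ZF 0 0 0 0) (ZF 0 0 0 0))"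

lemma evf_frame_id: "evf frame_id = (\<lambda>z. z)"
proof -
  have z: "Complex 0 0 = 0" by (simp add: complex_eq_iff)
  show ?thesis by (simp add: frame_id_def iso_def fun_eq_iff z)
qed

text \<open>The marks of the tile in which all stars will be found: each side has the smallest label of its parity.\<close>

definition seed :: xmarks where "seed = ((A0, True), (A1, True), (A0, True))"

text \<open>Pieces of a large tile that form the star \<open>C_1\<close>, for each label and orientation of its axis. The star with label 3
  appears after four decompositions, the star with label 1 six decompositions later.\<close>

fun C1_paths :: "lab \<Rightarrow> bool \<Rightarrow> pc list list" where
  "C1_paths A3 True = [[PL, PS, PU, PL], [PL, PS, PU, PS], [PS, PU, PL, PL]]"
| "C1_paths A3 False = [[PS, PU, PL, PL], [PS, PU, PL, PS], [PL, PS, PU, PL]]"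
| "C1_paths l True = [[PL, PS, PU, PL, PL, PS, PU, PS, PU, PL], [PL, PS, PU, PL, PL, PS, PU, PS, PU, PS], [PS, PU, PL, PL, PL, PS, PU, PS, PU, PL]]"
| "C1_paths l False = [[PS, PU, PL, PL, PL, PS, PU, PS, PU, PL], [PS, PU, PL, PL, PL, PS, PU, PS, PU, PS], [PL, PS, PU, PL, PL, PS, PU, PS, PU, PL]]"

fun xmv :: "lab \<Rightarrow> bool \<Rightarrow> sm \<Rightarrow> lab \<times> bool" where
  "xmv l r (Of x b) = (x, b)" | "xmv l r (Ax b) = (l, b = r)" | "xmv l r NoM = (l, True)"

definition C1_frame :: "lab \<Rightarrow> bool \<Rightarrow> fr" where
  "C1_frame l r = (case walk (hd (C1_paths l r)) Large frame_id seed of None \<Rightarrow> frame_id | Some (k, F, M) \<Rightarrow> fcomp F (finv (ef (hd (entries C1)))))"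

lemma C1_paths_check:
  "list_all (\<lambda>l. list_all (\<lambda>r. list_all2 (\<lambda>ps e. case walk ps Large frame_id seed of None \<Rightarrow> False | Some (k, F, M) \<Rightarrow>
     k = ek e \<and> F = fcomp (C1_frame l r) (ef e) \<and> (if l = A3 then length ps = 4 else length ps = 10) \<and>
     list_all (\<lambda>s. em e s = NoM \<or> xmark M s = xmv l r (em e s)) [Hyp, LLeg, SLeg]) (C1_paths l r) (entries C1)) [True, False]) [A1, A3]"
  by code_simp

lemma list_all2_right: "list_all2 P xs ys \<Longrightarrow> y \<in> set ys \<Longrightarrow> \<exists>x. P x y"
  by (induction xs ys rule: list_all2_induct) auto

lemma funpow_lift_surj:
  assumes "isometry h" obtains f where "isometry f" "(lift c ^^ n) f = h"
proof -
  have "\<exists>f. isometry f \<and> (lift c ^^ n) f = h" using assms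
  proof (induction n arbitrary: h)
    case (Suc n)
    obtain f where "isometry f" "(lift c ^^ n) f = drop c h" using Suc.IH[OF isometry_drop[OF Suc.prems]] by blast
    then show ?case by (intro exI[of _ f]) simp
  qed auto
  then show thesis using that by blast
qed

definition occurs :: "complex \<Rightarrow> sn \<Rightarrow> 4 \<Rightarrow> bool \<Rightarrow> (complex \<Rightarrow> complex) \<Rightarrow> bool" where
  "occurs c n l r h \<longleftrightarrow> (\<exists>N Q. colored_supertile c N Q \<and> has_star Q n l r h)"

text \<open>The center \<open>h\<close> can be prescribed, because repeated lifting of frames reaches every isometry.\<close>

lemma occurs_C1:
  assumes l: "valid_label C1 l" and h: "isometry h"
  shows "occurs c C1 l r h"
proof -
  have "l = lv A1 \<or> l = lv A3" using l unfolding valid_label_def by auto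
  then have "\<exists>x. x \<in> set [A1, A3] \<and> l = lv x" by (elim disjE) (rule exI[of _ A1], simp, rule exI[of _ A3], simp)
  then obtain x where x: "x \<in> set [A1, A3]" "l = lv x" by blast
  define N :: nat where "N = (if x = A3 then 4 else 10)"
  have r: "r \<in> set [True, False]" by simp
  have ck: "list_all2 (\<lambda>ps e. case walk ps Large frame_id seed of None \<Rightarrow> False | Some (k, F, M) \<Rightarrow>
     k = ek e \<and> F = fcomp (C1_frame x r) (ef e) \<and> (if x = A3 then length ps = 4 else length ps = 10) \<and>
     list_all (\<lambda>s. em e s = NoM \<or> xmark M s = xmv x r (em e s)) [Hyp, LLeg, SLeg]) (C1_paths x r) (entries C1)"
    by (rule bspec[OF bspec[OF C1_paths_check[unfolded list_all_iff[of _ "[A1, A3]"] list_all_iff[of _ "[True, False]"]] x(1)] r])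
  have hi: "isometry (h \<circ> evf (finv (C1_frame x r)))" by (intro isometry_comp h isometry_evf)
  obtain f where f: "isometry f" "(lift c ^^ N) f = h \<circ> evf (finv (C1_frame x r))" by (rule funpow_lift_surj[OF hi])
  define X where "X = ct Large f (marks seed)"
  have cX: "colored_tile X" unfolding X_def colored_tile_ct[OF f(1)] parity_ok_def all_side by (simp add: marks_def seed_def)
  have base: "colored_tiling {X}" using cX unfolding colored_tiling_def by (simp add: pairwise_def)
  have hf: "(lift c ^^ N) f \<circ> evf (fcomp (C1_frame x r) G) = h \<circ> evf G" for G
    unfolding f(2) evf_fcomp comp_assoc[symmetric] unfolding comp_assoc[of h] evf_finv by (simp add: comp_def)
  have "has_star ((sigma c ^^ N) {X}) C1 l r h" unfolding has_star_def
  proof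
    fix e assume e: "e \<in> set (entries C1)"
    obtain ps where "case walk ps Large frame_id seed of None \<Rightarrow> False | Some (k, F, M) \<Rightarrow>
     k = ek e \<and> F = fcomp (C1_frame x r) (ef e) \<and> (if x = A3 then length ps = 4 else length ps = 10) \<and>
     list_all (\<lambda>s. em e s = NoM \<or> xmark M s = xmv x r (em e s)) [Hyp, LLeg, SLeg]"
      using list_all2_right[OF ck e] by (elim exE)
    then obtain M where w: "walk ps Large frame_id seed = Some (ek e, fcomp (C1_frame x r) (ef e), M)" "length ps = N"
       and m: "list_all (\<lambda>s. em e s = NoM \<or> xmark M s = xmv x r (em e s)) [Hyp, LLeg, SLeg]"
      unfolding N_def by (cases "walk ps Large frame_id seed") (auto split: if_splits)
    have "ct Large (f \<circ> evf frame_id) (marks seed) \<in> {X}" unfolding X_def evf_frame_id by (simp add: comp_def)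
    from walk_sound[OF w(1) base f(1) this, of c] have "ct (ek e) (h \<circ> evf (ef e)) (marks M) \<in> (sigma c ^^ N) {X}"
      unfolding w(2) hf .
    moreover have "agr l r (em e s) (marks M s)" for s
      using all_sides_list[OF m, of s] unfolding agr_def marks_def x(2) by (cases "em e s") auto
    ultimately show "\<exists>m. ct (ek e) (h \<circ> evf (ef e)) m \<in> (sigma c ^^ N) {X} \<and> (\<forall>s. agr l r (em e s) (m s))" by blast
  qed
  moreover have "colored_supertile c N ((sigma c ^^ N) {X})" unfolding colored_supertile_def using cX by (intro exI[of _ X]) (simp add: X_def)
  ultimately show ?thesis unfolding occurs_def by blast
qed

text \<open>One more decomposition of a supertile that contains the preceding star.\<close>

lemma occurs_next:
  assumes "n \<noteq> C1" and prev: "\<And>l h. valid_label (pre n False) l \<Longrightarrow> isometry h \<Longrightarrow> occurs c (pre n False) l r h"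
    and l: "valid_label n l" and h: "isometry h"
  shows "occurs c n l r h"
proof -
  have nn: "nx (pre n False) = n" by (rule nx_pre[OF assms(1)])
  have p7: "pre n False \<noteq> C7" by (cases n) auto
  then have rn: "evf (rotn (pre n False)) = (\<lambda>z. z)" using evf_frame_id unfolding frame_id_def by (cases "pre n False") auto
  have rrr: "rr (pre n False) r = r" using p7 by (simp add: rr_def)
  obtain N Q where Q: "colored_supertile c N Q" "has_star Q (pre n False) (l - 1) r (drop c h)"
    using prev[OF valid_label_pre[OF l assms(1)] isometry_drop[OF h]] unfolding occurs_def by blast
  have "colored_tiling Q" using supertile_invariant[OF Q(1)] by blast
  from has_star_sigma[OF this isometry_drop[OF h] Q(2), of c] have "has_star (sigma c Q) n l r h"
    unfolding nn rrr rn by (simp add: comp_def)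
  moreover have "colored_supertile c (Suc N) (sigma c Q)" using Q(1) unfolding colored_supertile_def by auto
  ultimately show ?thesis unfolding occurs_def by blast
qed

lemma every_star_occurs:
  assumes "valid_label n l" "isometry h" shows "occurs c n l r h"
proof -
  have 1: "occurs c C1 l r h" if "valid_label C1 l" "isometry h" for l h by (rule occurs_C1[OF that])
  have 2: "occurs c C2 l r h" if "valid_label C2 l" "isometry h" for l h by (rule occurs_next[OF _ _ that]) (simp_all add: 1)
  have 3: "occurs c C3 l r h" if "valid_label C3 l" "isometry h" for l h by (rule occurs_next[OF _ _ that]) (simp_all add: 2)
  have 4: "occurs c C4 l r h" if "valid_label C4 l" "isometry h" for l h by (rule occurs_next[OF _ _ that]) (simp_all add: 3)
  have 5: "occurs c C5 l r h" if "valid_label C5 l" "isometry h" for l h by (rule occurs_next[OF _ _ that]) (simp_all add: 4)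
  have 6: "occurs c C6 l r h" if "valid_label C6 l" "isometry h" for l h by (rule occurs_next[OF _ _ that]) (simp_all add: 5)
  have 7: "occurs c C7 l r h" if "valid_label C7 l" "isometry h" for l h by (rule occurs_next[OF _ _ that]) (simp_all add: 6)
  show ?thesis using assms 1 2 3 4 5 6 7 by (cases n) simp_all
qed

section \<open>Repeated decomposition\<close>

definition hom :: "complex \<Rightarrow> nat \<Rightarrow> complex \<Rightarrow> complex" where "hom c K = (homothety c (1 / phi) ^^ K)"

lemma hom_simps: "hom c 0 z = z" "hom c (Suc K) z = homothety c (1 / phi) (hom c K z)"
  by (simp_all add: hom_def)

lemma dist_hom: "dist (hom c K x) (hom c K y) * phi ^ K = dist x y"
proof (induction K)
  case (Suc K)
  have "dist (hom c (Suc K) x) (hom c (Suc K) y) = dist (hom c K x) (hom c K y) / phi"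
    unfolding hom_simps dist_homothety by simp
  then show ?case using Suc.IH by simp
qed (simp add: hom_simps)

lemma hom_surj: "\<exists>z. hom c K z = w"
proof (induction K arbitrary: w)
  case (Suc K)
  obtain z where "hom c K z = homothety c phi w" using Suc.IH by blast
  then show ?case by (intro exI[of _ z]) (simp add: hom_simps)
qed (simp add: hom_simps)

lemma hom_inj: "hom c K x = hom c K y \<longleftrightarrow> x = y"
  using dist_hom[of c K x y] by (metis dist_eq_0_iff mult_zero_left)

lemma funpow_sigma_tiling: "colored_tiling T \<Longrightarrow> colored_tiling ((sigma c ^^ K) T)"
  by (induction K) (auto intro: colored_tiling_sigma)

lemma funpow_sigma_mono: "P \<subseteq> Q \<Longrightarrow> (sigma c ^^ K) P \<subseteq> (sigma c ^^ K) Q"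
  by (induction K) (auto dest: sigma_mono)

lemma funpow_sigma_parent: "Z \<in> (sigma c ^^ K) T \<Longrightarrow> \<exists>X\<in>T. Z \<in> (sigma c ^^ K) {X}"
proof (induction K arbitrary: Z)
  case (Suc K)
  have "Z \<in> sigma c ((sigma c ^^ K) T)" using Suc.prems by simp
  then have "Z \<in> map_ctile (homothety c (1 / phi)) ` (\<Union>X\<in>(sigma c ^^ K) T. decompose X)" unfolding sigma_def[of c "(sigma c ^^ K) T"] .
  then obtain Z' where Z': "Z = map_ctile (homothety c (1 / phi)) Z'" "Z' \<in> (\<Union>X\<in>(sigma c ^^ K) T. decompose X)" by (elim imageE)
  obtain W where "W \<in> (sigma c ^^ K) T" "Z' \<in> decompose W" by (rule UN_E[OF Z'(2)])
  note W = this Z'(1)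
  obtain X where X: "X \<in> T" "W \<in> (sigma c ^^ K) {X}" using Suc.IH[OF W(1)] by blast
  have "Z \<in> sigma c ((sigma c ^^ K) {X})" unfolding sigma_def[of c "(sigma c ^^ K) {X}"] W(3)
    by (rule imageI, rule UN_I, rule X(2), rule W(2))
  then show ?case using X(1) by (intro bexI[of _ X]) simp_all
qed auto

lemma support_funpow_sigma:
  assumes "colored_tiling T" shows "support ((sigma c ^^ K) T) = hom c K ` support T"
proof (induction K)
  case (Suc K)
  have "support (sigma c ((sigma c ^^ K) T)) = homothety c (1 / phi) ` support ((sigma c ^^ K) T)"
    by (rule support_sigma) (rule colored_tilingD(1)[OF funpow_sigma_tiling[OF assms]])
  then show ?case unfolding Suc.IH image_image by (simp add: hom_simps)
qed (simp add: hom_simps)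

text \<open>The color of a side of a piece can only depend on the color of the side of the ancestor that contains it. So two ways
  to color a tile give the same colors to all pieces that avoid the sides colored differently.\<close>

lemma recolor:
  assumes f: "isometry f" and X: "colored_tile (ct k f m)" and X': "colored_tile (ct k f m')"
  shows "isometry g \<Longrightarrow> ct kz g mz \<in> (sigma c ^^ K) {ct k f m} \<Longrightarrow>
    \<exists>mz'. ct kz g mz' \<in> (sigma c ^^ K) {ct k f m'} \<and>
      (\<forall>s. mz' s \<noteq> mz s \<longrightarrow> (\<exists>b. m b \<noteq> m' b \<and> side_of (tl kz g) s \<subseteq> hom c K ` side_of (tl k f) b))"
proof (induction K arbitrary: kz g mz)
  case 0
  then have e: "kz = k" "g = f" "mz = m" using ct_eqD[OF 0(1) f] by auto
  show ?case unfolding e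
  proof (intro exI[of _ m'] conjI allI impI)
    fix s assume "m' s \<noteq> m s"
    then show "\<exists>b. m b \<noteq> m' b \<and> side_of (tl k f) s \<subseteq> hom c 0 ` side_of (tl k f) b" by (intro exI[of _ s]) (simp add: hom_simps)
  qed simp
next
  case (Suc K)
  have t: "colored_tiling {ct k f m}" "colored_tiling {ct k f m'}" using X X' unfolding colored_tiling_def by (simp_all add: pairwise_def)
  let ?Q = "(sigma c ^^ K) {ct k f m}" and ?Q' = "(sigma c ^^ K) {ct k f m'}"
  have Q: "colored_tiling ?Q" "colored_tiling ?Q'" by (rule funpow_sigma_tiling[OF t(1)], rule funpow_sigma_tiling[OF t(2)])
  have S: "sigma c ?Q = {piece c p f m | p f m. isometry f \<and> ct (par p) f m \<in> ?Q}" by (rule sigma_ct) (rule colored_tilingD(1)[OF Q(1)])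
  obtain p g0 m0 where p: "isometry g0" "ct (par p) g0 m0 \<in> ?Q" "ct kz g mz = piece c p g0 m0" using Suc.prems(2) S by auto
  note e = ct_eqD[OF Suc.prems(1) isometry_piece[OF p(1)] p(3)[unfolded piece_def]]
  obtain m1 where m1: "ct (par p) g0 m1 \<in> ?Q'"
    "\<And>s. m1 s \<noteq> m0 s \<Longrightarrow> \<exists>b. m b \<noteq> m' b \<and> side_of (tl (par p) g0) s \<subseteq> hom c K ` side_of (tl k f) b"
    using Suc.IH[OF p(1,2)] by blast
  have "piece c p g0 m1 \<in> sigma c ?Q'" by (rule piece_in_sigma[OF p(1) colored_tilingD(1)[OF Q(2) m1(1)] m1(1)])
  then have "ct kz g (pm p m1) \<in> (sigma c ^^ Suc K) {ct k f m'}" unfolding piece_def e by simp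
  moreover have "\<exists>b. m b \<noteq> m' b \<and> side_of (tl kz g) s \<subseteq> hom c (Suc K) ` side_of (tl k f) b" if d: "pm p m1 s \<noteq> mz s" for s
  proof -
    have d': "pm p m1 s \<noteq> pm p m0 s" using d unfolding e(3) .
    then have "src p s \<noteq> None" unfolding pm_src by (cases "src p s") simp_all
    then obtain a fl where a1: "src p s = Some (a, fl)" by auto
    have "m1 a \<noteq> m0 a"
    proof
      assume "m1 a = m0 a" then show False using d' unfolding pm_src a1 by simp
    qed
    note a = a1 this
    obtain b where b: "m b \<noteq> m' b" "side_of (tl (par p) g0) a \<subseteq> hom c K ` side_of (tl k f) b" using m1(2)[OF a(2)] by blast
    have "side_of (tl kz g) s \<subseteq> homothety c (1 / phi) ` side_of (tl (par p) g0) a"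
    proof
      fix z assume z: "z \<in> side_of (tl kz g) s"
      obtain u where u: "z = homothety c (1 / phi) (g0 (emb p u))" "u \<in> std (pk p)" "bary (pk p) (opp s) u = 0"
        by (rule piece_side_point[OF p(1) z[unfolded e]])
      have "g0 (emb p u) \<in> side_of (tl (par p) g0) a"
        unfolding side_of_tl(1)[OF p(1)] using side_in_parent[OF a(1) u(2,3)] by blast
      then show "z \<in> homothety c (1 / phi) ` side_of (tl (par p) g0) a" unfolding u(1) by (rule imageI)
    qed
    also have "\<dots> \<subseteq> homothety c (1 / phi) ` hom c K ` side_of (tl k f) b" by (rule image_mono[OF b(2)])
    also have "\<dots> = hom c (Suc K) ` side_of (tl k f) b" unfolding image_image by (simp add: hom_simps)
    finally show ?thesis using b(1) by blast
  qed
  ultimately show ?case by blast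
qed

section \<open>Tilings with legal stars are substitution tilings\<close>

lemma compo_iterates:
  assumes T: "legal_tiling T" and U: "support T = UNIV"
  shows "legal_tiling ((compo c ^^ K) T) \<and> support ((compo c ^^ K) T) = UNIV \<and> (sigma c ^^ K) ((compo c ^^ K) T) = T"
proof (induction K)
  case (Suc K)
  let ?S = "(compo c ^^ K) T"
  have L: "legal_tiling ?S" and US: "support ?S = UNIV" and sg: "(sigma c ^^ K) ?S = T" using Suc.IH by blast+
  have lc: "legal_tiling (compo c ?S)" by (rule legal_tiling_compo[OF L])
  have "support (sigma c (compo c ?S)) = homothety c (1 / phi) ` support (compo c ?S)" by (rule support_sigma) (rule compo_colored)
  then have "homothety c (1 / phi) ` support (compo c ?S) = homothety c (1 / phi) ` UNIV"
    unfolding sigma_compo[OF L] US homothety_surj ..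
  then have uc: "support (compo c ?S) = UNIV" by (simp only: inj_image_eq_iff[OF homothety_inj])
  have "(sigma c ^^ Suc K) ((compo c ^^ Suc K) T) = T" using sg unfolding funpow_Suc_right[of K "sigma c"] comp_apply by (simp add: sigma_compo[OF L])
  then show ?case using lc uc by simp
qed (use T U in simp)

text \<open>The points near which the recorded colors of the star at \<open>A\<close> determine everything: the interior of the star without the
  sides that do not contain \<open>A\<close>.\<close>

definition core :: "ctile set \<Rightarrow> complex \<Rightarrow> complex set" where
  "core T A = interior (\<Union>X\<in>{X \<in> T. A \<in> body (fst X)}. body (fst X)) -
     \<Union>{side_of (fst X) s | X s. X \<in> T \<and> A \<in> body (fst X) \<and> A \<notin> side_of (fst X) s}"

definition std_core :: "sn \<Rightarrow> complex set" where
  "std_core n = interior (\<Union>e\<in>set (entries n). body (tl (ek e) (evf (ef e)))) -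
     \<Union>{side_of (tl (ek e) (evf (ef e))) s | e s. e \<in> set (entries n) \<and> \<not> sat (ep e) s}"

lemma body_comp: "isometry h \<Longrightarrow> isometry g \<Longrightarrow> body (tl k (h \<circ> g)) = h ` body (tl k g)"
  by (simp add: body_tl isometry_comp image_comp)

lemma legalat_tiles:
  assumes T: "colored_tiling T" and L: "legalat T n l r h"
  shows "fst ` {X \<in> T. h 0 \<in> body (fst X)} = (\<lambda>e. tl (ek e) (h \<circ> evf (ef e))) ` set (entries n)"
proof (intro equalityI subsetI)
  fix t assume "t \<in> fst ` {X \<in> T. h 0 \<in> body (fst X)}"
  then obtain X where X: "X \<in> T" "h 0 \<in> body (fst X)" "t = fst X" by blast
  then obtain e m where "e \<in> set (entries n)" "X = ct (ek e) (h \<circ> evf (ef e)) m" using L unfolding legalat_def by blast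
  then show "t \<in> (\<lambda>e. tl (ek e) (h \<circ> evf (ef e))) ` set (entries n)" using X(3) by simp
next
  fix t assume "t \<in> (\<lambda>e. tl (ek e) (h \<circ> evf (ef e))) ` set (entries n)"
  then obtain e where e: "e \<in> set (entries n)" "t = tl (ek e) (h \<circ> evf (ef e))" by blast
  have h: "isometry h" using L unfolding legalat_def by blast
  obtain m where m: "ct (ek e) (h \<circ> evf (ef e)) m \<in> T" using L e(1) unfolding legalat_def by blast
  have "evf (ef e) (ppt (ek e) (ep e)) \<in> evf (ef e) ` std (ek e)" using ppt_std(1) entry_ok(1)[OF e(1)] by blast
  then have "0 \<in> body (tl (ek e) (evf (ef e)))" unfolding body_tl[OF isometry_evf] entry_ok(2)[OF e(1)] .
  then have "h 0 \<in> body (fst (ct (ek e) (h \<circ> evf (ef e)) m))" unfolding fst_ct body_comp[OF h isometry_evf] by (rule imageI)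
  then have "ct (ek e) (h \<circ> evf (ef e)) m \<in> {X \<in> T. h 0 \<in> body (fst X)}" using m by blast
  from imageI[OF this, of fst] show "t \<in> fst ` {X \<in> T. h 0 \<in> body (fst X)}" unfolding e(2) fst_ct .
qed

text \<open>By legality the tiles at the center are the images of the tiles in the table, so only seven shapes of cores exist.\<close>

lemma core_std:
  assumes T: "colored_tiling T" and L: "legalat T n l r h"
  shows "core T (h 0) = h ` std_core n"
proof -
  have h: "isometry h" using L unfolding legalat_def by blast
  note LT = legalat_tiles[OF T L]
  have "(\<Union>X\<in>{X \<in> T. h 0 \<in> body (fst X)}. body (fst X)) = (\<Union>t\<in>fst ` {X \<in> T. h 0 \<in> body (fst X)}. body t)" by blast
  also have "\<dots> = h ` (\<Union>e\<in>set (entries n). body (tl (ek e) (evf (ef e))))" unfolding LT image_UN by (simp add: body_comp[OF h isometry_evf])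
  finally have 1: "interior (\<Union>X\<in>{X \<in> T. h 0 \<in> body (fst X)}. body (fst X)) = h ` interior (\<Union>e\<in>set (entries n). body (tl (ek e) (evf (ef e))))"
    by (simp only: isometry_interior[OF h])
  have "{side_of (fst X) s | X s. X \<in> T \<and> h 0 \<in> body (fst X) \<and> h 0 \<notin> side_of (fst X) s} =
      {side_of t s | t s. t \<in> fst ` {X \<in> T. h 0 \<in> body (fst X)} \<and> h 0 \<notin> side_of t s}" by blast
  also have "\<dots> = {side_of (tl (ek e) (h \<circ> evf (ef e))) s | e s. e \<in> set (entries n) \<and> h 0 \<notin> side_of (tl (ek e) (h \<circ> evf (ef e))) s}"
    unfolding LT by blast
  also have "\<dots> = {h ` side_of (tl (ek e) (evf (ef e))) s | e s. e \<in> set (entries n) \<and> \<not> sat (ep e) s}"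
    unfolding image_side_of[OF h isometry_evf] inj_image_mem_iff[OF isometry_inj[OF h]] using zero_in_side by blast
  also have "\<Union>\<dots> = h ` \<Union>{side_of (tl (ek e) (evf (ef e))) s | e s. e \<in> set (entries n) \<and> \<not> sat (ep e) s}" by blast
  finally show ?thesis unfolding core_def std_core_def 1 image_set_diff[OF isometry_inj[OF h]] by simp
qed

lemma open_std_core: "open (std_core n)"
proof -
  have "{side_of (tl (ek e) (evf (ef e))) s | e s. e \<in> set (entries n) \<and> \<not> sat (ep e) s} \<subseteq>
      (\<lambda>(e, s). side_of (tl (ek e) (evf (ef e))) s) ` (set (entries n) \<times> {Hyp, LLeg, SLeg})" (is "?A \<subseteq> ?B")
    unfolding side_UNIV[symmetric] by auto
  then have "finite ?A" by (rule finite_subset) simp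
  moreover have "closed S" if "S \<in> ?A" for S using that by (auto simp: side_of_tl(2)[OF isometry_evf])
  ultimately have "closed (\<Union>?A)" by (intro closed_Union ballI)
  then show ?thesis unfolding std_core_def by (intro open_Diff open_interior)
qed

lemma line_points:
  fixes z v :: complex assumes "v \<noteq> 0"
  shows "z + t *\<^sub>R v \<in> closed_segment (z + a *\<^sub>R v) (z + b *\<^sub>R v) \<longleftrightarrow> t \<in> closed_segment a b"
proof -
  have "closed_segment (z + a *\<^sub>R v) (z + b *\<^sub>R v) = (\<lambda>x. z + x *\<^sub>R v) ` closed_segment a b"
  proof -
    have l: "linear (\<lambda>x :: real. x *\<^sub>R v)" by (intro linearI) (simp_all add: scaleR_add_left)
    show ?thesis unfolding closed_segment_translation closed_segment_linear_image[OF l] image_image ..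
  qed
  moreover have "inj (\<lambda>x :: real. z + x *\<^sub>R v)" using assms by (intro injI) simp
  ultimately show ?thesis using inj_image_mem_iff[of "\<lambda>x :: real. z + x *\<^sub>R v" t "closed_segment a b"] by simp
qed

text \<open>In a coordinate on the line both segments become intervals around \<open>0\<close>, and the smaller one of their right ends lies in both.\<close>

lemma common_endpoint:
  fixes z n :: complex
  assumes n: "n \<noteq> 0" "e > 0" and near: "\<And>w. dist w z < e \<Longrightarrow> n \<bullet> (w - z) = 0 \<Longrightarrow> w \<in> closed_segment a b \<and> w \<in> closed_segment c d"
    and line: "\<And>w. w \<in> {a, b, c, d} \<Longrightarrow> n \<bullet> (w - z) = 0"
  shows "\<exists>p\<in>{a, b, c, d}. p \<in> closed_segment a b \<and> p \<in> closed_segment c d"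
proof -
  define v where "v = \<i> * n"
  have v: "v \<noteq> 0" "n \<bullet> v = 0" using n(1) by (auto simp: v_def inner_complex_def)
  have coord: "\<exists>t. w = z + t *\<^sub>R v" if "n \<bullet> (w - z) = 0" for w
  proof -
    have nn: "Re n * Re n + Im n * Im n \<noteq> 0" using n(1) by (metis complex_eq_iff sum_squares_eq_zero_iff zero_complex.sel)
    have o: "Re n * Re (w - z) + Im n * Im (w - z) = 0" using that by (simp add: inner_complex_def)
    define t where "t = (Re n * Im (w - z) - Im n * Re (w - z)) / (Re n * Re n + Im n * Im n)"
    have "- (t * Im n) * (Re n * Re n + Im n * Im n) = Re (w - z) * (Re n * Re n + Im n * Im n)"
      using nn o unfolding t_def by simp algebra
    moreover have "t * Re n * (Re n * Re n + Im n * Im n) = Im (w - z) * (Re n * Re n + Im n * Im n)"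
      using nn o unfolding t_def by simp algebra
    ultimately have "- (t * Im n) = Re (w - z)" "t * Re n = Im (w - z)" using nn by (simp_all only: mult_cancel_right) blast+
    then have "w = z + t *\<^sub>R v" by (simp add: complex_eq_iff v_def)
    then show ?thesis ..
  qed
  obtain \<alpha> where a: "a = z + \<alpha> *\<^sub>R v" using coord[OF line[of a]] by blast
  obtain \<beta> where b: "b = z + \<beta> *\<^sub>R v" using coord[OF line[of b]] by blast
  obtain \<gamma> where c: "c = z + \<gamma> *\<^sub>R v" using coord[OF line[of c]] by blast
  obtain \<delta> where d: "d = z + \<delta> *\<^sub>R v" using coord[OF line[of d]] by blast
  have "z \<in> closed_segment a b \<and> z \<in> closed_segment c d" using near[of z] n(2) by simp
  then have "z + 0 *\<^sub>R v \<in> closed_segment a b" "z + 0 *\<^sub>R v \<in> closed_segment c d" by simp_all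
  then have s: "0 \<in> closed_segment \<alpha> \<beta>" "0 \<in> closed_segment \<gamma> \<delta>" unfolding a b c d line_points[OF v(1)] by blast+
  have "\<exists>t\<in>{\<alpha>, \<beta>, \<gamma>, \<delta>}. t \<in> closed_segment \<alpha> \<beta> \<and> t \<in> closed_segment \<gamma> \<delta>"
    using s unfolding closed_segment_eq_real_ivl by (auto split: if_splits)
  then obtain t where t: "t \<in> {\<alpha>, \<beta>, \<gamma>, \<delta>}" "t \<in> closed_segment \<alpha> \<beta>" "t \<in> closed_segment \<gamma> \<delta>" by blast
  have "z + t *\<^sub>R v \<in> {a, b, c, d}" using t(1) unfolding a b c d by blast
  moreover have "z + t *\<^sub>R v \<in> closed_segment a b" "z + t *\<^sub>R v \<in> closed_segment c d"
    unfolding a b c d line_points[OF v(1)] using t(2,3) by blast+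
  ultimately show ?thesis by blast
qed

lemma on_side_unique:
  assumes "on_side k s z" "bary k (opp d) z = 0" shows "d = s"
proof -
  have "opp d = opp s" using assms unfolding on_side_def by force
  then show ?thesis by (cases d; cases s) auto
qed

lemma side_endpoint: "w \<in> {f (proto k (c0 s)), f (proto k (c1 s))} \<Longrightarrow> w \<in> range (vert (tl k f))"
  by auto

text \<open>A point in the interior of a tile lies in the core of any of its corners, and a vertex in its own core. At any other point two
  tiles meet along sides with a common endpoint (\<open>common_endpoint\<close>), whose core contains the point.\<close>

lemma core_cover:
  assumes T: "colored_tiling T" and U: "support T = UNIV" and X: "X \<in> T" and z: "z \<in> body (fst X)"
  shows "\<exists>A. isvert T A \<and> A \<in> body (fst X) \<and> z \<in> core T A"
proof -
  obtain k f m where f: "isometry f" "X = ct k f m" using colored_tileE[OF colored_tilingD(1)[OF T X]] by metis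
  obtain u where u: "u \<in> std k" "z = f u" using z unfolding f(2) fst_ct body_tl[OF f(1)] by blast
  have coreI: "z \<in> core T A" if A: "\<And>Y. Y \<in> T \<Longrightarrow> z \<in> body (fst Y) \<Longrightarrow> A \<in> body (fst Y) \<and> (\<forall>s. z \<in> side_of (fst Y) s \<longrightarrow> A \<in> side_of (fst Y) s)" for A
    unfolding core_def
  proof
    obtain e where e: "e > 0" "\<And>Y. Y \<in> T \<Longrightarrow> body (fst Y) \<inter> ball z e \<noteq> {} \<Longrightarrow> z \<in> body (fst Y)"
      by (rule ball_meets_only_tiles_containing[OF T]) (rule that; assumption)
    have "ball z e \<subseteq> (\<Union>X\<in>{X \<in> T. A \<in> body (fst X)}. body (fst X))"
    proof
      fix w assume w: "w \<in> ball z e"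
      have "w \<in> support T" using U by simp
      then obtain Y where Y: "Y \<in> T" "w \<in> body (fst Y)" unfolding support_def by blast
      have "z \<in> body (fst Y)" using e(2)[OF Y(1)] Y(2) w by blast
      then show "w \<in> (\<Union>X\<in>{X \<in> T. A \<in> body (fst X)}. body (fst X))" using A[OF Y(1)] Y by blast
    qed
    then show "z \<in> interior (\<Union>X\<in>{X \<in> T. A \<in> body (fst X)}. body (fst X))" unfolding mem_interior using e(1) by blast
    show "z \<notin> \<Union>{side_of (fst X) s | X s. X \<in> T \<and> A \<in> body (fst X) \<and> A \<notin> side_of (fst X) s}"
    proof
      assume "z \<in> \<Union>{side_of (fst X) s | X s. X \<in> T \<and> A \<in> body (fst X) \<and> A \<notin> side_of (fst X) s}"
      then obtain Y s where Y: "Y \<in> T" "A \<notin> side_of (fst Y) s" "z \<in> side_of (fst Y) s" by blast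
      obtain k' g m' where g: "isometry g" "Y = ct k' g m'" using colored_tileE[OF colored_tilingD(1)[OF T Y(1)]] by metis
      have "z \<in> body (fst Y)" using Y(3) side_in_body[OF g(1), of k' s] unfolding g(2) fst_ct by blast
      then show False using A[OF Y(1)] Y by blast
    qed
  qed
  show ?thesis
  proof (cases "isvert T z")
    case True
    have "z \<in> core T z" by (rule coreI) blast
    then show ?thesis using True z by blast
  next
    case False
    show ?thesis
    proof (rule std_cases[OF u(1)])
      assume i: "u \<in> interior (std k)"
      have "z \<in> interior (body (fst X))" unfolding f(2) fst_ct body_tl[OF f(1)] isometry_interior[OF f(1)] u(2) using i by (rule imageI)
      have only: "Y = X" if Y: "Y \<in> T" "z \<in> body (fst Y)" for Y
      proof -
        obtain k' g m' where g: "isometry g" "Y = ct k' g m'" using colored_tileE[OF colored_tilingD(1)[OF T Y(1)]] by metis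
        have "interior (body (fst X)) \<inter> interior (body (tl k' g)) \<noteq> {}"
          using open_meets_interior[OF g(1) open_interior, of "body (fst X)" k'] \<open>z \<in> interior (body (fst X))\<close> Y(2) unfolding g(2) fst_ct by blast
        then show ?thesis using colored_tilingD(2)[OF T X Y(1)] unfolding g(2) fst_ct by blast
      qed
      have ns: "z \<notin> side_of (fst X) s" for s
      proof
        assume "z \<in> side_of (fst X) s"
        then have "bary k (opp s) u = 0" unfolding f(2) fst_ct side_of_tl(1)[OF f(1)] u(2) inj_image_mem_iff[OF isometry_inj[OF f(1)]] by blast
        then show False using i unfolding interior_std by (metis less_irrefl mem_Collect_eq)
      qed
      have vb: "f (proto k Rt) \<in> body (fst X)" unfolding f(2) fst_ct body_def tl_sel by (rule hull_inc, rule range_eqI[of _ _ Rt]) simp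
      have "z \<in> core T (f (proto k Rt))" by (rule coreI) (use only ns vb in blast)
      moreover have "isvert T (f (proto k Rt))" unfolding isvert_def by (rule bexI[OF _ X], unfold f(2) fst_ct tl_sel, rule range_eqI[of _ _ Rt]) simp
      ultimately show ?thesis using vb by blast
    next
      fix v assume "u = proto k v"
      then have "isvert T z" unfolding isvert_def using X f(2) u(2) by (intro bexI[of _ X]) auto
      then show ?thesis using False by blast
    next
      fix s assume os: "on_side k s u"
      have zi: "z \<in> interior (support T)" unfolding U by simp
      obtain k' g m' s' u' where Y: "ct k' g m' \<in> T" "isometry g" "z = g u'" "on_side k' s' u'" "ct k' g m' \<noteq> ct k f m"
        "\<And>Y. Y \<in> T \<Longrightarrow> z \<in> body (fst Y) \<Longrightarrow> Y = ct k f m \<or> Y = ct k' g m'"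
        "\<exists>n e. n \<noteq> 0 \<and> e > 0 \<and> (\<forall>w. dist w z < e \<longrightarrow> (w \<in> side_of (tl k f) s \<longleftrightarrow> n \<bullet> (w - z) = 0) \<and> (w \<in> side_of (tl k' g) s' \<longleftrightarrow> n \<bullet> (w - z) = 0))
           \<and> (\<forall>w. w \<in> side_of (tl k f) s \<or> w \<in> side_of (tl k' g) s' \<longrightarrow> n \<bullet> (w - z) = 0)"
        by (rule tile_across[OF T zi False X[unfolded f(2)] f(1) u(2) os]) (rule that; assumption)
      obtain n e where n: "n \<noteq> 0" "e > 0"
        and near: "\<forall>w. dist w z < e \<longrightarrow> (w \<in> side_of (tl k f) s \<longleftrightarrow> n \<bullet> (w - z) = 0) \<and> (w \<in> side_of (tl k' g) s' \<longleftrightarrow> n \<bullet> (w - z) = 0)"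
        and line: "\<forall>w. w \<in> side_of (tl k f) s \<or> w \<in> side_of (tl k' g) s' \<longrightarrow> n \<bullet> (w - z) = 0" using Y(7) by (elim exE conjE)
      note s1 = side_of_tl(2)[OF f(1), of k s] and s2 = side_of_tl(2)[OF Y(2), of k' s']
      obtain A where A: "A \<in> {f (proto k (c0 s)), f (proto k (c1 s)), g (proto k' (c0 s')), g (proto k' (c1 s'))}"
         "A \<in> side_of (tl k f) s" "A \<in> side_of (tl k' g) s'"
      proof -
        have nr: "w \<in> closed_segment (f (proto k (c0 s))) (f (proto k (c1 s))) \<and> w \<in> closed_segment (g (proto k' (c0 s'))) (g (proto k' (c1 s')))"
          if "dist w z < e" "n \<bullet> (w - z) = 0" for w using near that unfolding s1 s2 by blast
        have ln: "n \<bullet> (w - z) = 0" if "w \<in> {f (proto k (c0 s)), f (proto k (c1 s)), g (proto k' (c0 s')), g (proto k' (c1 s'))}" for w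
        proof -
          have "w \<in> side_of (tl k f) s \<or> w \<in> side_of (tl k' g) s'" using that unfolding s1 s2 by auto
          then show ?thesis using line by blast
        qed
        show thesis using common_endpoint[OF n nr ln] that unfolding s1 s2 by blast
      qed
      have iv: "isvert T A"
      proof -
        have "A \<in> range (vert (tl k f)) \<or> A \<in> range (vert (tl k' g))"
          using A(1) side_endpoint[of A f k s] side_endpoint[of A g k' s'] by blast
        then show ?thesis unfolding isvert_def
        proof
          assume "A \<in> range (vert (tl k f))" then show "\<exists>X\<in>T. A \<in> range (vert (fst X))" using X f(2) by (intro bexI[of _ X]) simp_all
        next
          assume "A \<in> range (vert (tl k' g))" then show "\<exists>X\<in>T. A \<in> range (vert (fst X))" using Y(1) by (intro bexI[of _ "ct k' g m'"]) simp_all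
        qed
      qed
      have b1: "A \<in> body (tl k f)" "A \<in> body (tl k' g)" using A(2,3) side_in_body[OF f(1)] side_in_body[OF Y(2)] by blast+
      have d1: "d = s" if "z \<in> side_of (tl k f) d" for d
        using that on_side_unique[OF os] unfolding side_of_tl(1)[OF f(1)] u(2) inj_image_mem_iff[OF isometry_inj[OF f(1)]] by blast
      have d2: "d = s'" if "z \<in> side_of (tl k' g) d" for d
        using that on_side_unique[OF Y(4)] unfolding side_of_tl(1)[OF Y(2)] Y(3) inj_image_mem_iff[OF isometry_inj[OF Y(2)]] by blast
      have "z \<in> core T A"
      proof (rule coreI)
        fix W assume W: "W \<in> T" "z \<in> body (fst W)"
        show "A \<in> body (fst W) \<and> (\<forall>s. z \<in> side_of (fst W) s \<longrightarrow> A \<in> side_of (fst W) s)"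
          using Y(6)[OF W]
        proof
          assume w: "W = ct k f m" show ?thesis unfolding w fst_ct using b1(1) d1 A(2) by blast
        next
          assume w: "W = ct k' g m'" show ?thesis unfolding w fst_ct using b1(2) d2 A(3) by blast
        qed
      qed
      then show ?thesis using iv b1(1) f(2) by auto
    qed
  qed
qed

text \<open>Seen from the frame of a tile, each core is one of finitely many open sets \<open>V (n, e)\<close>, where \<open>e\<close> is the place of the tile in
  the star \<open>n\<close>. Those at the tile cover it and have a Lebesgue number by compactness; the minimum over all
  covering subfamilies works for all tilings and all points.\<close>

lemma core_radius:
  obtains \<delta> where "\<delta> > 0"
    "\<And>T z. legal_tiling T \<Longrightarrow> support T = UNIV \<Longrightarrow> \<exists>n l r h. valid_label n l \<and> legalat T n l r h \<and> ball z \<delta> \<subseteq> core T (h 0)"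
proof -
  define I where "I = Sigma (set [C1, C2, C3, C4, C5, C6, C7]) (\<lambda>n. set (entries n))"
  define V where "V = (\<lambda>(n, e). evf (finv (ef e)) ` std_core n)"
  have finI: "finite I" unfolding I_def by simp
  have opV: "open (V i)" for i
  proof -
    obtain n e where i: "i = (n, e)" by (cases i)
    have "V i = evf (ef e) -` std_core n"
    proof (intro equalityI subsetI)
      fix w assume "w \<in> V i"
      then obtain x where "x \<in> std_core n" "w = inv (evf (ef e)) x" unfolding V_def i evf_finv_inv by auto
      then show "w \<in> evf (ef e) -` std_core n" using isometry_inv_comp(2)[OF isometry_evf] by simp
    next
      fix w assume "w \<in> evf (ef e) -` std_core n"
      then have "inv (evf (ef e)) (evf (ef e) w) \<in> V i" unfolding V_def i evf_finv_inv by auto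
      then show "w \<in> V i" unfolding isometry_inv_comp(1)[OF isometry_evf] .
    qed
    then show ?thesis using continuous_on_open_vimage[of UNIV "evf (ef e)"] isometry_continuous[OF isometry_evf] open_std_core by simp
  qed
  have "\<exists>\<epsilon>>0. std k \<subseteq> \<Union>(V ` J) \<longrightarrow> (\<forall>x\<in>std k. \<exists>i\<in>J. ball x \<epsilon> \<subseteq> V i)" for k J
  proof (cases "std k \<subseteq> \<Union>(V ` J)")
    case True
    obtain \<epsilon> where e: "0 < \<epsilon>" "\<And>x. x \<in> std k \<Longrightarrow> \<exists>G\<in>V ` J. ball x \<epsilon> \<subseteq> G"
      by (rule Heine_Borel_lemma[OF compact_std True]) (use opV in blast)+
    then show ?thesis by (intro exI[of _ \<epsilon>]) blast
  qed (rule exI[of _ 1], simp)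
  then have "\<forall>kJ. \<exists>\<epsilon>. \<epsilon> > 0 \<and> (std (fst kJ) \<subseteq> \<Union>(V ` snd kJ) \<longrightarrow> (\<forall>x\<in>std (fst kJ). \<exists>i\<in>snd kJ. ball x \<epsilon> \<subseteq> V i))" by blast
  from choice[OF this] obtain \<epsilon> where eps0: "\<forall>kJ. \<epsilon> kJ > 0 \<and> (std (fst kJ) \<subseteq> \<Union>(V ` snd kJ) \<longrightarrow> (\<forall>x\<in>std (fst kJ). \<exists>i\<in>snd kJ. ball x (\<epsilon> kJ) \<subseteq> V i))"
    by (rule exE)
  have eps: "\<epsilon> (k, J) > 0" "std k \<subseteq> \<Union>(V ` J) \<Longrightarrow> x \<in> std k \<Longrightarrow> \<exists>i\<in>J. ball x (\<epsilon> (k, J)) \<subseteq> V i" for k J x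
    using eps0[THEN spec, of "(k, J)", unfolded fst_conv snd_conv] by blast+
  define D where "D = \<epsilon> ` ({Large, Small} \<times> Pow I)"
  have D: "finite D" "D \<noteq> {}" "\<And>d. d \<in> D \<Longrightarrow> d > 0" unfolding D_def using finI eps(1) by auto
  define \<delta> where "\<delta> = Min D"
  have d0: "\<delta> > 0" unfolding \<delta>_def using D by simp
  have dle: "\<delta> \<le> \<epsilon> (k, J)" if "J \<subseteq> I" for k J
    unfolding \<delta>_def by (rule Min_le[OF D(1)]) (use that in \<open>cases k; auto simp: D_def\<close>)
  show thesis
  proof (rule that[OF d0])
    fix T z assume T: "legal_tiling T" and U: "support T = UNIV"
    have tt: "colored_tiling T" using T unfolding legal_tiling_def by blast
    have "z \<in> support T" using U by simp
    then obtain X where X: "X \<in> T" "z \<in> body (fst X)" unfolding support_def by blast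
    obtain k f m where f: "isometry f" "X = ct k f m" using colored_tileE[OF colored_tilingD(1)[OF tt X(1)]] by metis
    obtain u where u: "u \<in> std k" "z = f u" using X(2) unfolding f(2) fst_ct body_tl[OF f(1)] by blast
    define J where "J = {(n, e). e \<in> set (entries n) \<and> (\<exists>l r h. valid_label n l \<and> legalat T n l r h \<and> f = h \<circ> evf (ef e))}"
    have JI: "J \<subseteq> I" unfolding J_def I_def by (auto, metis sn.exhaust)
    have fV: "f ` V (n, e) = core T (h 0)" if "legalat T n l r h" "f = h \<circ> evf (ef e)" for n e l r h
    proof -
      have "f ` V (n, e) = h ` ((evf (ef e) \<circ> inv (evf (ef e))) ` std_core n)" unfolding V_def that(2) evf_finv_inv by (simp add: image_comp comp_assoc)
      then show ?thesis unfolding isometry_inv_comp(4)[OF isometry_evf] core_std[OF tt that(1)] by simp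
    qed
    have "std k \<subseteq> \<Union>(V ` J)"
    proof
      fix w assume w: "w \<in> std k"
      have "f w \<in> body (fst X)" unfolding f(2) fst_ct body_tl[OF f(1)] using w by (rule imageI)
      then obtain A where A: "isvert T A" "A \<in> body (fst X)" "f w \<in> core T A" using core_cover[OF tt U X(1)] by blast
      obtain Y v where Y: "Y \<in> T" "A = vert (fst Y) v" using A(1) unfolding isvert_def by blast
      obtain n l r h where h: "valid_label n l" "h 0 = A" "legalat T n l r h" using T Y unfolding legal_tiling_def by blast
      obtain e m' where e: "e \<in> set (entries n)" "X = ct (ek e) (h \<circ> evf (ef e)) m'" using h(3) X(1) A(2) unfolding legalat_def h(2) by blast
      have hi: "isometry h" using h(3) unfolding legalat_def by blast
      have fe: "f = h \<circ> evf (ef e)" by (rule ct_eqD(2)[OF f(1) isometry_comp[OF hi isometry_evf] e(2)[unfolded f(2)]])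
      have "f w \<in> f ` V (n, e)" using A(3) unfolding fV[OF h(3) fe] h(2) .
      then have "w \<in> V (n, e)" unfolding inj_image_mem_iff[OF isometry_inj[OF f(1)]] .
      moreover have "(n, e) \<in> J" unfolding J_def using e(1) h(1,3) fe by blast
      ultimately show "w \<in> \<Union>(V ` J)" by blast
    qed
    from eps(2)[OF this u(1)] obtain n e where ne: "(n, e) \<in> J" "ball u (\<epsilon> (k, J)) \<subseteq> V (n, e)" by force
    obtain l r h where h: "valid_label n l" "legalat T n l r h" "f = h \<circ> evf (ef e)" using ne(1) unfolding J_def by blast
    have "ball z \<delta> \<subseteq> f ` ball u (\<epsilon> (k, J))"
    proof
      fix y assume y: "y \<in> ball z \<delta>"
      have "dist u (inv f y) = dist (f u) (f (inv f y))" using f(1) unfolding isometry_def by simp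
      also have "\<dots> < \<epsilon> (k, J)" using y dle[OF JI, of k] unfolding isometry_inv_comp(2)[OF f(1)] u(2) by simp
      finally have "f (inv f y) \<in> f ` ball u (\<epsilon> (k, J))" by (intro imageI) simp
      then show "y \<in> f ` ball u (\<epsilon> (k, J))" unfolding isometry_inv_comp(2)[OF f(1)] .
    qed
    also have "\<dots> \<subseteq> core T (h 0)" unfolding fV[OF h(2,3), symmetric] by (rule image_mono[OF ne(2)])
    finally show "\<exists>n l r h. valid_label n l \<and> legalat T n l r h \<and> ball z \<delta> \<subseteq> core T (h 0)" using h(1,2) by blast
  qed
qed

text \<open>A tile that reaches into the core reaches into the interior of the star, hence belongs to it; and of its sides only those
  through the center reach into the core.\<close>

lemma core_meets:
  assumes T: "colored_tiling T" and B: "ball z \<delta> \<subseteq> core T A" and X: "X \<in> T" and y: "y \<in> body (fst X)" "y \<in> ball z \<delta>"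
  shows "A \<in> body (fst X)" "y \<in> side_of (fst X) s \<Longrightarrow> A \<in> side_of (fst X) s"
proof -
  define P where "P = {X \<in> T. A \<in> body (fst X)}"
  have P: "P \<subseteq> T" "finite P" unfolding P_def by (rule subsetI, simp) (rule finite_subset[OF _ finitely_many_tiles_meet_ball[OF T, of A 0]], auto)
  have "y \<in> interior (support P)" using B y(2) unfolding core_def P_def support_def by blast
  from tiles_at_point_in_patch[OF T P this X y(1)] show A: "A \<in> body (fst X)" unfolding P_def by blast
  show "A \<in> side_of (fst X) s" if "y \<in> side_of (fst X) s"
    using B y(2) that X A unfolding core_def by blast
qed

text \<open>A ball that contains \<open>P\<close> shrinks under \<open>K\<close>-fold composition below the radius of \<open>core_radius\<close>. Then all
  ancestors of \<open>P\<close> belong to one star, and \<open>P\<close> avoids all sides whose colors the star does not record. A supertile that contains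
  this star, possibly with other colors on those sides, contains \<open>P\<close> after \<open>K\<close> decompositions.\<close>

theorem legal_tiling_covered:
  assumes T: "legal_tiling T" and U: "support T = UNIV" and P: "finite P" "P \<subseteq> T"
  shows "\<exists>N Q. colored_supertile c N Q \<and> P \<subseteq> Q"
proof -
  obtain \<delta> where d: "\<delta> > 0"
    "\<And>T z. legal_tiling T \<Longrightarrow> support T = UNIV \<Longrightarrow> \<exists>n l r h. valid_label n l \<and> legalat T n l r h \<and> ball z \<delta> \<subseteq> core T (h 0)"
    by (rule core_radius) (rule that; assumption)
  have "compact (support P)" unfolding support_def using P(1) body_compact by (intro compact_UN) auto
  then obtain R where R: "\<And>y. y \<in> support P \<Longrightarrow> dist 0 y \<le> R" "R > 0"
    using compact_imp_bounded bounded_pos[of "support P"] by (auto simp: dist_norm)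
  obtain K where K: "phi ^ K < \<delta> / R" using real_arch_pow_inv[of "\<delta> / R" phi] d(1) R(2) phi_lt1 by auto
  have K': "R * phi ^ K < \<delta>" using K R(2) by (simp add: pos_less_divide_eq mult.commute)
  define S where "S = (compo c ^^ K) T"
  have S: "legal_tiling S" "support S = UNIV" "(sigma c ^^ K) S = T" using compo_iterates[OF T U, where c = c and K = K] unfolding S_def by blast+
  have tS: "colored_tiling S" using S(1) unfolding legal_tiling_def by blast
  obtain z where z: "hom c K z = 0" using hom_surj by blast
  obtain n l r h where h: "valid_label n l" "legalat S n l r h" "ball z \<delta> \<subseteq> core S (h 0)" using d(2)[OF S(1,2)] by blast
  have hi: "isometry h" using h(2) unfolding legalat_def by blast
  obtain N Q where Q: "colored_supertile c N Q" "has_star Q n l r h" using every_star_occurs[OF h(1) hi] unfolding occurs_def by blast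
  have tQ: "colored_tiling Q" using supertile_invariant[OF Q(1)] by blast
  have "P \<subseteq> (sigma c ^^ K) Q"
  proof
    fix Z assume Z: "Z \<in> P"
    then obtain X where X: "X \<in> S" "Z \<in> (sigma c ^^ K) {X}" using funpow_sigma_parent[where T = S and c = c and K = K] P(2) S(3) by blast
    have tX: "colored_tiling {X}" using colored_tilingD(1)[OF tS X(1)] unfolding colored_tiling_def by (simp add: pairwise_def)
    have near: "\<exists>y0. y = hom c K y0 \<and> y0 \<in> body (fst X) \<and> y0 \<in> ball z \<delta>" if y: "y \<in> body (fst Z)" for y
    proof -
      have "y \<in> support ((sigma c ^^ K) {X})" using y X(2) unfolding support_def by blast
      then obtain y0 where y0: "y = hom c K y0" "y0 \<in> body (fst X)" unfolding support_funpow_sigma[OF tX] unfolding support_def by auto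
      have "dist z y0 = dist (hom c K z) (hom c K y0) * phi ^ K" by (rule dist_hom[symmetric])
      also have "\<dots> \<le> R * phi ^ K" unfolding z y0(1)[symmetric] using R(1)[of y] y Z unfolding support_def by (intro mult_right_mono) auto
      also have "\<dots> < \<delta>" by (rule K')
      finally show ?thesis using y0 by auto
    qed
    have cZ: "colored_tile Z" using colored_tilingD(1)[OF funpow_sigma_tiling[OF tX] X(2)] .
    obtain kz g mz where g: "isometry g" "Z = ct kz g mz" using colored_tileE[OF cZ] by metis
    have "g (proto kz Rt) \<in> body (fst Z)" unfolding g(2) fst_ct body_def tl_sel by (rule hull_inc, rule range_eqI[of _ _ Rt]) simp
    from near[OF this] obtain y where y: "y \<in> body (fst X)" "y \<in> ball z \<delta>" by blast
    have hX: "h 0 \<in> body (fst X)" by (rule core_meets(1)[OF tS h(3) X(1) y])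
    then obtain e m where e: "e \<in> set (entries n)" "X = ct (ek e) (h \<circ> evf (ef e)) m" using h(2) X(1) unfolding legalat_def by blast
    have fi: "isometry (h \<circ> evf (ef e))" by (rule isometry_comp[OF hi isometry_evf])
    obtain m1 where m1: "ct (ek e) (h \<circ> evf (ef e)) m1 \<in> S" "\<And>s. agr l r (em e s) (m1 s)" using h(2) e(1) unfolding legalat_def by blast
    have "m1 = m" by (rule colored_tiling_frame_unique[OF tS fi m1(1)]) (use X(1) e(2) in simp)
    note am = m1(2)[unfolded this]
    obtain m' where m': "ct (ek e) (h \<circ> evf (ef e)) m' \<in> Q" "\<And>s. agr l r (em e s) (m' s)" using Q(2) e(1) unfolding has_star_def by blast
    have same: "m s = m' s" if "h 0 \<in> side_of (fst X) s" for s
    proof -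
      have "0 \<in> side_of (tl (ek e) (evf (ef e))) s"
        using that unfolding e(2) fst_ct image_side_of[OF hi isometry_evf] inj_image_mem_iff[OF isometry_inj[OF hi]] .
      then have "em e s \<noteq> NoM" using zero_in_side[OF e(1)] entry_ok(3)[OF e(1)] by blast
      then show ?thesis using am[of s] m'(2)[of s] unfolding agr_def by simp
    qed
    obtain mz' where mz': "ct kz g mz' \<in> (sigma c ^^ K) {ct (ek e) (h \<circ> evf (ef e)) m'}"
      "\<forall>s. mz' s \<noteq> mz s \<longrightarrow> (\<exists>b. m b \<noteq> m' b \<and> side_of (tl kz g) s \<subseteq> hom c K ` side_of (tl (ek e) (h \<circ> evf (ef e))) b)"
      using recolor[OF fi colored_tilingD(1)[OF tS X(1), unfolded e(2)] colored_tilingD(1)[OF tQ m'(1)] g(1) X(2)[unfolded e(2) g(2)]] by blast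
    have "mz' s = mz s" for s
    proof (rule ccontr)
      assume "mz' s \<noteq> mz s"
      then obtain b where b: "m b \<noteq> m' b" "side_of (tl kz g) s \<subseteq> hom c K ` side_of (fst X) b" using mz'(2) unfolding e(2) fst_ct by blast
      have gs: "g (proto kz (c0 s)) \<in> side_of (tl kz g) s" unfolding side_of_tl(2)[OF g(1)] by simp
      obtain y1 where y1: "g (proto kz (c0 s)) = hom c K y1" "y1 \<in> side_of (fst X) b" using b(2) gs by blast
      have "g (proto kz (c0 s)) \<in> body (fst Z)" using gs side_in_body[OF g(1)] unfolding g(2) fst_ct by blast
      from near[OF this] obtain y0 where y0: "g (proto kz (c0 s)) = hom c K y0" "y0 \<in> body (fst X)" "y0 \<in> ball z \<delta>" by blast
      have "y1 = y0" using y1(1) y0(1) hom_inj by metis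
      then have "h 0 \<in> side_of (fst X) b" using core_meets(2)[OF tS h(3) X(1) y0(2,3)] y1(2) by blast
      then show False using same b(1) by blast
    qed
    then have "mz' = mz" by (rule ext)
    then have "Z \<in> (sigma c ^^ K) {ct (ek e) (h \<circ> evf (ef e)) m'}" using mz'(1) g(2) by simp
    then show "Z \<in> (sigma c ^^ K) Q" using funpow_sigma_mono[where P = "{ct (ek e) (h \<circ> evf (ef e)) m'}" and Q = Q and K = K and c = c] m'(1) by blast
  qed
  moreover have "colored_supertile c (K + N) ((sigma c ^^ K) Q)" using Q(1) unfolding colored_supertile_def by (auto simp: funpow_add)
  ultimately show ?thesis by blast
qed

theorem theorem4:
  fixes T :: "ctile set" and c :: complex
  assumes "colored_tiling_of_plane T"
  shows "substitution_tiling c T \<longleftrightarrow> L_tiling T"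
proof
  assume "substitution_tiling c T"
  then show "L_tiling T" by (rule substitution_imp_L_tiling[OF assms])
next
  assume L: "L_tiling T"
  have T: "colored_tiling T" "support T = UNIV" using assms unfolding colored_tiling_of_plane_def by blast+
  have "legal_tiling T" unfolding legal_tiling_def
  proof (intro conjI ballI allI)
    fix X v assume "X \<in> T"
    then have "legal_star (vert (fst X) v) (star T (vert (fst X) v))" using L unfolding L_tiling_def by blast
    then show "\<exists>n l r h. valid_label n l \<and> h 0 = vert (fst X) v \<and> legalat T n l r h" unfolding legal_star_iff[OF T(1)] by blast
  qed (rule T(1))
  then show "substitution_tiling c T" unfolding substitution_tiling_def using legal_tiling_covered[OF _ T(2)] T(1) by blast
qed

end
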